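(* Let $x\subseteq\omega$ be ITTM-recognizable. Then either $x$ is ITTM-computable, or $0'_{\mathrm{ITTM}}$ is ITTM-computable from $x$.
   Context: ITTMs are Hamkins–Lewis Infinite Time Turing Machines, possibly with an oracle. A real $x$ is ITTM-computable from $y$ if some ITTM-program in oracle $y$ halts with $x$ on the output tape; ITTM-computable means computable from $\emptyset$. $0'_{\mathrm{ITTM}}=\{i\in\omega: P_i(0)\text{ halts}\}$ is the ITTM halting set for a fixed natural enumeration $(P_i)$ of ITTM-programs. $\delta(a,x)=1$ if $a=x$, else $0$. A real $x$ is ITTM-recognizable if there is an ITTM-program $P$ with $P^{z}\downarrow=\delta(z,x)$ for every $z\subseteq\omega$. *)

theory Defs
  imports Main "HOL-Library.Nat_Bijection"
begin

text \<open>Reals are subsets of omega, i.e. values of type nat set.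
  A machine has a read-only oracle tape (holding the oracle real) and the three
  standard Hamkins--Lewis tapes (input, scratch, output), each with cells indexed
  by nat.  Special states: 0 = start, 1 = halt, 2 = limit state.\<close>

record cfg =
  st   :: nat
  hd   :: nat
  tin  :: "nat \<Rightarrow> bool"
  tsc  :: "nat \<Rightarrow> bool"
  tout :: "nat \<Rightarrow> bool"

text \<open>An instruction (q, r, q', w, m): in state q, reading the symbol combination
  coded by r (oracle + 2*input + 4*scratch + 8*output), go to state q', write the
  bits of w (bit 0 input, bit 1 scratch, bit 2 output) and move left if m = 0,
  right otherwise.  A program is a finite list of instructions; the first matching
  instruction is used; if none matches, the machine halts.\<close>

type_synonym instr = "nat \<times> nat \<times> nat \<times> nat \<times> nat"
type_synonym prog = "instr list"

definition init_cfg :: "nat set \<Rightarrow> cfg" where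
  "init_cfg z = \<lparr>st = 0, hd = 0, tin = (\<lambda>n. n \<in> z), tsc = (\<lambda>_. False), tout = (\<lambda>_. False)\<rparr>"

definition readcode :: "nat set \<Rightarrow> cfg \<Rightarrow> nat" where
  "readcode y c = (if hd c \<in> y then 1 else 0) + (if tin c (hd c) then 2 else 0)
      + (if tsc c (hd c) then 4 else 0) + (if tout c (hd c) then 8 else 0)"

definition step :: "prog \<Rightarrow> nat set \<Rightarrow> cfg \<Rightarrow> cfg" where
  "step p y c = (if st c = 1 then c else
     (case find (\<lambda>(q, r, _). q = st c \<and> r = readcode y c) p of
        None \<Rightarrow> c\<lparr>st := 1\<rparr>
      | Some (_, _, q', w, m) \<Rightarrow>
          c\<lparr>st := q',
            tin := (tin c)(hd c := odd w),
            tsc := (tsc c)(hd c := odd (w div 2)),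
            tout := (tout c)(hd c := odd (w div 4)),
            hd := (if m = 0 then hd c - 1 else Suc (hd c))\<rparr>))"

definition limsup_cell :: "'a rel \<Rightarrow> 'a \<Rightarrow> ('a \<Rightarrow> bool) \<Rightarrow> bool" where
  "limsup_cell r a v \<longleftrightarrow> (\<forall>b\<in>underS r a. \<exists>d\<in>underS r a. (b, d) \<in> r \<and> v d)"

definition lim_cfg :: "'a rel \<Rightarrow> ('a \<Rightarrow> cfg) \<Rightarrow> 'a \<Rightarrow> cfg" where
  "lim_cfg r c a = \<lparr>st = 2, hd = 0,
      tin = (\<lambda>n. limsup_cell r a (\<lambda>d. tin (c d) n)),
      tsc = (\<lambda>n. limsup_cell r a (\<lambda>d. tsc (c d) n)),
      tout = (\<lambda>n. limsup_cell r a (\<lambda>d. tout (c d) n))\<rparr>"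

definition is_run :: "prog \<Rightarrow> nat set \<Rightarrow> nat set \<Rightarrow> 'a rel \<Rightarrow> ('a \<Rightarrow> cfg) \<Rightarrow> bool" where
  "is_run p y z r c \<longleftrightarrow> Well_order r \<and> Field r \<noteq> {} \<and>
     (\<forall>a\<in>Field r.
        (underS r a = {} \<longrightarrow> c a = init_cfg z) \<and>
        (\<forall>b\<in>underS r a. (\<forall>d\<in>underS r a. (d, b) \<in> r) \<longrightarrow> c a = step p y (c b)) \<and>
        (underS r a \<noteq> {} \<and> (\<forall>b\<in>underS r a. \<exists>d\<in>underS r a. (b, d) \<in> r \<and> d \<noteq> b)
            \<longrightarrow> c a = lim_cfg r c a))"

text \<open>p with oracle y on input z halts with output x: there is a run along a
  well-order with a last element at which the machine is (for the first time) in
  the halting state, and the output tape then contains x.  Run lengths are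
  well-orders on subsets of the type nat set (this covers all countable ordinals,
  in fact all ordinals below (2^aleph_0)^+).\<close>

definition halts_with :: "prog \<Rightarrow> nat set \<Rightarrow> nat set \<Rightarrow> nat set \<Rightarrow> bool" where
  "halts_with p y z x \<longleftrightarrow> (\<exists>(r :: nat set rel) c t.
     is_run p y z r c \<and> t \<in> Field r \<and> (\<forall>a\<in>Field r. (a, t) \<in> r) \<and>
     st (c t) = 1 \<and> (\<forall>a\<in>underS r t. st (c a) \<noteq> 1) \<and>
     {n. tout (c t) n} = x)"

definition halts :: "prog \<Rightarrow> nat set \<Rightarrow> nat set \<Rightarrow> bool" where
  "halts p y z \<longleftrightarrow> (\<exists>x. halts_with p y z x)"

definition decode_instr :: "nat \<Rightarrow> instr" where
  "decode_instr n = (case prod_decode n of (q, n1) \<Rightarrow>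
     (case prod_decode n1 of (r, n2) \<Rightarrow>
       (case prod_decode n2 of (q', n3) \<Rightarrow>
         (case prod_decode n3 of (w, m) \<Rightarrow> (q, r, q', w, m)))))"

definition P :: "nat \<Rightarrow> prog" where
  "P i = map decode_instr (list_decode i)"

text \<open>Natural numbers 0/1 as outputs are coded as the reals {} and {0}.\<close>

definition delta :: "nat set \<Rightarrow> nat set \<Rightarrow> nat set" where
  "delta a x = (if a = x then {0} else {})"

definition ittm_computable_from :: "nat set \<Rightarrow> nat set \<Rightarrow> bool" where
  "ittm_computable_from x y \<longleftrightarrow> (\<exists>i. halts_with (P i) y {} x)"

definition ittm_computable :: "nat set \<Rightarrow> bool" where
  "ittm_computable x \<longleftrightarrow> ittm_computable_from x {}"

definition ittm_halting_set :: "nat set" where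
  "ittm_halting_set = {i. halts (P i) {} {}}"

definition ittm_recognizable :: "nat set \<Rightarrow> bool" where
  "ittm_recognizable x \<longleftrightarrow> (\<exists>i. \<forall>z. halts_with (P i) z {} (delta z x))"

end

theory Submission
  imports Defs
begin

text \<open>
  Let program \<open>r\<close> recognize \<open>x\<close> and let \<open>\<tau>\<close> be its halting time with oracle \<open>x\<close>.  Run all programs at once with empty
  oracle and read the relations shown on their output tapes as codes of ordinals.  Let \<open>\<sigma>\<close> be the limit superior of the
  ordinals shown and \<open>\<zeta>\<close> the supremum of the ordinals of eventually writable reals.  As in Welch's analysis, a machine that
  keeps guessing ordinals until it has seen a cell change shows that all runs have the same snapshot at \<open>\<zeta>\<close> and at \<open>\<sigma>\<close>
  and then cycle; hence a program that halts does so before \<open>\<sigma>\<close>.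

  If \<open>\<sigma> \<le> \<tau>\<close>, running all programs until \<open>r\<close> halts with oracle \<open>x\<close> decides the halting set from \<open>x\<close>.  If \<open>\<tau> < \<sigma>\<close>, a code of
  an ordinal above \<open>\<tau>\<close> is shown at some time.  Given such a code, the accepting runs of \<open>r\<close>, with the oracle unknown, are the
  branches of a computable tree; its pruning is computable and leaves \<open>x\<close> as the only oracle.  So \<open>x\<close> is found by
  trying all codes that are shown, and is certified by \<open>r\<close>.

  All computations are built from operators on reals iterated transfinitely with limits superior, which are compiled
  to machines once and for all.
\<close>

section \<open>Transfinite time\<close>

text \<open>At a limit the control of a machine is lost and only a limit superior of each cell
  survives. So every subcomputation carries flags whose limit superior tells where it stands; with
  this settled in \<open>compile\<close>, \<open>lc_comp\<close> and
  \<open>iteration_machine\<close>, later computability claims are closure arguments for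
  \<open>lc\<close> and \<open>cop\<close>.

  No levels of the constructible hierarchy are coded. A bare ordinal suffices as a guess, because
  the universal run can be started afresh and followed for that many steps, which answers whether a
  cell is on within an interval below the guess. Ordinals are taken from arbitrary relations through
  their well-founded parts, so that no tape ever has to be tested for being a well-order.

  \<sigma> is a limit superior and not a supremum: an ordinal below it is exceeded again at
  arbitrarily late times, so a machine that begins its search late, after some other real has
  settled, still meets it. The same property provides the code needed when \<tau> <
  \<sigma>.\<close>

unbundle cardinal_syntax

abbreviation contin :: "nat set rel" where "contin \<equiv> card_of (UNIV :: nat set set)"

definition Om :: "nat set set rel" where "Om = cardSuc contin"

lemma Om_well: "Well_order Om"
  unfolding Om_def by (rule cardSuc_Well_order) (rule card_of_Card_order)

lemma contin_infinite: "infinite (Field contin)"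
proof -
  have "infinite (range (\<lambda>n::nat. {n}))" by (simp add: finite_image_iff inj_on_def)
  then show ?thesis unfolding Field_card_of by (rule contrapos_nn) (rule finite_subset[OF subset_UNIV])
qed

lemma Om_infinite: "infinite (Field Om)"
  unfolding Om_def cardSuc_finite[OF card_of_Card_order] by (rule contin_infinite)

lemma Om_nonempty: "\<exists>x. x \<in> Field Om"
  using infinite_imp_nonempty[OF Om_infinite] by blast

text \<open>Every map from the reals to times is bounded, and every proper initial segment has at most continuum many
  elements, so that times measure all run lengths admitted by \<^const>\<open>halts_with\<close>.\<close>

typedef time = "Field Om" by (rule Om_nonempty)

instantiation time :: linorder
begin
definition less_eq_time where "less_eq_time a b \<longleftrightarrow> (Rep_time a, Rep_time b) \<in> Om"
definition less_time where "less_time (a::time) b \<longleftrightarrow> a \<le> b \<and> a \<noteq> b"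
instance
proof
  have r: "refl_on (Field Om) Om" and t: "trans Om" and a: "antisym Om" and tot: "total_on (Field Om) Om"
    using Om_well unfolding well_order_on_def linear_order_on_def partial_order_on_def preorder_on_def by auto
  fix x y z :: time
  show refl: "x \<le> x" unfolding less_eq_time_def using refl_onD[OF r Rep_time] .
  show "x \<le> y \<Longrightarrow> y \<le> z \<Longrightarrow> x \<le> z" unfolding less_eq_time_def by (rule transD[OF t])
  have anti: "x = y" if "x \<le> y" "y \<le> x"
    using antisymD[OF a that[unfolded less_eq_time_def]] by (simp only: Rep_time_inject)
  then show "x \<le> y \<Longrightarrow> y \<le> x \<Longrightarrow> x = y" .
  show "x < y \<longleftrightarrow> x \<le> y \<and> \<not> y \<le> x" unfolding less_time_def using anti refl by blast
  show "x \<le> y \<or> y \<le> x"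
  proof (cases "x = y")
    case False
    then have "Rep_time x \<noteq> Rep_time y" unfolding Rep_time_inject .
    then show ?thesis unfolding less_eq_time_def
      using tot Rep_time[of x] Rep_time[of y] unfolding total_on_def by blast
  qed (use refl in simp)
qed
end

lemma wf_time: "wf {(x::time, y). x < y}"
proof -
  have "wf (Om - Id)" using Om_well unfolding well_order_on_def by auto
  then have "wf (inv_image (Om - Id) Rep_time)" by (rule wf_inv_image)
  moreover have "{(x::time, y). x < y} \<subseteq> inv_image (Om - Id) Rep_time"
    by (auto simp: inv_image_def less_time_def less_eq_time_def Rep_time_inject)
  ultimately show ?thesis by (rule wf_subset)
qed

instance time :: wellorder
proof
  fix Q and a :: time
  assume "\<And>x::time. (\<And>y. y < x \<Longrightarrow> Q y) \<Longrightarrow> Q x"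
  then show "Q a" using wf_induct[OF wf_time, of Q] by blast
qed

text \<open>Regularity of the successor cardinal: the proper initial segments \<open>As i\<close>
  form a chain indexed by \<open>Om\<close>, and a set of at most continuum many elements covered by
  such a chain lies in a single member.\<close>

lemma time_bounded:
  fixes S :: "time set"
  assumes "|S| \<le>o contin"
  shows "\<exists>b. \<forall>s\<in>S. s < b"
proof -
  define As where "As i = {j. (j, i) \<in> Om \<and> j \<noteq> i}" for i
  have r: "trans Om" "antisym Om" "total_on (Field Om) Om"
    using Om_well unfolding well_order_on_def linear_order_on_def partial_order_on_def preorder_on_def by auto
  have "|Rep_time ` S| \<le>o contin"
    by (rule ordLeq_transitive[OF card_of_image assms])
  moreover have "relChain (cardSuc contin) As"
    unfolding relChain_def Om_def[symmetric]
  proof (intro allI impI subsetI)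
    fix i j x assume ij: "(i, j) \<in> Om" and "x \<in> As i"
    then have x: "(x, i) \<in> Om" "x \<noteq> i" unfolding As_def by auto
    have "(x, j) \<in> Om" using r(1) x(1) ij by (rule transD)
    moreover have "x \<noteq> j" using antisymD[OF r(2) ij] x by auto
    ultimately show "x \<in> As j" unfolding As_def by simp
  qed
  moreover have "Rep_time ` S \<subseteq> (\<Union>i\<in>Field (cardSuc contin). As i)"
  proof
    fix a assume "a \<in> Rep_time ` S"
    then have "a \<in> Field Om" using Rep_time by auto
    then obtain b where "b \<in> Field Om" "a \<noteq> b" "(a, b) \<in> Om"
      using infinite_Card_order_limit[OF cardSuc_Card_order[OF card_of_Card_order], of "UNIV :: nat set set" a] Om_infinite
      unfolding Om_def by blast
    then show "a \<in> (\<Union>i\<in>Field (cardSuc contin). As i)" unfolding As_def Om_def by auto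
  qed
  moreover note contin_infinite
  ultimately have "\<exists>i\<in>Field (cardSuc contin). Rep_time ` S \<subseteq> As i"
    by (intro cardSuc_UNION[OF card_of_Card_order])
  then obtain i where i: "i \<in> Field Om" "Rep_time ` S \<subseteq> As i" unfolding Om_def by blast
  have "\<forall>s\<in>S. s < Abs_time i"
  proof
    fix s assume "s \<in> S"
    then have "(Rep_time s, i) \<in> Om" "Rep_time s \<noteq> i" using i(2) unfolding As_def by auto
    then show "s < Abs_time i" unfolding less_time_def less_eq_time_def using Abs_time_inverse[OF i(1)] by auto
  qed
  then show ?thesis by blast
qed

lemma time_segment: "|{..<t::time}| \<le>o contin"
proof -
  have "|underS Om (Rep_time t)| <o Om"
    using card_of_underS[of Om "Rep_time t"] Rep_time[of t] unfolding Om_def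
    by (simp add: cardSuc_Card_order[OF card_of_Card_order])
  then have a: "|underS Om (Rep_time t)| \<le>o contin"
    unfolding Om_def using cardSuc_ordLeq_ordLess[OF card_of_Card_order card_of_Card_order] by blast
  have "Rep_time ` {..<t} \<subseteq> underS Om (Rep_time t)"
    unfolding underS_def by (auto simp: less_time_def less_eq_time_def Rep_time_inject)
  then have "|{..<t}| \<le>o |underS Om (Rep_time t)|"
    by (intro card_of_ordLeqI[of Rep_time]) (auto simp: inj_on_def Rep_time_inject)
  then show ?thesis using a by (rule ordLeq_transitive)
qed

lemma time_bounded_image:
  fixes f :: "'a \<Rightarrow> time"
  assumes "|A| \<le>o contin"
  shows "\<exists>b. \<forall>a\<in>A. f a < b"
  using time_bounded[OF ordLeq_transitive[OF card_of_image assms]] by (metis image_eqI)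

lemma time_bounded_nat: "\<exists>b. \<forall>n::nat. f n < (b::time)"
proof -
  have "|UNIV::nat set| \<le>o contin"
    using card_of_ordLeqI[of "\<lambda>n. {n}" "UNIV::nat set" "UNIV::nat set set"] by (auto simp: inj_on_def)
  from time_bounded_image[OF this, of f] show ?thesis by auto
qed

lemma time_bounded_real: "\<exists>b. \<forall>c::nat set. f c < (b::time)"
proof -
  have "contin \<le>o contin" by (rule ordLeq_refl[OF card_of_Card_order])
  from time_bounded_image[OF this, of f] show ?thesis by auto
qed

section \<open>Successor and limit times, recursion along times\<close>

definition tz :: time where "tz = (LEAST t. True)"
definition tsuc :: "time \<Rightarrow> time" where "tsuc t = (LEAST u. t < u)"
definition tlim :: "time \<Rightarrow> bool" where "tlim t \<longleftrightarrow> t \<noteq> tz \<and> (\<forall>b<t. tsuc b < t)"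

lemma tz_le [simp]: "tz \<le> t" unfolding tz_def by (rule Least_le) simp
lemma not_less_tz [simp]: "\<not> t < tz" by (simp add: leD)
lemma le_tz_iff [simp]: "t \<le> tz \<longleftrightarrow> t = tz" by (auto intro: order_antisym)
lemma tz_less_iff: "tz < t \<longleftrightarrow> t \<noteq> tz" by (auto simp: less_le)

lemma less_tsuc [simp]: "t < tsuc t"
proof -
  obtain b where "t < b" using time_bounded_nat[of "\<lambda>_. t"] by auto
  then show ?thesis unfolding tsuc_def by (rule LeastI)
qed

lemma le_tsuc [simp]: "t \<le> tsuc t" by (rule less_imp_le) simp
lemma tsuc_neq [simp]: "tsuc t \<noteq> t" "t \<noteq> tsuc t" using less_irrefl[of t] less_tsuc[of t] by metis+

lemma less_tsuc_iff: "u < tsuc t \<longleftrightarrow> u \<le> t"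
proof
  assume "u < tsuc t"
  show "u \<le> t" using not_less_Least[of u "\<lambda>u. t < u"] \<open>u < tsuc t\<close> unfolding tsuc_def by auto
qed (use le_less_trans less_tsuc in blast)

lemma tsuc_le_iff: "tsuc t \<le> u \<longleftrightarrow> t < u"
  using less_tsuc_iff[of u t] by (simp add: not_less[symmetric])

lemma tsuc_inject [simp]: "tsuc t = tsuc u \<longleftrightarrow> t = u"
  by (metis antisym less_tsuc less_tsuc_iff)

lemma tsuc_not_tz [simp]: "tsuc t \<noteq> tz" "tz \<noteq> tsuc t"
  using less_tsuc not_less_tz by metis+

lemma tsuc_less_iff [simp]: "tsuc t < tsuc u \<longleftrightarrow> t < u"
  using less_tsuc_iff tsuc_le_iff by simp

lemma tlim_not_tsuc [simp]: "\<not> tlim (tsuc t)" unfolding tlim_def using less_tsuc[of t] by blast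
lemma tlim_not_tz [simp]: "\<not> tlim tz" unfolding tlim_def by auto

lemma time_cases:
  obtains "t = tz" | u where "t = tsuc u" | "tlim t"
proof (cases "t = tz \<or> tlim t")
  case False
  then obtain b where "b < t" "\<not> tsuc b < t" unfolding tlim_def by auto
  then have "t = tsuc b" using tsuc_le_iff[of b t] by auto
  then show ?thesis using that by blast
qed (use that in blast)

lemma time_induct [case_names zero suc lim]:
  assumes "Q tz" "\<And>t. Q t \<Longrightarrow> Q (tsuc t)" "\<And>t. tlim t \<Longrightarrow> (\<And>u. u < t \<Longrightarrow> Q u) \<Longrightarrow> Q t"
  shows "Q t"
proof (induction t rule: less_induct)
  case (less t)
  show ?case by (cases t rule: time_cases) (use assms less in auto)
qed

lemma tlimD: "tlim t \<Longrightarrow> b < t \<Longrightarrow> tsuc b < t" unfolding tlim_def by auto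
lemma tlim_pos: "tlim t \<Longrightarrow> tz < t" unfolding tlim_def by (simp add: tz_less_iff)

definition trec :: "'c \<Rightarrow> ('c \<Rightarrow> 'c) \<Rightarrow> ((time \<Rightarrow> 'c) \<Rightarrow> time \<Rightarrow> 'c) \<Rightarrow> time \<Rightarrow> 'c" where
  "trec z s l = wfrec {(x, y). x < y}
     (\<lambda>f t. if t = tz then z else if \<exists>u. t = tsuc u then s (f (THE u. t = tsuc u)) else l f t)"

lemma trec_tz: "trec z s l tz = z"
  unfolding trec_def by (subst wfrec[OF wf_time]) simp

lemma trec_tsuc: "trec z s l (tsuc t) = s (trec z s l t)"
  unfolding trec_def by (subst wfrec[OF wf_time]) (simp add: cut_apply)

text \<open>\<open>wfrec\<close> hands \<open>l\<close> the history cut off at \<open>t\<close>,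
  which is undefined from \<open>t\<close> on; hence the hypothesis that \<open>l\<close> looks only
  below \<open>t\<close>.\<close>

lemma trec_tlim:
  assumes "tlim t" "\<And>f g. (\<And>u. u < t \<Longrightarrow> f u = g u) \<Longrightarrow> l f t = l g t"
  shows "trec z s l t = l (trec z s l) t"
proof -
  have "t \<noteq> tz" "\<not> (\<exists>u. t = tsuc u)" using assms(1) by auto
  then have "trec z s l t = l (cut (trec z s l) {(x, y). x < y} t) t"
    unfolding trec_def by (subst wfrec[OF wf_time]) simp
  also have "\<dots> = l (trec z s l) t"
    by (rule assms(2)) (simp add: cut_apply)
  finally show ?thesis .
qed

text \<open>The limit rule of the tapes, with a tape as a set of cells: those that are on cofinally
  often before \<open>t\<close>.\<close>

definition Lim :: "(time \<Rightarrow> nat set) \<Rightarrow> time \<Rightarrow> nat set" where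
  "Lim f t = {n. \<forall>b<t. \<exists>d. b \<le> d \<and> d < t \<and> n \<in> f d}"

lemma Lim_cong: "(\<And>u. u < t \<Longrightarrow> f u = g u) \<Longrightarrow> Lim f t = Lim g t"
  unfolding Lim_def by (intro Collect_cong) metis

lemma Lim_vimage: "{n. h n \<in> Lim f t} = Lim (\<lambda>u. {n. h n \<in> f u}) t"
  unfolding Lim_def by simp

lemma in_LimI:
  assumes "\<And>b. b < t \<Longrightarrow> \<exists>d. b \<le> d \<and> d < t \<and> n \<in> f d" shows "n \<in> Lim f t"
  using assms unfolding Lim_def by auto

lemma in_LimD:
  assumes "n \<in> Lim f t" "b < t" obtains d where "b \<le> d" "d < t" "n \<in> f d"
  using assms unfolding Lim_def by auto

lemma Lim_eventually:
  assumes "b < t" "\<And>u. b \<le> u \<Longrightarrow> u < t \<Longrightarrow> (n \<in> f u) = v"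
  shows "(n \<in> Lim f t) = v"
proof (cases v)
  case True
  have "n \<in> Lim f t"
    by (rule in_LimI) (use assms True in \<open>metis max.cobounded1 max.cobounded2 max_less_iff_conj\<close>)
  then show ?thesis using True by simp
next
  case False
  then show ?thesis using assms by (auto elim!: in_LimD)
qed

section \<open>Iterated operators and machine runs indexed by times\<close>

definition arun :: "(nat set \<Rightarrow> nat set) \<Rightarrow> nat set \<Rightarrow> time \<Rightarrow> nat set" where
  "arun G S = trec S G Lim"

lemma arun_tz [simp]: "arun G S tz = S" unfolding arun_def by (rule trec_tz)
lemma arun_tsuc [simp]: "arun G S (tsuc t) = G (arun G S t)" unfolding arun_def by (rule trec_tsuc)
lemma arun_tlim: "tlim t \<Longrightarrow> arun G S t = Lim (arun G S) t"
  unfolding arun_def by (erule trec_tlim) (rule Lim_cong)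

definition clim :: "(time \<Rightarrow> cfg) \<Rightarrow> time \<Rightarrow> cfg" where
  "clim c t = \<lparr>st = 2, hd = 0,
      tin = (\<lambda>n. n \<in> Lim (\<lambda>d. Collect (tin (c d))) t),
      tsc = (\<lambda>n. n \<in> Lim (\<lambda>d. Collect (tsc (c d))) t),
      tout = (\<lambda>n. n \<in> Lim (\<lambda>d. Collect (tout (c d))) t)\<rparr>"

definition crun :: "prog \<Rightarrow> nat set \<Rightarrow> nat set \<Rightarrow> time \<Rightarrow> cfg" where
  "crun p y z = trec (init_cfg z) (step p y) clim"

lemma crun_tz [simp]: "crun p y z tz = init_cfg z" unfolding crun_def by (rule trec_tz)
lemma crun_tsuc [simp]: "crun p y z (tsuc t) = step p y (crun p y z t)" unfolding crun_def by (rule trec_tsuc)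
lemma crun_tlim:
  assumes "tlim t" shows "crun p y z t = clim (crun p y z) t"
  unfolding crun_def
proof (rule trec_tlim[OF assms])
  fix f g :: "time \<Rightarrow> cfg" assume "\<And>u. u < t \<Longrightarrow> f u = g u"
  then have "Lim (\<lambda>d. Collect (v (f d))) t = Lim (\<lambda>d. Collect (v (g d))) t" for v
    by (intro Lim_cong) simp
  then show "clim f t = clim g t" unfolding clim_def by simp
qed

text \<open>Given an isomorphism \<open>h\<close> of \<open>r\<close> onto an initial segment of the
  times, having no predecessor, a last predecessor, or predecessors without a last one means that
  \<open>h a\<close> is zero, a successor or a limit. So the clauses of \<open>is_run\<close> become
  those of \<open>crun\<close>, and the only run along \<open>r\<close> is the pullback of
  \<open>crun\<close>.\<close>

lemma run_along:
  assumes wo: "Well_order r"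
    and emb: "\<And>a b. a \<in> Field r \<Longrightarrow> b \<in> Field r \<Longrightarrow> (a, b) \<in> r \<longleftrightarrow> h a \<le> (h b :: time)"
    and seg: "\<And>a w. a \<in> Field r \<Longrightarrow> w < h a \<Longrightarrow> \<exists>b\<in>Field r. h b = w"
  shows "Field r \<noteq> {} \<Longrightarrow> is_run p y z r (\<lambda>a. crun p y z (h a))"
    and "is_run p y z r c \<Longrightarrow> a \<in> Field r \<Longrightarrow> c a = crun p y z (h a)"
proof -
  have und: "b \<in> underS r a \<longleftrightarrow> b \<in> Field r \<and> h b < h a" if "a \<in> Field r" for a b
  proof
    assume *: "b \<in> underS r a"
    then have "b \<in> Field r" "b \<noteq> a" "(b, a) \<in> r" unfolding underS_def Field_def by auto
    moreover have "(a, b) \<notin> r"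
      using wo calculation unfolding well_order_on_def linear_order_on_def partial_order_on_def antisym_def by auto
    ultimately show "b \<in> Field r \<and> h b < h a" using emb that by (auto simp: not_le[symmetric])
  next
    assume "b \<in> Field r \<and> h b < h a"
    then show "b \<in> underS r a" using emb[of b a] that unfolding underS_def by auto
  qed
  have z: "underS r a = {} \<longleftrightarrow> h a = tz" if "a \<in> Field r" for a
    using und[OF that] seg[OF that] by (metis all_not_in_conv not_less_tz tz_less_iff)
  have s: "(\<forall>d\<in>underS r a. (d, b) \<in> r) \<longleftrightarrow> h a = tsuc (h b)" if "a \<in> Field r" "b \<in> underS r a" for a b
  proof
    assume *: "\<forall>d\<in>underS r a. (d, b) \<in> r"
    have b: "b \<in> Field r" "h b < h a" and aF: "a \<in> Field r" using und that by auto
    show "h a = tsuc (h b)"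
    proof (rule ccontr)
      assume "h a \<noteq> tsuc (h b)"
      then have "tsuc (h b) < h a" using b(2) tsuc_le_iff[of "h b" "h a"] by (simp add: less_le)
      then obtain d where "d \<in> Field r" "h d = tsuc (h b)" using seg aF by blast
      then show False using * und[OF that(1)] emb[of d b] b(1) \<open>tsuc (h b) < h a\<close>
        by (metis less_tsuc not_le)
    qed
  next
    assume "h a = tsuc (h b)"
    then show "\<forall>d\<in>underS r a. (d, b) \<in> r" using und that emb less_tsuc_iff by auto
  qed
  have l: "underS r a \<noteq> {} \<and> (\<forall>b\<in>underS r a. \<exists>d\<in>underS r a. (b, d) \<in> r \<and> d \<noteq> b) \<longleftrightarrow> tlim (h a)"
    if a: "a \<in> Field r" for a
  proof
    assume *: "underS r a \<noteq> {} \<and> (\<forall>b\<in>underS r a. \<exists>d\<in>underS r a. (b, d) \<in> r \<and> d \<noteq> b)"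
    show "tlim (h a)" unfolding tlim_def
    proof (intro conjI allI impI)
      show "h a \<noteq> tz" using * z a by auto
      fix w assume "w < h a"
      then obtain b where b: "b \<in> Field r" "h b = w" using seg a by blast
      then have "b \<in> underS r a" using und a \<open>w < h a\<close> by auto
      then obtain d where d: "d \<in> underS r a" "(b, d) \<in> r" "d \<noteq> b" using * by blast
      then have "\<not> h d \<le> h b" using emb und a b wo
        unfolding well_order_on_def linear_order_on_def partial_order_on_def antisym_def by metis
      then show "tsuc w < h a" using d und a b tsuc_le_iff by (metis le_less_trans not_le)
    qed
  next
    assume tl: "tlim (h a)"
    then have "underS r a \<noteq> {}" using z a by auto
    moreover have "\<exists>d\<in>underS r a. (b, d) \<in> r \<and> d \<noteq> b" if "b \<in> underS r a" for b
    proof -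
      have b: "b \<in> Field r" "h b < h a" using und a that by auto
      then have "tsuc (h b) < h a" using tl tlimD by blast
      then obtain d where d: "d \<in> Field r" "h d = tsuc (h b)" using seg a by blast
      then show ?thesis using und a emb b \<open>tsuc (h b) < h a\<close> by (intro bexI[of _ d]) auto
    qed
    ultimately show "underS r a \<noteq> {} \<and> (\<forall>b\<in>underS r a. \<exists>d\<in>underS r a. (b, d) \<in> r \<and> d \<noteq> b)" by blast
  qed
  have ls: "limsup_cell r a (\<lambda>d. v (c d) n) \<longleftrightarrow> n \<in> Lim (\<lambda>d. Collect (v (c' d))) (h a)"
    if a: "a \<in> Field r" and eq: "\<And>d. d \<in> Field r \<Longrightarrow> h d < h a \<Longrightarrow> c d = c' (h d)"
    for a v c n and c' :: "time \<Rightarrow> cfg"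
  proof
    assume *: "limsup_cell r a (\<lambda>d. v (c d) n)"
    show "n \<in> Lim (\<lambda>d. Collect (v (c' d))) (h a)"
    proof (rule in_LimI)
      fix w assume "w < h a"
      then obtain b where b: "b \<in> Field r" "h b = w" using seg a by blast
      then have "b \<in> underS r a" using und a \<open>w < h a\<close> by auto
      then obtain d where "d \<in> underS r a" "(b, d) \<in> r" "v (c d) n"
        using * unfolding limsup_cell_def by blast
      then show "\<exists>d. w \<le> d \<and> d < h a \<and> n \<in> Collect (v (c' d))"
        using und a b emb eq by (intro exI[of _ "h d"]) auto
    qed
  next
    assume *: "n \<in> Lim (\<lambda>d. Collect (v (c' d))) (h a)"
    show "limsup_cell r a (\<lambda>d. v (c d) n)" unfolding limsup_cell_def
    proof
      fix b assume b: "b \<in> underS r a"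
      then have bf: "b \<in> Field r" "h b < h a" using und a by auto
      then obtain w where w: "h b \<le> w" "w < h a" "v (c' w) n" using * by (auto elim!: in_LimD)
      then obtain d where d: "d \<in> Field r" "h d = w" using seg a by blast
      then show "\<exists>d\<in>underS r a. (b, d) \<in> r \<and> v (c d) n"
        using und a w emb bf eq by (intro bexI[of _ d]) auto
    qed
  qed
  have lc: "lim_cfg r c a = clim c' (h a)"
    if "a \<in> Field r" "\<And>d. d \<in> Field r \<Longrightarrow> h d < h a \<Longrightarrow> c d = c' (h d)" for a c c'
  proof -
    have "limsup_cell r a (\<lambda>d. v (c d) n) \<longleftrightarrow> n \<in> Lim (\<lambda>d. Collect (v (c' d))) (h a)" for v n
      by (rule ls[where c = c and c' = c', OF that(1)]) (erule (1) that(2))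
    then show ?thesis unfolding lim_cfg_def clim_def by simp
  qed
  show "is_run p y z r (\<lambda>a. crun p y z (h a))" if "Field r \<noteq> {}"
    unfolding is_run_def
  proof (intro conjI ballI impI wo that)
    fix a assume a: "a \<in> Field r"
    show "underS r a = {} \<Longrightarrow> crun p y z (h a) = init_cfg z" using z a by simp
    show "crun p y z (h a) = step p y (crun p y z (h b))"
      if "b \<in> underS r a" "\<forall>d\<in>underS r a. (d, b) \<in> r" for b
      using s[OF a that(1)] that by simp
    show "crun p y z (h a) = lim_cfg r (\<lambda>a. crun p y z (h a)) a"
      if "underS r a \<noteq> {} \<and> (\<forall>b\<in>underS r a. \<exists>d\<in>underS r a. (b, d) \<in> r \<and> d \<noteq> b)"
      using l a that crun_tlim lc[of a "\<lambda>a. crun p y z (h a)" "crun p y z"] by simp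
  qed
  show "c a = crun p y z (h a)" if run: "is_run p y z r c" and "a \<in> Field r"
    using that(2)
  proof (induction "h a" arbitrary: a rule: less_induct)
    case less
    have R: "underS r a = {} \<longrightarrow> c a = init_cfg z"
        "\<forall>b\<in>underS r a. (\<forall>d\<in>underS r a. (d, b) \<in> r) \<longrightarrow> c a = step p y (c b)"
        "underS r a \<noteq> {} \<and> (\<forall>b\<in>underS r a. \<exists>d\<in>underS r a. (b, d) \<in> r \<and> d \<noteq> b) \<longrightarrow> c a = lim_cfg r c a"
      using run less.prems unfolding is_run_def by blast+
    show ?case
    proof (cases "h a" rule: time_cases)
      case 1
      then show ?thesis using R(1) z less.prems by simp
    next
      case (2 u)
      then obtain b where b: "b \<in> Field r" "h b = u" using seg[OF less.prems] less_tsuc by metis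
      then have "b \<in> underS r a" using und less.prems 2 by auto
      then have "c a = step p y (c b)" using R(2) s[OF less.prems, of b] 2 b by auto
      then show ?thesis using less.hyps[of b] b 2 by simp
    next
      case 3
      then have "c a = lim_cfg r c a" using R(3) l[OF less.prems] by blast
      then show ?thesis using lc[OF less.prems, of c "crun p y z"] less.hyps crun_tlim[OF 3] by simp
    qed
  qed
qed

text \<open>A well-order on reals is collapsed into the times by its rank function; the least strict
  bound defining a rank exists because no map from the reals into the times is cofinal. Conversely
  the segment up to a halting time injects into the reals, and its order is transported along the
  injection.\<close>

lemma halts_with_iff:
  "halts_with p y z x \<longleftrightarrow> (\<exists>t. st (crun p y z t) = 1 \<and> (\<forall>u<t. st (crun p y z u) \<noteq> 1) \<and>
     {n. tout (crun p y z t) n} = x)"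
proof
  assume "halts_with p y z x"
  then obtain r :: "nat set rel" and c t where
    run: "is_run p y z r c" and t: "t \<in> Field r" "\<forall>a\<in>Field r. (a, t) \<in> r" "st (c t) = 1"
      "\<forall>a\<in>underS r t. st (c a) \<noteq> 1" "{n. tout (c t) n} = x"
    unfolding halts_with_def by blast
  have wo: "Well_order r" using run unfolding is_run_def by auto
  then have wf: "wf (r - Id)" and anti: "antisym r" and tr: "trans r" and tot: "total_on (Field r) r" and rf: "refl_on (Field r) r"
    unfolding well_order_on_def linear_order_on_def partial_order_on_def preorder_on_def by auto
  define h where "h = wfrec (r - Id) (\<lambda>f a. LEAST w. \<forall>b. (b, a) \<in> r - Id \<longrightarrow> f b < (w::time))"
  have h: "h a = (LEAST w. \<forall>b. (b, a) \<in> r - Id \<longrightarrow> h b < w)" for a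
    unfolding h_def by (subst wfrec[OF wf]) (simp add: cut_apply cong: imp_cong)
  have bdd: "\<forall>b. (b, a) \<in> r - Id \<longrightarrow> h b < h a" for a
  proof -
    obtain w where "\<forall>b. h b < w" using time_bounded_real[of h] by blast
    then have "\<forall>b. (b, a) \<in> r - Id \<longrightarrow> h b < w" by blast
    then show ?thesis by (subst (2) h) (rule LeastI)
  qed
  have least: "h a \<le> w" if "\<And>b. (b, a) \<in> r - Id \<Longrightarrow> h b < w" for a w
    by (subst h) (use that in \<open>auto intro: Least_le\<close>)
  have emb: "(a, b) \<in> r \<longleftrightarrow> h a \<le> h b" if "a \<in> Field r" "b \<in> Field r" for a b
  proof (cases "a = b")
    case True
    then show ?thesis using rf that unfolding refl_on_def by auto
  next
    case False
    show ?thesis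
    proof (cases "(a, b) \<in> r")
      case True then show ?thesis using bdd[of b] \<open>a \<noteq> b\<close> by (auto simp: less_imp_le)
    next
      case nr: False
      then have "(b, a) \<in> r" using tot that \<open>a \<noteq> b\<close> unfolding total_on_def by blast
      then have "h b < h a" using bdd[of a] False by auto
      then show ?thesis using nr by auto
    qed
  qed
  have seg: "\<exists>b\<in>Field r. h b = w" if "a \<in> Field r" "w < h a" for a w
    using that
  proof (induction a rule: wf_induct_rule[OF wf])
    case (1 a)
    have "\<not> (\<forall>b. (b, a) \<in> r - Id \<longrightarrow> h b < w)" using least[of a w] 1(3) by (metis not_less)
    then obtain b where b: "(b, a) \<in> r - Id" "w \<le> h b" by (auto simp: not_less)
    then have "b \<in> Field r" unfolding Field_def by auto
    then show ?case using 1(1)[OF b(1)] b by (cases "w = h b") auto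
  qed
  have und: "\<exists>b\<in>underS r t. h b = w" if w: "w < h t" for w
  proof -
    obtain b where b: "b \<in> Field r" "h b = w" using seg t(1) w by blast
    then have "(b, t) \<in> r" "b \<noteq> t" using t w by auto
    then show ?thesis using b unfolding underS_def by auto
  qed
  have eq: "c a = crun p y z (h a)" if "a \<in> Field r" for a
    by (rule run_along(2)[where h = h, OF wo _ _ run that]) (erule (1) emb, erule (1) seg)
  have fld: "b \<in> Field r" if "b \<in> underS r t" for b using that unfolding underS_def Field_def by auto
  show "\<exists>t. st (crun p y z t) = 1 \<and> (\<forall>u<t. st (crun p y z u) \<noteq> 1) \<and> {n. tout (crun p y z t) n} = x"
  proof (intro exI[of _ "h t"] conjI allI impI)
    show "st (crun p y z (h t)) = 1" "{n. tout (crun p y z (h t)) n} = x" using eq[OF t(1)] t by auto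
    fix u assume "u < h t"
    then obtain b where "b \<in> underS r t" "h b = u" using und by blast
    then show "st (crun p y z u) \<noteq> 1" using eq[OF fld] t(4) by metis
  qed
next
  assume "\<exists>t. st (crun p y z t) = 1 \<and> (\<forall>u<t. st (crun p y z u) \<noteq> 1) \<and> {n. tout (crun p y z t) n} = x"
  then obtain t where t: "st (crun p y z t) = 1" "\<forall>u<t. st (crun p y z u) \<noteq> 1" "{n. tout (crun p y z t) n} = x" by blast
  obtain f :: "time \<Rightarrow> nat set" where inj: "inj_on f {..<tsuc t}"
    using time_segment[of "tsuc t"] card_of_ordLeq[of "{..<tsuc t}" "UNIV :: nat set set"] by auto
  have eqi: "{..<tsuc t} = {..t}" by (auto simp: less_tsuc_iff)
  define r where "r = {(f a, f b) | a b. a \<le> b \<and> b \<le> t}"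
  have fld: "Field r = f ` {..t}"
    unfolding r_def Field_def Domain_unfold Range_iff by (auto intro: order_trans)
  have mem: "(f a, f b) \<in> r \<longleftrightarrow> a \<le> b" if "a \<le> t" "b \<le> t" for a b
  proof
    assume "(f a, f b) \<in> r"
    then obtain a' b' where "f a = f a'" "f b = f b'" "a' \<le> b'" "b' \<le> t" unfolding r_def by blast
    then show "a \<le> b" using inj that unfolding eqi inj_on_def by (metis atMost_iff order_trans)
  qed (use that in \<open>auto simp: r_def\<close>)
  define h where "h = the_inv_into {..t} f"
  have hf: "h (f a) = a" if "a \<le> t" for a
    unfolding h_def using inj that by (simp add: eqi the_inv_into_f_f)
  have lin: "Linear_order r"
    unfolding linear_order_on_def partial_order_on_def preorder_on_def
  proof (intro conjI)
    show "refl_on (Field r) r" unfolding refl_on_def fld by (auto simp: r_def)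
    show "r \<subseteq> Field r \<times> Field r" by (auto simp: Field_def)
    show "trans r"
    proof (rule transI)
      fix a b c assume ab: "(a, b) \<in> r" "(b, c) \<in> r"
      then obtain a' b' c' where "a = f a'" "b = f b'" "c = f c'" "a' \<le> t" "b' \<le> t" "c' \<le> t"
        unfolding r_def by (auto intro: order_trans)
      then show "(a, c) \<in> r" using ab mem by auto
    qed
    show "antisym r"
    proof (rule antisymI)
      fix a b assume ab: "(a, b) \<in> r" "(b, a) \<in> r"
      then obtain a' b' where "a = f a'" "b = f b'" "a' \<le> t" "b' \<le> t"
        unfolding r_def by (auto intro: order_trans)
      then show "a = b" using ab mem by auto
    qed
    show "total_on (Field r) r" unfolding total_on_def fld using mem by (metis (no_types, lifting) atMost_iff image_iff linear)
  qed
  have wo: "Well_order r"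
    unfolding well_order_on_def
  proof (intro conjI lin)
    have "wf (inv_image {(x, y). x < y} h)" using wf_time by (rule wf_inv_image)
    moreover have "r - Id \<subseteq> inv_image {(x, y). x < y} h"
      unfolding r_def inv_image_def by (auto simp: hf order_trans less_le)
    ultimately show "wf (r - Id)" by (rule wf_subset)
  qed
  have emb: "(a, b) \<in> r \<longleftrightarrow> h a \<le> h b" if "a \<in> Field r" "b \<in> Field r" for a b
    using that mem hf unfolding fld by auto
  have seg: "\<exists>b\<in>Field r. h b = w" if "a \<in> Field r" "w < h a" for a w
    using that hf unfolding fld by (auto intro!: bexI[of _ w])
  have ne: "Field r \<noteq> {}" unfolding fld by auto
  have "is_run p y z r (\<lambda>a. crun p y z (h a))"
    by (rule run_along(1)[where h = h, OF wo _ _ ne]) (erule (1) emb, erule (1) seg)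
  moreover have "f t \<in> Field r" "\<forall>a\<in>Field r. (a, f t) \<in> r" unfolding fld using mem by auto
  moreover have "\<forall>a\<in>underS r (f t). st (crun p y z (h a)) \<noteq> 1"
  proof
    fix a assume "a \<in> underS r (f t)"
    then obtain a' where "a = f a'" "a' \<le> t" "a' \<noteq> t" unfolding underS_def r_def by (auto intro: order_trans)
    then show "st (crun p y z (h a)) \<noteq> 1" using t(2) hf by auto
  qed
  ultimately show "halts_with p y z x" unfolding halts_with_def using t hf[of t]
    by (intro exI[of _ r] exI[of _ "\<lambda>a. crun p y z (h a)"] exI[of _ "f t"]) auto
qed

section \<open>Strict suprema and ordinal addition of times\<close>

definition tsup :: "(time \<Rightarrow> time) \<Rightarrow> time \<Rightarrow> time" where
  "tsup f t = (LEAST w. \<forall>s<t. f s < w)"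

lemma tsup_upper: "s < t \<Longrightarrow> f s < tsup f t"
proof -
  assume "s < t"
  obtain w where "\<forall>s\<in>{..<t}. f s < w" using time_bounded_image[OF time_segment, of t f] by blast
  then have "\<forall>s<t. f s < w" by simp
  then have "\<forall>s<t. f s < tsup f t" unfolding tsup_def by (rule LeastI)
  then show ?thesis using \<open>s < t\<close> by blast
qed

lemma tsup_least: "w < tsup f t \<Longrightarrow> \<exists>s<t. w \<le> f s"
  using not_less_Least[of w "\<lambda>w. \<forall>s<t. f s < w"] unfolding tsup_def by (auto simp: not_less)

lemma tsup_cong: "(\<And>s. s < t \<Longrightarrow> f s = g s) \<Longrightarrow> tsup f t = tsup g t"
  unfolding tsup_def by (intro arg_cong[where f = Least] ext) auto

lemma tsup_tlim:
  assumes "tlim t" "\<And>s. s < t \<Longrightarrow> f s < f (tsuc s)" shows "tlim (tsup f t)"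
  unfolding tlim_def
proof (intro conjI allI impI)
  have "f tz < tsup f t" using tsup_upper tlim_pos[OF assms(1)] by blast
  then show "tsup f t \<noteq> tz" by auto
  fix b assume "b < tsup f t"
  then obtain s where s: "s < t" "b \<le> f s" using tsup_least by blast
  then have "b < f (tsuc s)" using assms(2) by (meson le_less_trans)
  then have "tsuc b \<le> f (tsuc s)" by (simp add: tsuc_le_iff)
  also have "\<dots> < tsup f t" using tsup_upper tlimD[OF assms(1) s(1)] by blast
  finally show "tsuc b < tsup f t" .
qed

definition tadd :: "time \<Rightarrow> time \<Rightarrow> time" where "tadd u = trec u tsuc tsup"

lemma tadd_tz [simp]: "tadd u tz = u" unfolding tadd_def by (rule trec_tz)
lemma tadd_tsuc [simp]: "tadd u (tsuc t) = tsuc (tadd u t)" unfolding tadd_def by (rule trec_tsuc)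
lemma tadd_tlim: "tlim t \<Longrightarrow> tadd u t = tsup (tadd u) t"
  unfolding tadd_def by (erule trec_tlim) (rule tsup_cong)

lemma tlim_tadd: "tlim t \<Longrightarrow> tlim (tadd u t)"
  unfolding tadd_tlim by (rule tsup_tlim) auto

lemma tadd_mono: "s < t \<Longrightarrow> tadd u s < tadd u t"
proof (induction t rule: time_induct)
  case (suc t)
  then have "s = t \<or> s < t" by (auto simp: less_tsuc_iff le_less)
  then show ?case using suc.IH less_tsuc[of "tadd u t"] by (auto intro: order.strict_trans)
next
  case (lim t)
  then show ?case by (simp add: tadd_tlim tsup_upper)
qed simp

lemma tadd_mono_iff: "tadd u s < tadd u t \<longleftrightarrow> s < t"
  using tadd_mono[of s t u] tadd_mono[of t s u] by (metis less_asym less_linear)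

lemma le_tadd: "u \<le> tadd u t"
  using tadd_mono[of tz t u] by (cases "t = tz") (auto simp: tz_less_iff)

lemma le_tadd2: "t \<le> tadd u t"
proof (induction t rule: time_induct)
  case (suc t)
  then show ?case by (simp add: tsuc_le_iff less_tsuc_iff)
next
  case (lim t)
  show ?case
  proof (rule ccontr)
    assume "\<not> t \<le> tadd u t"
    then have *: "tadd u t < t" by simp
    from lim(2)[OF *] tadd_mono[OF *, of u] show False by simp
  qed
qed simp

text \<open>Subtraction from the left: every later time is an offset from the start of a phase, so
  facts about an embedded run reach all times of that phase.\<close>

lemma tadd_surj: "u \<le> w \<Longrightarrow> \<exists>t. tadd u t = w"
proof (induction w rule: time_induct)
  case (suc w)
  show ?case
  proof (cases "u \<le> w")
    case True
    then show ?thesis using suc.IH tadd_tsuc by metis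
  next
    case False
    then have "u = tsuc w" using suc.prems less_tsuc_iff[of u w] by auto
    then show ?thesis using tadd_tz by blast
  qed
next
  case (lim w)
  define T where "T = (LEAST t. w \<le> tadd u t)"
  have T: "w \<le> tadd u T" unfolding T_def using le_tadd2 by (rule LeastI)
  have less: "tadd u s < w" if "s < T" for s
    using not_less_Least[of s "\<lambda>t. w \<le> tadd u t"] that unfolding T_def by auto
  show ?case
  proof (cases T rule: time_cases)
    case 1 then show ?thesis using T lim.prems by (metis antisym tadd_tz)
  next
    case (2 s)
    then have "tsuc (tadd u s) < w" using less lim(1) tlimD by simp
    then show ?thesis using T 2 by simp
  next
    case 3
    have "tadd u T \<le> w"
    proof (rule ccontr)
      assume "\<not> tadd u T \<le> w"
      then obtain s where "s < T" "w \<le> tadd u s" using tsup_least[of w "tadd u" T] tadd_tlim[OF 3, of u] by (auto simp: not_le)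
      then show False using less by fastforce
    qed
    then show ?thesis using T by auto
  qed
qed (simp, rule exI[of _ tz], simp)

text \<open>A limit superior depends only on a final segment of the sequence, and the offsets from
  \<open>u\<close> exhaust one.\<close>

lemma Lim_tadd:
  assumes "tlim t" shows "Lim g (tadd u t) = Lim (\<lambda>s. g (tadd u s)) t"
proof (intro set_eqI iffI)
  fix n assume n: "n \<in> Lim g (tadd u t)"
  show "n \<in> Lim (\<lambda>s. g (tadd u s)) t"
  proof (rule in_LimI)
    fix b assume "b < t"
    then obtain d where d: "tadd u b \<le> d" "d < tadd u t" "n \<in> g d" using n tadd_mono by (blast elim: in_LimD)
    then obtain s where "tadd u s = d" using tadd_surj le_tadd order_trans by meson
    then show "\<exists>s. b \<le> s \<and> s < t \<and> n \<in> g (tadd u s)" using d tadd_mono_iff by (metis not_le)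
  qed
next
  fix n assume n: "n \<in> Lim (\<lambda>s. g (tadd u s)) t"
  show "n \<in> Lim g (tadd u t)"
  proof (rule in_LimI)
    fix w assume "w < tadd u t"
    then obtain s where s: "s < t" "w \<le> tadd u s" using tsup_least tadd_tlim[OF assms] by metis
    then obtain d where "s \<le> d" "d < t" "n \<in> g (tadd u d)" using n by (blast elim: in_LimD)
    then show "\<exists>d. w \<le> d \<and> d < tadd u t \<and> n \<in> g d"
      using s tadd_mono_iff by (metis not_le order_trans)
  qed
qed

text \<open>A subcomputation carried on one track of a larger one; the cells in \<^term>\<open>N\<close> are its frozen control data.\<close>

lemma embedded_run:
  assumes a0: "{n. h n \<in> arun G' S u} = a0"
    and N: "\<forall>n\<in>N. n \<in> arun G' S u \<longleftrightarrow> n \<in> K"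
    and stp: "\<And>S. (\<forall>n\<in>N. n \<in> S \<longleftrightarrow> n \<in> K) \<Longrightarrow> h 0 \<notin> S \<Longrightarrow>
        {n. h n \<in> G' S} = G {n. h n \<in> S} \<and> (\<forall>n\<in>N. n \<in> G' S \<longleftrightarrow> n \<in> K)"
    and run: "\<forall>s<t. 0 \<notin> arun G a0 s"
  shows "{n. h n \<in> arun G' S (tadd u t)} = arun G a0 t \<and> (\<forall>n\<in>N. n \<in> arun G' S (tadd u t) \<longleftrightarrow> n \<in> K)"
  using run
proof (induction t rule: time_induct)
  case (suc t)
  then have IH: "{n. h n \<in> arun G' S (tadd u t)} = arun G a0 t" "\<forall>n\<in>N. n \<in> arun G' S (tadd u t) \<longleftrightarrow> n \<in> K"
    by (auto simp: less_tsuc_iff)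
  have "0 \<notin> arun G a0 t" using suc.prems by simp
  then have "h 0 \<notin> arun G' S (tadd u t)" using IH(1) by blast
  from stp[OF IH(2) this] IH(1) show ?case by simp
next
  case (lim t)
  then have IH: "{n. h n \<in> arun G' S (tadd u s)} = arun G a0 s" "\<forall>n\<in>N. n \<in> arun G' S (tadd u s) \<longleftrightarrow> n \<in> K" if "s < t" for s
    using that by (meson order.strict_trans)+
  have L: "arun G' S (tadd u t) = Lim (\<lambda>s. arun G' S (tadd u s)) t"
    using arun_tlim[OF tlim_tadd[OF lim(1)]] Lim_tadd[OF lim(1)] by simp
  have "{n. h n \<in> arun G' S (tadd u t)} = Lim (\<lambda>s. {n. h n \<in> arun G' S (tadd u s)}) t"
    unfolding L Lim_vimage ..
  also have "\<dots> = Lim (arun G a0) t" by (rule Lim_cong) (rule IH)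
  finally have "{n. h n \<in> arun G' S (tadd u t)} = arun G a0 t" using arun_tlim[OF lim(1)] by simp
  moreover have "n \<in> arun G' S (tadd u t) \<longleftrightarrow> n \<in> K" if "n \<in> N" for n
    unfolding L by (rule Lim_eventually[OF tlim_pos[OF lim(1)]]) (use IH that in blast)
  ultimately show ?case by blast
qed (use a0 N in simp)

text \<open>Transfinite simulation: \<^term>\<open>B u t\<close> says that the simulating run has, at its time \<^term>\<open>u\<close>, completed
  stage \<^term>\<open>t\<close> of the simulated run.\<close>

lemma simulation:
  fixes ob ab :: "time \<Rightarrow> nat set"
  assumes base: "B u0 tz"
    and stp: "\<And>u t. B u t \<Longrightarrow> \<not> H t \<Longrightarrow> \<exists>u'>u. B u' (tsuc t) \<and>
        (\<forall>w n. u \<le> w \<longrightarrow> w \<le> u' \<longrightarrow> (n \<in> ob w) = (n \<in> ab t) \<or> (n \<in> ob w) = (n \<in> ab (tsuc t)))"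
    and lim: "\<And>u t. tlim t \<Longrightarrow> tlim u \<Longrightarrow> (\<And>b. b < u \<Longrightarrow> \<exists>w s. b \<le> w \<and> w < u \<and> s < t \<and> B w s) \<Longrightarrow>
        ob u = ab t \<Longrightarrow> \<exists>u'\<ge>u. B u' t \<and> (\<forall>w. u \<le> w \<longrightarrow> w \<le> u' \<longrightarrow> ob w = ab t)"
    and olim: "\<And>u. tlim u \<Longrightarrow> ob u = Lim ob u"
    and alim: "\<And>u. tlim u \<Longrightarrow> ab u = Lim ab u"
    and bo: "\<And>u t. B u t \<Longrightarrow> ob u = ab t"
  obtains \<phi> where "\<And>t. (\<forall>s<t. \<not> H s) \<Longrightarrow> B (\<phi> t) t \<and> t \<le> \<phi> t \<and> (\<forall>s<t. \<phi> s < \<phi> t) \<and>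
      (\<forall>s w n. s \<le> t \<longrightarrow> \<phi> s \<le> w \<longrightarrow> w \<le> \<phi> t \<longrightarrow> (\<exists>r\<ge>s. r \<le> t \<and> (n \<in> ob w) = (n \<in> ab r)))"
proof -
  \<comment> \<open>The successor clause of \<open>trec\<close> is not told the time, so the first
    component carries the simulated stage and the second the simulating time chosen for it.\<close>
  define nxt where "nxt = (\<lambda>(t, u). (tsuc t, SOME u'. u < u' \<and> B u' (tsuc t) \<and>
        (\<forall>w n. u \<le> w \<longrightarrow> w \<le> u' \<longrightarrow> (n \<in> ob w) = (n \<in> ab t) \<or> (n \<in> ob w) = (n \<in> ab (tsuc t)))))"
  define lmt where "lmt = (\<lambda>(f :: time \<Rightarrow> time \<times> time) t. (t, SOME u'. tsup (\<lambda>s. snd (f s)) t \<le> u' \<and> B u' t \<and>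
        (\<forall>w. tsup (\<lambda>s. snd (f s)) t \<le> w \<longrightarrow> w \<le> u' \<longrightarrow> ob w = ab t)))"
  define \<psi> where "\<psi> = trec (tz, u0) nxt lmt"
  define \<phi> where "\<phi> t = snd (\<psi> t)" for t
  have lmt_local: "lmt f t = lmt g t" if "\<And>u. u < t \<Longrightarrow> f u = g u" for f g t
  proof -
    have "tsup (\<lambda>s. snd (f s)) t = tsup (\<lambda>s. snd (g s)) t" by (rule tsup_cong) (simp add: that)
    then show ?thesis unfolding lmt_def by simp
  qed
  have \<psi>_tz: "\<psi> tz = (tz, u0)" unfolding \<psi>_def by (rule trec_tz)
  have \<psi>_suc: "\<psi> (tsuc t) = nxt (\<psi> t)" for t unfolding \<psi>_def by (rule trec_tsuc)
  have \<psi>_lim: "\<psi> t = lmt \<psi> t" if "tlim t" for t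
    unfolding \<psi>_def by (rule trec_tlim[OF that]) (rule lmt_local)
  have fst: "fst (\<psi> t) = t" for t
  proof (induction t rule: time_induct)
    case (suc t)
    then show ?case unfolding \<psi>_suc nxt_def by (simp add: case_prod_beta)
  next
    case (lim t)
    then show ?case by (simp add: \<psi>_lim lmt_def)
  qed (simp add: \<psi>_tz)
  define good where "good t \<longleftrightarrow> B (\<phi> t) t \<and> t \<le> \<phi> t \<and> (\<forall>s<t. \<phi> s < \<phi> t) \<and>
      (\<forall>s w n. s \<le> t \<longrightarrow> \<phi> s \<le> w \<longrightarrow> w \<le> \<phi> t \<longrightarrow> (\<exists>r\<ge>s. r \<le> t \<and> (n \<in> ob w) = (n \<in> ab r)))" for t
  have "good t" if "\<forall>s<t. \<not> H s" for t
    using that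
  proof (induction t rule: time_induct)
    case zero
    have "\<phi> tz = u0" unfolding \<phi>_def \<psi>_tz by simp
    then show ?case unfolding good_def using base bo[OF base] by (auto intro: order_antisym)
  next
    case (suc t)
    have "\<forall>s<t. \<not> H s" using suc.prems by (simp add: less_tsuc_iff less_imp_le)
    then have g: "good t" by (rule suc.IH)
    have nH: "\<not> H t" using suc.prems by simp
    have ex: "\<exists>u'. \<phi> t < u' \<and> B u' (tsuc t) \<and> (\<forall>w n. \<phi> t \<le> w \<longrightarrow> w \<le> u' \<longrightarrow> (n \<in> ob w) = (n \<in> ab t) \<or> (n \<in> ob w) = (n \<in> ab (tsuc t)))"
      (is "\<exists>u'. ?Q u'")
      using stp[OF _ nH] g unfolding good_def by blast
    have "\<psi> t = (t, \<phi> t)" unfolding \<phi>_def using fst[of t] by (metis prod.collapse)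
    then have "\<phi> (tsuc t) = (SOME u'. ?Q u')" unfolding \<phi>_def[of "tsuc t"] \<psi>_suc nxt_def by simp
    then have "?Q (\<phi> (tsuc t))" using someI_ex[OF ex] by presburger
    then have nx: "\<phi> t < \<phi> (tsuc t)" "B (\<phi> (tsuc t)) (tsuc t)"
      "\<And>w n. \<phi> t \<le> w \<Longrightarrow> w \<le> \<phi> (tsuc t) \<Longrightarrow> (n \<in> ob w) = (n \<in> ab t) \<or> (n \<in> ob w) = (n \<in> ab (tsuc t))"
      by blast+
    show ?case unfolding good_def
    proof (intro conjI allI impI)
      show "B (\<phi> (tsuc t)) (tsuc t)" by fact
      show "tsuc t \<le> \<phi> (tsuc t)" using g nx(1) unfolding good_def tsuc_le_iff by auto
      show "\<phi> s < \<phi> (tsuc t)" if "s < tsuc t" for s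
        using that g nx(1) unfolding good_def less_tsuc_iff by (metis le_less order.strict_trans)
      fix s w n assume s: "s \<le> tsuc t" "\<phi> s \<le> w" "w \<le> \<phi> (tsuc t)"
      show "\<exists>r\<ge>s. r \<le> tsuc t \<and> (n \<in> ob w) = (n \<in> ab r)"
      proof (cases "s = tsuc t")
        case True
        then have "w = \<phi> (tsuc t)" using s by auto
        then show ?thesis using bo[OF nx(2)] True by blast
      next
        case False
        then have st: "s \<le> t" using s(1) less_tsuc_iff[of s t] by auto
        show ?thesis
        proof (cases "w \<le> \<phi> t")
          case True
          then obtain r where "r \<ge> s" "r \<le> t" "(n \<in> ob w) = (n \<in> ab r)"
            using g st s(2) unfolding good_def by blast
          then have "r \<le> tsuc t" using le_tsuc[of t] by (blast intro: order_trans)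
          then show ?thesis using \<open>r \<ge> s\<close> \<open>(n \<in> ob w) = (n \<in> ab r)\<close> by blast
        next
          case False
          then have "(n \<in> ob w) = (n \<in> ab t) \<or> (n \<in> ob w) = (n \<in> ab (tsuc t))" using nx(3)[of w n] s(3) by simp
          then show ?thesis using st s(1) le_tsuc[of t] by blast
        qed
      qed
    qed
  next
    case (lim t)
    then have g: "good s" if "s < t" for s using that by (meson order.strict_trans)
    define u where "u = tsup \<phi> t"
    have up: "\<phi> s < u" if "s < t" for s unfolding u_def using that by (rule tsup_upper)
    have mono: "\<phi> s < \<phi> s'" if "s < s'" "s' < t" for s s' using g[OF that(2)] that(1) unfolding good_def by blast
    have lu: "tlim u" unfolding u_def by (rule tsup_tlim[OF lim(1)]) (use mono tlimD[OF lim(1)] in auto)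
    have below: "\<exists>s'<t. s \<le> s' \<and> w \<le> \<phi> s'" if "w < u" "s < t" for w s
    proof -
      obtain s' where s': "s' < t" "w \<le> \<phi> s'" using \<open>w < u\<close> tsup_least unfolding u_def by blast
      show ?thesis
      proof (cases "s \<le> s'")
        case False
        then have "\<phi> s' < \<phi> s" using mono \<open>s < t\<close> by simp
        then show ?thesis using s' \<open>s < t\<close> by (intro exI[of _ s]) auto
      qed (use s' in blast)
    qed
    \<comment> \<open>From time \<open>\<phi> b\<close> on a simulating cell shows only values that
      the simulated cell has at stages from \<open>b\<close> on, and every stage is fully shown at
      its own time. Hence the two limits superior agree, however long a single stage takes.\<close>
    have oa: "ob u = ab t"
      unfolding olim[OF lu] alim[OF lim(1)]
    proof (intro set_eqI iffI)
      fix n assume n: "n \<in> Lim ob u"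
      show "n \<in> Lim ab t"
      proof (rule in_LimI)
        fix b assume b: "b < t"
        then obtain w where w: "\<phi> b \<le> w" "w < u" "n \<in> ob w" using n up by (blast elim: in_LimD)
        then obtain s' where s': "s' < t" "b \<le> s'" "w \<le> \<phi> s'" using below b by blast
        then obtain r where "b \<le> r" "r \<le> s'" "(n \<in> ob w) = (n \<in> ab r)" using g[OF s'(1)] w(1) unfolding good_def by blast
        then show "\<exists>d. b \<le> d \<and> d < t \<and> n \<in> ab d" using s' w le_less_trans[of r s' t] by blast
      qed
    next
      fix n assume n: "n \<in> Lim ab t"
      show "n \<in> Lim ob u"
      proof (rule in_LimI)
        fix w assume "w < u"
        then obtain s where s: "s < t" "w \<le> \<phi> s" using below[OF _ tlim_pos[OF lim(1)]] by blast
        then obtain d where d: "s \<le> d" "d < t" "n \<in> ab d" using n by (blast elim: in_LimD)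
        then have "B (\<phi> d) d" "\<phi> s \<le> \<phi> d" using g mono[of s d] unfolding good_def by (auto simp: le_less)
        then show "\<exists>d. w \<le> d \<and> d < u \<and> n \<in> ob d" using up[OF d(2)] d(3) s bo by (metis order_trans)
      qed
    qed
    have ex: "\<exists>u'. u \<le> u' \<and> B u' t \<and> (\<forall>w. u \<le> w \<longrightarrow> w \<le> u' \<longrightarrow> ob w = ab t)" (is "\<exists>u'. ?Q u'")
    proof (rule lim.hyps(1)[THEN assms(3), OF lu _ oa])
      fix b assume "b < u"
      then obtain s where "s < t" "b \<le> \<phi> s" using below[OF _ tlim_pos[OF lim(1)]] by blast
      then show "\<exists>w s. b \<le> w \<and> w < u \<and> s < t \<and> B w s" using up g unfolding good_def by blast
    qed
    have "tsup (\<lambda>s. snd (\<psi> s)) t = u" unfolding u_def \<phi>_def ..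
    then have "\<phi> t = (SOME u'. ?Q u')" unfolding \<phi>_def[of t] \<psi>_lim[OF lim(1)] lmt_def by simp
    then have "?Q (\<phi> t)" using someI_ex[OF ex] by presburger
    then have nx: "u \<le> \<phi> t" "B (\<phi> t) t" "\<And>w. u \<le> w \<Longrightarrow> w \<le> \<phi> t \<Longrightarrow> ob w = ab t" by blast+
    have up': "\<phi> s < \<phi> t" if "s < t" for s using up[OF that] nx(1) by simp
    show ?case unfolding good_def
    proof (intro conjI allI impI)
      show "t \<le> \<phi> t"
      proof (rule ccontr)
        assume "\<not> t \<le> \<phi> t"
        then have *: "\<phi> t < t" by simp
        from g[OF this] have "\<phi> t \<le> \<phi> (\<phi> t)" unfolding good_def by blast
        then show False using up'[OF *] by simp
      qed
      fix s w n assume s: "s \<le> t" "\<phi> s \<le> w" "w \<le> \<phi> t"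
      show "\<exists>r\<ge>s. r \<le> t \<and> (n \<in> ob w) = (n \<in> ab r)"
      proof (cases "u \<le> w")
        case True
        then show ?thesis using nx(3) s by blast
      next
        case False
        then have "s < t" using s nx(1) by (metis le_less order_trans)
        then obtain s' where s': "s' < t" "s \<le> s'" "w \<le> \<phi> s'" using below[of w s] False by (auto simp: not_le)
        then obtain r where "s \<le> r" "r \<le> s'" "(n \<in> ob w) = (n \<in> ab r)" using g[OF s'(1)] s(2) unfolding good_def by blast
        then have "r \<le> t" using s'(1) by simp
        then show ?thesis using \<open>s \<le> r\<close> \<open>(n \<in> ob w) = (n \<in> ab r)\<close> by blast
      qed
    qed (use nx up' in auto)
  qed
  then show ?thesis using that[of \<phi>] unfolding good_def by blast
qed

text \<open>This is \<open>u\<close> + \<omega>, the end of a phase of \<omega> many machine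
  steps.\<close>

definition tom :: "time \<Rightarrow> time" where "tom u = (LEAST w. \<forall>n. (tsuc ^^ n) u < w)"

lemma less_tom: "(tsuc ^^ n) u < tom u"
proof -
  obtain w where "\<forall>n. (tsuc ^^ n) u < w" using time_bounded_nat[of "\<lambda>n. (tsuc ^^ n) u"] by blast
  then have "\<forall>n. (tsuc ^^ n) u < tom u" unfolding tom_def by (rule LeastI)
  then show ?thesis by blast
qed

lemma tsuc_funpow_mono: "n \<le> m \<Longrightarrow> (tsuc ^^ n) u \<le> (tsuc ^^ m) u"
  by (rule lift_Suc_mono_le[of "\<lambda>n. (tsuc ^^ n) u"]) (auto simp: less_imp_le)

lemma tom_least: "w < tom u \<Longrightarrow> \<exists>n. w \<le> (tsuc ^^ n) u"
  using not_less_Least[of w "\<lambda>w. \<forall>n. (tsuc ^^ n) u < w"] unfolding tom_def by (auto simp: not_less)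

lemma tlim_tom: "tlim (tom u)"
  unfolding tlim_def
proof (intro conjI allI impI)
  show "tom u \<noteq> tz" using less_tom[of 0 u] by auto
  fix b assume "b < tom u"
  then obtain n where "b \<le> (tsuc ^^ n) u" using tom_least by blast
  then have "tsuc b \<le> tsuc ((tsuc ^^ n) u)" by (simp add: tsuc_le_iff less_tsuc_iff)
  then show "tsuc b < tom u" using less_tom[of "Suc n" u] by simp
qed

lemma tom_between: "u \<le> w \<Longrightarrow> w < tom u \<Longrightarrow> \<exists>n. w = (tsuc ^^ n) u"
proof -
  assume a: "u \<le> w" "w < tom u"
  define n where "n = (LEAST n. w \<le> (tsuc ^^ n) u)"
  have n: "w \<le> (tsuc ^^ n) u" unfolding n_def using tom_least[OF a(2)] by (rule LeastI_ex)
  show ?thesis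
  proof (cases n)
    case 0 then show ?thesis using n a by (intro exI[of _ 0]) auto
  next
    case (Suc m)
    then have "\<not> w \<le> (tsuc ^^ m) u" using not_less_Least[of m "\<lambda>n. w \<le> (tsuc ^^ n) u"] unfolding n_def by auto
    then have "tsuc ((tsuc ^^ m) u) \<le> w" by (simp add: tsuc_le_iff)
    then show ?thesis using n Suc by (intro exI[of _ n]) auto
  qed
qed

lemma crun_funpow: "crun p y z ((tsuc ^^ n) u) = (step p y ^^ n) (crun p y z u)"
  by (induction n) auto

lemma P_surj: "\<exists>i. P i = p"
proof -
  have "\<exists>n. decode_instr n = a" for a
    by (cases a) (rule exI[of _ "prod_encode (fst a, prod_encode (fst (snd a), prod_encode (fst (snd (snd a)),
      prod_encode (fst (snd (snd (snd a))), snd (snd (snd (snd a)))))))"], simp add: decode_instr_def)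
  then obtain g where g: "\<And>a. decode_instr (g a) = a" by metis
  have "P (list_encode (map g p)) = p" unfolding P_def by (simp add: g o_def)
  then show ?thesis by blast
qed

section \<open>Primitive recursive functions and loop programs\<close>

abbreviation pr :: "nat \<Rightarrow> nat \<Rightarrow> nat" where "pr a b \<equiv> prod_encode (a, b)"
definition p1 :: "nat \<Rightarrow> nat" where "p1 n = fst (prod_decode n)"
definition p2 :: "nat \<Rightarrow> nat" where "p2 n = snd (prod_decode n)"

lemma p_pr [simp]: "p1 (pr a b) = a" "p2 (pr a b) = b" unfolding p1_def p2_def by auto
lemma pr_p [simp]: "pr (p1 n) (p2 n) = n" unfolding p1_def p2_def by simp
lemma p_zero [simp]: "p1 0 = 0" "p2 0 = 0"
  using p_pr[of 0 0] by (simp_all add: prod_encode_def)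

text \<open>The step along the diagonals of Cantor's enumeration of pairs; it lets
  \<open>dcd\<close> decode a pair by counting.\<close>

lemma p_Suc: "p1 (Suc n) = (if p2 n = 0 then 0 else Suc (p1 n))" "p2 (Suc n) = (if p2 n = 0 then Suc (p1 n) else p2 n - 1)"
proof -
  have "pr (if p2 n = 0 then 0 else Suc (p1 n)) (if p2 n = 0 then Suc (p1 n) else p2 n - 1) = Suc (pr (p1 n) (p2 n))"
    by (auto simp: prod_encode_def simp del: pr_p)
  then have "Suc n = pr (if p2 n = 0 then 0 else Suc (p1 n)) (if p2 n = 0 then Suc (p1 n) else p2 n - 1)" by simp
  then show "p1 (Suc n) = (if p2 n = 0 then 0 else Suc (p1 n))" "p2 (Suc n) = (if p2 n = 0 then Suc (p1 n) else p2 n - 1)"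
    by (metis p_pr)+
qed

text \<open>The unary primitive recursive functions: pairing replaces several arguments, and
  iteration replaces the recursion scheme.\<close>

inductive rf :: "(nat \<Rightarrow> nat) \<Rightarrow> bool" where
  rf_id: "rf (\<lambda>n. n)"
| rf_zero: "rf (\<lambda>n. 0)"
| rf_Suc: "rf f \<Longrightarrow> rf (\<lambda>n. Suc (f n))"
| rf_p1: "rf f \<Longrightarrow> rf (\<lambda>n. p1 (f n))"
| rf_p2: "rf f \<Longrightarrow> rf (\<lambda>n. p2 (f n))"
| rf_pr: "rf f \<Longrightarrow> rf g \<Longrightarrow> rf (\<lambda>n. pr (f n) (g n))"
| rf_iter: "rf h \<Longrightarrow> rf f \<Longrightarrow> rf g \<Longrightarrow> rf (\<lambda>n. (h ^^ g n) (f n))"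

lemma rf_comp: "rf f \<Longrightarrow> rf g \<Longrightarrow> rf (\<lambda>n. f (g n))"
proof (induction rule: rf.induct)
  case (rf_iter h f k)
  from rf.rf_iter[OF rf_iter.hyps(1) rf_iter.IH(2) rf_iter.IH(3)] rf_iter.prems show ?case by simp
qed (auto intro: rf.intros)

lemma rf_const: "rf (\<lambda>n. k)"
  by (induction k) (auto intro: rf.intros)

lemma rf_if0:
  assumes "rf c" "rf f" "rf g" shows "rf (\<lambda>n. if c n = 0 then f n else g n)"
proof -
  \<comment> \<open>Zero rounds leave the first component in front; one or more bring the second
    there for good. Iteration thus acts as a test for zero.\<close>
  have e: "((\<lambda>s. pr (p2 s) (p2 s)) ^^ k) (pr a b) = (if k = 0 then pr a b else pr b b)" for k a b
    by (induction k) auto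
  have "rf (\<lambda>n. p1 (((\<lambda>s. pr (p2 s) (p2 s)) ^^ c n) (pr (f n) (g n))))"
    by (intro rf.intros assms)
  moreover have "(\<lambda>n. p1 (((\<lambda>s. pr (p2 s) (p2 s)) ^^ c n) (pr (f n) (g n)))) = (\<lambda>n. if c n = 0 then f n else g n)"
    by (rule ext) (simp add: e)
  ultimately show ?thesis by simp
qed

lemma rf_pred: assumes "rf f" shows "rf (\<lambda>n. f n - 1)"
proof -
  have e: "((\<lambda>s. pr (p2 s) (Suc (p2 s))) ^^ k) (pr 0 0) = pr (k - 1) k" for k
    by (induction k) auto
  have "rf (\<lambda>n. p1 (((\<lambda>s. pr (p2 s) (Suc (p2 s))) ^^ f n) (pr 0 0)))"
    by (intro rf.intros assms)
  moreover have "(\<lambda>n. p1 (((\<lambda>s. pr (p2 s) (Suc (p2 s))) ^^ f n) (pr 0 0))) = (\<lambda>n. f n - 1)"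
    by (rule ext) (simp only: e p_pr)
  ultimately show ?thesis by simp
qed

lemma rf_minus: assumes "rf f" "rf g" shows "rf (\<lambda>n. f n - g n)"
proof -
  have e: "((\<lambda>n. n - 1) ^^ k) a = a - k" for k a :: nat by (induction k) auto
  have "rf (\<lambda>n. ((\<lambda>n. n - 1) ^^ g n) (f n))" by (intro rf_iter rf_pred rf_id assms)
  then show ?thesis unfolding e .
qed

lemma rf_plus: assumes "rf f" "rf g" shows "rf (\<lambda>n. f n + g n)"
proof -
  have e: "(Suc ^^ k) a = a + k" for k a by (induction k) auto
  have "rf (\<lambda>n. ((\<lambda>n. Suc n) ^^ g n) (f n))" by (intro rf_iter rf_Suc rf_id assms)
  then show ?thesis unfolding e .
qed

lemma rf_half: assumes "rf f" shows "rf (\<lambda>n. f n div 2)"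
proof -
  \<comment> \<open>The two components exchange places and only one of them grows, so each is raised
    in every second round.\<close>
  have e: "((\<lambda>s. pr (p2 s) (Suc (p1 s))) ^^ k) (pr 0 0) = pr (k div 2) (Suc k div 2)" for k
    by (induction k) auto
  have "rf (\<lambda>n. p1 (((\<lambda>s. pr (p2 s) (Suc (p1 s))) ^^ f n) (pr 0 0)))" by (intro rf.intros assms)
  then show ?thesis unfolding e p_pr .
qed

lemma rf_mod2: assumes "rf f" shows "rf (\<lambda>n. f n mod 2)"
proof -
  have "rf (\<lambda>n. f n - (f n div 2 + f n div 2))" by (intro rf_minus rf_plus rf_half assms)
  moreover have "k - (k div 2 + k div 2) = k mod 2" for k :: nat by presburger
  ultimately show ?thesis by simp
qed

lemmas rf_intros = rf_const rf_id rf_Suc rf_p1 rf_p2 rf_pr rf_plus rf_minus rf_half rf_mod2 rf_if0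

text \<open>Predicates decided in finitely many steps from an oracle \<^term>\<open>y\<close> and a tape \<^term>\<open>X\<close>.\<close>

inductive rp :: "(nat set \<Rightarrow> nat set \<Rightarrow> nat \<Rightarrow> bool) \<Rightarrow> bool" where
  rp_X: "rf f \<Longrightarrow> rp (\<lambda>y X n. f n \<in> X)"
| rp_O: "rf f \<Longrightarrow> rp (\<lambda>y X n. f n \<in> y)"
| rp_zero: "rf f \<Longrightarrow> rp (\<lambda>y X n. f n = 0)"
| rp_not: "rp Q \<Longrightarrow> rp (\<lambda>y X n. \<not> Q y X n)"
| rp_and: "rp Q \<Longrightarrow> rp R \<Longrightarrow> rp (\<lambda>y X n. Q y X n \<and> R y X n)"

lemma rp_comp: "rp Q \<Longrightarrow> rf f \<Longrightarrow> rp (\<lambda>y X n. Q y X (f n))"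
proof (induction rule: rp.induct)
  case (rp_X g) then show ?case using rp.rp_X[OF rf_comp] by blast
next
  case (rp_O g) then show ?case using rp.rp_O[OF rf_comp] by blast
next
  case (rp_zero g) then show ?case using rp.rp_zero[OF rf_comp] by blast
next
  case (rp_not Q) then show ?case using rp.rp_not by blast
next
  case (rp_and Q R) then show ?case using rp.rp_and by blast
qed

text \<open>Reading a track instead of the whole tape only changes the addresses of the queries, and
  these may be any \<open>rf\<close> functions.\<close>

lemma rp_view: "rp Q \<Longrightarrow> rf h \<Longrightarrow> rp (\<lambda>y X n. Q y {m. h m \<in> X} n)"
proof (induction rule: rp.induct)
  case (rp_X g) then show ?case using rp.rp_X[OF rf_comp, of h g] by simp
next
  case (rp_O g) then show ?case using rp.rp_O by blast
next
  case (rp_zero g) then show ?case using rp.rp_zero by blast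
next
  case (rp_not Q) then show ?case using rp.rp_not by blast
next
  case (rp_and Q R) then show ?case using rp.rp_and by blast
qed

lemma rp_or: assumes "rp Q" "rp R" shows "rp (\<lambda>y X n. Q y X n \<or> R y X n)"
proof -
  have "rp (\<lambda>y X n. \<not> (\<not> Q y X n \<and> \<not> R y X n))" by (intro rp_not rp_and assms)
  then show ?thesis by simp
qed

lemma rp_eq: assumes "rf f" "rf g" shows "rp (\<lambda>y X n. f n = g n)"
proof -
  have "rp (\<lambda>y X n. (f n - g n) + (g n - f n) = 0)" by (intro rp_zero rf_plus rf_minus assms)
  moreover have "(f n - g n) + (g n - f n) = 0 \<longleftrightarrow> f n = g n" for n by auto
  ultimately show ?thesis by simp
qed

lemma rp_le: assumes "rf f" "rf g" shows "rp (\<lambda>y X n. f n \<le> g n)"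
proof -
  have "rp (\<lambda>y X n. f n - g n = 0)" by (intro rp_zero rf_minus assms)
  then show ?thesis by simp
qed

lemma rp_less: assumes "rf f" "rf g" shows "rp (\<lambda>y X n. f n < g n)"
  using rp_le[OF rf_Suc[OF assms(1)] assms(2)] by (simp add: Suc_le_eq)

lemma rp_odd: assumes "rf f" shows "rp (\<lambda>y X n. odd (f n))"
  unfolding odd_iff_mod_2_eq_one by (rule rp_eq[OF rf_mod2[OF assms] rf_const])

lemma rp_const: "rp (\<lambda>y X n. b)"
  using rp_zero[OF rf_const[of 0]] rp_not[OF rp_zero[OF rf_const[of 0]]] by (cases b) auto

lemma rp_imp: assumes "rp Q" "rp R" shows "rp (\<lambda>y X n. Q y X n \<longrightarrow> R y X n)"
  unfolding imp_conv_disj by (rule rp_or[OF rp_not[OF assms(1)] assms(2)])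

lemma rp_iff: assumes "rp Q" "rp R" shows "rp (\<lambda>y X n. Q y X n \<longleftrightarrow> R y X n)"
proof -
  have "rp (\<lambda>y X n. (Q y X n \<longrightarrow> R y X n) \<and> (R y X n \<longrightarrow> Q y X n))" by (intro rp_and rp_imp assms)
  moreover have "((Q y X n \<longrightarrow> R y X n) \<and> (R y X n \<longrightarrow> Q y X n)) = (Q y X n \<longleftrightarrow> R y X n)" for y X n by blast
  ultimately show ?thesis by simp
qed

lemma rp_if: assumes "rp C" "rp Q" "rp R" shows "rp (\<lambda>y X n. if C y X n then Q y X n else R y X n)"
proof -
  have "rp (\<lambda>y X n. (C y X n \<longrightarrow> Q y X n) \<and> (\<not> C y X n \<longrightarrow> R y X n))" by (intro rp_and rp_imp rp_not assms)
  then show ?thesis unfolding if_bool_eq_conj .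
qed

text \<open>Loop programs: \<open>GetX\<close> and \<open>GetO\<close> add to register 1 the bit of the tape (oracle) at the address
  in register 0, \<open>Put\<close> stores a bit at that address.\<close>

datatype com = Skip | Inc nat | Dec nat | Seq com com | If nat com com | Loop nat com | GetX | GetO | Put bool

fun ex :: "nat set \<Rightarrow> nat set \<Rightarrow> com \<Rightarrow> (nat \<Rightarrow> nat) \<Rightarrow> nat \<Rightarrow> nat" where
  "ex y X Skip s = s"
| "ex y X (Inc i) s = s(i := Suc (s i))"
| "ex y X (Dec i) s = s(i := s i - 1)"
| "ex y X (Seq c d) s = ex y X d (ex y X c s)"
| "ex y X (If i c d) s = (if s i \<noteq> 0 then ex y X c s else ex y X d s)"
| "ex y X (Loop i c) s = ((\<lambda>s. ex y X c (s(i := s i - 1))) ^^ s i) s"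
| "ex y X GetX s = (if s 0 \<in> X then s(1 := Suc (s 1)) else s)"
| "ex y X GetO s = (if s 0 \<in> y then s(1 := Suc (s 1)) else s)"
| "ex y X (Put b) s = s"

fun wr :: "com \<Rightarrow> nat set" where
  "wr (Inc i) = {i}" | "wr (Dec i) = {i}" | "wr (Seq c d) = wr c \<union> wr d"
| "wr (If i c d) = wr c \<union> wr d" | "wr (Loop i c) = insert i (wr c)" | "wr GetX = {1}" | "wr GetO = {1}" | "wr _ = {}"

text \<open>A loop counts its register down and must not touch it otherwise.\<close>

fun wfc :: "com \<Rightarrow> bool" where
  "wfc (Seq c d) \<longleftrightarrow> wfc c \<and> wfc d" | "wfc (If i c d) \<longleftrightarrow> wfc c \<and> wfc d"
| "wfc (Loop i c) \<longleftrightarrow> i \<notin> wr c \<and> wfc c" | "wfc (Put b) \<longleftrightarrow> False" | "wfc _ \<longleftrightarrow> True"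

lemma ex_unchanged: "i \<notin> wr c \<Longrightarrow> ex y X c s i = s i"
proof (induction c arbitrary: s)
  case (Loop j c)
  have "((\<lambda>s. ex y X c (s(j := s j - 1))) ^^ k) s i = s i" for k
    by (induction k) (use Loop in auto)
  then show ?case by simp
qed auto

definition clr :: "nat \<Rightarrow> com" where "clr i = Loop i Skip"
definition mv :: "nat \<Rightarrow> nat \<Rightarrow> com" where "mv i j = Loop i (Inc j)"
text \<open>Counting register \<open>i\<close> down destroys it; \<open>t\<close> receives a second
  copy, from which \<open>i\<close> is restored.\<close>

definition cpy :: "nat \<Rightarrow> nat \<Rightarrow> nat \<Rightarrow> com" where
  "cpy i j t = Seq (clr j) (Seq (clr t) (Seq (Loop i (Seq (Inc j) (Inc t))) (mv t i)))"

lemma clr [simp]: "ex y X (clr i) s = s(i := 0)" "wr (clr i) = {i}" "wfc (clr i)"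
proof -
  have "((\<lambda>s. s(i := s i - Suc 0)) ^^ k) s = s(i := s i - k)" for k
    by (induction k) auto
  then show "ex y X (clr i) s = s(i := 0)" by (simp add: clr_def)
qed (auto simp: clr_def)

lemma mv: assumes "i \<noteq> j"
  shows mv_ex: "ex y X (mv i j) s = s(i := 0, j := s j + s i)" and mv_wr: "wr (mv i j) = {i, j}" "wfc (mv i j)"
proof -
  have "((\<lambda>s. ex y X (Inc j) (s(i := s i - 1))) ^^ k) s = s(i := s i - k, j := s j + k)" for k
  proof (induction k)
    case (Suc k)
    show ?case unfolding funpow.simps o_apply Suc.IH using assms by (simp add: fun_eq_iff)
  qed (use assms in \<open>simp add: fun_eq_iff\<close>)
  then show "ex y X (mv i j) s = s(i := 0, j := s j + s i)" by (simp add: mv_def)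
qed (use assms in \<open>auto simp: mv_def\<close>)

lemma cpy: assumes "i \<noteq> j" "i \<noteq> t" "j \<noteq> t"
  shows cpy_ex: "ex y X (cpy i j t) s = s(j := s i, t := 0)" and cpy_wr: "wr (cpy i j t) = {i, j, t}" "wfc (cpy i j t)"
proof -
  have "((\<lambda>s. ex y X (Seq (Inc j) (Inc t)) (s(i := s i - 1))) ^^ k) s = s(i := s i - k, j := s j + k, t := s t + k)" for k s
  proof (induction k)
    case (Suc k)
    show ?case unfolding funpow.simps o_apply Suc.IH using assms by (simp add: fun_eq_iff)
  qed (use assms in \<open>simp add: fun_eq_iff\<close>)
  then have L: "ex y X (Loop i (Seq (Inc j) (Inc t))) s = s(i := 0, j := s j + s i, t := s t + s i)" for s
    by (simp only: ex.simps diff_self_eq_0)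
  show "ex y X (cpy i j t) s = s(j := s i, t := 0)"
    unfolding cpy_def ex.simps(4) clr L mv_ex[OF assms(2)[symmetric]] using assms by (simp add: fun_eq_iff)
qed (use assms in \<open>auto simp: cpy_def mv_wr\<close>)

text \<open>\<open>pr a b\<close> equals \<open>triangle (a + b) + a\<close>: register
  \<open>m + 2\<close> gets a + b, and the loop adds 1, 2, ..., a + b to the \<open>a\<close> in
  register \<open>m\<close>.\<close>

definition enc :: "nat \<Rightarrow> com" where
  "enc m = Seq (cpy m (m+2) (m+3)) (Seq (mv (m+1) (m+2))
     (Loop (m+2) (Seq (Inc (m+1)) (Seq (cpy (m+1) (m+3) (m+4)) (mv (m+3) m)))))"

lemma enc: "ex y X (enc m) s m = pr (s m) (s (m+1))" "j < m \<Longrightarrow> j \<notin> wr (enc m)" "wfc (enc m)"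
proof -
  define B where "B = (\<lambda>s. ex y X (Seq (Inc (m+1)) (Seq (cpy (m+1) (m+3) (m+4)) (mv (m+3) m))) (s(m+2 := s (m+2) - 1)))"
  have B: "B s m = s m + Suc (s (m+1))" "B s (m+1) = Suc (s (m+1))" for s
    unfolding B_def by (simp_all add: cpy_ex mv_ex)
  have *: "(B ^^ k) s m = s m + triangle k + k * s (m+1) \<and> (B ^^ k) s (m+1) = s (m+1) + k" for k s
    by (induction k) (simp_all add: B del: One_nat_def add_Suc_right)
  define s' where "s' = ex y X (mv (m+1) (m+2)) (ex y X (cpy m (m+2) (m+3)) s)"
  have s': "s' m = s m" "s' (m+1) = 0" "s' (m+2) = s m + s (m+1)" unfolding s'_def by (simp_all add: cpy_ex mv_ex)
  have "ex y X (enc m) s = (B ^^ (s' (m+2))) s'" by (simp only: enc_def ex.simps B_def s'_def)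
  then have "ex y X (enc m) s m = s m + triangle (s m + s (m+1))" using *[of _ s'] s' by simp
  then show "ex y X (enc m) s m = pr (s m) (s (m+1))" by (simp add: prod_encode_def)
qed (auto simp: enc_def mv_wr cpy_wr)

text \<open>Starting from the pair (0, 0), the loop makes as many steps along the diagonals as the
  code says.\<close>

definition dcd :: "nat \<Rightarrow> com" where
  "dcd m = Seq (clr (m+2)) (Seq (mv m (m+2)) (Seq (clr (m+1))
     (Loop (m+2) (If (m+1) (Seq (Dec (m+1)) (Inc m)) (Seq (mv m (m+1)) (Inc (m+1)))))))"

lemma dcd: "ex y X (dcd m) s m = p1 (s m)" "ex y X (dcd m) s (m+1) = p2 (s m)" "j < m \<Longrightarrow> j \<notin> wr (dcd m)" "wfc (dcd m)"
proof -
  define B where "B = (\<lambda>s. ex y X (If (m+1) (Seq (Dec (m+1)) (Inc m)) (Seq (mv m (m+1)) (Inc (m+1)))) (s(m+2 := s (m+2) - 1)))"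
  have B: "B s m = (if s (m+1) = 0 then 0 else Suc (s m))" "B s (m+1) = (if s (m+1) = 0 then Suc (s m) else s (m+1) - 1)" for s
    unfolding B_def by (simp_all add: mv_ex)
  have *: "s m = 0 \<Longrightarrow> s (m+1) = 0 \<Longrightarrow> (B ^^ k) s m = p1 k \<and> (B ^^ k) s (m+1) = p2 k" for k s
    by (induction k) (simp_all add: B p_Suc del: One_nat_def add_Suc_right)
  define s' where "s' = ex y X (clr (m+1)) (ex y X (mv m (m+2)) (ex y X (clr (m+2)) s))"
  have s': "s' m = 0" "s' (m+1) = 0" "s' (m+2) = s m" unfolding s'_def by (simp_all add: mv_ex)
  have "ex y X (dcd m) s = (B ^^ (s' (m+2))) s'" by (simp only: dcd_def ex.simps B_def s'_def)
  then show "ex y X (dcd m) s m = p1 (s m)" "ex y X (dcd m) s (m+1) = p2 (s m)" using *[of s', OF s'(1,2)] s'(3) by simp_all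
qed (auto simp: dcd_def mv_wr)

text \<open>Register \<open>m\<close> is the top of a stack of registers: argument and result stand
  in it, what is below stays intact, and scratch space lies above. The lemma is proved for all
  \<open>m\<close>, so that a nested call can be placed higher up.\<close>

lemma rf_compile: "rf f \<Longrightarrow> \<exists>c. wfc c \<and> (\<forall>j<m. j \<notin> wr c) \<and> (\<forall>y X s. ex y X c s m = f (s m))"
proof (induction arbitrary: m rule: rf.induct)
  case rf_id then show ?case by (intro exI[of _ Skip]) auto
next
  case rf_zero then show ?case by (intro exI[of _ "clr m"]) auto
next
  case (rf_Suc f)
  then obtain c where "wfc c" "\<forall>j<m. j \<notin> wr c" "\<forall>y X s. ex y X c s m = f (s m)" by meson
  then show ?case by (intro exI[of _ "Seq c (Inc m)"]) auto
next
  case (rf_p1 f)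
  then obtain c where "wfc c" "\<forall>j<m. j \<notin> wr c" "\<forall>y X s. ex y X c s m = f (s m)" by meson
  then show ?case by (intro exI[of _ "Seq c (dcd m)"]) (auto simp: dcd)
next
  case (rf_p2 f)
  then obtain c where "wfc c" "\<forall>j<m. j \<notin> wr c" "\<forall>y X s. ex y X c s m = f (s m)" by meson
  then show ?case using dcd(2)[of _ _ m]
    by (intro exI[of _ "Seq c (Seq (dcd m) (Seq (clr m) (mv (m+1) m)))"]) (auto simp: dcd mv_ex mv_wr)
next
  case (rf_pr f g)
  obtain c where c: "wfc c" "\<forall>j<m+2. j \<notin> wr c" "\<forall>y X s. ex y X c s (m+2) = f (s (m+2))" using rf_pr.IH(1) by meson
  obtain d where d: "wfc d" "\<forall>j<m+1. j \<notin> wr d" "\<forall>y X s. ex y X d s (m+1) = g (s (m+1))" using rf_pr.IH(2) by meson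
  have u: "m \<notin> wr d" "m \<notin> wr c" "m+1 \<notin> wr c" using c d by auto
  show ?case
    by (intro exI[of _ "Seq (cpy m (m+1) (m+2)) (Seq d (Seq (cpy m (m+2) (m+3)) (Seq c (Seq (clr m) (Seq (mv (m+2) m) (enc m))))))"])
       (use c d u in \<open>auto simp: cpy_ex cpy_wr mv_ex mv_wr enc ex_unchanged simp del: One_nat_def\<close>)
next
  case (rf_iter h f g)
  obtain c where c: "wfc c" "\<forall>j<m+2. j \<notin> wr c" "\<forall>y X s. ex y X c s (m+2) = f (s (m+2))" using rf_iter.IH(2) by meson
  obtain d where d: "wfc d" "\<forall>j<m+1. j \<notin> wr d" "\<forall>y X s. ex y X d s (m+1) = g (s (m+1))" using rf_iter.IH(3) by meson
  obtain b where b: "wfc b" "\<forall>j<m+2. j \<notin> wr b" "\<forall>y X s. ex y X b s (m+2) = h (s (m+2))" using rf_iter.IH(1) by meson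
  have u: "m \<notin> wr d" "m \<notin> wr c" "m+1 \<notin> wr c" "m \<notin> wr b" "m+1 \<notin> wr b" using c d b by auto
  have it: "((\<lambda>s. ex y X b (s(m+1 := s (m+1) - 1))) ^^ k) s (m+2) = (h ^^ k) (s (m+2))" for y X k s
    by (induction k) (use b in auto)
  show ?case
    by (intro exI[of _ "Seq (cpy m (m+1) (m+2)) (Seq d (Seq (cpy m (m+2) (m+3)) (Seq c (Seq (Loop (m+1) b) (Seq (clr m) (mv (m+2) m))))))"])
       (use c d u b it in \<open>auto simp: cpy_ex cpy_wr mv_ex mv_wr ex_unchanged simp del: One_nat_def\<close>)
qed

text \<open>Registers 0 and 1 are the fixed address and answer registers of the queries. They are
  handed back cleared, so that one query can follow another.\<close>

lemma rp_compile:
  "rp Q \<Longrightarrow> m \<ge> 2 \<Longrightarrow> \<exists>c. wfc c \<and> (\<forall>j\<ge>2. j < m \<longrightarrow> j \<notin> wr c) \<and>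
     (\<forall>y X s. s 0 = 0 \<longrightarrow> s 1 = 0 \<longrightarrow> ex y X c s m = of_bool (Q y X (s m)) \<and> ex y X c s 0 = 0 \<and> ex y X c s 1 = 0)"
proof (induction arbitrary: m rule: rp.induct)
  case (rp_X f)
  obtain c where c: "wfc c" "\<forall>j<m. j \<notin> wr c" "\<forall>y X s. ex y X c s m = f (s m)" using rf_compile[OF rp_X.hyps] by blast
  have m: "m \<noteq> 0" "m \<noteq> 1" using rp_X.prems by auto
  have u: "ex y X c s 0 = s 0" "ex y X c s (Suc 0) = s (Suc 0)" for y X s
    using c(2) rp_X.prems by (simp_all add: ex_unchanged)
  let ?c = "Seq c (Seq (mv m 0) (Seq GetX (Seq (clr 0) (mv 1 m))))"
  have "wfc ?c" using c(1) m by (simp add: mv_wr)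
  moreover have "\<forall>j\<ge>2. j < m \<longrightarrow> j \<notin> wr ?c" using c(2) m by (simp add: mv_wr)
  moreover have "ex y X ?c s m = of_bool (f (s m) \<in> X) \<and> ex y X ?c s 0 = 0 \<and> ex y X ?c s 1 = 0"
    if "s 0 = 0" "s 1 = 0" for y X s
    using m that c(3) by (simp add: mv_ex u)
  ultimately show ?case by blast
next
  case (rp_O f)
  obtain c where c: "wfc c" "\<forall>j<m. j \<notin> wr c" "\<forall>y X s. ex y X c s m = f (s m)" using rf_compile[OF rp_O.hyps] by blast
  have m: "m \<noteq> 0" "m \<noteq> 1" using rp_O.prems by auto
  have u: "ex y X c s 0 = s 0" "ex y X c s (Suc 0) = s (Suc 0)" for y X s
    using c(2) rp_O.prems by (simp_all add: ex_unchanged)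
  let ?c = "Seq c (Seq (mv m 0) (Seq GetO (Seq (clr 0) (mv 1 m))))"
  have "wfc ?c" using c(1) m by (simp add: mv_wr)
  moreover have "\<forall>j\<ge>2. j < m \<longrightarrow> j \<notin> wr ?c" using c(2) m by (simp add: mv_wr)
  moreover have "ex y X ?c s m = of_bool (f (s m) \<in> y) \<and> ex y X ?c s 0 = 0 \<and> ex y X ?c s 1 = 0"
    if "s 0 = 0" "s 1 = 0" for y X s
    using m that c(3) by (simp add: mv_ex u)
  ultimately show ?case by blast
next
  case (rp_zero f)
  obtain c where c: "wfc c" "\<forall>j<m. j \<notin> wr c" "\<forall>y X s. ex y X c s m = f (s m)" using rf_compile[OF rp_zero.hyps] by blast
  have m: "m \<noteq> 0" "m \<noteq> 1" using rp_zero.prems by auto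
  have u: "ex y X c s 0 = s 0" "ex y X c s (Suc 0) = s (Suc 0)" for y X s
    using c(2) rp_zero.prems by (simp_all add: ex_unchanged)
  let ?c = "Seq c (If m (clr m) (Inc m))"
  have "wfc ?c" using c(1) m by (simp add: mv_wr)
  moreover have "\<forall>j\<ge>2. j < m \<longrightarrow> j \<notin> wr ?c" using c(2) m by (simp add: mv_wr)
  moreover have "ex y X ?c s m = of_bool (f (s m) = 0) \<and> ex y X ?c s 0 = 0 \<and> ex y X ?c s 1 = 0"
    if "s 0 = 0" "s 1 = 0" for y X s
    using m that c(3) by (simp add: mv_ex u)
  ultimately show ?case by blast
next
  case (rp_not Q)
  from rp_not.IH[OF rp_not.prems] obtain c where c: "wfc c" "\<forall>j\<ge>2. j < m \<longrightarrow> j \<notin> wr c"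
    "\<forall>y X s. s 0 = 0 \<longrightarrow> s 1 = 0 \<longrightarrow> ex y X c s m = of_bool (Q y X (s m)) \<and> ex y X c s 0 = 0 \<and> ex y X c s 1 = 0"
    by blast
  have m: "m \<noteq> 0" "m \<noteq> 1" using rp_not.prems by auto
  let ?c = "Seq c (If m (clr m) (Inc m))"
  have "wfc ?c" "\<forall>j\<ge>2. j < m \<longrightarrow> j \<notin> wr ?c" using c(1,2) by simp_all
  moreover have "ex y X ?c s m = of_bool (\<not> Q y X (s m)) \<and> ex y X ?c s 0 = 0 \<and> ex y X ?c s 1 = 0"
    if "s 0 = 0" "s 1 = 0" for y X s
    using c(3)[rule_format, OF that, of y X] m by simp
  ultimately show ?case by blast
next
  case (rp_and Q R)
  have "2 \<le> m + 1" using rp_and.prems by simp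
  from rp_and.IH(1)[OF this] obtain c where c: "wfc c" "\<forall>j\<ge>2. j < m + 1 \<longrightarrow> j \<notin> wr c"
    "\<forall>y X s. s 0 = 0 \<longrightarrow> s 1 = 0 \<longrightarrow> ex y X c s (m + 1) = of_bool (Q y X (s (m + 1))) \<and> ex y X c s 0 = 0 \<and> ex y X c s 1 = 0"
    by blast
  from rp_and.IH(2)[OF rp_and.prems] obtain d where d: "wfc d" "\<forall>j\<ge>2. j < m \<longrightarrow> j \<notin> wr d"
    "\<forall>y X s. s 0 = 0 \<longrightarrow> s 1 = 0 \<longrightarrow> ex y X d s m = of_bool (R y X (s m)) \<and> ex y X d s 0 = 0 \<and> ex y X d s 1 = 0"
    by blast
  have m: "m \<noteq> 0" "m \<noteq> 1" using rp_and.prems by auto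
  have u: "ex y X c s m = s m" for y X s using c(2) rp_and.prems by (simp add: ex_unchanged)
  let ?c = "Seq (cpy m (m+1) (m+2)) (Seq c (If (m+1) d (clr m)))"
  have "wfc ?c" "\<forall>j\<ge>2. j < m \<longrightarrow> j \<notin> wr ?c" using c(1,2) d(1,2) by (simp_all add: cpy_wr)
  moreover have "ex y X ?c s m = of_bool (Q y X (s m) \<and> R y X (s m)) \<and> ex y X ?c s 0 = 0 \<and> ex y X ?c s 1 = 0"
    if s: "s 0 = 0" "s 1 = 0" for y X s
  proof -
    define s1 where "s1 = s(m+1 := s m, m+2 := 0)"
    have s1: "s1 0 = 0" "s1 1 = 0" "s1 m = s m" "s1 (m+1) = s m" unfolding s1_def using s m by simp_all
    define s2 where "s2 = ex y X c s1"
    have s2: "s2 (m+1) = of_bool (Q y X (s m))" "s2 0 = 0" "s2 1 = 0" "s2 m = s m"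
      unfolding s2_def using c(3)[rule_format, OF s1(1,2), of y X] s1 u by simp_all
    have "ex y X ?c s = (if s2 (m+1) \<noteq> 0 then ex y X d s2 else s2(m := 0))"
      unfolding ex.simps clr by (simp add: cpy_ex s1_def s2_def)
    then show ?thesis using s2 d(3)[rule_format, OF s2(2,3), of y X] m by simp
  qed
  ultimately show ?case by blast
qed

text \<open>\<open>Ret\<close> and \<open>Seek\<close> walk left and right counting marks;
  \<open>SeekD\<close> goes on to the last mark before a deletion; \<open>Ins\<close> and
  \<open>Del\<close> shift the marks by one cell, carrying the bit last read; \<open>Tst\<close>
  looks at the cell left of a mark. Every instruction moves the head, so acting in place means a
  step to the right followed by \<open>Back\<close>. \<open>Mk\<close> writes the initial marks,
  \<open>GoR\<close>, \<open>GoL\<close> and \<open>LN\<close> inspect the first cells after a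
  phase, and \<open>Sw\<close> sweeps the tapes.\<close>

datatype q = Init | Lm | Ret nat "com list" | Seek nat "com list" | Tst "com list" | SeekD nat nat "com list"
  | Ins bool nat "com list" | Del bool nat nat "com list" | Back q
  | Mk nat | GoR nat | GoL bool nat | LN | Sw bool

type_synonym act = "(q \<times> bool \<times> bool \<times> bool \<times> bool) option"

fun reg :: "com \<Rightarrow> nat" where
  "reg (Inc i) = i" | "reg (Dec i) = i" | "reg (If i c d) = i" | "reg (Loop i c) = i" | "reg _ = 0"

text \<open>Register 0 is the gap before the first mark, so the first mark stands on the very cell
  whose number is the address: the bits under the head answer \<open>GetX\<close> and
  \<open>GetO\<close>, and \<open>Put\<close> can write there at once. The empty stack starts
  \<open>main\<close> again, which makes the evaluation endless.\<close>

fun dispatch :: "com \<Rightarrow> com list \<Rightarrow> bool \<Rightarrow> bool \<Rightarrow> q" where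
  "dispatch main [] bo bx = Ret 1 [main]"
| "dispatch main (Skip # K) bo bx = Ret 1 K"
| "dispatch main (Put b # K) bo bx = Ret 1 K"
| "dispatch main (Seq c d # K) bo bx = Ret 1 (c # d # K)"
| "dispatch main (GetX # K) bo bx = Ret 1 (if bx then Inc 1 # K else K)"
| "dispatch main (GetO # K) bo bx = Ret 1 (if bo then Inc 1 # K else K)"
| "dispatch main (c # K) bo bx = Seek (Suc (reg c)) (c # K)"

definition putbit :: "com list \<Rightarrow> bool \<Rightarrow> bool" where
  "putbit K bi = (case K of Put b # _ \<Rightarrow> b | _ \<Rightarrow> bi)"

section \<open>The Turing machine\<close>

text \<open>The machine evaluates a loop program for ever.  Its \<open>k\<close> registers are marks on the scratch tape,
  register \<open>i\<close> being the gap before mark \<open>i\<close>; the tape \<open>X\<close> is the output tape, and \<open>Put\<close> writes to the input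
  tape.  \<open>Ret 1 K\<close> on the first mark executes the stack \<open>K\<close>.  At a limit the bits of the scratch and input tape
  at cell 0 tell what just ended: an evaluation phase (1,0), a limit of phases (1,1), a sweep (0,1), or the final
  sweep (0,0).\<close>

fun dl :: "nat \<Rightarrow> com \<Rightarrow> q \<Rightarrow> bool \<Rightarrow> bool \<Rightarrow> bool \<Rightarrow> bool \<Rightarrow> act" where
  "dl k main (Ret r K) bo bi bs bx = (if bs \<and> r \<le> 1
     then Some (Back (dispatch main K bo bx), putbit K bi, bs, bx, True)
     else Some (Ret (if bs then r - 1 else r) K, bi, bs, bx, False))"
| "dl k main (Seek j L) bo bi bs bx = (if bs \<and> j \<le> 1
     then (case L of Inc i # K \<Rightarrow> Some (Ins True (k - i) K, bi, False, bx, True)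
           | _ \<Rightarrow> Some (Tst L, bi, bs, bx, False))
     else Some (Seek (if bs then j - 1 else j) L, bi, bs, bx, True))"
| "dl k main (Tst L) bo bi bs bx = (case L of
       If i c d # K \<Rightarrow> (if bs then Some (Back (Ret (max 1 i) (d # K)), bi, bs, bx, True) else Some (Ret (Suc i) (c # K), bi, bs, bx, True))
     | Loop i c # K \<Rightarrow> (if bs then Some (Back (Ret (max 1 i) K), bi, bs, bx, True)
          else Some (Ret (Suc i) (Dec i # c # Loop i c # K), bi, bs, bx, True))
     | Dec i # K \<Rightarrow> (if bs then Some (Back (Ret (max 1 i) K), bi, bs, bx, True) else Some (SeekD (k - i) i K, bi, bs, bx, True))
     | _ \<Rightarrow> None)"
| "dl k main (SeekD j i K) bo bi bs bx = (if bs \<and> j \<le> 1 then Some (Del True (k - i) i K, bi, False, bx, False)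
     else Some (SeekD (if bs then j - 1 else j) i K, bi, bs, bx, True))"
| "dl k main (Ins b r K) bo bi bs bx = (if r - of_bool b = 0 then Some (Back (Ret k K), bi, b, bx, True)
     else Some (Ins bs (r - of_bool b) K, bi, b, bx, True))"
| "dl k main (Del b r i K) bo bi bs bx = (if r - of_bool b = 0 then Some (Back (Ret (Suc i) K), bi, b, bx, True)
     else Some (Del bs (r - of_bool b) i K, bi, b, bx, False))"
| "dl k main (Back s) bo bi bs bx = Some (s, bi, bs, bx, False)"
| "dl k main Init bo bi bs bx = Some (Mk (k - 1), False, True, bx, True)"
| "dl k main (Mk j) bo bi bs bx = (if j \<le> 1 then Some (Back (Ret k []), bi, True, bx, True) else Some (Mk (j - 1), bi, True, bx, True))"
| "dl k main Lm bo bi bs bx = (if bs then (if bi then Some (Sw False, True, False, bx, True) else Some (GoR 0, bi, bs, bx, True))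
     else if bi then Some (Mk (k - 1), False, True, bx, True) else None)"
| "dl k main (GoR j) bo bi bs bx = (if j = 0 then (if bx then Some (GoR 1, bi, bs, bx, True) else Some (LN, bi, bs, bx, False))
     else if j = 1 then Some (GoR 2, bi, bs, bx, True) else Some (GoL bx 1, bi, bs, bx, False))"
| "dl k main (GoL b j) bo bi bs bx = (if j = 1 then Some (GoL b 2, bi, bs, bx, False)
     else if j = 2 then Some (GoL b 3, bi, bs, bx, False) else Some (Sw True, False, False, b, True))"
| "dl k main LN bo bi bs bx = Some (Sw True, True, False, bx, True)"
| "dl k main (Sw cp) bo bi bs bx = Some (Sw cp, bi, False, if cp then bi else bx, True)"

definition app_act :: "(q \<Rightarrow> nat) \<Rightarrow> act \<Rightarrow> cfg \<Rightarrow> cfg" where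
  "app_act f a c = (case a of None \<Rightarrow> c\<lparr>st := 1\<rparr> | Some (q', wi, ws, wo, r) \<Rightarrow>
     \<lparr>st = f q', hd = (if r then Suc (hd c) else hd c - 1), tin = (tin c)(hd c := wi),
      tsc = (tsc c)(hd c := ws), tout = (tout c)(hd c := wo)\<rparr>)"

lemma find_unique:
  assumes "x \<in> set xs" "R x" "\<And>z. z \<in> set xs \<Longrightarrow> R z \<Longrightarrow> z = x"
  shows "find R xs = Some x"
proof (cases "find R xs")
  case None
  then show ?thesis using assms(1,2) by (auto simp: find_None_iff)
next
  case (Some z)
  then have "z \<in> set xs" "R z" unfolding find_Some_iff by auto
  then show ?thesis using assms(3) Some by simp
qed

text \<open>The numbers 0, 1, 2 are reserved for start, halt and limit, so all other control states
  are numbered from 3. An entry of the table is determined by state and reading, hence the order of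
  the instruction list is irrelevant and a missing entry means halting.\<close>

lemma program_exists:
  fixes \<delta> :: "q \<Rightarrow> bool \<Rightarrow> bool \<Rightarrow> bool \<Rightarrow> bool \<Rightarrow> act"
  assumes fin: "finite S"
  shows "\<exists>i f. f Init = 0 \<and> f Lm = 2 \<and> (\<forall>s. f s \<noteq> (1::nat)) \<and>
    (\<forall>y c s. s \<in> S \<longrightarrow> st c = f s \<longrightarrow>
      step (P i) y c = app_act f (\<delta> s (hd c \<in> y) (tin c (hd c)) (tsc c (hd c)) (tout c (hd c))) c)"
proof -
  obtain g :: "q \<Rightarrow> nat" where g: "inj_on g S" using finite_imp_inj_to_nat_seg[OF fin] by blast
  define f where "f s = (if s = Init then 0 else if s = Lm then 2 else g s + 3)" for s
  have inj: "inj_on f S" using g unfolding inj_on_def f_def by auto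
  obtain l where l: "set l = S" using finite_list[OF fin] by blast
  define en where "en = (\<lambda>s a b c d. case \<delta> s a b c d of None \<Rightarrow> [] | Some (q', wi, ws, wo, r) \<Rightarrow>
     [(f s, of_bool a + 2 * of_bool b + 4 * of_bool c + 8 * of_bool d, f q',
       of_bool wi + 2 * of_bool ws + 4 * of_bool wo, of_bool r :: nat) :: instr])"
  define p where "p = concat [en s a b c d. s \<leftarrow> l, a \<leftarrow> [False, True], b \<leftarrow> [False, True], c \<leftarrow> [False, True], d \<leftarrow> [False, True]]"
  have set_p: "set p = (\<Union>s\<in>S. \<Union>a. \<Union>b. \<Union>c. \<Union>d. set (en s a b c d))"
  proof -
    have U: "(\<Union>a. F a) = F False \<union> F True" for F :: "bool \<Rightarrow> instr set" unfolding UNIV_bool by auto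
    show ?thesis unfolding p_def by (simp add: l U Un_assoc)
  qed
  have rc: "(of_bool a + 2 * of_bool b + 4 * of_bool c + 8 * of_bool d :: nat) = of_bool a' + 2 * of_bool b' + 4 * of_bool c' + 8 * of_bool d'
     \<longleftrightarrow> a = a' \<and> b = b' \<and> c = c' \<and> d = d'" for a b c d a' b' c' d'
    by (cases a; cases b; cases c; cases d; cases a'; cases b'; cases c'; cases d') simp_all
  have step: "step p y c = app_act f (\<delta> s (hd c \<in> y) (tin c (hd c)) (tsc c (hd c)) (tout c (hd c))) c"
    if s: "s \<in> S" "st c = f s" for y c s
  proof -
    define a b e d where abed: "a = (hd c \<in> y)" "b = tin c (hd c)" "e = tsc c (hd c)" "d = tout c (hd c)"
    have n1: "st c \<noteq> 1" using s unfolding f_def by auto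
    have code: "readcode y c = of_bool a + 2 * of_bool b + 4 * of_bool e + 8 * of_bool d"
      unfolding readcode_def abed by simp
    define Rd where "Rd x \<longleftrightarrow> fst x = st c \<and> fst (snd x) = readcode y c" for x :: instr
    have Rd_eq: "(\<lambda>(q, r, _). q = st c \<and> r = readcode y c) = Rd" unfolding Rd_def by (simp add: fun_eq_iff)
    have mem: "x \<in> set (en s a b e d)" if "x \<in> set p" "Rd x" for x
    proof -
      obtain s' a' b' e' d' where x: "s' \<in> S" "x \<in> set (en s' a' b' e' d')" using \<open>x \<in> set p\<close> unfolding set_p by blast
      have x2: "fst x = f s'" "fst (snd x) = of_bool a' + 2 * of_bool b' + 4 * of_bool e' + 8 * of_bool d'"
        using x(2) unfolding en_def by (cases "\<delta> s' a' b' e' d'"; force)+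
      have Rx: "fst x = st c" "fst (snd x) = readcode y c" using \<open>Rd x\<close> unfolding Rd_def by blast+
      have fs: "f s' = f s" by (rule trans[OF x2(1)[symmetric] trans[OF Rx(1) s(2)]])
      have bits: "a' = a \<and> b' = b \<and> e' = e \<and> d' = d"
        by (rule rc[THEN iffD1, OF trans[OF x2(2)[symmetric] trans[OF Rx(2) code]]])
      have "s' = s" by (rule inj_onD[OF inj fs x(1) s(1)])
      then show ?thesis using x(2) bits by simp
    qed
    show ?thesis
    proof (cases "\<delta> s a b e d")
      case None
      then have "en s a b e d = []" unfolding en_def by simp
      then have "\<not> Rd x" if "x \<in> set p" for x using mem[OF that] by auto
      then have "find Rd p = None" unfolding find_None_iff by blast
      then show ?thesis unfolding step_def app_act_def abed[symmetric] None Rd_eq using n1 by simp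
    next
      case (Some t)
      obtain q' wi ws wo r where t: "t = (q', wi, ws, wo, r)" by (cases t)
      define x :: instr where "x = (f s, of_bool a + 2 * of_bool b + 4 * of_bool e + 8 * of_bool d, f q', of_bool wi + 2 * of_bool ws + 4 * of_bool wo, of_bool r)"
      have en: "en s a b e d = [x]" unfolding en_def Some t x_def by simp
      have "x \<in> set p" unfolding set_p
        by (rule UN_I[OF s(1)], rule UN_I[where a = a, OF UNIV_I], rule UN_I[where a = b, OF UNIV_I], rule UN_I[where a = e, OF UNIV_I],
            rule UN_I[where a = d, OF UNIV_I]) (simp add: en)
      moreover have "Rd x" unfolding Rd_def x_def using s(2) code by simp
      moreover have "z = x" if "z \<in> set p" "Rd z" for z using mem[OF that] en by simp
      ultimately have fd: "find Rd p = Some x" by (rule find_unique)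
      have bits: "odd (of_bool wi + 2 * of_bool ws + 4 * of_bool wo :: nat) = wi"
        "odd ((of_bool wi + 2 * of_bool ws + 4 * of_bool wo :: nat) div 2) = ws"
        "odd ((of_bool wi + 2 * of_bool ws + 4 * of_bool wo :: nat) div 4) = wo"
        by (cases wi; cases ws; cases wo; simp)+
      show ?thesis unfolding step_def app_act_def abed[symmetric] Some t Rd_eq fd x_def using n1
        by (simp add: bits del: even_add odd_add)
    qed
  qed
  obtain i where "P i = p" using P_surj by blast
  then show ?thesis using step by (intro exI[of _ i] exI[of _ f]) (auto simp: f_def)
qed

text \<open>The stack of pending commands is determined by the place reached in the program. It
  therefore takes finitely many values and can be part of the control state.\<close>

fun conts :: "com \<Rightarrow> com list \<Rightarrow> com list set" where
  "conts (Seq c d) K = insert (Seq c d # K) (conts c (d # K) \<union> conts d K)"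
| "conts (If i c d) K = insert (If i c d # K) (conts c K \<union> conts d K)"
| "conts (Loop i c) K = insert (Loop i c # K) (insert (Dec i # c # Loop i c # K) (conts c (Loop i c # K)))"
| "conts GetX K = {GetX # K, Inc 1 # K}"
| "conts GetO K = {GetO # K, Inc 1 # K}"
| "conts c K = {c # K}"

lemma finite_conts: "finite (conts c K)"
  by (induction c K rule: conts.induct) auto

lemma conts_self: "c # K \<in> conts c K"
  by (cases c) auto

fun regs :: "com \<Rightarrow> nat set" where
  "regs (Inc i) = {i}" | "regs (Dec i) = {i}" | "regs (Seq c d) = regs c \<union> regs d"
| "regs (If i c d) = insert i (regs c \<union> regs d)" | "regs (Loop i c) = insert i (regs c)" | "regs _ = {}"

lemma finite_regs: "finite (regs c)" by (induction c) auto

definition states :: "nat \<Rightarrow> com list set \<Rightarrow> q set" where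
  "states k R = (let S = {Init, Lm, LN} \<union> (\<lambda>(r, K). Ret r K) ` ({..k} \<times> R) \<union> (\<lambda>(r, K). Seek r K) ` ({..k} \<times> R)
     \<union> Tst ` R \<union> (\<lambda>(j, i, K). SeekD j i K) ` ({..k} \<times> {..k} \<times> R)
     \<union> (\<lambda>(b, r, K). Ins b r K) ` (UNIV \<times> {..k} \<times> R) \<union> (\<lambda>(b, r, i, K). Del b r i K) ` (UNIV \<times> {..k} \<times> {..k} \<times> R)
     \<union> Mk ` {..k} \<union> GoR ` {..3} \<union> (\<lambda>(b, r). GoL b r) ` (UNIV \<times> {..3}) \<union> range Sw in S \<union> Back ` S)"

lemma finite_states: "finite R \<Longrightarrow> finite (states k R)"
  unfolding states_def Let_def by (intro finite_UnI finite_imageI) auto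

lemma in_states [simp]:
  "Init \<in> states k R" "Lm \<in> states k R" "LN \<in> states k R" "Sw b \<in> states k R"
  "Ret r K \<in> states k R \<longleftrightarrow> r \<le> k \<and> K \<in> R" "Seek r K \<in> states k R \<longleftrightarrow> r \<le> k \<and> K \<in> R"
  "Tst K \<in> states k R \<longleftrightarrow> K \<in> R" "SeekD r i K \<in> states k R \<longleftrightarrow> r \<le> k \<and> i \<le> k \<and> K \<in> R"
  "Ins b r K \<in> states k R \<longleftrightarrow> r \<le> k \<and> K \<in> R" "Del b r i K \<in> states k R \<longleftrightarrow> r \<le> k \<and> i \<le> k \<and> K \<in> R"
  "Mk r \<in> states k R \<longleftrightarrow> r \<le> k" "GoR r \<in> states k R \<longleftrightarrow> r \<le> 3" "GoL b r \<in> states k R \<longleftrightarrow> r \<le> 3"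
  "Back (Ret r K) \<in> states k R \<longleftrightarrow> r \<le> k \<and> K \<in> R" "Back (Seek r K) \<in> states k R \<longleftrightarrow> r \<le> k \<and> K \<in> R"
  unfolding states_def Let_def by (auto simp: image_iff)

section \<open>Registers as gaps between marks\<close>

primrec pos :: "(nat \<Rightarrow> nat) \<Rightarrow> nat \<Rightarrow> nat" where
  "pos s 0 = s 0"
| "pos s (Suc i) = Suc (pos s i + s (Suc i))"

lemma pos_mono_iff: "pos s i < pos s j \<longleftrightarrow> i < j"
  by (rule lift_Suc_mono_less_iff) simp

lemma pos_le_iff: "pos s i \<le> pos s j \<longleftrightarrow> i \<le> j"
  using pos_mono_iff[of s j i] by auto

lemma pos_eq_iff: "pos s i = pos s j \<longleftrightarrow> i = j"
  by (metis order_antisym pos_le_iff order_refl)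

definition marks :: "nat \<Rightarrow> (nat \<Rightarrow> nat) \<Rightarrow> nat set" where "marks k s = pos s ` {..<k}"

lemma finite_marks [simp]: "finite (marks k s)" unfolding marks_def by simp

lemma pos_in_marks [simp]: "pos s i \<in> marks k s \<longleftrightarrow> i < k"
  unfolding marks_def by (auto simp: pos_eq_iff image_iff)

lemma marks_filter: "{m \<in> marks k s. Q m} = pos s ` {i. i < k \<and> Q (pos s i)}"
  unfolding marks_def by auto

lemma card_marks: "card {m \<in> marks k s. Q m} = card {i. i < k \<and> Q (pos s i)}"
  unfolding marks_filter by (rule card_image) (auto simp: inj_on_def pos_eq_iff)

lemma pos_upd_less: "j < i \<Longrightarrow> pos (s(i := v)) j = pos s j"
  by (induction j) auto

lemma pos_inc: "i \<le> j \<Longrightarrow> pos (s(i := Suc (s i))) j = Suc (pos s j)"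
proof (induction j)
  case (Suc j)
  show ?case
  proof (cases "i = Suc j")
    case True
    then show ?thesis using pos_upd_less[of j "Suc j" s "Suc (s (Suc j))"] by (simp only: pos.simps fun_upd_same)
  qed (use Suc in auto)
qed simp

lemma pos_dec: "i \<le> j \<Longrightarrow> s i \<noteq> 0 \<Longrightarrow> Suc (pos (s(i := s i - 1)) j) = pos s j"
  using pos_inc[of i j "s(i := s i - 1)"] by simp

lemma pos_pred_zero: "0 < i \<Longrightarrow> s i = 0 \<Longrightarrow> pos s i - 1 = pos s (i - 1)"
  by (cases i) auto

lemma pos_pred_notin: "s i \<noteq> 0 \<Longrightarrow> pos s i - 1 \<notin> marks k s"
proof
  assume "s i \<noteq> 0" "pos s i - 1 \<in> marks k s"
  moreover have "0 < pos s i" using \<open>s i \<noteq> 0\<close> by (cases i) auto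
  ultimately obtain j where j: "pos s j = pos s i - 1" "pos s j < pos s i" unfolding marks_def by auto
  then have "j < i" using pos_mono_iff[of s j i] by blast
  then obtain i' where i: "i = Suc i'" "j \<le> i'" by (cases i) auto
  then have "pos s j \<le> pos s i'" by (simp add: pos_le_iff)
  then show False using j(1) i(1) \<open>s i \<noteq> 0\<close> by simp
qed

lemma marks_inc:
  assumes "i < k"
  shows "marks k (s(i := Suc (s i))) = {n. (n < pos s i \<and> n \<in> marks k s) \<or> (pos s i < n \<and> n - 1 \<in> marks k s)}"
proof (rule set_eqI)
  fix n
  have P: "pos (s(i := Suc (s i))) j = (if j < i then pos s j else Suc (pos s j))" for j
    using pos_inc[of i j s] pos_upd_less[of j i s] by auto
  have "n \<in> marks k (s(i := Suc (s i))) \<longleftrightarrow> (\<exists>j<k. j < i \<and> n = pos s j) \<or> (\<exists>j<k. i \<le> j \<and> n = Suc (pos s j))"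
    unfolding marks_def image_iff P Bex_def lessThan_iff by (metis not_le)
  also have "(\<exists>j<k. j < i \<and> n = pos s j) \<longleftrightarrow> n < pos s i \<and> n \<in> marks k s"
    unfolding marks_def by (auto simp: pos_mono_iff)
  also have "(\<exists>j<k. i \<le> j \<and> n = Suc (pos s j)) \<longleftrightarrow> pos s i < n \<and> n - 1 \<in> marks k s"
    unfolding marks_def by (cases n) (auto simp: pos_le_iff less_Suc_eq_le)
  finally show "n \<in> marks k (s(i := Suc (s i))) \<longleftrightarrow> n \<in> {n. (n < pos s i \<and> n \<in> marks k s) \<or> (pos s i < n \<and> n - 1 \<in> marks k s)}"
    by blast
qed

lemma marks_dec:
  assumes "i < k" "s i \<noteq> 0"
  shows "marks k (s(i := s i - 1)) = {n. (n < pos s i - 1 \<and> n \<in> marks k s) \<or> (pos s i - 1 \<le> n \<and> Suc n \<in> marks k s)}"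
proof (rule set_eqI)
  fix n
  have P: "j < i \<Longrightarrow> pos (s(i := s i - 1)) j = pos s j" "i \<le> j \<Longrightarrow> Suc (pos (s(i := s i - 1)) j) = pos s j" for j
    using pos_dec[of i j s] pos_upd_less[of j i s] assms by auto
  have pi: "0 < pos s i" using assms by (cases i) auto
  have "n \<in> marks k (s(i := s i - 1)) \<longleftrightarrow> (\<exists>j<k. j < i \<and> n = pos s j) \<or> (\<exists>j<k. i \<le> j \<and> Suc n = pos s j)"
    unfolding marks_def image_iff using P by (metis lessThan_iff nat.inject not_le)
  also have "(\<exists>j<k. j < i \<and> n = pos s j) \<longleftrightarrow> n < pos s i \<and> n \<in> marks k s"
    unfolding marks_def by (auto simp: pos_mono_iff)
  also have "\<dots> \<longleftrightarrow> n < pos s i - 1 \<and> n \<in> marks k s"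
    using pos_pred_notin[of s i k] assms(2) by (cases "n = pos s i - 1") auto
  also have "(\<exists>j<k. i \<le> j \<and> Suc n = pos s j) \<longleftrightarrow> pos s i \<le> Suc n \<and> Suc n \<in> marks k s"
    unfolding marks_def by (auto simp: pos_le_iff)
  also have "pos s i \<le> Suc n \<longleftrightarrow> pos s i - 1 \<le> n" using pi by auto
  finally show "n \<in> marks k (s(i := s i - 1)) \<longleftrightarrow> n \<in> {n. (n < pos s i - 1 \<and> n \<in> marks k s) \<or> (pos s i - 1 \<le> n \<and> Suc n \<in> marks k s)}"
    by blast
qed

section \<open>Finite stretches of a run and single register instructions\<close>

definition rch :: "prog \<Rightarrow> nat set \<Rightarrow> (nat \<Rightarrow> bool) \<Rightarrow> (nat \<Rightarrow> bool) \<Rightarrow> cfg \<Rightarrow> cfg \<Rightarrow> bool" where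
  "rch p y Y X c d \<longleftrightarrow> (\<exists>n. d = (step p y ^^ n) c \<and>
     (\<forall>j\<le>n. tin ((step p y ^^ j) c) = Y \<and> tout ((step p y ^^ j) c) = X \<and> st ((step p y ^^ j) c) \<noteq> 1))"

lemma rch_refl: "tin c = Y \<Longrightarrow> tout c = X \<Longrightarrow> st c \<noteq> 1 \<Longrightarrow> rch p y Y X c c"
  unfolding rch_def by (intro exI[of _ 0]) simp

lemma rch_trans: assumes "rch p y Y X c d" "rch p y Y X d e" shows "rch p y Y X c e"
proof -
  obtain n where n: "d = (step p y ^^ n) c"
    "\<forall>j\<le>n. tin ((step p y ^^ j) c) = Y \<and> tout ((step p y ^^ j) c) = X \<and> st ((step p y ^^ j) c) \<noteq> 1"
    using assms(1) unfolding rch_def by blast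
  obtain m where m: "e = (step p y ^^ m) d"
    "\<forall>j\<le>m. tin ((step p y ^^ j) d) = Y \<and> tout ((step p y ^^ j) d) = X \<and> st ((step p y ^^ j) d) \<noteq> 1"
    using assms(2) unfolding rch_def by blast
  have add: "(step p y ^^ (j + n)) c = (step p y ^^ j) d" for j unfolding n(1) by (simp add: funpow_add)
  show ?thesis unfolding rch_def
  proof (intro exI[of _ "m + n"] conjI allI impI)
    show "e = (step p y ^^ (m + n)) c" using m(1) add by simp
    fix j assume "j \<le> m + n"
    show "tin ((step p y ^^ j) c) = Y" "tout ((step p y ^^ j) c) = X" "st ((step p y ^^ j) c) \<noteq> 1"
    proof -
      have "tin ((step p y ^^ j) c) = Y \<and> tout ((step p y ^^ j) c) = X \<and> st ((step p y ^^ j) c) \<noteq> 1"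
      proof (cases "j \<le> n")
        case False
        then show ?thesis using m(2)[rule_format, of "j - n"] add[of "j - n"] \<open>j \<le> m + n\<close> by simp
      qed (use n(2) in blast)
      then show "tin ((step p y ^^ j) c) = Y" "tout ((step p y ^^ j) c) = X" "st ((step p y ^^ j) c) \<noteq> 1" by blast+
    qed
  qed
qed

lemma rch_step:
  assumes "tin c = Y" "tout c = X" "st c \<noteq> 1" "tin (step p y c) = Y" "tout (step p y c) = X" "st (step p y c) \<noteq> 1"
  shows "rch p y Y X c (step p y c)"
  unfolding rch_def
proof (intro exI[of _ 1] conjI allI impI)
  fix j :: nat assume "j \<le> 1"
  then have "j = 0 \<or> j = 1" by auto
  then show "tin ((step p y ^^ j) c) = Y" "tout ((step p y ^^ j) c) = X" "st ((step p y ^^ j) c) \<noteq> 1"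
    using assms by auto
qed simp

locale tm =
  fixes p :: prog and y :: "nat set" and f :: "q \<Rightarrow> nat" and k :: nat and main :: com and R :: "com list set"
  assumes stp: "\<And>c s. s \<in> states k R \<Longrightarrow> st c = f s \<Longrightarrow>
      step p y c = app_act f (dl k main s (hd c \<in> y) (tin c (hd c)) (tsc c (hd c)) (tout c (hd c))) c"
    and f: "f Init = 0" "f Lm = 2" "\<And>s. f s \<noteq> 1"
    and k: "1 < k"
    and R: "[] \<in> R" "conts main [] \<subseteq> R"
begin

definition cf :: "(nat \<Rightarrow> bool) \<Rightarrow> (nat \<Rightarrow> bool) \<Rightarrow> q \<Rightarrow> nat \<Rightarrow> nat set \<Rightarrow> cfg" where
  "cf Y X s h M = \<lparr>st = f s, hd = h, tin = Y, tsc = (\<lambda>n. n \<in> M), tout = X\<rparr>"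

lemma cf_sel [simp]: "st (cf Y X s h M) = f s" "hd (cf Y X s h M) = h" "tin (cf Y X s h M) = Y"
  "tsc (cf Y X s h M) = (\<lambda>n. n \<in> M)" "tout (cf Y X s h M) = X"
  unfolding cf_def by auto

lemma step_cf:
  assumes "s \<in> states k R" "dl k main s (h \<in> y) (Y h) (h \<in> M) (X h) = Some (s', wi, b, wo, r)"
  shows "step p y (cf Y X s h M) =
    cf (Y(h := wi)) (X(h := wo)) s' (if r then Suc h else h - 1) (if b then insert h M else M - {h})"
proof -
  have "step p y (cf Y X s h M) = app_act f (Some (s', wi, b, wo, r)) (cf Y X s h M)"
    using stp[of s "cf Y X s h M"] assms by simp
  then show ?thesis by (auto simp: app_act_def cf_def fun_eq_iff)
qed

lemma rch_cf:
  assumes "s \<in> states k R" "dl k main s (h \<in> y) (Y h) (h \<in> M) (X h) = Some (s', Y h, b, X h, r)"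
    "h' = (if r then Suc h else h - 1)" "M' = (if b then insert h M else M - {h})"
    "rch p y Y X (cf Y X s' h' M') d"
  shows "rch p y Y X (cf Y X s h M) d"
proof -
  have e: "step p y (cf Y X s h M) = cf Y X s' h' M'" using step_cf[of s h Y M X s' "Y h" b "X h" r] assms by simp
  then have "rch p y Y X (cf Y X s h M) (cf Y X s' h' M')"
    using rch_step[of "cf Y X s h M" Y X p y] f by simp
  then show ?thesis using assms(5) rch_trans by blast
qed

lemma rch_cf_refl: "rch p y Y X (cf Y X s h M) (cf Y X s h M)"
  by (rule rch_refl) (use f in auto)

lemma back_step:
  assumes "Back s \<in> states k R" "rch p y Y X (cf Y X s h M) d"
  shows "rch p y Y X (cf Y X (Back s) (Suc h) M) d"
  by (rule rch_cf[OF assms(1), of _ _ _ _ s "Suc h \<in> M" False h M]) (use assms(2) in \<open>auto simp: insert_absorb\<close>)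

text \<open>\<open>r\<close> is always the number of marks at or left of the head, so the count is
  down to 1 just when the first mark is reached.\<close>

lemma walk_left:
  assumes M: "finite M" and K: "K \<in> R" and "t \<in> M" "\<And>m. m \<in> M \<Longrightarrow> t \<le> m"
    "card {m \<in> M. m \<le> h} = r" "t \<le> h" "r \<le> k"
    "rch p y Y X (cf Y X (Ret 1 K) t M) d"
  shows "rch p y Y X (cf Y X (Ret r K) h M) d"
  using assms(5-7)
proof (induction h arbitrary: r)
  case 0
  then have "{m \<in> M. m \<le> 0} = {0}" "t = 0" using assms(3,4) by auto
  then show ?case using 0 assms(8) by simp
next
  case (Suc h)
  have fin: "finite {m \<in> M. m \<le> h}" using M by simp
  have sub: "{m \<in> M. m \<le> Suc h} = (if Suc h \<in> M then insert (Suc h) {m \<in> M. m \<le> h} else {m \<in> M. m \<le> h})"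
    by (auto simp: le_Suc_eq)
  show ?case
  proof (cases "t = Suc h")
    case True
    then have "{m \<in> M. m \<le> Suc h} = {Suc h}" using assms(3,4) by (auto intro: order_antisym)
    then show ?thesis using Suc.prems assms(8) True by simp
  next
    case False
    then have th: "t \<le> h" using Suc.prems by simp
    then have "t \<in> {m \<in> M. m \<le> h}" using assms(3) by simp
    then have pos: "0 < card {m \<in> M. m \<le> h}" using fin card_gt_0_iff by blast
    show ?thesis
    proof (cases "Suc h \<in> M")
      case True
      then have r: "card {m \<in> M. m \<le> h} = r - 1" "1 < r" using Suc.prems(1) sub fin pos by auto
      show ?thesis
        by (rule rch_cf[where s' = "Ret (r - 1) K" and b = True and r = False])
           (use r True Suc.prems Suc.IH[OF r(1) th] K in \<open>auto simp: insert_absorb\<close>)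
    next
      case False
      then have r: "card {m \<in> M. m \<le> h} = r" using Suc.prems(1) sub by auto
      show ?thesis
        by (rule rch_cf[where s' = "Ret r K" and b = False and r = False])
           (use r False Suc.prems Suc.IH[OF r th] K in auto)
    qed
  qed
qed

lemma walk_right:
  assumes M: "finite M" and "t \<in> M"
    and q: "\<And>j. j \<le> k \<Longrightarrow> q j \<in> states k R"
    and mv: "\<And>j bo bi bs bx. \<not> (bs \<and> j \<le> 1) \<Longrightarrow> dl k main (q j) bo bi bs bx = Some (q (if bs then j - 1 else j), bi, bs, bx, True)"
    and "card {m \<in> M. h \<le> m \<and> m \<le> t} = j" "h \<le> t" "j \<le> k"
    and fin: "rch p y Y X (cf Y X (q 1) t M) d"
  shows "rch p y Y X (cf Y X (q j) h M) d"
  using assms(5-7)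
proof (induction "t - h" arbitrary: h j)
  case 0
  then have "h = t" by simp
  then have "{m \<in> M. h \<le> m \<and> m \<le> t} = {t}" using assms(2) by auto
  then show ?case using 0 fin \<open>h = t\<close> by simp
next
  case (Suc n)
  then have ht: "h < t" "n = t - Suc h" by auto
  have fn: "finite {m \<in> M. Suc h \<le> m \<and> m \<le> t}" using M by simp
  have sub: "{m \<in> M. h \<le> m \<and> m \<le> t} = (if h \<in> M then insert h {m \<in> M. Suc h \<le> m \<and> m \<le> t} else {m \<in> M. Suc h \<le> m \<and> m \<le> t})"
    using ht by (auto simp: le_less Suc_le_eq)
  have "t \<in> {m \<in> M. Suc h \<le> m \<and> m \<le> t}" using assms(2) ht by simp
  then have pos: "0 < card {m \<in> M. Suc h \<le> m \<and> m \<le> t}" using fn card_gt_0_iff by blast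
  show ?case
  proof (cases "h \<in> M")
    case True
    then have r: "card {m \<in> M. Suc h \<le> m \<and> m \<le> t} = j - 1" "1 < j" using Suc.prems(1) sub fn pos by auto
    have IH: "rch p y Y X (cf Y X (q (j - 1)) (Suc h) M) d" using Suc.hyps(1)[OF ht(2) r(1)] ht Suc.prems by simp
    show ?thesis
      by (rule rch_cf[OF q[OF Suc.prems(3)] mv]) (use r True IH in \<open>auto simp: insert_absorb\<close>)
  next
    case False
    then have r: "card {m \<in> M. Suc h \<le> m \<and> m \<le> t} = j" using Suc.prems(1) sub by auto
    have IH: "rch p y Y X (cf Y X (q j) (Suc h) M) d" using Suc.hyps(1)[OF ht(2) r] ht Suc.prems by simp
    show ?thesis
      by (rule rch_cf[OF q[OF Suc.prems(3)] mv]) (use False IH in auto)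
  qed
qed

text \<open>Invariant \<open>T c\<close>: beyond \<open>a\<close> and up to \<open>c\<close> the
  marks are already shifted, after \<open>c\<close> they are the old ones, and the state carries the
  old bit of cell \<open>c\<close>. \<open>r\<close> counts the marks not yet rewritten, the carried
  one included, so the shift ends with the last mark.\<close>

lemma insert_mark:
  assumes M: "finite M" and K: "K \<in> R" and "t \<in> M" "\<And>m. m \<in> M \<Longrightarrow> m \<le> t" "a \<le> c" "c \<le> t"
    "card {m \<in> M. c \<le> m} = r" "r \<le> k"
    "rch p y Y X (cf Y X (Ret k K) (Suc t) {n. (n < a \<and> n \<in> M) \<or> (a < n \<and> n - 1 \<in> M)}) d"
  shows "rch p y Y X (cf Y X (Ins (c \<in> M) r K) (Suc c)
      {n. (n < a \<and> n \<in> M) \<or> (a < n \<and> n \<le> c \<and> n - 1 \<in> M) \<or> (c < n \<and> n \<in> M)}) d"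
proof -
  define T where "T c = {n. (n < a \<and> n \<in> M) \<or> (a < n \<and> n \<le> c \<and> n - 1 \<in> M) \<or> (c < n \<and> n \<in> M)}" for c
  have T_Suc: "T (Suc c) = (if c \<in> M then insert (Suc c) (T c) else T c - {Suc c})" if "a \<le> c" for c
  proof (rule set_eqI)
    fix n
    show "n \<in> T (Suc c) \<longleftrightarrow> n \<in> (if c \<in> M then insert (Suc c) (T c) else T c - {Suc c})"
    proof (cases "n = Suc c")
      case True
      then show ?thesis unfolding T_def using that by simp
    next
      case False
      then have "n \<le> Suc c \<longleftrightarrow> n \<le> c" "Suc c < n \<longleftrightarrow> c < n" by auto
      then show ?thesis unfolding T_def using False by simp
    qed
  qed
  have T_read: "Suc c \<in> T c \<longleftrightarrow> Suc c \<in> M" if "a \<le> c" for c unfolding T_def using that by simp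
  have T_end: "T (Suc t) = {n. (n < a \<and> n \<in> M) \<or> (a < n \<and> n - 1 \<in> M)}"
  proof (rule set_eqI)
    fix n
    have "n \<notin> M" if "Suc t < n" using assms(4)[of n] that by auto
    moreover have "n - 1 \<notin> M" if "\<not> n \<le> Suc t" using assms(4)[of "n - 1"] that by auto
    ultimately show "n \<in> T (Suc t) \<longleftrightarrow> n \<in> {n. (n < a \<and> n \<in> M) \<or> (a < n \<and> n - 1 \<in> M)}"
      unfolding T_def by blast
  qed
  have "rch p y Y X (cf Y X (Ins (c \<in> M) r K) (Suc c) (T c)) d"
    using assms(5-8)
  proof (induction "t - c" arbitrary: c r)
    case 0
    then have c: "c = t" by simp
    have "{m \<in> M. t \<le> m} = {t}" using assms(3,4) by (auto intro: order_antisym)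
    then have r: "r = 1" using 0 c by simp
    have e: "rch p y Y X (cf Y X (Back (Ret k K)) (Suc (Suc t)) (T (Suc t))) d"
      using back_step[of "Ret k K" Y X "Suc t" "T (Suc t)" d] assms(9) K T_end by simp
    show ?case
      by (rule rch_cf[OF _ _ _ _ e, where b = True and r = True])
         (use c r K assms(3) T_Suc[OF 0(2)] k in simp_all)
  next
    case (Suc n)
    then have ct: "c < t" "n = t - Suc c" by auto
    have fn: "finite {m \<in> M. Suc c \<le> m}" using M by simp
    have sub: "{m \<in> M. c \<le> m} = (if c \<in> M then insert c {m \<in> M. Suc c \<le> m} else {m \<in> M. Suc c \<le> m})"
      by (auto simp: le_less Suc_le_eq)
    have "t \<in> {m \<in> M. Suc c \<le> m}" using assms(3) ct by simp
    then have pos: "card {m \<in> M. Suc c \<le> m} \<noteq> 0" using fn by auto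
    have r: "card {m \<in> M. Suc c \<le> m} = r - of_bool (c \<in> M)" using Suc.prems(3) sub fn by (cases "c \<in> M") auto
    have IH: "rch p y Y X (cf Y X (Ins (Suc c \<in> M) (r - of_bool (c \<in> M)) K) (Suc (Suc c)) (T (Suc c))) d"
      using Suc.hyps(1)[OF ct(2) _ _ r] ct Suc.prems by simp
    have nz: "r - of_bool (c \<in> M) \<noteq> 0" using r pos by metis
    show ?case
      by (rule rch_cf[OF _ _ _ _ IH, where b = "c \<in> M" and r = True])
         (use Suc.prems K T_read[OF Suc.prems(1)] T_Suc[OF Suc.prems(1)] nz in simp_all)
  qed
  then show ?thesis unfolding T_def .
qed

text \<open>The mirror image of insertion: it starts at the last mark, moves left, and the state
  carries the old bit of cell \<open>Suc c\<close>. The cell before mark \<open>i\<close> is free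
  because register \<open>i\<close> is positive, and it absorbs the shift.\<close>

lemma delete_mark:
  assumes M: "finite M" and K: "K \<in> R" and "Suc a \<in> M" "a \<notin> M" "i < k" "a \<le> c"
    "card {m \<in> M. Suc a \<le> m \<and> m \<le> Suc c} = r" "r \<le> k"
    "rch p y Y X (cf Y X (Ret (Suc i) K) a {n. (n < a \<and> n \<in> M) \<or> (a \<le> n \<and> Suc n \<in> M)}) d"
  shows "rch p y Y X (cf Y X (Del (Suc c \<in> M) r i K) c {n. (n \<le> c \<and> n \<in> M) \<or> (c < n \<and> Suc n \<in> M)}) d"
proof -
  define T where "T c = {n. (n \<le> c \<and> n \<in> M) \<or> (c < n \<and> Suc n \<in> M)}" for c
  have T_Suc: "T c = (if Suc (Suc c) \<in> M then insert (Suc c) (T (Suc c)) else T (Suc c) - {Suc c})" for c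
  proof (rule set_eqI)
    fix n
    show "n \<in> T c \<longleftrightarrow> n \<in> (if Suc (Suc c) \<in> M then insert (Suc c) (T (Suc c)) else T (Suc c) - {Suc c})"
    proof (cases "n = Suc c")
      case False
      then have "n \<le> Suc c \<longleftrightarrow> n \<le> c" "Suc c < n \<longleftrightarrow> c < n" by auto
      then show ?thesis unfolding T_def using False by simp
    qed (simp add: T_def)
  qed
  have T_read: "c \<in> T c \<longleftrightarrow> c \<in> M" for c unfolding T_def by simp
  have T_end: "insert a (T a) = {n. (n < a \<and> n \<in> M) \<or> (a \<le> n \<and> Suc n \<in> M)}"
  proof (rule set_eqI)
    fix n
    show "n \<in> insert a (T a) \<longleftrightarrow> n \<in> {n. (n < a \<and> n \<in> M) \<or> (a \<le> n \<and> Suc n \<in> M)}"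
      unfolding T_def using assms(3,4) by (cases "n = a") auto
  qed
  have "rch p y Y X (cf Y X (Del (Suc c \<in> M) r i K) c (T c)) d"
    using assms(6-8)
  proof (induction "c - a" arbitrary: c r)
    case 0
    then have c: "c = a" by simp
    have "{m \<in> M. Suc a \<le> m \<and> m \<le> Suc a} = {Suc a}" using assms(3) by auto
    then have r: "r = 1" using 0 c by simp
    have e: "rch p y Y X (cf Y X (Back (Ret (Suc i) K)) (Suc a) (insert a (T a))) d"
      using back_step[of "Ret (Suc i) K" Y X a "insert a (T a)" d] assms(5,9) K T_end by simp
    show ?case
      by (rule rch_cf[OF _ _ _ _ e, where b = True and r = True])
         (use c r K assms(3,5) k in simp_all)
  next
    case (Suc n)
    then obtain c' where c': "c = Suc c'" "a \<le> c'" "n = c' - a" by (cases c) auto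
    have fn: "finite {m \<in> M. Suc a \<le> m \<and> m \<le> Suc c'}" using M by simp
    have sub: "{m \<in> M. Suc a \<le> m \<and> m \<le> Suc c} = (if Suc c \<in> M then insert (Suc c) {m \<in> M. Suc a \<le> m \<and> m \<le> Suc c'} else {m \<in> M. Suc a \<le> m \<and> m \<le> Suc c'})"
      using c' by (auto simp: le_Suc_eq)
    have "Suc a \<in> {m \<in> M. Suc a \<le> m \<and> m \<le> Suc c'}" using assms(3) c' by simp
    then have pos: "card {m \<in> M. Suc a \<le> m \<and> m \<le> Suc c'} \<noteq> 0" using fn by auto
    have r: "card {m \<in> M. Suc a \<le> m \<and> m \<le> Suc c'} = r - of_bool (Suc c \<in> M)"
      using Suc.prems(2) sub fn c' by (cases "Suc c \<in> M") auto
    have IH: "rch p y Y X (cf Y X (Del (Suc c' \<in> M) (r - of_bool (Suc c \<in> M)) i K) c' (T c')) d"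
      using Suc.hyps(1)[OF c'(3) c'(2) r] Suc.prems by simp
    have nz: "r - of_bool (Suc c \<in> M) \<noteq> 0" using r pos by metis
    show ?case
      by (rule rch_cf[OF _ _ _ _ IH, where b = "Suc c \<in> M" and r = False])
         (use Suc.prems assms(5) K T_read[of c] T_Suc[of c'] nz c' in simp_all)
  qed
  then show ?thesis unfolding T_def .
qed

text \<open>The resting position between two instructions: the head is on the first mark and the
  stack is about to be dispatched.\<close>

definition bd :: "(nat \<Rightarrow> bool) \<Rightarrow> (nat \<Rightarrow> bool) \<Rightarrow> com list \<Rightarrow> (nat \<Rightarrow> nat) \<Rightarrow> cfg" where
  "bd Y X K s = cf Y X (Ret 1 K) (s 0) (marks k s)"

lemma first_mark: "s 0 \<in> marks k s" "m \<in> marks k s \<Longrightarrow> s 0 \<le> m"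
  using pos_in_marks[of s 0 k] k pos_le_iff[of s 0] unfolding marks_def by auto

lemma last_mark: "pos s (k - 1) \<in> marks k s" "m \<in> marks k s \<Longrightarrow> m \<le> pos s (k - 1)"
  using k unfolding marks_def by (auto simp: pos_le_iff)

lemma card_upto: "i < k \<Longrightarrow> card {j. j < k \<and> j \<le> i} = Suc i"
proof -
  assume "i < k"
  then have "{j. j < k \<and> j \<le> i} = {..i}" by auto
  then show ?thesis by simp
qed

lemma card_from: "card {j. j < k \<and> i \<le> j} = k - i"
proof -
  have "{j. j < k \<and> i \<le> j} = {i..<k}" by auto
  then show ?thesis by simp
qed

lemma return_to_first:
  assumes "i < k" "K \<in> R" "rch p y Y X (bd Y X K s) d"
  shows "rch p y Y X (cf Y X (Ret (Suc i) K) (pos s i) (marks k s)) d"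
proof -
  have "card {m \<in> marks k s. m \<le> pos s i} = Suc i"
    unfolding card_marks pos_le_iff by (rule card_upto[OF assms(1)])
  note card = this
  show ?thesis
  proof (rule walk_left[where M = "marks k s" and t = "s 0"])
    show "s 0 \<le> m" if "m \<in> marks k s" for m using that by (rule first_mark(2))
    show "card {m \<in> marks k s. m \<le> pos s i} = Suc i" by (rule card)
    show "s 0 \<le> pos s i" using pos_le_iff[of s 0 i] by simp
  qed (use assms first_mark(1)[of s] in \<open>simp_all add: bd_def\<close>)
qed

lemma skip_instr:
  assumes "c # K \<in> R" "K' \<in> R" "dispatch main (c # K) (s 0 \<in> y) (X (s 0)) = Ret 1 K'" "\<And>b. c \<noteq> Put b"
    "rch p y Y X (bd Y X K' s) d"
  shows "rch p y Y X (bd Y X (c # K) s) d"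
proof -
  have e: "rch p y Y X (cf Y X (Back (Ret 1 K')) (Suc (s 0)) (marks k s)) d"
    by (rule back_step) (use assms k in \<open>auto simp: bd_def\<close>)
  have pb: "putbit (c # K) b = b" for b unfolding putbit_def using assms(4) by (cases c) auto
  show ?thesis unfolding bd_def
    by (rule rch_cf[OF _ _ _ _ e, where b = True and r = True])
       (use assms(1,3) k first_mark(1)[of s] pb in \<open>simp_all add: insert_absorb\<close>)
qed

lemma seek_instr:
  assumes "c # K \<in> R" "dispatch main (c # K) (s 0 \<in> y) (X (s 0)) = Seek (Suc i) (c # K)" "i < k"
    "rch p y Y X (cf Y X (Seek 1 (c # K)) (pos s i) (marks k s)) d"
  shows "rch p y Y X (bd Y X (c # K) s) d"
proof -
  have "{m \<in> marks k s. s 0 \<le> m \<and> m \<le> pos s i} = {m \<in> marks k s. m \<le> pos s i}" using first_mark(2) by auto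
  then have card: "card {m \<in> marks k s. s 0 \<le> m \<and> m \<le> pos s i} = Suc i"
    using card_upto[OF assms(3)] by (simp only: card_marks pos_le_iff)
  have sk: "rch p y Y X (cf Y X (Seek (Suc i) (c # K)) (s 0) (marks k s)) d"
    by (rule walk_right[where t = "pos s i" and q = "\<lambda>j. Seek j (c # K)"])
       (use assms card pos_le_iff[of s 0 i] in auto)
  have e: "rch p y Y X (cf Y X (Back (Seek (Suc i) (c # K))) (Suc (s 0)) (marks k s)) d"
    by (rule back_step) (use assms sk in auto)
  have pb: "putbit (c # K) b = b" for b unfolding putbit_def using assms(2) by (cases c) auto
  show ?thesis unfolding bd_def
    by (rule rch_cf[OF _ _ _ _ e, where b = True and r = True])
       (use assms(1,2) k first_mark(1)[of s] pb in \<open>simp_all add: insert_absorb\<close>)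
qed

lemma inc_instr:
  assumes "Inc i # K \<in> R" "K \<in> R" "i < k" "rch p y Y X (bd Y X K (s(i := Suc (s i)))) d"
  shows "rch p y Y X (bd Y X (Inc i # K) s) d"
proof (rule seek_instr[of "Inc i" K s X i])
  let ?M = "marks k s" and ?s = "s(i := Suc (s i))"
  have pk: "pos ?s (k - 1) = Suc (pos s (k - 1))" using pos_inc[of i "k - 1" s] assms(3) by simp
  have "rch p y Y X (cf Y X (Ret (Suc (k - 1)) K) (pos ?s (k - 1)) (marks k ?s)) d"
    by (rule return_to_first) (use assms k in auto)
  then have 1: "rch p y Y X (cf Y X (Ret k K) (Suc (pos s (k - 1))) {n. (n < pos s i \<and> n \<in> ?M) \<or> (pos s i < n \<and> n - 1 \<in> ?M)}) d"
    using pk k marks_inc[OF assms(3), of s] by (simp only: Suc_diff_1)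
  have card: "card {m \<in> ?M. pos s i \<le> m} = k - i"
    unfolding card_marks pos_le_iff by (rule card_from)
  have "rch p y Y X (cf Y X (Ins (pos s i \<in> ?M) (k - i) K) (Suc (pos s i))
      {n. (n < pos s i \<and> n \<in> ?M) \<or> (pos s i < n \<and> n \<le> pos s i \<and> n - 1 \<in> ?M) \<or> (pos s i < n \<and> n \<in> ?M)}) d"
    by (rule insert_mark[OF _ _ last_mark(1) last_mark(2)]) (use assms card 1 in \<open>auto simp: pos_le_iff\<close>)
  moreover have "{n. (n < pos s i \<and> n \<in> ?M) \<or> (pos s i < n \<and> n \<le> pos s i \<and> n - 1 \<in> ?M) \<or> (pos s i < n \<and> n \<in> ?M)} = ?M - {pos s i}"
    by auto
  ultimately have 2: "rch p y Y X (cf Y X (Ins True (k - i) K) (Suc (pos s i)) (?M - {pos s i})) d"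
    using assms(3) by simp
  show "rch p y Y X (cf Y X (Seek 1 (Inc i # K)) (pos s i) ?M) d"
    by (rule rch_cf[OF _ _ _ _ 2, where b = False and r = True]) (use assms k in simp_all)
qed (use assms in auto)

text \<open>Moving left from mark \<open>i\<close> lands on a mark iff register \<open>i\<close> is zero; for \<open>i = 0\<close> this uses that the head
  cannot leave cell 0.\<close>

lemma test_instr:
  assumes "c # K \<in> R" "dispatch main (c # K) (s 0 \<in> y) (X (s 0)) = Seek (Suc i) (c # K)" "i < k" "\<And>i. c \<noteq> Inc i"
    and Z: "\<And>bo bi bx. dl k main (Tst (c # K)) bo bi True bx = Some (Back (Ret (max 1 i) K0), bi, True, bx, True)" "K0 \<in> R"
      "s i = 0 \<Longrightarrow> rch p y Y X (bd Y X K0 s) d"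
    and N: "\<And>bo bi bx. dl k main (Tst (c # K)) bo bi False bx = Some (qn, bi, False, bx, True)"
      "s i \<noteq> 0 \<Longrightarrow> rch p y Y X (cf Y X qn (pos s i) (marks k s)) d"
  shows "rch p y Y X (bd Y X (c # K) s) d"
proof (rule seek_instr[of c K s X i])
  let ?M = "marks k s"
  have 1: "rch p y Y X (cf Y X (Tst (c # K)) (pos s i - 1) ?M) d"
  proof (cases "s i = 0")
    case True
    have *: "pos s i - 1 \<in> ?M" "rch p y Y X (cf Y X (Ret (max 1 i) K0) (pos s i - 1) ?M) d"
    proof -
      have "pos s i - 1 \<in> ?M \<and> rch p y Y X (cf Y X (Ret (max 1 i) K0) (pos s i - 1) ?M) d"
      proof (cases "i = 0")
        case i0: True
        then show ?thesis using True first_mark(1)[of s] Z(3)[OF True] by (simp add: bd_def)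
      next
        case False
        then have e: "pos s i - 1 = pos s (i - 1)" "max 1 i = Suc (i - 1)" using pos_pred_zero[of i s] True by auto
        show ?thesis unfolding e using return_to_first[of "i - 1" K0 Y X s d] Z(2,3) True assms(3) by simp
      qed
      then show "pos s i - 1 \<in> ?M" "rch p y Y X (cf Y X (Ret (max 1 i) K0) (pos s i - 1) ?M) d" by blast+
    qed
    have e: "rch p y Y X (cf Y X (Back (Ret (max 1 i) K0)) (Suc (pos s i - 1)) ?M) d"
      by (rule back_step[OF _ *(2)]) (use assms(3) k Z(2) in auto)
    show ?thesis
      by (rule rch_cf[OF _ _ _ _ e, where b = True and r = True])
         (use assms(1) Z(1) *(1) in \<open>simp_all add: insert_absorb\<close>)
  next
    case False
    have np: "0 < pos s i" using False by (cases i) auto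
    have nin: "pos s i - 1 \<notin> ?M" using pos_pred_notin False by blast
    show ?thesis
      by (rule rch_cf[OF _ _ _ _ N(2)[OF False], where b = False and r = True])
         (use assms(1) N(1) nin np in simp_all)
  qed
  show "rch p y Y X (cf Y X (Seek 1 (c # K)) (pos s i) ?M) d"
  proof (rule rch_cf[OF _ _ _ _ 1, where b = True and r = False])
    show "dl k main (Seek 1 (c # K)) (pos s i \<in> y) (Y (pos s i)) (pos s i \<in> ?M) (X (pos s i))
        = Some (Tst (c # K), Y (pos s i), True, X (pos s i), False)"
      by (cases c) (use assms(3,4) in force)+
  qed (use assms(1,3) k in \<open>simp_all add: insert_absorb\<close>)
qed (fact assms)+

lemma dec_instr:
  assumes R: "Dec i # K \<in> R" "K \<in> R" "i < k" and fin: "rch p y Y X (bd Y X K (s(i := s i - 1))) d"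
  shows "rch p y Y X (bd Y X (Dec i # K) s) d"
proof (rule test_instr[where i = i and ?K0.0 = K and qn = "SeekD (k - i) i K"])
  show "rch p y Y X (bd Y X K s) d" if "s i = 0"
    using fin that by (simp add: fun_upd_idem)
  assume nz: "s i \<noteq> 0"
  let ?M = "marks k s" and ?s = "s(i := s i - 1)" and ?t = "pos s (k - 1)"
  have pi: "pos s i = Suc (pos s i - 1)" using nz by (cases i) auto
  have ps: "pos ?s i = pos s i - 1" using pos_dec[of i i s] nz by simp
  have "rch p y Y X (cf Y X (Ret (Suc i) K) (pos ?s i) (marks k ?s)) d"
    by (rule return_to_first) (use assms in auto)
  then have 1: "rch p y Y X (cf Y X (Ret (Suc i) K) (pos s i - 1) {n. (n < pos s i - 1 \<and> n \<in> ?M) \<or> (pos s i - 1 \<le> n \<and> Suc n \<in> ?M)}) d"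
    unfolding marks_dec[of i k s, OF assms(3) nz] ps .
  have ti: "pos s i \<le> ?t" using assms(3) by (simp add: pos_le_iff)
  then have t: "?t = Suc (?t - 1)" using pi by auto
  have "{m \<in> ?M. pos s i \<le> m \<and> m \<le> ?t} = {m \<in> ?M. pos s i \<le> m}" using last_mark(2) by auto
  then have card: "card {m \<in> ?M. pos s i \<le> m \<and> m \<le> ?t} = k - i"
    using card_from[of i] by (simp only: card_marks pos_le_iff)
  have "rch p y Y X (cf Y X (Del (Suc (?t - 1) \<in> ?M) (k - i) i K) (?t - 1)
      {n. (n \<le> ?t - 1 \<and> n \<in> ?M) \<or> (?t - 1 < n \<and> Suc n \<in> ?M)}) d"
  proof (rule delete_mark[where a = "pos s i - 1"])
    show "Suc (pos s i - 1) \<in> ?M" using pi assms(3) by (metis pos_in_marks)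
    show "pos s i - 1 \<notin> ?M" using pos_pred_notin nz by blast
    show "card {m \<in> ?M. Suc (pos s i - 1) \<le> m \<and> m \<le> Suc (?t - 1)} = k - i" using card pi t by metis
  qed (use assms 1 ti in auto)
  moreover have "{n. (n \<le> ?t - 1 \<and> n \<in> ?M) \<or> (?t - 1 < n \<and> Suc n \<in> ?M)} = ?M - {?t}"
  proof (rule set_eqI)
    fix n
    have "Suc n \<notin> ?M" if "?t - 1 < n" using last_mark(2)[of "Suc n" s] that t by auto
    moreover have "n \<le> ?t - 1 \<longleftrightarrow> n \<noteq> ?t" if "n \<in> ?M" using last_mark(2)[of n s] that t by auto
    ultimately show "n \<in> {n. (n \<le> ?t - 1 \<and> n \<in> ?M) \<or> (?t - 1 < n \<and> Suc n \<in> ?M)} \<longleftrightarrow> n \<in> ?M - {?t}" by blast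
  qed
  ultimately have 2: "rch p y Y X (cf Y X (Del True (k - i) i K) (?t - 1) (?M - {?t})) d"
    using t last_mark(1)[of s] by simp
  have 3: "rch p y Y X (cf Y X (SeekD 1 i K) ?t ?M) d"
    by (rule rch_cf[OF _ _ _ _ 2, where b = False and r = False]) (use assms k last_mark(1)[of s] in simp_all)
  show "rch p y Y X (cf Y X (SeekD (k - i) i K) (pos s i) ?M) d"
    by (rule walk_right[where t = ?t and q = "\<lambda>j. SeekD j i K"]) (use assms card 3 ti last_mark in auto)
qed (use assms in auto)

text \<open>The target \<open>d\<close> is fixed and the stack is general, so the induction passes
  to longer stacks and never splices runs. For a loop there is an inner induction on its counter,
  which is sound because the body leaves the counter alone.\<close>

lemma run_com:
  assumes "wfc c" "regs c \<subseteq> {..<k}" "conts c K \<subseteq> R" "K \<in> R" "rch p y Y X (bd Y X K (ex y (Collect X) c s)) d"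
  shows "rch p y Y X (bd Y X (c # K) s) d"
  using assms
proof (induction c arbitrary: K s d)
  case Skip
  then show ?case by (intro skip_instr[where K' = K]) auto
next
  case (Inc i)
  then show ?case by (intro inc_instr) (simp_all add: fun_upd_def)
next
  case (Dec i)
  then show ?case by (intro dec_instr) (simp_all add: fun_upd_def)
next
  case (Seq c1 c2)
  have R: "c2 # K \<in> R" "c1 # c2 # K \<in> R" "Seq c1 c2 # K \<in> R"
    using Seq.prems(3) conts_self[of c1 "c2 # K"] conts_self[of c2 K] by auto
  have 2: "rch p y Y X (bd Y X (c2 # K) (ex y (Collect X) c1 s)) d"
    by (rule Seq.IH(2)) (use Seq.prems in auto)
  have 1: "rch p y Y X (bd Y X (c1 # c2 # K) s) d"
    by (rule Seq.IH(1)) (use Seq.prems R 2 in auto)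
  show ?case by (rule skip_instr[where K' = "c1 # c2 # K"]) (use R 1 in auto)
next
  case (If i c1 c2)
  have R: "c2 # K \<in> R" "c1 # K \<in> R" "If i c1 c2 # K \<in> R"
    using If.prems(3) conts_self[of c1 K] conts_self[of c2 K] by auto
  have i: "i < k" using If.prems by auto
  have 1: "rch p y Y X (bd Y X (c1 # K) s) d" if "s i \<noteq> 0"
    by (rule If.IH(1)) (use If.prems that in auto)
  have 2: "rch p y Y X (bd Y X (c2 # K) s) d" if "s i = 0"
    by (rule If.IH(2)) (use If.prems that in auto)
  show ?case
    by (rule test_instr[where i = i and ?K0.0 = "c2 # K" and qn = "Ret (Suc i) (c1 # K)"])
       (use R i 1 2 in \<open>auto intro: return_to_first\<close>)
next
  case (Loop i c)
  have R: "Loop i c # K \<in> R" "Dec i # c # Loop i c # K \<in> R" "c # Loop i c # K \<in> R"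
    using Loop.prems(3) conts_self[of c "Loop i c # K"] by auto
  have i: "i < k" and ni: "i \<notin> wr c" using Loop.prems by auto
  let ?B = "\<lambda>s. ex y (Collect X) c (s(i := s i - 1))"
  have "rch p y Y X (bd Y X (Loop i c # K) s) d" if "rch p y Y X (bd Y X K ((?B ^^ s i) s)) d" for s
    using that
  proof (induction "s i" arbitrary: s)
    case 0
    have z: "s i = 0" using 0 by simp
    have 1: "rch p y Y X (bd Y X K s) d" using 0 z by simp
    show ?case
      by (rule test_instr[where i = i and ?K0.0 = K and qn = "Ret (Suc i) (Dec i # c # Loop i c # K)"])
         (use R i Loop.prems 1 z in auto)
  next
    case (Suc n)
    have Bi: "?B s i = n" using Suc.hyps(2) ni by (simp add: ex_unchanged)
    have "(?B ^^ s i) s = (?B ^^ n) (?B s)" using Suc.hyps(2) funpow_Suc_right[of n ?B] by (simp del: funpow.simps)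
    then have "rch p y Y X (bd Y X K ((?B ^^ (?B s i)) (?B s))) d" using Suc.prems Bi by simp
    then have 1: "rch p y Y X (bd Y X (Loop i c # K) (?B s)) d" using Suc.hyps(1)[of "?B s"] Bi by simp
    have 2: "rch p y Y X (bd Y X (c # Loop i c # K) (s(i := s i - 1))) d"
      by (rule Loop.IH) (use Loop.prems R 1 in \<open>simp_all add: fun_upd_def\<close>)
    have 3: "rch p y Y X (bd Y X (Dec i # c # Loop i c # K) s) d"
      by (rule dec_instr) (use R i 2 in \<open>simp_all add: fun_upd_def\<close>)
    have nz: "s i \<noteq> 0" using Suc.hyps(2) by simp
    show ?case
      by (rule test_instr[where i = i and ?K0.0 = K and qn = "Ret (Suc i) (Dec i # c # Loop i c # K)"])
         (use R i Loop.prems 3 nz in \<open>auto intro: return_to_first\<close>)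
  qed
  then show ?case using Loop.prems by simp
next
  case GetX
  have R: "GetX # K \<in> R" "Inc 1 # K \<in> R" using GetX.prems(3) by auto
  show ?case
  proof (cases "X (s 0)")
    case True
    then have 1: "rch p y Y X (bd Y X (Inc 1 # K) s) d" using GetX.prems R k by (intro inc_instr) (simp_all add: fun_upd_def)
    show ?thesis by (rule skip_instr[where K' = "Inc 1 # K"]) (use True R 1 in auto)
  next
    case False
    then show ?thesis using GetX.prems R by (intro skip_instr[where K' = K]) auto
  qed
next
  case GetO
  have R: "GetO # K \<in> R" "Inc 1 # K \<in> R" using GetO.prems(3) by auto
  show ?case
  proof (cases "s 0 \<in> y")
    case True
    then have 1: "rch p y Y X (bd Y X (Inc 1 # K) s) d" using GetO.prems R k by (intro inc_instr) (simp_all add: fun_upd_def)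
    show ?thesis by (rule skip_instr[where K' = "Inc 1 # K"]) (use True R 1 in auto)
  next
    case False
    then show ?thesis using GetO.prems R by (intro skip_instr[where K' = K]) auto
  qed
qed auto

end

section \<open>Evaluation phases, sweeps and limits of phases\<close>

definition rcn :: "prog \<Rightarrow> nat set \<Rightarrow> (cfg \<Rightarrow> bool) \<Rightarrow> cfg \<Rightarrow> cfg \<Rightarrow> bool" where
  "rcn p y I c d \<longleftrightarrow> (\<exists>n. d = (step p y ^^ n) c \<and> (\<forall>j\<le>n. I ((step p y ^^ j) c)))"

lemma rcn_rch:
  assumes "rch p y Y X c d" "\<And>e. tin e = Y \<Longrightarrow> tout e = X \<Longrightarrow> st e \<noteq> 1 \<Longrightarrow> I e"
  shows "rcn p y I c d"
  using assms unfolding rch_def rcn_def by blast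

lemma rcn_trans: assumes "rcn p y I c d" "rcn p y I d e" shows "rcn p y I c e"
proof -
  obtain n where n: "d = (step p y ^^ n) c" "\<forall>j\<le>n. I ((step p y ^^ j) c)" using assms(1) unfolding rcn_def by blast
  obtain m where m: "e = (step p y ^^ m) d" "\<forall>j\<le>m. I ((step p y ^^ j) d)" using assms(2) unfolding rcn_def by blast
  have add: "(step p y ^^ (j + n)) c = (step p y ^^ j) d" for j unfolding n(1) by (simp add: funpow_add)
  show ?thesis unfolding rcn_def
  proof (intro exI[of _ "m + n"] conjI allI impI)
    show "e = (step p y ^^ (m + n)) c" using m(1) add by simp
    fix j assume "j \<le> m + n"
    then show "I ((step p y ^^ j) c)"
      using n(2) m(2)[rule_format, of "j - n"] add[of "j - n"] by (cases "j \<le> n") auto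
  qed
qed

lemma rcn_step:
  assumes "I c" "rcn p y I (step p y c) d" shows "\<exists>n. d = (step p y ^^ Suc n) c \<and> (\<forall>j\<le>Suc n. I ((step p y ^^ j) c))"
proof -
  obtain n where n: "d = (step p y ^^ n) (step p y c)" "\<forall>j\<le>n. I ((step p y ^^ j) (step p y c))"
    using assms(2) unfolding rcn_def by blast
  have sw: "(step p y ^^ Suc j) c = (step p y ^^ j) (step p y c)" for j by (simp only: funpow_Suc_right o_apply)
  have "I ((step p y ^^ j) c)" if "j \<le> Suc n" for j
    using that n(2) sw assms(1) by (cases j) (auto simp del: funpow.simps(2))
  then show ?thesis using n(1) sw by metis
qed

text \<open>Register 2 counts the cells and is raised before each evaluation, so cell 0 is never
  written by \<open>Put\<close> and remains free for control bits. Register 3 holds argument and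
  result, and register 0 finally gets the address for \<open>Put\<close>. \<open>Put\<close> lies
  outside \<open>wfc\<close>, so that part of the program is followed by hand in
  \<open>one_round\<close>.\<close>

definition main_com :: "com \<Rightarrow> com" where
  "main_com c = Seq (Seq (Inc 2) (Seq (cpy 2 3 4) (Seq c (cpy 2 0 4)))) (Seq (If 3 (Put True) (Put False)) (clr 0))"

locale ct = tm p y f k "main_com c" R for p y f k c R +
  fixes Q :: "nat set \<Rightarrow> nat set \<Rightarrow> nat \<Rightarrow> bool"
  assumes k5: "4 < k" and rc: "regs c \<subseteq> {..<k}"
    and c: "wfc c" "2 \<notin> wr c"
      "\<And>X s. s 0 = 0 \<Longrightarrow> s 1 = 0 \<Longrightarrow> ex y X c s 3 = of_bool (Q y X (s 3)) \<and> ex y X c s 0 = 0 \<and> ex y X c s 1 = 0"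
begin

lemma one_round:
  assumes s: "s 0 = 0" "s 1 = 0" "s 2 = n"
  shows "\<exists>N>0. \<exists>s'. s' 0 = 0 \<and> s' 1 = 0 \<and> s' 2 = Suc n \<and>
    (step p y ^^ N) (bd Y X [] s) = bd (Y(Suc n := Q y (Collect X) (Suc n))) X [] s' \<and>
    (\<forall>j\<le>N. tout ((step p y ^^ j) (bd Y X [] s)) = X \<and> st ((step p y ^^ j) (bd Y X [] s)) \<noteq> 1 \<and>
       (\<forall>m. m \<noteq> Suc n \<longrightarrow> tin ((step p y ^^ j) (bd Y X [] s)) m = Y m))"
proof -
  let ?pre = "Seq (Inc 2) (Seq (cpy 2 3 4) (Seq c (cpy 2 0 4)))" and ?put = "If 3 (Put True) (Put False)"
  let ?X = "Collect X"
  define s1 where "s1 = ex y ?X ?pre s"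
  define sa where "sa = s(2 := Suc n, 3 := Suc n, 4 := 0)"
  define b where "b = Q y ?X (Suc n)"
  define Y' where "Y' = Y(Suc n := b)"
  define I where "I e \<longleftrightarrow> tout e = X \<and> st e \<noteq> 1 \<and> (\<forall>m. m \<noteq> Suc n \<longrightarrow> tin e m = Y m)" for e :: cfg
  have sa: "sa 0 = 0" "sa 1 = 0" "sa 3 = Suc n" "sa 2 = Suc n" unfolding sa_def using s by simp_all
  have "s1 = (ex y ?X c sa)(0 := ex y ?X c sa 2, 4 := 0)"
    unfolding s1_def ex.simps(2,4) cpy_ex[of 2 3 4, simplified] cpy_ex[of 2 0 4, simplified] sa_def using s
    by (simp add: fun_upd_def)
  moreover have "ex y ?X c sa 2 = Suc n" using ex_unchanged[OF c(2)] sa by simp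
  moreover have "ex y ?X c sa 3 = of_bool b" "ex y ?X c sa 1 = 0" using c(3)[OF sa(1,2), of ?X] sa(3) unfolding b_def by auto
  ultimately have s1: "s1 0 = Suc n" "s1 1 = 0" "s1 2 = Suc n" "s1 3 = of_bool b" by simp_all
  define s2 where "s2 = ex y ?X (clr 0) s1"
  have s2: "s2 0 = 0" "s2 1 = 0" "s2 2 = Suc n" unfolding s2_def using s1 by simp_all
  have inR: "[main_com c] \<in> R" "[?pre, Seq ?put (clr 0)] \<in> R" "[Seq ?put (clr 0)] \<in> R" "[?put, clr 0] \<in> R"
    "[Put x, clr 0] \<in> R" "[clr 0] \<in> R" "conts ?pre [Seq ?put (clr 0)] \<subseteq> R" "conts (clr 0) [] \<subseteq> R" "[] \<in> R" for x
  proof -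
    have "conts (Seq ?pre (Seq ?put (clr 0))) [] \<subseteq> R" using R(2) unfolding main_com_def .
    then have *: "conts ?pre [Seq ?put (clr 0)] \<subseteq> R" "conts (Seq ?put (clr 0)) [] \<subseteq> R" "[main_com c] \<in> R"
      unfolding conts.simps(1)[of ?pre "Seq ?put (clr 0)"] main_com_def by blast+
    then show "[main_com c] \<in> R" "conts ?pre [Seq ?put (clr 0)] \<subseteq> R" "[?pre, Seq ?put (clr 0)] \<in> R"
      using conts_self[of ?pre "[Seq ?put (clr 0)]"] by blast+
    show "[Seq ?put (clr 0)] \<in> R" using *(2) by auto
    show "[?put, clr 0] \<in> R" using *(2) by auto
    show "[Put x, clr 0] \<in> R" using *(2) by (cases x) auto
    show "conts (clr 0) [] \<subseteq> R" using *(2) by auto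
    then show "[clr 0] \<in> R" using conts_self[of "clr 0" "[]"] by blast
  qed (rule R(1))
  have kk: "1 < k" "3 < k" using k5 by auto
  have wp: "wfc ?pre" "regs ?pre \<subseteq> {..<k}" using c(1) rc k5 by (auto simp: cpy_wr) (auto simp: cpy_def clr_def mv_def)
  have a3: "rch p y Y X (bd Y X [Put b, clr 0] s1) (bd Y X [Put b, clr 0] s1)" unfolding bd_def by (rule rch_cf_refl)
  have a2: "rch p y Y X (bd Y X [?put, clr 0] s1) (bd Y X [Put b, clr 0] s1)"
  proof (rule test_instr[where i = 3 and ?K0.0 = "[Put False, clr 0]" and qn = "Ret (Suc 3) [Put True, clr 0]"])
    show "rch p y Y X (bd Y X [Put False, clr 0] s1) (bd Y X [Put b, clr 0] s1)" if "s1 3 = 0"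
      using a3 that s1(4) by simp
    show "rch p y Y X (cf Y X (Ret (Suc 3) [Put True, clr 0]) (pos s1 3) (marks k s1)) (bd Y X [Put b, clr 0] s1)" if "s1 3 \<noteq> 0"
      by (rule return_to_first) (use a3 that s1(4) kk inR in simp_all)
  qed (use inR kk in simp_all)
  have a1: "rch p y Y X (bd Y X [Seq ?put (clr 0)] s1) (bd Y X [Put b, clr 0] s1)"
    by (rule skip_instr[where K' = "[?put, clr 0]"]) (use inR a2 in simp_all)
  have a0: "rch p y Y X (bd Y X [?pre, Seq ?put (clr 0)] s) (bd Y X [Put b, clr 0] s1)"
    by (rule run_com) (use wp inR a1 in \<open>simp_all only: s1_def\<close>)
  have a: "rch p y Y X (bd Y X [main_com c] s) (bd Y X [Put b, clr 0] s1)"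
    by (rule skip_instr[where K' = "[?pre, Seq ?put (clr 0)]"]) (use inR a0 in \<open>simp_all add: main_com_def\<close>)
  have z: "rch p y Y' X (bd Y' X [clr 0] s1) (bd Y' X [] s2)"
    by (rule run_com) (use inR kk in \<open>simp_all add: s2_def bd_def rch_cf_refl clr_def\<close>)
  have m1: "s1 0 \<in> marks k s1" by (rule first_mark(1))
  have p1: "step p y (bd Y X [Put b, clr 0] s1) = cf Y' X (Back (Ret 1 [clr 0])) (Suc (s1 0)) (marks k s1)"
    unfolding bd_def
    by (subst step_cf[where s' = "Back (Ret 1 [clr 0])" and wi = b and wo = "X (s1 0)" and b = True and r = True])
       (use inR kk m1 s1(1) in \<open>simp_all add: putbit_def insert_absorb Y'_def\<close>)
  have p2: "rch p y Y' X (cf Y' X (Back (Ret 1 [clr 0])) (Suc (s1 0)) (marks k s1)) (bd Y' X [] s2)"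
    by (rule back_step) (use inR kk z in \<open>simp_all add: bd_def\<close>)
  have I': "I e" if "tin e = Y' \<and> tout e = X \<and> st e \<noteq> 1 \<or> tin e = Y \<and> tout e = X \<and> st e \<noteq> 1" for e
    using that unfolding I_def Y'_def by auto
  have Ibd: "I (bd Y X K s')" for K s' unfolding I_def bd_def using f by simp
  have "rcn p y I (bd Y X [main_com c] s) (bd Y X [Put b, clr 0] s1)" by (rule rcn_rch[OF a]) (use I' in blast)
  moreover have "rcn p y I (bd Y X [Put b, clr 0] s1) (bd Y' X [] s2)"
  proof -
    have "rcn p y I (step p y (bd Y X [Put b, clr 0] s1)) (bd Y' X [] s2)"
      unfolding p1 by (rule rcn_rch[OF p2]) (use I' in blast)
    from rcn_step[of I, OF Ibd this] show ?thesis unfolding rcn_def by blast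
  qed
  ultimately have r1: "rcn p y I (bd Y X [main_com c] s) (bd Y' X [] s2)" by (rule rcn_trans)
  have m0: "s 0 \<in> marks k s" by (rule first_mark(1))
  have st0: "step p y (bd Y X [] s) = cf Y X (Back (Ret 1 [main_com c])) (Suc (s 0)) (marks k s)"
    unfolding bd_def
    by (subst step_cf[where s' = "Back (Ret 1 [main_com c])" and wi = "Y (s 0)" and wo = "X (s 0)" and b = True and r = True])
       (use inR kk m0 in \<open>simp_all add: putbit_def insert_absorb\<close>)
  have r0: "rch p y Y X (cf Y X (Back (Ret 1 [main_com c])) (Suc (s 0)) (marks k s)) (bd Y X [main_com c] s)"
    by (rule back_step) (use inR kk in \<open>simp_all add: bd_def rch_cf_refl\<close>)
  have "rcn p y I (step p y (bd Y X [] s)) (bd Y X [main_com c] s)" unfolding st0 by (rule rcn_rch[OF r0]) (use I' in blast)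
  then have "rcn p y I (step p y (bd Y X [] s)) (bd Y' X [] s2)" using r1 by (rule rcn_trans)
  from rcn_step[of I, OF Ibd this] obtain N where N: "bd Y' X [] s2 = (step p y ^^ Suc N) (bd Y X [] s)"
    "\<forall>j\<le>Suc N. I ((step p y ^^ j) (bd Y X [] s))" by blast
  show ?thesis
    by (rule exI[of _ "Suc N"], intro conjI exI[of _ s2]) (use N s2 in \<open>simp_all only: Y'_def b_def I_def zero_less_Suc\<close>)
qed

lemma start_phase:
  assumes "s = Init \<or> s = Lm \<and> Y 0"
  shows "\<exists>N. (step p y ^^ N) (cf Y X s 0 {}) = bd (Y(0 := False)) X [] (\<lambda>_. 0) \<and>
    (\<forall>j\<le>N. tout ((step p y ^^ j) (cf Y X s 0 {})) = X \<and> st ((step p y ^^ j) (cf Y X s 0 {})) \<noteq> 1) \<and>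
    0 < N \<and> tsc (step p y (cf Y X s 0 {})) 0"
proof -
  define Y0 where "Y0 = Y(0 := False)"
  define I where "I e \<longleftrightarrow> tout e = X \<and> st e \<noteq> 1" for e :: cfg
  have ps: "pos (\<lambda>_. 0) i = i" for i by (induction i) auto
  have mk: "marks k (\<lambda>_. 0) = {..<k}" unfolding marks_def ps by simp
  have fin: "rch p y Y0 X (cf Y0 X (Back (Ret k [])) (Suc (k - 1)) {..<k}) (bd Y0 X [] (\<lambda>_. 0))"
  proof (rule back_step)
    have "rch p y Y0 X (cf Y0 X (Ret (Suc (k - 1)) []) (pos (\<lambda>_. 0) (k - 1)) (marks k (\<lambda>_. 0))) (bd Y0 X [] (\<lambda>_. 0))"
      by (rule return_to_first) (use R k in \<open>simp_all add: bd_def rch_cf_refl\<close>)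
    then show "rch p y Y0 X (cf Y0 X (Ret k []) (k - 1) {..<k}) (bd Y0 X [] (\<lambda>_. 0))" using k by (simp add: ps mk)
  qed (use R in simp)
  have wr: "rch p y Y0 X (cf Y0 X (Mk j) (k - j) {..<k - j}) (bd Y0 X [] (\<lambda>_. 0))" if "0 < j" "j < k" for j
    using that
  proof (induction j rule: less_induct)
    case (less j)
    have ins: "insert (k - j) {..<k - j} = {..<Suc (k - j)}" by auto
    show ?case
    proof (cases "j = 1")
      case True
      have e: "Suc (k - 1) = k" using k by simp
      show ?thesis
        by (rule rch_cf[OF _ _ _ _ fin, where b = True and r = True]) (use True less.prems e ins in simp_all)
    next
      case False
      have e: "k - (j - 1) = Suc (k - j)" using less.prems False by simp
      have IH: "rch p y Y0 X (cf Y0 X (Mk (j - 1)) (Suc (k - j)) {..<Suc (k - j)}) (bd Y0 X [] (\<lambda>_. 0))"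
        using less.IH[of "j - 1"] False less.prems e by simp
      show ?thesis
        by (rule rch_cf[OF _ _ _ _ IH, where b = True and r = True]) (use False less.prems ins in simp_all)
    qed
  qed
  have st: "step p y (cf Y X s 0 {}) = cf Y0 X (Mk (k - 1)) 1 {0}"
    by (subst step_cf[where s' = "Mk (k - 1)" and wi = False and wo = "X 0" and b = True and r = True])
       (use assms in \<open>auto simp: Y0_def\<close>)
  have "rch p y Y0 X (cf Y0 X (Mk (k - 1)) 1 {0}) (bd Y0 X [] (\<lambda>_. 0))"
  proof -
    have "k - (k - 1) = 1" "{..<1::nat} = {0}" using k by auto
    then show ?thesis using wr[of "k - 1"] k by simp
  qed
  then have "rcn p y I (step p y (cf Y X s 0 {})) (bd Y0 X [] (\<lambda>_. 0))"
    unfolding st by (rule rcn_rch) (simp add: I_def)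
  moreover have "I (cf Y X s 0 {})" unfolding I_def using f by simp
  ultimately obtain N where "bd Y0 X [] (\<lambda>_. 0) = (step p y ^^ Suc N) (cf Y X s 0 {})" "\<forall>j\<le>Suc N. I ((step p y ^^ j) (cf Y X s 0 {}))"
    using rcn_step[of I] by blast
  moreover have "tsc (step p y (cf Y X s 0 {})) 0" unfolding st by simp
  ultimately show ?thesis unfolding I_def Y0_def[symmetric] by (intro exI[of _ "Suc N"]) simp
qed

lemma crun_lim_eventually:
  assumes v: "v = tin \<or> v = tsc \<or> v = tout" and "tlim w" "b < w" "\<And>u. b \<le> u \<Longrightarrow> u < w \<Longrightarrow> v (crun p y {} u) n = x"
  shows "v (crun p y {} w) n = x"
proof -
  have "(n \<in> Lim (\<lambda>d. Collect (v (crun p y {} d))) w) = x" by (rule Lim_eventually[OF assms(3)]) (simp add: assms(4))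
  then show ?thesis using v crun_tlim[OF assms(2), of p y "{}"] by (auto simp: clim_def)
qed

lemma crun_lim_cofinal:
  assumes v: "v = tin \<or> v = tsc \<or> v = tout" and "tlim w" "\<And>b. b < w \<Longrightarrow> \<exists>u\<ge>b. u < w \<and> v (crun p y {} u) n"
  shows "v (crun p y {} w) n"
proof -
  have "n \<in> Lim (\<lambda>d. Collect (v (crun p y {} d))) w" by (rule in_LimI) (use assms(3) in auto)
  then show ?thesis using v crun_tlim[OF assms(2), of p y "{}"] by (auto simp: clim_def)
qed

lemma crun_lim_state:
  assumes "tlim w" "tin (crun p y {} w) = Y" "tout (crun p y {} w) = X" "Collect (tsc (crun p y {} w)) = M"
  shows "crun p y {} w = cf Y X Lm 0 M"
proof -
  have "st (crun p y {} w) = 2" "hd (crun p y {} w) = 0" by (simp_all add: crun_tlim[OF assms(1)] clim_def)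
  then show ?thesis using assms(2-4) unfolding cf_def f by auto
qed

text \<open>After \<omega> rounds every input cell has settled, each in its own round. A round
  begins with register 0 empty, hence with the first mark on cell 0; so at the limit the scratch bit
  of cell 0 is on and its input bit is off, which announces the end of an evaluation.\<close>

lemma eval_phase:
  assumes s: "s = Init \<or> s = Lm \<and> Y 0" and u: "crun p y {} u = cf Y X s 0 {}"
  shows "\<exists>w M. u < w \<and> tlim w \<and> crun p y {} w = cf (\<lambda>m. m \<noteq> 0 \<and> Q y (Collect X) m) X Lm 0 M \<and> 0 \<in> M \<and>
     tsuc u < w \<and> tsc (crun p y {} (tsuc u)) 0 \<and> (\<forall>v. u \<le> v \<longrightarrow> v \<le> w \<longrightarrow> tout (crun p y {} v) = X \<and> st (crun p y {} v) \<noteq> 1)"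
proof -
  define g where "g j = (step p y ^^ j) (cf Y X s 0 {})" for j
  have g: "crun p y {} ((tsuc ^^ j) u) = g j" for j unfolding g_def crun_funpow u ..
  have ga: "(step p y ^^ i) (g j) = g (i + j)" for i j unfolding g_def by (simp add: funpow_add)
  have g1: "g 1 = step p y (cf Y X s 0 {})" unfolding g_def by simp
  obtain N where N: "g N = bd (Y(0 := False)) X [] (\<lambda>_. 0)" "\<forall>j\<le>N. tout (g j) = X \<and> st (g j) \<noteq> 1" "0 < N" "tsc (g 1) 0"
    using start_phase[where s = s and Y = Y and X = X, OF s] unfolding g1 unfolding g_def by blast
  define Yn where "Yn n m = (if m = 0 then False else if m \<le> n then Q y (Collect X) m else Y m)" for n m
  define Pn where "Pn n j \<longleftrightarrow> (\<exists>s. s 0 = 0 \<and> s 1 = 0 \<and> s 2 = n \<and> g j = bd (Yn n) X [] s)" for n j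
  define Rn where "Rn n j j' \<longleftrightarrow> j < j' \<and> (\<forall>i. j \<le> i \<longrightarrow> i \<le> j' \<longrightarrow> tout (g i) = X \<and> st (g i) \<noteq> 1 \<and> (\<forall>m. m \<noteq> Suc n \<longrightarrow> tin (g i) m = Yn n m))"
    for n j j' :: nat
  have P0: "Pn 0 N"
  proof -
    have "Yn 0 = Y(0 := False)" unfolding Yn_def by (auto simp: fun_eq_iff)
    then show ?thesis unfolding Pn_def N(1) by (intro exI[of _ "\<lambda>_. 0"]) simp
  qed
  have nxt: "\<exists>j'. Pn (Suc n) j' \<and> Rn n j j'" if Pj: "Pn n j" for n j
  proof -
    obtain s where s: "s 0 = 0" "s 1 = 0" "s 2 = n" "g j = bd (Yn n) X [] s" using Pj unfolding Pn_def by blast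
    obtain M s' where M: "0 < M" "s' 0 = 0" "s' 1 = 0" "s' 2 = Suc n"
      "(step p y ^^ M) (g j) = bd ((Yn n)(Suc n := Q y (Collect X) (Suc n))) X [] s'"
      "\<forall>i\<le>M. tout ((step p y ^^ i) (g j)) = X \<and> st ((step p y ^^ i) (g j)) \<noteq> 1 \<and> (\<forall>m. m \<noteq> Suc n \<longrightarrow> tin ((step p y ^^ i) (g j)) m = Yn n m)"
      using one_round[OF s(1-3), of "Yn n" X] unfolding s(4)[symmetric] by blast
    have eY: "(Yn n)(Suc n := Q y (Collect X) (Suc n)) = Yn (Suc n)"
    proof
      fix m show "((Yn n)(Suc n := Q y (Collect X) (Suc n))) m = Yn (Suc n) m"
        unfolding Yn_def by (cases "m = Suc n") (simp_all add: le_Suc_eq)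
    qed
    have "g (M + j) = bd (Yn (Suc n)) X [] s'" using M(5) unfolding ga eY .
    then have "Pn (Suc n) (M + j)" unfolding Pn_def using M(2-4) by blast
    moreover have "Rn n j (M + j)" unfolding Rn_def
    proof (intro conjI allI impI)
      show "j < M + j" using M(1) by simp
      fix i assume i: "j \<le> i" "i \<le> M + j"
      then have "i - j \<le> M" by simp
      note * = M(6)[THEN spec, THEN mp, OF this]
      have e: "g i = (step p y ^^ (i - j)) (g j)" unfolding ga using i(1) by simp
      show "tout (g i) = X" "st (g i) \<noteq> 1" using * unfolding e by blast+
      show "tin (g i) m = Yn n m" if "m \<noteq> Suc n" for m using * that unfolding e by blast
    qed
    ultimately show ?thesis by blast
  qed
  \<comment> \<open>\<open>J0 n\<close> is the machine step at which round \<open>n\<close>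
    begins.\<close>
  have "\<exists>J0. \<forall>n. (Pn n (J0 n) \<and> (n = 0 \<longrightarrow> J0 n = N)) \<and> Rn n (J0 n) (J0 (Suc n))"
  proof (rule dependent_nat_choice)
    show "\<exists>j. Pn 0 j \<and> (0 = (0::nat) \<longrightarrow> j = N)" using P0 by blast
    fix j n assume "Pn n j \<and> (n = 0 \<longrightarrow> j = N)"
    then obtain j' where "Pn (Suc n) j'" "Rn n j j'" using nxt by blast
    then show "\<exists>j'. (Pn (Suc n) j' \<and> (Suc n = 0 \<longrightarrow> j' = N)) \<and> Rn n j j'" by (intro exI[of _ j']) simp
  qed
  then obtain J0 where J0: "\<forall>n. (Pn n (J0 n) \<and> (n = 0 \<longrightarrow> J0 n = N)) \<and> Rn n (J0 n) (J0 (Suc n))" ..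
  then have J: "Pn n (J0 n)" "Rn n (J0 n) (J0 (Suc n))" "J0 0 = N" for n by simp_all
  have Jlt: "J0 n < J0 (Suc n)" for n using J(2) unfolding Rn_def by blast
  have Jge: "n \<le> J0 n" for n
  proof (induction n)
    case (Suc n) then show ?case using Jlt[of n] by simp
  qed simp
  have Jmono: "J0 n \<le> J0 m" if "n \<le> m" for n m using lift_Suc_mono_le[of J0, OF _ that] Jlt by (simp add: less_imp_le)
  have find: "\<exists>n\<ge>m. J0 n \<le> i \<and> i \<le> J0 (Suc n)" if "J0 m \<le> i" for i m
  proof -
    define n where "n = (LEAST n. i < J0 (Suc n))"
    have "i < J0 (Suc i)" using Jge[of "Suc i"] by simp
    then have n: "i < J0 (Suc n)" unfolding n_def by (rule LeastI)
    have "m \<le> n"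
    proof (rule ccontr)
      assume "\<not> m \<le> n"
      then have "J0 (Suc n) \<le> J0 m" by (intro Jmono) simp
      then show False using n that by simp
    qed
    moreover have "J0 n \<le> i"
    proof (cases "n = m")
      case False
      then obtain n' where n': "n = Suc n'" using \<open>m \<le> n\<close> by (cases n) auto
      then have "\<not> i < J0 (Suc n')" using not_less_Least[of n' "\<lambda>n. i < J0 (Suc n)"] unfolding n_def by simp
      then show ?thesis using n' by simp
    qed (use that in simp)
    ultimately show ?thesis using n by (intro exI[of _ n]) auto
  qed
  have Gt: "tout (g i) = X \<and> st (g i) \<noteq> 1" for i
  proof (cases "i \<le> N")
    case False
    then obtain n where "J0 n \<le> i" "i \<le> J0 (Suc n)" using find[of 0 i] J(3) by auto
    then show ?thesis using J(2)[of n] unfolding Rn_def by blast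
  qed (use N(2) in blast)
  have Gin: "tin (g i) m = (m \<noteq> 0 \<and> Q y (Collect X) m)" if i: "J0 m \<le> i" for i m
  proof -
    obtain n where n: "m \<le> n" "J0 n \<le> i" "i \<le> J0 (Suc n)" using find[OF i] by blast
    then have "m \<noteq> Suc n" by simp
    then have "tin (g i) m = Yn n m" using J(2)[of n] n unfolding Rn_def by blast
    then show ?thesis using n(1) unfolding Yn_def by simp
  qed
  define w where "w = tom u"
  have wl: "tlim w" "u < w" unfolding w_def using tlim_tom less_tom[of 0 u] by auto
  have btw: "\<exists>j. v = (tsuc ^^ j) u" if "u \<le> v" "v < w" for v using tom_between that unfolding w_def by blast
  have lt: "(tsuc ^^ j) u < w" for j unfolding w_def by (rule less_tom)
  have ord: "j \<le> i" if "(tsuc ^^ j) u \<le> (tsuc ^^ i) u" for i j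
  proof (rule ccontr)
    assume "\<not> j \<le> i"
    then have "(tsuc ^^ Suc i) u \<le> (tsuc ^^ j) u" by (intro tsuc_funpow_mono) simp
    then show False using that less_tsuc[of "(tsuc ^^ i) u"] by (metis funpow.simps(2) leD o_apply order_trans)
  qed
  have tw: "tout (crun p y {} w) = X"
  proof
    fix n show "tout (crun p y {} w) n = X n"
    proof (rule crun_lim_eventually[OF _ wl])
      fix v assume "u \<le> v" "v < w"
      then obtain j where "v = (tsuc ^^ j) u" using btw by blast
      then show "tout (crun p y {} v) n = X n" using g[of j] Gt[of j] by simp
    qed simp
  qed
  have iw: "tin (crun p y {} w) = (\<lambda>m. m \<noteq> 0 \<and> Q y (Collect X) m)"
  proof
    fix m
    show "tin (crun p y {} w) m = (m \<noteq> 0 \<and> Q y (Collect X) m)"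
    proof (rule crun_lim_eventually[OF _ wl(1) lt[of "J0 m"]])
      fix v assume v: "(tsuc ^^ J0 m) u \<le> v" "v < w"
      have "u \<le> v" using v(1) tsuc_funpow_mono[of 0 "J0 m" u] by simp
      then obtain i where i: "v = (tsuc ^^ i) u" using btw v by blast
      then have "J0 m \<le> i" using ord v(1) by blast
      then show "tin (crun p y {} v) m = (m \<noteq> 0 \<and> Q y (Collect X) m)" using Gin[of m i] g[of i] i by simp
    qed simp
  qed
  have sw: "tsc (crun p y {} w) 0"
  proof (rule crun_lim_cofinal[OF _ wl(1)])
    fix b assume "b < w"
    then obtain n where n: "b \<le> (tsuc ^^ n) u" using tom_least unfolding w_def by blast
    then have "b \<le> (tsuc ^^ J0 n) u" using tsuc_funpow_mono[OF Jge[of n], of u] by (rule order_trans)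
    moreover have "tsc (g (J0 n)) 0"
    proof -
      obtain s where "s 0 = 0" "g (J0 n) = bd (Yn n) X [] s" using J(1)[of n] unfolding Pn_def by blast
      then show ?thesis using first_mark(1)[of s] by (simp add: bd_def)
    qed
    ultimately show "\<exists>v\<ge>b. v < w \<and> tsc (crun p y {} v) 0"
      using lt[of "J0 n"] g[of "J0 n"] by (intro exI[of _ "(tsuc ^^ J0 n) u"]) simp
  qed simp
  show ?thesis
  proof (intro exI[of _ w] exI[of _ "Collect (tsc (crun p y {} w))"] conjI allI impI)
    show "crun p y {} w = cf (\<lambda>m. m \<noteq> 0 \<and> Q y (Collect X) m) X Lm 0 (Collect (tsc (crun p y {} w)))"
      by (rule crun_lim_state[OF wl(1) iw tw refl])
    show "tsuc u < w" using lt[of 1] by simp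
    show "tsc (crun p y {} (tsuc u)) 0" using N(4) g[of 1] by simp
    fix v assume v: "u \<le> v" "v \<le> w"
    show "tout (crun p y {} v) = X" "st (crun p y {} v) \<noteq> 1"
    proof -
      have "tout (crun p y {} v) = X \<and> st (crun p y {} v) \<noteq> 1"
      proof (cases "v = w")
        case True
        then show ?thesis using tw wl(1) by (simp add: crun_tlim clim_def)
      next
        case False
        then have "v < w" using v(2) by (simp add: less_le)
        then obtain j where "v = (tsuc ^^ j) u" using btw[of v] v(1) by blast
        then show ?thesis using g[of j] Gt[of j] by simp
      qed
      then show "tout (crun p y {} v) = X" "st (crun p y {} v) \<noteq> 1" by auto
    qed
  qed (use wl sw in auto)
qed

lemma sweep_phase:
  assumes u: "crun p y {} u = cf Y X (Sw cp) 1 M" "0 \<notin> M"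
  shows "\<exists>w. u < w \<and> tlim w \<and> crun p y {} w = cf Y (\<lambda>m. if cp \<and> m \<noteq> 0 then Y m else X m) Lm 0 {} \<and>
     (\<forall>v. u \<le> v \<longrightarrow> v \<le> w \<longrightarrow> st (crun p y {} v) \<noteq> 1 \<and> (\<forall>m. tout (crun p y {} v) m = X m \<or> tout (crun p y {} v) m = (if cp \<and> m \<noteq> 0 then Y m else X m)))"
proof -
  let ?X = "\<lambda>j m. if cp \<and> m \<noteq> 0 \<and> m < Suc j then Y m else X m"
  have g: "crun p y {} ((tsuc ^^ j) u) = cf Y (?X j) (Sw cp) (Suc j) (M - {..j})" for j
  proof (induction j)
    case 0
    have "?X 0 = X" "M - {..0} = M" using assms(2) by auto
    then show ?case using u by simp
  next
    case (Suc j)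
    have a: "(?X j)(Suc j := (if cp then Y (Suc j) else X (Suc j))) = ?X (Suc j)" by (auto simp: fun_eq_iff less_Suc_eq)
    have b: "M - {..j} - {Suc j} = M - {..Suc j}" by auto
    have "step p y (cf Y (?X j) (Sw cp) (Suc j) (M - {..j})) = cf Y (?X (Suc j)) (Sw cp) (Suc (Suc j)) (M - {..Suc j})"
      by (subst step_cf[where s' = "Sw cp" and wi = "Y (Suc j)" and wo = "if cp then Y (Suc j) else X (Suc j)" and b = False and r = True])
         (auto simp only: a b dl.simps in_states fun_upd_triv if_True if_False less_irrefl simp_thms split: if_splits)
    then show ?case using Suc.IH by (simp only: funpow.simps o_apply crun_tsuc)
  qed
  define w where "w = tom u"
  have wl: "tlim w" "u < w" unfolding w_def using tlim_tom less_tom[of 0 u] by auto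
  have btw: "\<exists>j. v = (tsuc ^^ j) u" if "u \<le> v" "v < w" for v using tom_between that unfolding w_def by blast
  have lt: "(tsuc ^^ j) u < w" for j unfolding w_def by (rule less_tom)
  have late: "\<exists>j\<ge>n. v = (tsuc ^^ j) u" if v: "(tsuc ^^ n) u \<le> v" "v < w" for v n
  proof -
    have "u \<le> v" using v(1) tsuc_funpow_mono[of 0 n u] by simp
    then obtain j where j: "v = (tsuc ^^ j) u" using btw v by blast
    have "n \<le> j"
    proof (rule ccontr)
      assume "\<not> n \<le> j"
      then have "(tsuc ^^ Suc j) u \<le> (tsuc ^^ n) u" by (intro tsuc_funpow_mono) simp
      then show False using v(1) j less_tsuc[of "(tsuc ^^ j) u"] by (metis funpow.simps(2) leD o_apply order_trans)
    qed
    then show ?thesis using j by blast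
  qed
  have tw: "tout (crun p y {} w) = (\<lambda>m. if cp \<and> m \<noteq> 0 then Y m else X m)"
  proof
    fix m
    show "tout (crun p y {} w) m = (if cp \<and> m \<noteq> 0 then Y m else X m)"
    proof (rule crun_lim_eventually[OF _ wl(1) lt[of m]])
      fix v assume "(tsuc ^^ m) u \<le> v" "v < w"
      then obtain j where "j \<ge> m" "v = (tsuc ^^ j) u" using late by blast
      then show "tout (crun p y {} v) m = (if cp \<and> m \<noteq> 0 then Y m else X m)" using g[of j] by simp
    qed simp
  qed
  have iw: "tin (crun p y {} w) = Y"
  proof
    fix m
    show "tin (crun p y {} w) m = Y m"
    proof (rule crun_lim_eventually[OF _ wl(1) lt[of m]])
      fix v assume "(tsuc ^^ m) u \<le> v" "v < w"
      then obtain j where "v = (tsuc ^^ j) u" using late by blast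
      then show "tin (crun p y {} v) m = Y m" using g[of j] by simp
    qed simp
  qed
  have sw: "Collect (tsc (crun p y {} w)) = {}"
  proof -
    have "tsc (crun p y {} w) m = False" for m
    proof (rule crun_lim_eventually[OF _ wl(1) lt[of m]])
      fix v assume "(tsuc ^^ m) u \<le> v" "v < w"
      then obtain j where "j \<ge> m" "v = (tsuc ^^ j) u" using late by blast
      then show "tsc (crun p y {} v) m = False" using g[of j] by simp
    qed simp
    then show ?thesis by simp
  qed
  show ?thesis
  proof (intro exI[of _ w] conjI)
    show "crun p y {} w = cf Y (\<lambda>m. if cp \<and> m \<noteq> 0 then Y m else X m) Lm 0 {}"
      by (rule crun_lim_state[OF wl(1) iw tw sw])
    show "\<forall>v. u \<le> v \<longrightarrow> v \<le> w \<longrightarrow> st (crun p y {} v) \<noteq> 1 \<and> (\<forall>m. tout (crun p y {} v) m = X m \<or> tout (crun p y {} v) m = (if cp \<and> m \<noteq> 0 then Y m else X m))"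
    proof (intro allI impI)
      fix v assume v: "u \<le> v" "v \<le> w"
      show "st (crun p y {} v) \<noteq> 1 \<and> (\<forall>m. tout (crun p y {} v) m = X m \<or> tout (crun p y {} v) m = (if cp \<and> m \<noteq> 0 then Y m else X m))"
      proof (cases "v = w")
        case True
        then show ?thesis using tw wl(1) by (simp add: crun_tlim clim_def)
      next
        case False
        then have "v < w" using v(2) by (simp add: less_le)
        then obtain j where "v = (tsuc ^^ j) u" using btw[of v] v(1) by blast
        then show ?thesis using g[of j] f by simp
      qed
    qed
  qed (use wl in auto)
qed

text \<open>The output tape holds the state shifted by one, so cell 1 tells whether 0 has entered
  the state and this phase was the last. In that case cell 0, which no evaluation computes, gets its
  final value from cell 3: element 0 of the result is \<open>pr 1 0 = 2\<close> in the
  state.\<close>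

lemma goto_sweep:
  assumes u: "crun p y {} u = cf Y X Lm 0 M" "0 \<in> M"
  shows "\<exists>w. u < w \<and> crun p y {} w = cf (Y(0 := Y 0 \<or> \<not> X 1)) (X(0 := (if \<not> Y 0 \<and> X 1 then X 3 else X 0))) (Sw (\<not> Y 0)) 1 (M - {0}) \<and>
     (\<forall>v. u \<le> v \<longrightarrow> v < w \<longrightarrow> tout (crun p y {} v) = X \<and> st (crun p y {} v) \<noteq> 1)"
proof -
  have fin: "\<exists>w. u < w \<and> crun p y {} w = e \<and> (\<forall>v. u \<le> v \<longrightarrow> v < w \<longrightarrow> tout (crun p y {} v) = X \<and> st (crun p y {} v) \<noteq> 1)"
    if "(step p y ^^ N) (cf Y X Lm 0 M) = e" "0 < N" "\<forall>j<N. tout ((step p y ^^ j) (cf Y X Lm 0 M)) = X \<and> st ((step p y ^^ j) (cf Y X Lm 0 M)) \<noteq> 1" for N e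
  proof (intro exI[of _ "(tsuc ^^ N) u"] conjI allI impI)
    show "u < (tsuc ^^ N) u" using \<open>0 < N\<close> tsuc_funpow_mono[of 1 N u] by (simp add: Suc_le_eq tsuc_le_iff)
    show "crun p y {} ((tsuc ^^ N) u) = e" using that(1) crun_funpow u by simp
    fix v assume v: "u \<le> v" "v < (tsuc ^^ N) u"
    then obtain j where j: "v = (tsuc ^^ j) u" using tom_between less_tom order.strict_trans by blast
    have "j < N"
    proof (rule ccontr)
      assume "\<not> j < N" then have "(tsuc ^^ N) u \<le> v" unfolding j by (intro tsuc_funpow_mono) simp
      then show False using v by simp
    qed
    then show "tout (crun p y {} v) = X" "st (crun p y {} v) \<noteq> 1" using that(3) crun_funpow[of p y "{}" j u] u j by auto
  qed
  have ins: "insert h M = M" if "h \<in> M" for h using that by auto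
  have st: "step p y (cf Y X q h M) = cf Y X q' (if r then Suc h else h - 1) M"
    if "q \<in> states k R" "dl k (main_com c) q (h \<in> y) (Y h) (h \<in> M) (X h) = Some (q', Y h, h \<in> M, X h, r)" for q q' h r
    using step_cf[of q h Y M X q' "Y h" "h \<in> M" "X h" r, OF that] ins[of h] by (cases "h \<in> M") simp_all
  show ?thesis
  proof (cases "Y 0")
    case True
    have "step p y (cf Y X Lm 0 M) = cf (Y(0 := True)) (X(0 := X 0)) (Sw False) 1 (M - {0})"
      by (subst step_cf[where s' = "Sw False" and wi = True and wo = "X 0" and b = False and r = True]) (use True u in simp_all)
    then show ?thesis using True f by (intro fin[of 1]) simp_all
  next
    case nY: False
    have s1: "step p y (cf Y X Lm 0 M) = cf Y X (GoR 0) 1 M"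
      by (subst st[where q' = "GoR 0" and r = True]) (use nY u in simp_all)
    show ?thesis
    proof (cases "X 1")
      case False
      have s2: "step p y (cf Y X (GoR 0) 1 M) = cf Y X LN 0 M"
        by (subst st[where q' = LN and r = False]) (use False in simp_all)
      have s3: "step p y (cf Y X LN 0 M) = cf (Y(0 := True)) (X(0 := X 0)) (Sw True) 1 (M - {0})"
        by (subst step_cf[where s' = "Sw True" and wi = True and wo = "X 0" and b = False and r = True]) simp_all
      have 3: "3 = Suc (Suc (Suc 0))" by simp
      note ss = s1[unfolded One_nat_def] s2[unfolded One_nat_def] s3[unfolded One_nat_def]
      have "(step p y ^^ 3) (cf Y X Lm 0 M) = cf (Y(0 := True)) (X(0 := X 0)) (Sw True) 1 (M - {0})"
        unfolding 3 One_nat_def by (simp only: funpow.simps o_apply id_apply ss)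
      moreover have "\<forall>j<3. tout ((step p y ^^ j) (cf Y X Lm 0 M)) = X \<and> st ((step p y ^^ j) (cf Y X Lm 0 M)) \<noteq> 1"
        unfolding 3
        by (simp only: All_less_Suc funpow.simps o_apply id_apply ss cf_sel not_less0 f(3)[unfolded One_nat_def] One_nat_def simp_thms)
      ultimately show ?thesis using nY False by (intro fin[of 3]) simp_all
    next
      case True
      have s2: "step p y (cf Y X (GoR 0) 1 M) = cf Y X (GoR 1) 2 M"
        by (subst st[where q' = "GoR 1" and r = True]) (use True in simp_all)
      have s3: "step p y (cf Y X (GoR 1) 2 M) = cf Y X (GoR 2) 3 M"
        by (subst st[where q' = "GoR 2" and r = True]) simp_all
      have s4: "step p y (cf Y X (GoR 2) 3 M) = cf Y X (GoL (X 3) 1) 2 M"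
        by (subst st[where q' = "GoL (X 3) 1" and r = False]) simp_all
      have s5: "step p y (cf Y X (GoL (X 3) 1) 2 M) = cf Y X (GoL (X 3) 2) 1 M"
        by (subst st[where q' = "GoL (X 3) 2" and r = False]) simp_all
      have s6: "step p y (cf Y X (GoL (X 3) 2) 1 M) = cf Y X (GoL (X 3) 3) 0 M"
        by (subst st[where q' = "GoL (X 3) 3" and r = False]) simp_all
      have s7: "step p y (cf Y X (GoL (X 3) 3) 0 M) = cf (Y(0 := False)) (X(0 := X 3)) (Sw True) 1 (M - {0})"
        by (subst step_cf[where s' = "Sw True" and wi = False and wo = "X 3" and b = False and r = True]) simp_all
      have 7: "7 = Suc (Suc (Suc (Suc (Suc (Suc (Suc 0))))))" by simp
      note ss = s1[unfolded One_nat_def] s2[unfolded One_nat_def] s3[unfolded One_nat_def] s4[unfolded One_nat_def]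
        s5[unfolded One_nat_def] s6[unfolded One_nat_def] s7[unfolded One_nat_def]
      have "(step p y ^^ 7) (cf Y X Lm 0 M) = cf (Y(0 := False)) (X(0 := X 3)) (Sw True) 1 (M - {0})"
        unfolding 7 One_nat_def by (simp only: funpow.simps o_apply id_apply ss)
      moreover have "\<forall>j<7. tout ((step p y ^^ j) (cf Y X Lm 0 M)) = X \<and> st ((step p y ^^ j) (cf Y X Lm 0 M)) \<noteq> 1"
        unfolding 7
        by (simp only: All_less_Suc funpow.simps o_apply id_apply ss cf_sel not_less0 f(3)[unfolded One_nat_def] One_nat_def simp_thms)
      ultimately show ?thesis using nY True by (intro fin[of 7]) simp_all
    qed
  qed
qed

text \<open>Two of the conclusions serve limits. The scratch bit of cell 0 shortly after the start
  of each phase makes that bit, like the input bit, on at limits of phases. And while the run goes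
  on, every output cell shows its old or its new value at all times in between, as
  \<open>simulation\<close> demands.\<close>

lemma macro_step:
  assumes s: "s = Init \<or> s = Lm \<and> Y 0" and u: "crun p y {} u = cf Y X s 0 {}"
  defines "X' \<equiv> \<lambda>m. if m \<noteq> 0 then Q y (Collect X) m else if X 1 then X 3 else X 0"
  shows "\<exists>w Y'. u < w \<and> crun p y {} w = cf Y' X' Lm 0 {} \<and> Y' 0 = (\<not> X 1) \<and> tsuc u < w \<and> tsc (crun p y {} (tsuc u)) 0 \<and>
     (\<forall>v. u \<le> v \<longrightarrow> v \<le> w \<longrightarrow> st (crun p y {} v) \<noteq> 1 \<and> (\<not> X 1 \<longrightarrow> (\<forall>m. tout (crun p y {} v) m = X m \<or> tout (crun p y {} v) m = X' m)))"
proof -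
  define Y1 where "Y1 m = (m \<noteq> 0 \<and> Q y (Collect X) m)" for m
  obtain w1 M where w1: "u < w1" "crun p y {} w1 = cf Y1 X Lm 0 M" "0 \<in> M" "tsuc u < w1" "tsc (crun p y {} (tsuc u)) 0"
    "\<forall>v. u \<le> v \<longrightarrow> v \<le> w1 \<longrightarrow> tout (crun p y {} v) = X \<and> st (crun p y {} v) \<noteq> 1"
    using eval_phase[where s = s and Y = Y and X = X and u = u] s u unfolding Y1_def by blast
  define Y2 X2 where "Y2 = Y1(0 := \<not> X 1)" and "X2 = X(0 := (if X 1 then X 3 else X 0))"
  have Y10: "\<not> Y1 0" unfolding Y1_def by simp
  obtain w2 where w2: "w1 < w2" "crun p y {} w2 = cf Y2 X2 (Sw True) 1 (M - {0})"
    "\<forall>v. w1 \<le> v \<longrightarrow> v < w2 \<longrightarrow> tout (crun p y {} v) = X \<and> st (crun p y {} v) \<noteq> 1"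
    using goto_sweep[OF w1(2,3)] Y10 unfolding Y2_def X2_def by auto
  obtain w3 where w3: "w2 < w3" "crun p y {} w3 = cf Y2 (\<lambda>m. if True \<and> m \<noteq> 0 then Y2 m else X2 m) Lm 0 {}"
    "\<forall>v. w2 \<le> v \<longrightarrow> v \<le> w3 \<longrightarrow> st (crun p y {} v) \<noteq> 1 \<and> (\<forall>m. tout (crun p y {} v) m = X2 m \<or> tout (crun p y {} v) m = (if True \<and> m \<noteq> 0 then Y2 m else X2 m))"
    using sweep_phase[OF w2(2)] by auto
  have X': "(\<lambda>m. if True \<and> m \<noteq> 0 then Y2 m else X2 m) = X'"
    unfolding X'_def Y2_def X2_def Y1_def by (auto simp: fun_eq_iff)
  have X2: "X2 = X" if "\<not> X 1" unfolding X2_def using that by auto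
  have all: "st (crun p y {} v) \<noteq> 1 \<and> (\<not> X 1 \<longrightarrow> (\<forall>m. tout (crun p y {} v) m = X m \<or> tout (crun p y {} v) m = X' m))"
    if v: "u \<le> v" "v \<le> w3" for v
  proof -
    consider "v \<le> w1" | "w1 \<le> v" "v < w2" | "w2 \<le> v" using le_cases not_le by blast
    then show ?thesis
    proof cases
      case 1 then show ?thesis using w1(6) v(1) by simp
    next
      case 2 then show ?thesis using w2(3) by simp
    next
      case 3 then show ?thesis using w3(3) v(2) X2 unfolding X'[symmetric] by metis
    qed
  qed
  show ?thesis
  proof (intro exI[of _ w3] exI[of _ Y2] conjI)
    show "u < w3" "tsuc u < w3" using w1 w2(1) w3(1) by (meson order.strict_trans)+
    show "crun p y {} w3 = cf Y2 X' Lm 0 {}" using w3(2) X' by simp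
    show "Y2 0 = (\<not> X 1)" unfolding Y2_def by simp
  qed (use w1(5) all in blast)+
qed

text \<open>At a limit of phases the output tape is already the limit of the simulated states; only
  the remains of old marks must be wiped before the next phase.\<close>

lemma clean_step:
  assumes u: "crun p y {} u = cf Y X Lm 0 M" "0 \<in> M" "Y 0"
  shows "\<exists>w\<ge>u. crun p y {} w = cf Y X Lm 0 {} \<and> (\<forall>v. u \<le> v \<longrightarrow> v \<le> w \<longrightarrow> st (crun p y {} v) \<noteq> 1 \<and> tout (crun p y {} v) = X)"
proof -
  obtain w2 where w2: "u < w2" "crun p y {} w2 = cf Y X (Sw False) 1 (M - {0})"
    "\<forall>v. u \<le> v \<longrightarrow> v < w2 \<longrightarrow> tout (crun p y {} v) = X \<and> st (crun p y {} v) \<noteq> 1"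
    using goto_sweep[OF u(1,2)] u(3) by (auto simp: fun_upd_idem)
  obtain w3 where w3: "w2 < w3" "crun p y {} w3 = cf Y X Lm 0 {}"
    "\<forall>v. w2 \<le> v \<longrightarrow> v \<le> w3 \<longrightarrow> st (crun p y {} v) \<noteq> 1 \<and> (\<forall>m. tout (crun p y {} v) m = X m)"
    using sweep_phase[OF w2(2)] by auto
  show ?thesis
  proof (intro exI[of _ w3] conjI allI impI)
    fix v assume v: "u \<le> v" "v \<le> w3"
    have "st (crun p y {} v) \<noteq> 1 \<and> tout (crun p y {} v) = X"
      using w2(3) w3(3) v by (cases "v < w2") (auto simp: fun_eq_iff)
    then show "st (crun p y {} v) \<noteq> 1" "tout (crun p y {} v) = X" by blast+
  qed (use w2 w3 in auto)
qed

lemma runs: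
  assumes Q: "\<And>X n. Q y X n = (if 1 \<in> X then Suc (pr 1 n) \<in> X else n - 1 \<in> G {m. Suc m \<in> X})"
  defines "a \<equiv> arun G {}"
  obtains \<phi> where "\<And>t. (\<forall>s<t. 0 \<notin> a s) \<Longrightarrow> t \<le> \<phi> t \<and> Collect (tout (crun p y {} (\<phi> t))) = Suc ` a t \<and>
      (\<forall>s w n. s \<le> t \<longrightarrow> \<phi> s \<le> w \<longrightarrow> w \<le> \<phi> t \<longrightarrow> (\<exists>r\<ge>s. r \<le> t \<and> tout (crun p y {} w) n = (n \<in> Suc ` a r)))"
    and "\<And>t. (\<forall>s<t. 0 \<notin> a s) \<Longrightarrow> 0 \<in> a t \<Longrightarrow> halts_with p y {} {n. pr 1 n \<in> a t}"
proof -
  define Xs where "Xs S m \<longleftrightarrow> m \<in> Suc ` S" for S m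
  have Xs: "Collect (Xs S) = Suc ` S" "{m. Suc m \<in> Suc ` S} = S" "Xs S (Suc 0) = (0 \<in> S)" "Xs S 0 = False" "Xs S 3 = (2 \<in> S)" for S
    unfolding Xs_def by (auto simp: image_iff numeral_3_eq_3 numeral_2_eq_2)
  have a_suc: "a (tsuc t) = G (a t)" for t unfolding a_def by simp
  define B where "B u t \<longleftrightarrow> (\<exists>Y s. (u = tz \<and> s = Init \<or> s = Lm \<and> Y 0) \<and> crun p y {} u = cf Y (Xs (a t)) s 0 {}) \<and>
      (\<forall>v\<le>u. st (crun p y {} v) \<noteq> 1)" for u t
  define ob where "ob w = Collect (tout (crun p y {} w))" for w
  have next_B: "\<exists>u'>u. B u' (tsuc t) \<and> (\<forall>w n. u \<le> w \<longrightarrow> w \<le> u' \<longrightarrow> (n \<in> ob w) = (n \<in> Suc ` a t) \<or> (n \<in> ob w) = (n \<in> Suc ` a (tsuc t)))"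
    if B: "B u t" and n0: "0 \<notin> a t" for u t
  proof -
    obtain Y s where Y: "s = Init \<or> s = Lm \<and> Y 0" "crun p y {} u = cf Y (Xs (a t)) s 0 {}" "\<forall>v\<le>u. st (crun p y {} v) \<noteq> 1"
      using B unfolding B_def by blast
    have e: "(\<lambda>m. if m \<noteq> 0 then Q y (Collect (Xs (a t))) m else if Xs (a t) 1 then Xs (a t) 3 else Xs (a t) 0) = Xs (a (tsuc t))"
    proof
      fix m
      show "(if m \<noteq> 0 then Q y (Collect (Xs (a t))) m else if Xs (a t) 1 then Xs (a t) 3 else Xs (a t) 0) = Xs (a (tsuc t)) m"
      proof (cases m)
        case 0 then show ?thesis using n0 by (simp add: Xs)
      next
        case (Suc j)
        have "1 \<notin> Suc ` a t" using n0 by auto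
        then show ?thesis unfolding Suc Q Xs a_suc using Xs_def by auto
      qed
    qed
    from macro_step[OF Y(1,2), unfolded e fun_cong[OF e]] obtain w Y' where w: "u < w" "crun p y {} w = cf Y' (Xs (a (tsuc t))) Lm 0 {}"
      "Y' 0" "\<forall>v. u \<le> v \<longrightarrow> v \<le> w \<longrightarrow> st (crun p y {} v) \<noteq> 1 \<and> (\<forall>m. tout (crun p y {} v) m = Xs (a t) m \<or> tout (crun p y {} v) m = Xs (a (tsuc t)) m)"
      using n0 unfolding One_nat_def Xs by blast
    have "st (crun p y {} v) \<noteq> 1" if "v \<le> w" for v using Y(3) w(4) that by (cases "v \<le> u") auto
    then have "B w (tsuc t)" unfolding B_def using w(2,3) by blast
    then show ?thesis using w(1,4) unfolding ob_def Xs_def by (intro exI[of _ w]) auto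
  qed
  obtain \<phi> where \<phi>: "\<And>t. (\<forall>s<t. \<not> 0 \<in> a s) \<Longrightarrow> B (\<phi> t) t \<and> t \<le> \<phi> t \<and> (\<forall>s<t. \<phi> s < \<phi> t) \<and>
      (\<forall>s w n. s \<le> t \<longrightarrow> \<phi> s \<le> w \<longrightarrow> w \<le> \<phi> t \<longrightarrow> (\<exists>r\<ge>s. r \<le> t \<and> (n \<in> ob w) = (n \<in> Suc ` a r)))"
  proof (rule simulation[where B = B and H = "\<lambda>t. 0 \<in> a t" and ob = ob and ab = "\<lambda>t. Suc ` a t" and ?u0.0 = tz])
    show "B tz tz" unfolding B_def
    proof (intro conjI exI[of _ "\<lambda>_. False"] exI[of _ Init])
      show "crun p y {} tz = cf (\<lambda>_. False) (Xs (a tz)) Init 0 {}"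
        by (simp add: init_cfg_def cf_def f a_def Xs_def fun_eq_iff)
      show "\<forall>v\<le>tz. st (crun p y {} v) \<noteq> 1" by (simp add: init_cfg_def)
    qed simp
    show "\<exists>u'>u. B u' (tsuc t) \<and> (\<forall>w n. u \<le> w \<longrightarrow> w \<le> u' \<longrightarrow> (n \<in> ob w) = (n \<in> Suc ` a t) \<or> (n \<in> ob w) = (n \<in> Suc ` a (tsuc t)))"
      if "B u t" "\<not> 0 \<in> a t" for u t using next_B that by blast
    show "\<exists>u'\<ge>u. B u' t \<and> (\<forall>w. u \<le> w \<longrightarrow> w \<le> u' \<longrightarrow> ob w = Suc ` a t)"
      if "tlim t" and u: "tlim u" and cof: "\<And>b. b < u \<Longrightarrow> \<exists>w s. b \<le> w \<and> w < u \<and> s < t \<and> B w s" and o: "ob u = Suc ` a t" for u t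
    proof -
      define Y where "Y = tin (crun p y {} u)"
      have bnd: "\<exists>w. b \<le> w \<and> w < u \<and> tin (crun p y {} w) 0 \<and> tsuc w < u \<and> tsc (crun p y {} (tsuc w)) 0 \<and> (\<forall>v\<le>w. st (crun p y {} v) \<noteq> 1)"
        if b: "b < u" for b
      proof -
        \<comment> \<open>Excludes time zero, the only time at which a phase starts in
          \<open>Init\<close>, with no claim about the input bit of cell 0.\<close>
        have "max b (tsuc tz) < u" using b tlimD[OF u tlim_pos[OF u]] by simp
        then obtain w s where w: "max b (tsuc tz) \<le> w" "w < u" "B w s" using cof by blast
        then have "w \<noteq> tz" using less_tsuc[of tz] by (metis leD max.boundedE)
        then obtain Z where Z: "Z 0" "crun p y {} w = cf Z (Xs (a s)) Lm 0 {}" "\<forall>v\<le>w. st (crun p y {} v) \<noteq> 1"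
          using w(3) unfolding B_def by auto
        have "tsc (crun p y {} (tsuc w)) 0" using macro_step[of Lm Z w "Xs (a s)"] Z by blast
        then show ?thesis using w Z tlimD[OF u] by (intro exI[of _ w]) auto
      qed
      have Y0: "Y 0" unfolding Y_def
        by (rule crun_lim_cofinal[OF _ u]) (use bnd in blast)+
      have S0: "tsc (crun p y {} u) 0"
      proof (rule crun_lim_cofinal[OF _ u])
        fix b assume "b < u"
        then obtain w where w: "b \<le> w" "tsuc w < u" "tsc (crun p y {} (tsuc w)) 0" using bnd by blast
        then have "b \<le> tsuc w" using le_tsuc[of w] order_trans by blast
        then show "\<exists>w\<ge>b. w < u \<and> tsc (crun p y {} w) 0" using w by blast
      qed simp
      have "tout (crun p y {} u) n = Xs (a t) n" for n
        using o unfolding ob_def Xs_def by (metis mem_Collect_eq)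
      then have "tout (crun p y {} u) = Xs (a t)" by (rule ext)
      from crun_lim_state[OF u Y_def[symmetric] this refl]
      have c: "crun p y {} u = cf Y (Xs (a t)) Lm 0 (Collect (tsc (crun p y {} u)))" .
      obtain w where w: "w \<ge> u" "crun p y {} w = cf Y (Xs (a t)) Lm 0 {}"
        "\<forall>v. u \<le> v \<longrightarrow> v \<le> w \<longrightarrow> st (crun p y {} v) \<noteq> 1 \<and> tout (crun p y {} v) = Xs (a t)"
        using clean_step[OF c _ Y0] S0 by auto
      have "st (crun p y {} v) \<noteq> 1" if "v \<le> w" for v
      proof (cases "v < u")
        case True
        then show ?thesis using bnd by blast
      qed (use w(3) that in simp)
      then have "B w t" unfolding B_def using w(2) Y0 by blast
      then show ?thesis using w(1,3) unfolding ob_def Xs_def by (intro exI[of _ w]) auto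
    qed
    show "ob u = Lim ob u" if "tlim u" for u
      unfolding ob_def by (simp add: crun_tlim[OF that] clim_def)
    show "Suc ` a u = Lim (\<lambda>t. Suc ` a t) u" if "tlim u" for u
    proof (rule set_eqI)
      fix n
      show "n \<in> Suc ` a u \<longleftrightarrow> n \<in> Lim (\<lambda>t. Suc ` a t) u"
      proof (cases n)
        case 0 then show ?thesis using tlim_pos[OF that] by (auto simp: Lim_def)
      next
        case (Suc m) then show ?thesis unfolding a_def arun_tlim[OF that] by (simp add: Lim_def inj_image_mem_iff)
      qed
    qed
    show "ob u = Suc ` a t" if "B u t" for u t
      using that unfolding B_def ob_def Xs_def by auto
  qed (rule that)
  show thesis
  proof (rule that[of \<phi>])
    fix t assume t: "\<forall>s<t. 0 \<notin> a s"
    note g = \<phi>[OF t]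
    show "t \<le> \<phi> t \<and> Collect (tout (crun p y {} (\<phi> t))) = Suc ` a t \<and>
      (\<forall>s w n. s \<le> t \<longrightarrow> \<phi> s \<le> w \<longrightarrow> w \<le> \<phi> t \<longrightarrow> (\<exists>r\<ge>s. r \<le> t \<and> tout (crun p y {} w) n = (n \<in> Suc ` a r)))"
    proof -
      have "Collect (tout (crun p y {} (\<phi> t))) = Suc ` a t" using g unfolding B_def Xs_def by auto
      then show ?thesis using g unfolding ob_def by simp
    qed
    assume h: "0 \<in> a t"
    obtain Y s where Y: "s = Init \<or> s = Lm \<and> Y 0" "crun p y {} (\<phi> t) = cf Y (Xs (a t)) s 0 {}" "\<forall>v\<le>\<phi> t. st (crun p y {} v) \<noteq> 1"
      using g unfolding B_def by blast
    \<comment> \<open>Once 0 has entered, one more macro step replaces the state by the output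
      track, and the ensuing limit configuration has no instruction.\<close>
    define X' where "X' = (\<lambda>m. if m \<noteq> 0 then Q y (Collect (Xs (a t))) m else if Xs (a t) 1 then Xs (a t) 3 else Xs (a t) 0)"
    from macro_step[OF Y(1,2)] obtain w Y' where w: "\<phi> t < w" "crun p y {} w = cf Y' X' Lm 0 {}"
      "\<not> Y' 0" "\<forall>v. \<phi> t \<le> v \<longrightarrow> v \<le> w \<longrightarrow> st (crun p y {} v) \<noteq> 1"
      using h unfolding X'_def by (auto simp: Xs)
    have ne: "st (crun p y {} v) \<noteq> 1" if "v \<le> w" for v using Y(3) w(4) that by (cases "v \<le> \<phi> t") auto
    have fin: "crun p y {} (tsuc w) = (cf Y' X' Lm 0 {})\<lparr>st := 1\<rparr>"
      using stp[of Lm "cf Y' X' Lm 0 {}"] w(2,3) by (simp add: app_act_def)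
    have X': "X' m = (pr 1 m \<in> a t)" for m
    proof (cases "m = 0")
      case True
      have "pr 1 0 = 2" by (simp add: prod_encode_def numeral_2_eq_2)
      then show ?thesis using True h unfolding X'_def by (simp add: Xs)
    next
      case False
      have "1 \<in> Suc ` a t" using h by auto
      then show ?thesis using False unfolding X'_def Q Xs by (simp add: inj_image_mem_iff)
    qed
    show "halts_with p y {} {n. pr 1 n \<in> a t}" unfolding halts_with_iff
    proof (intro exI[of _ "tsuc w"] conjI allI impI)
      show "st (crun p y {} (tsuc w)) = 1" unfolding fin by simp
      show "st (crun p y {} v) \<noteq> 1" if "v < tsuc w" for v using ne that by (simp add: less_tsuc_iff)
      show "{n. tout (crun p y {} (tsuc w)) n} = {n. pr 1 n \<in> a t}" unfolding fin using X' by simp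
    qed
  qed
qed

end

text \<open>The last two claims concern iterations that never halt. Every stage appears on the
  output tape at some late time. Conversely, from some time on each single cell shows a value of a
  stage not before \<open>t\<close>; different cells may show different stages while the tape is
  being rewritten.\<close>

theorem compile:
  assumes "rp (\<lambda>y X n. n \<in> G y X)"
  obtains i where
    "\<And>y t. (\<forall>s<t. 0 \<notin> arun (G y) {} s) \<Longrightarrow> 0 \<in> arun (G y) {} t \<Longrightarrow> halts_with (P i) y {} {n. pr 1 n \<in> arun (G y) {} t}"
    "\<And>y t. (\<forall>s. 0 \<notin> arun (G y) {} s) \<Longrightarrow> \<exists>u\<ge>t. \<forall>n. tout (crun (P i) y {} u) (Suc n) = (n \<in> arun (G y) {} t)"
    "\<And>y t. (\<forall>s. 0 \<notin> arun (G y) {} s) \<Longrightarrow> \<exists>u. \<forall>w\<ge>u. \<forall>n. \<exists>r\<ge>t. tout (crun (P i) y {} w) (Suc n) = (n \<in> arun (G y) {} r)"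
proof -
  \<comment> \<open>Machine cell 0 is reserved for control, so the state is shifted by one. If
    element 0 is present, the evaluation computes track 1, the output, in place of the next
    state.\<close>
  define Q where "Q y X n = (if 1 \<in> X then Suc (pr 1 n) \<in> X else n - 1 \<in> G y {m. Suc m \<in> X})" for y X n
  have "rp (\<lambda>y X n. n - 1 \<in> G y {m. Suc m \<in> X})"
    using rp_comp[OF rp_view[OF assms rf_Suc[OF rf_id]] rf_pred[OF rf_id]] .
  then have "rp Q" unfolding Q_def[abs_def] by (intro rp_if rp_X rf_intros)
  from rp_compile[OF this, of 3] obtain c where c: "wfc c" "\<forall>j\<ge>2. j < 3 \<longrightarrow> j \<notin> wr c"
    "\<forall>y X s. s 0 = 0 \<longrightarrow> s 1 = 0 \<longrightarrow> ex y X c s 3 = of_bool (Q y X (s 3)) \<and> ex y X c s 0 = 0 \<and> ex y X c s 1 = 0" by auto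
  obtain k0 where k0: "\<forall>x\<in>regs c. x \<le> k0" using finite_regs finite_nat_set_iff_bounded_le by meson
  \<comment> \<open>\<open>main_com\<close> itself uses the registers up to 4.\<close>
  define k where "k = k0 + 5"
  define R where "R = insert [] (conts (main_com c) [])"
  have "finite (states k R)" unfolding R_def by (intro finite_states) (simp add: finite_conts)
  from program_exists[OF this, of "dl k (main_com c)"] obtain i f where i: "f Init = 0" "f Lm = 2" "\<forall>s. f s \<noteq> (1::nat)"
    "\<forall>y c' s. s \<in> states k R \<longrightarrow> st c' = f s \<longrightarrow>
      step (P i) y c' = app_act f (dl k (main_com c) s (hd c' \<in> y) (tin c' (hd c')) (tsc c' (hd c')) (tout c' (hd c'))) c'"
    by blast
  have ct: "ct (P i) y f k c R Q" for y
  proof (rule ct.intro)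
    show "tm (P i) y f k (main_com c) R"
    proof (rule tm.intro)
      show "step (P i) y c' = app_act f (dl k (main_com c) s (hd c' \<in> y) (tin c' (hd c')) (tsc c' (hd c')) (tout c' (hd c'))) c'"
        if "s \<in> states k R" "st c' = f s" for c' s using i(4) that by blast
    qed (use i(1-3) in \<open>simp_all add: k_def R_def subset_insertI\<close>)
    show "ct_axioms y k c Q"
    proof (rule ct_axioms.intro)
      show "4 < k" unfolding k_def by simp
      show "regs c \<subseteq> {..<k}"
      proof
        fix x assume "x \<in> regs c"
        then have "x \<le> k0" using k0 by blast
        then show "x \<in> {..<k}" unfolding k_def by simp
      qed
      show "ex y X c s 3 = of_bool (Q y X (s 3)) \<and> ex y X c s 0 = 0 \<and> ex y X c s 1 = 0" if "s 0 = 0" "s 1 = 0" for X s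
        using c(3) that by blast
    qed (use c in simp_all)
  qed
  show ?thesis
  proof (rule that[of i])
    show "halts_with (P i) y {} {n. pr 1 n \<in> arun (G y) {} t}" if h: "\<forall>s<t. 0 \<notin> arun (G y) {} s" "0 \<in> arun (G y) {} t" for y t
    proof -
      obtain \<phi> where \<phi>: "\<And>t. (\<forall>s<t. 0 \<notin> arun (G y) {} s) \<Longrightarrow> t \<le> \<phi> t \<and> Collect (tout (crun (P i) y {} (\<phi> t))) = Suc ` arun (G y) {} t \<and>
      (\<forall>s w n. s \<le> t \<longrightarrow> \<phi> s \<le> w \<longrightarrow> w \<le> \<phi> t \<longrightarrow> (\<exists>r\<ge>s. r \<le> t \<and> tout (crun (P i) y {} w) n = (n \<in> Suc ` arun (G y) {} r)))"
        and hw: "\<And>t. (\<forall>s<t. 0 \<notin> arun (G y) {} s) \<Longrightarrow> 0 \<in> arun (G y) {} t \<Longrightarrow> halts_with (P i) y {} {n. pr 1 n \<in> arun (G y) {} t}"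
        by (rule ct.runs[where G = "G y", OF ct[of y] Q_def]) (rule that)
      show ?thesis using h by (rule hw)
    qed
    show "\<exists>u\<ge>t. \<forall>n. tout (crun (P i) y {} u) (Suc n) = (n \<in> arun (G y) {} t)" if nh: "\<forall>s. 0 \<notin> arun (G y) {} s" for y t
    proof -
      obtain \<phi> where \<phi>: "\<And>t. (\<forall>s<t. 0 \<notin> arun (G y) {} s) \<Longrightarrow> t \<le> \<phi> t \<and> Collect (tout (crun (P i) y {} (\<phi> t))) = Suc ` arun (G y) {} t \<and>
      (\<forall>s w n. s \<le> t \<longrightarrow> \<phi> s \<le> w \<longrightarrow> w \<le> \<phi> t \<longrightarrow> (\<exists>r\<ge>s. r \<le> t \<and> tout (crun (P i) y {} w) n = (n \<in> Suc ` arun (G y) {} r)))"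
        and hw: "\<And>t. (\<forall>s<t. 0 \<notin> arun (G y) {} s) \<Longrightarrow> 0 \<in> arun (G y) {} t \<Longrightarrow> halts_with (P i) y {} {n. pr 1 n \<in> arun (G y) {} t}"
        by (rule ct.runs[where G = "G y", OF ct[of y] Q_def]) (rule that)
      have "\<forall>s<t. 0 \<notin> arun (G y) {} s" using nh by simp
      note g = \<phi>[OF this]
      have "Suc n \<in> Collect (tout (crun (P i) y {} (\<phi> t))) \<longleftrightarrow> Suc n \<in> Suc ` arun (G y) {} t" for n
        unfolding conjunct1[OF conjunct2[OF g]] ..
      then have "tout (crun (P i) y {} (\<phi> t)) (Suc n) = (n \<in> arun (G y) {} t)" for n by auto
      then show ?thesis using conjunct1[OF g] by (intro exI[of _ "\<phi> t"]) simp
    qed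
    show "\<exists>u. \<forall>w\<ge>u. \<forall>n. \<exists>r\<ge>t. tout (crun (P i) y {} w) (Suc n) = (n \<in> arun (G y) {} r)" if nh: "\<forall>s. 0 \<notin> arun (G y) {} s" for y t
    proof -
      obtain \<phi> where \<phi>: "\<And>t. (\<forall>s<t. 0 \<notin> arun (G y) {} s) \<Longrightarrow> t \<le> \<phi> t \<and> Collect (tout (crun (P i) y {} (\<phi> t))) = Suc ` arun (G y) {} t \<and>
      (\<forall>s w n. s \<le> t \<longrightarrow> \<phi> s \<le> w \<longrightarrow> w \<le> \<phi> t \<longrightarrow> (\<exists>r\<ge>s. r \<le> t \<and> tout (crun (P i) y {} w) n = (n \<in> Suc ` arun (G y) {} r)))"
        and hw: "\<And>t. (\<forall>s<t. 0 \<notin> arun (G y) {} s) \<Longrightarrow> 0 \<in> arun (G y) {} t \<Longrightarrow> halts_with (P i) y {} {n. pr 1 n \<in> arun (G y) {} t}"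
        by (rule ct.runs[where G = "G y", OF ct[of y] Q_def]) (rule that)
      show ?thesis
      proof (rule exI[of _ "\<phi> t"], intro allI impI)
        fix w n assume w: "\<phi> t \<le> w"
        have "\<forall>s<max t w. 0 \<notin> arun (G y) {} s" using nh by simp
        note g = \<phi>[OF this]
        have "w \<le> \<phi> (max t w)" using conjunct1[OF g] by simp
        then have "\<exists>r\<ge>t. r \<le> max t w \<and> tout (crun (P i) y {} w) (Suc n) = (Suc n \<in> Suc ` arun (G y) {} r)"
          using conjunct2[OF conjunct2[OF g], rule_format, of t w "Suc n"] w by simp
        then obtain r where "r \<ge> t" "tout (crun (P i) y {} w) (Suc n) = (Suc n \<in> Suc ` arun (G y) {} r)" by blast
        then show "\<exists>r\<ge>t. tout (crun (P i) y {} w) (Suc n) = (n \<in> arun (G y) {} r)" by (intro exI[of _ r]) auto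
      qed
    qed
  qed
qed

section \<open>Computable operators on reals\<close>

text \<open>A state is divided into tracks by the pairing function. \<open>ec X\<close> is the
  initial state for argument \<open>X\<close>: it stands on track 1, and track 0, which carries
  flags, is empty. As \<open>pr 0 0 = 0\<close>, the halting signal 0 is itself a flag.\<close>

definition ec :: "nat set \<Rightarrow> nat set" where "ec X = {m. p1 m = 1 \<and> p2 m \<in> X}"
definition tr :: "nat \<Rightarrow> nat set \<Rightarrow> nat set" where "tr i S = {n. pr i n \<in> S}"
definition jn :: "nat set \<Rightarrow> nat set \<Rightarrow> nat set" where
  "jn A B = {m. if p1 m = 0 then p2 m \<in> A else p2 m \<in> B}"

lemma in_tr [simp]: "n \<in> tr i S \<longleftrightarrow> pr i n \<in> S" unfolding tr_def by simp
lemma pr_in_ec [simp]: "pr i n \<in> ec X \<longleftrightarrow> i = 1 \<and> n \<in> X" unfolding ec_def by simp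
lemma zero_notin_ec [simp]: "0 \<notin> ec X" unfolding ec_def by simp
lemma tr_ec [simp]: "tr (Suc 0) (ec X) = X" unfolding tr_def by simp
lemma tr_jn [simp]: "tr 0 (jn A B) = A" "tr (Suc 0) (jn A B) = B" unfolding tr_def jn_def by auto
lemma pr_in_jn: "pr i n \<in> jn A B \<longleftrightarrow> (if i = 0 then n \<in> A else n \<in> B)" unfolding jn_def by simp
lemma pr_0_0: "pr 0 0 = 0" by (simp add: prod_encode_def)
lemma pr_eq_0_iff [simp]: "pr a b = 0 \<longleftrightarrow> a = 0 \<and> b = 0" using prod_encode_eq[of "(a, b)" "(0, 0)"] pr_0_0 by auto
lemma tr_Collect: "tr i {m. \<Phi> m} = {n. \<Phi> (pr i n)}" unfolding tr_def by simp

definition rop :: "(nat set \<Rightarrow> nat set) \<Rightarrow> bool" where "rop G \<longleftrightarrow> rp (\<lambda>y X n. n \<in> G X)"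

definition hlt :: "(nat set \<Rightarrow> nat set) \<Rightarrow> nat set \<Rightarrow> time \<Rightarrow> bool" where
  "hlt G S t \<longleftrightarrow> 0 \<in> arun G S t \<and> (\<forall>s<t. 0 \<notin> arun G S s)"

lemma hltD: "hlt G S t \<Longrightarrow> 0 \<in> arun G S t" "hlt G S t \<Longrightarrow> s < t \<Longrightarrow> 0 \<notin> arun G S s" unfolding hlt_def by auto

text \<open>\<open>lcd D F\<close>: on \<open>D\<close>, the operator \<open>F\<close> is computed by iterating a finitary operator until 0 enters the state.\<close>

definition lcd :: "nat set set \<Rightarrow> (nat set \<Rightarrow> nat set) \<Rightarrow> bool" where
  "lcd D F \<longleftrightarrow> (\<exists>G. rop G \<and> (\<forall>X\<in>D. \<exists>t. hlt G (ec X) t \<and> tr 1 (arun G (ec X) t) = F X))"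

abbreviation lc :: "(nat set \<Rightarrow> nat set) \<Rightarrow> bool" where "lc F \<equiv> lcd UNIV F"

lemma rop_tr: "rop G \<Longrightarrow> rf f \<Longrightarrow> rp (\<lambda>y S m. f m \<in> G (tr i S))"
proof -
  assume "rop G" "rf f"
  have "rp (\<lambda>y S m. m \<in> G {n. pr i n \<in> S})"
    using rp_view[OF \<open>rop G\<close>[unfolded rop_def] rf_pr[OF rf_const rf_id]] .
  from rp_comp[OF this \<open>rf f\<close>] show ?thesis unfolding tr_def .
qed

lemma rp_tr: "rf f \<Longrightarrow> rp (\<lambda>y S m. f m \<in> tr i S)"
  unfolding in_tr by (intro rp_X rf_pr rf_const)

lemma rp_tr_tr: "rf f \<Longrightarrow> rp (\<lambda>y S m. f m \<in> tr j (tr i S))"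
  unfolding in_tr by (intro rp_X rf_pr rf_const)

lemmas rp_rules = rp_const rp_eq rp_le rp_less rp_odd rp_not rp_and rp_or rp_imp rp_iff rp_if rp_tr rp_tr_tr

lemma lc_rop: assumes "rop F" shows "lc F"
proof -
  define G where "G S = {m. m = 0 \<or> (p1 m = 1 \<and> p2 m \<in> F (tr 1 S))}" for S
  have "rop G" unfolding rop_def G_def mem_Collect_eq
    by (intro rp_or rp_and rp_eq rop_tr assms rf_intros)
  moreover have "hlt G (ec X) (tsuc tz)" "tr 1 (arun G (ec X) (tsuc tz)) = F X" for X
    unfolding hlt_def by (auto simp: less_tsuc_iff G_def tr_def[of _ "Collect _"])
  ultimately show ?thesis unfolding lcd_def by blast
qed

text \<open>Flag \<open>pr 0 1\<close> says that the first machine has been started,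
  \<open>pr 0 2\<close> that the second has. Track 1 keeps the argument for the glue
  \<open>H\<close>, and track 2 is the state of the machine at work. Flags and argument are constant
  during a subcomputation and therefore survive its limits.\<close>

lemma lc_comp:
  assumes "lcd D F" "lcd E F'" "rop H" "\<And>X. X \<in> D \<Longrightarrow> H (jn X (F X)) \<in> E"
  shows "lcd D (\<lambda>X. F' (H (jn X (F X))))"
proof -
  obtain G1 where G1: "rop G1" "\<forall>X\<in>D. \<exists>t. hlt G1 (ec X) t \<and> tr 1 (arun G1 (ec X) t) = F X" using assms(1) unfolding lcd_def by blast
  obtain G2 where G2: "rop G2" "\<forall>X\<in>E. \<exists>t. hlt G2 (ec X) t \<and> tr 1 (arun G2 (ec X) t) = F' X" using assms(2) unfolding lcd_def by blast
  define G where "G S = {m. if 1 \<notin> tr 0 S then (m = pr 0 1 \<or> p1 m = 1 \<and> p2 m \<in> tr 1 S \<or> p1 m = 2 \<and> p1 (p2 m) = 1 \<and> p2 (p2 m) \<in> tr 1 S)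
     else if 2 \<notin> tr 0 S then
       (if 0 \<in> tr 2 S then (m = pr 0 1 \<or> m = pr 0 2 \<or> p1 m = 2 \<and> p1 (p2 m) = 1 \<and>
            p2 (p2 m) \<in> H {n. (if p1 n = 0 then pr 1 (p2 n) else pr 2 (pr 1 (p2 n))) \<in> S})
        else (m = pr 0 1 \<or> p1 m = 1 \<and> p2 m \<in> tr 1 S \<or> p1 m = 2 \<and> p2 m \<in> G1 (tr 2 S)))
     else if 0 \<in> tr 2 S then (m = 0 \<or> p1 m = 1 \<and> p2 m \<in> tr 1 (tr 2 S))
     else (m = pr 0 1 \<or> m = pr 0 2 \<or> p1 m = 2 \<and> p2 m \<in> G2 (tr 2 S))}" for S
  have rH: "rp (\<lambda>y S m. p2 (p2 m) \<in> H {n. (if p1 n = 0 then pr 1 (p2 n) else pr 2 (pr 1 (p2 n))) \<in> S})"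
    by (rule rp_comp[OF rp_view[OF assms(3)[unfolded rop_def]]]) (intro rf_intros)+
  have "rop G" unfolding rop_def G_def mem_Collect_eq
    by (intro rp_rules rop_tr G1(1) G2(1) rH rf_intros)
  moreover have "\<exists>t. hlt G (ec X) t \<and> tr 1 (arun G (ec X) t) = F' (H (jn X (F X)))" if XD: "X \<in> D" for X
  proof -
    define c where "c = arun G (ec X)"
    have c_suc: "c (tsuc t) = G (c t)" for t unfolding c_def by simp
    obtain t1 where t1: "hlt G1 (ec X) t1" "tr 1 (arun G1 (ec X) t1) = F X" using G1(2) XD by blast
    obtain t2 where t2: "hlt G2 (ec (H (jn X (F X)))) t2" "tr 1 (arun G2 (ec (H (jn X (F X)))) t2) = F' (H (jn X (F X)))"
      using G2(2) assms(4)[OF XD] by blast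
    define u1 where "u1 = tsuc tz"
    have cu1: "c u1 = {m. m = pr 0 1 \<or> p1 m = 1 \<and> p2 m \<in> X \<or> p1 m = 2 \<and> p2 m \<in> ec X}"
      unfolding u1_def c_suc by (simp add: c_def G_def ec_def)
    define N where "N = {m. p1 m \<noteq> 2}"
    have run1: "{n. pr 2 n \<in> c (tadd u1 t)} = arun G1 (ec X) t \<and> (\<forall>n\<in>N. n \<in> c (tadd u1 t) \<longleftrightarrow> n \<in> c u1)" if t: "t \<le> t1" for t
      unfolding c_def
    proof (rule embedded_run)
      show "{n. pr 2 n \<in> arun G (ec X) u1} = ec X" unfolding c_def[symmetric] cu1 by simp
      show "\<forall>n\<in>N. n \<in> arun G (ec X) u1 \<longleftrightarrow> n \<in> arun G (ec X) u1" by simp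
      show "\<forall>s<t. 0 \<notin> arun G1 (ec X) s" using hltD(2)[OF t1(1)] t by simp
      fix S assume S: "\<forall>n\<in>N. n \<in> S \<longleftrightarrow> n \<in> arun G (ec X) u1" and h: "pr 2 0 \<notin> S"
      have SN: "m \<in> S \<longleftrightarrow> m = pr 0 1 \<or> p1 m = 1 \<and> p2 m \<in> X" if "p1 m \<noteq> 2" for m
        using S that unfolding N_def c_def[symmetric] cu1 by simp
      have GS: "G S = {m. m = pr 0 1 \<or> p1 m = 1 \<and> p2 m \<in> X \<or> p1 m = 2 \<and> p2 m \<in> G1 (tr 2 S)}"
        unfolding G_def using SN[of "pr 0 1"] SN[of "pr 0 2"] SN[of "pr 1 _"] h by simp
      show "{n. pr 2 n \<in> G S} = G1 {n. pr 2 n \<in> S} \<and> (\<forall>n\<in>N. n \<in> G S \<longleftrightarrow> n \<in> arun G (ec X) u1)"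
        unfolding GS c_def[symmetric] cu1 N_def tr_def by simp
    qed
    define v where "v = tadd u1 t1"
    have cv: "tr 2 (c v) = arun G1 (ec X) t1" "m \<in> c v \<longleftrightarrow> m = pr 0 1 \<or> p1 m = 1 \<and> p2 m \<in> X" if "p1 m \<noteq> 2" for m
      using run1[OF order_refl] that unfolding v_def cu1 N_def tr_def by simp_all
    have cv2: "tr 2 (c v) = arun G1 (ec X) t1" using run1[OF order_refl] unfolding v_def tr_def by simp
    define u2 where "u2 = tsuc v"
    have "0 \<in> tr 2 (c v)" "tr 1 (tr 2 (c v)) = F X" "tr 1 (c v) = X" "1 \<in> tr 0 (c v)" "2 \<notin> tr 0 (c v)"
      using cv2 hltD(1)[OF t1(1)] t1(2) cv(2)[of "pr 0 1"] cv(2)[of "pr 0 2"] cv(2)[of "pr 1 _"] by (simp_all add: tr_def)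
    then have cu2: "c u2 = {m. m = pr 0 1 \<or> m = pr 0 2 \<or> p1 m = 2 \<and> p2 m \<in> ec (H (jn X (F X)))}"
    proof -
      assume h: "0 \<in> tr 2 (c v)" "tr 1 (tr 2 (c v)) = F X" "tr 1 (c v) = X" "1 \<in> tr 0 (c v)" "2 \<notin> tr 0 (c v)"
      have "{n. (if p1 n = 0 then pr 1 (p2 n) else pr 2 (pr 1 (p2 n))) \<in> c v} = jn X (F X)"
      proof -
        have "pr 1 k \<in> c v \<longleftrightarrow> k \<in> X" "pr 2 (pr 1 k) \<in> c v \<longleftrightarrow> k \<in> F X" for k
          unfolding h(2)[symmetric] using h(3) by (auto simp: tr_def)
        then show ?thesis unfolding jn_def by simp
      qed
      then show ?thesis unfolding u2_def c_suc G_def using h(1,4,5) by (simp add: ec_def)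
    qed
    have run2: "{n. pr 2 n \<in> c (tadd u2 t)} = arun G2 (ec (H (jn X (F X)))) t \<and> (\<forall>n\<in>N. n \<in> c (tadd u2 t) \<longleftrightarrow> n \<in> c u2)" if t: "t \<le> t2" for t
      unfolding c_def
    proof (rule embedded_run)
      show "{n. pr 2 n \<in> arun G (ec X) u2} = ec (H (jn X (F X)))" unfolding c_def[symmetric] cu2 by simp
      show "\<forall>n\<in>N. n \<in> arun G (ec X) u2 \<longleftrightarrow> n \<in> arun G (ec X) u2" by simp
      show "\<forall>s<t. 0 \<notin> arun G2 (ec (H (jn X (F X)))) s" using hltD(2)[OF t2(1)] t by simp
      fix S assume S: "\<forall>n\<in>N. n \<in> S \<longleftrightarrow> n \<in> arun G (ec X) u2" and h: "pr 2 0 \<notin> S"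
      have SN: "m \<in> S \<longleftrightarrow> m = pr 0 1 \<or> m = pr 0 2" if "p1 m \<noteq> 2" for m
        using S that unfolding N_def c_def[symmetric] cu2 by simp
      have GS: "G S = {m. m = pr 0 1 \<or> m = pr 0 2 \<or> p1 m = 2 \<and> p2 m \<in> G2 (tr 2 S)}"
        unfolding G_def using SN[of "pr 0 1"] SN[of "pr 0 2"] h by simp
      show "{n. pr 2 n \<in> G S} = G2 {n. pr 2 n \<in> S} \<and> (\<forall>n\<in>N. n \<in> G S \<longleftrightarrow> n \<in> arun G (ec X) u2)"
        unfolding GS c_def[symmetric] cu2 N_def tr_def by simp
    qed
    define w where "w = tadd u2 t2"
    have cw: "tr 2 (c w) = arun G2 (ec (H (jn X (F X)))) t2" using run2[OF order_refl] unfolding w_def tr_def by simp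
    have cwN: "m \<in> c w \<longleftrightarrow> m = pr 0 1 \<or> m = pr 0 2" if "p1 m \<noteq> 2" for m
      using run2[OF order_refl] that unfolding w_def cu2 N_def by simp
    have "0 \<in> tr 2 (c w)" "tr 1 (tr 2 (c w)) = F' (H (jn X (F X)))" "1 \<in> tr 0 (c w)" "2 \<in> tr 0 (c w)"
      using cw hltD(1)[OF t2(1)] t2(2) cwN[of "pr 0 1"] cwN[of "pr 0 2"] by simp_all
    then have fin: "c (tsuc w) = {m. m = 0 \<or> p1 m = 1 \<and> p2 m \<in> F' (H (jn X (F X)))}"
      unfolding c_suc G_def by simp
    have no: "0 \<notin> c s" if s: "s < tsuc w" for s
    proof -
      have N0: "0 \<in> N" unfolding N_def by simp
      consider "s < u1" | "u1 \<le> s" "s \<le> v" | "u2 \<le> s" "s \<le> w"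
        using s unfolding u1_def u2_def less_tsuc_iff tsuc_le_iff by (metis less_linear le_less tz_less_iff)
      then show ?thesis
      proof cases
        case 1
        then have "s = tz" unfolding u1_def less_tsuc_iff by simp
        then show ?thesis unfolding c_def by simp
      next
        case 2
        then obtain t where t: "s = tadd u1 t" using tadd_surj[of u1 s] by auto
        then have "t \<le> t1" using 2(2) tadd_mono_iff[of u1 t1 t] unfolding v_def by (simp add: not_less[symmetric])
        from run1[OF this] N0 show ?thesis unfolding t cu1 by simp
      next
        case 3
        then obtain t where t: "s = tadd u2 t" using tadd_surj[of u2 s] by auto
        then have "t \<le> t2" using 3(2) tadd_mono_iff[of u2 t2 t] unfolding w_def by (simp add: not_less[symmetric])
        from run2[OF this] N0 show ?thesis unfolding t cu2 by simp
      qed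
    qed
    show ?thesis
      by (rule exI[of _ "tsuc w"]) (use fin no in \<open>simp add: hlt_def c_def[symmetric] tr_def\<close>)
  qed
  ultimately show ?thesis unfolding lcd_def by blast
qed

text \<open>Iterating a computed operator: track 2 holds the iterate, track 3 the current subcomputation; the flag
  \<open>pr 0 2\<close> is on between subcomputations, hence also at limits of them.\<close>

lemma iteration_machine:
  assumes "lc F"
  obtains G where "rop G"
    "\<And>X t. hlt F X t \<Longrightarrow> \<exists>u. hlt G (ec X) u \<and> tr 1 (arun G (ec X) u) = arun F X t"
    "\<And>X t. (\<forall>s. 0 \<notin> arun F X s) \<Longrightarrow> (\<forall>s. 0 \<notin> arun G (ec X) s) \<and> (\<exists>u\<ge>t. tr 2 (arun G (ec X) u) = arun F X t) \<and>
       (\<exists>u. \<forall>w\<ge>u. \<forall>n. \<exists>r\<ge>t. (pr 2 n \<in> arun G (ec X) w) = (n \<in> arun F X r))"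
proof -
  obtain G1 where G1: "rop G1" "\<And>X. \<exists>t. hlt G1 (ec X) t \<and> tr 1 (arun G1 (ec X) t) = F X" using assms unfolding lcd_def by blast
  define G where "G S = {m. if 1 \<notin> tr 0 S then (m = pr 0 1 \<or> m = pr 0 2 \<or> p1 m = 2 \<and> p2 m \<in> tr 1 S)
     else if 2 \<in> tr 0 S then
       (if 0 \<in> tr 2 S then (m = 0 \<or> p1 m = 1 \<and> p2 m \<in> tr 2 S)
        else (m = pr 0 1 \<or> p1 m = 2 \<and> p2 m \<in> tr 2 S \<or> p1 m = 3 \<and> p1 (p2 m) = 1 \<and> p2 (p2 m) \<in> tr 2 S))
     else if 0 \<in> tr 3 S then (m = pr 0 1 \<or> m = pr 0 2 \<or> p1 m = 2 \<and> p2 m \<in> tr 1 (tr 3 S))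
     else (m = pr 0 1 \<or> p1 m = 2 \<and> p2 m \<in> tr 2 S \<or> p1 m = 3 \<and> p2 m \<in> G1 (tr 3 S))}" for S
  have rG: "rop G" unfolding rop_def G_def mem_Collect_eq
    by (intro rp_rules rop_tr G1(1) rf_intros)
  define c where "c X = arun G (ec X)" for X
  define a where "a X = arun F X" for X
  define B where "B X u t \<longleftrightarrow> tr 2 (c X u) = a X t \<and> pr 0 1 \<in> c X u \<and> pr 0 2 \<in> c X u \<and> (\<forall>v\<le>u. 0 \<notin> c X v)" for X u t
  define ob where "ob X w = tr 2 (c X w)" for X w
  have main: "\<exists>\<phi>. \<forall>t. (\<forall>s<t. \<not> 0 \<in> a X s) \<longrightarrow> B X (\<phi> t) t \<and> t \<le> \<phi> t \<and> (\<forall>s<t. \<phi> s < \<phi> t) \<and>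
      (\<forall>s w n. s \<le> t \<longrightarrow> \<phi> s \<le> w \<longrightarrow> w \<le> \<phi> t \<longrightarrow> (\<exists>r\<ge>s. r \<le> t \<and> (n \<in> ob X w) = (n \<in> a X r)))" for X
  proof -
    have c_suc: "c X (tsuc t) = G (c X t)" for t unfolding c_def by simp
    have step: "\<exists>u'>u. B X u' (tsuc t) \<and> (\<forall>w n. u \<le> w \<longrightarrow> w \<le> u' \<longrightarrow> (n \<in> ob X w) = (n \<in> a X t) \<or> (n \<in> ob X w) = (n \<in> a X (tsuc t)))"
      if B: "B X u t" and n0: "\<not> 0 \<in> a X t" for u t
    proof -
      have b: "tr 2 (c X u) = a X t" "1 \<in> tr 0 (c X u)" "2 \<in> tr 0 (c X u)" "\<forall>v\<le>u. 0 \<notin> c X v" using B unfolding B_def by simp_all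
      define u1 where "u1 = tsuc u"
      have cu1: "c X u1 = {m. m = pr 0 1 \<or> p1 m = 2 \<and> p2 m \<in> a X t \<or> p1 m = 3 \<and> p2 m \<in> ec (a X t)}"
        unfolding u1_def c_suc G_def using b n0 by (simp add: ec_def)
      obtain T where T: "hlt G1 (ec (a X t)) T" "tr 1 (arun G1 (ec (a X t)) T) = F (a X t)" using G1(2) by blast
      define N where "N = {m. p1 m \<noteq> 3}"
      have run: "{n. pr 3 n \<in> c X (tadd u1 s)} = arun G1 (ec (a X t)) s \<and> (\<forall>n\<in>N. n \<in> c X (tadd u1 s) \<longleftrightarrow> n \<in> c X u1)" if s: "s \<le> T" for s
        unfolding c_def
      proof (rule embedded_run)
        show "{n. pr 3 n \<in> arun G (ec X) u1} = ec (a X t)" unfolding c_def[symmetric] cu1 by simp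
        show "\<forall>n\<in>N. n \<in> arun G (ec X) u1 \<longleftrightarrow> n \<in> arun G (ec X) u1" by simp
        show "\<forall>s'<s. 0 \<notin> arun G1 (ec (a X t)) s'" using hltD(2)[OF T(1)] s by simp
        fix S assume S: "\<forall>n\<in>N. n \<in> S \<longleftrightarrow> n \<in> arun G (ec X) u1" and h: "pr 3 0 \<notin> S"
        have SN: "m \<in> S \<longleftrightarrow> m = pr 0 1 \<or> p1 m = 2 \<and> p2 m \<in> a X t" if "p1 m \<noteq> 3" for m
          using S that unfolding N_def c_def[symmetric] cu1 by simp
        have GS: "G S = {m. m = pr 0 1 \<or> p1 m = 2 \<and> p2 m \<in> a X t \<or> p1 m = 3 \<and> p2 m \<in> G1 (tr 3 S)}"
          unfolding G_def using SN[of "pr 0 1"] SN[of "pr 0 2"] SN[of "pr 2 _"] h by simp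
        show "{n. pr 3 n \<in> G S} = G1 {n. pr 3 n \<in> S} \<and> (\<forall>n\<in>N. n \<in> G S \<longleftrightarrow> n \<in> arun G (ec X) u1)"
          unfolding GS c_def[symmetric] cu1 N_def tr_def by simp
      qed
      define w where "w = tadd u1 T"
      have cw: "tr 3 (c X w) = arun G1 (ec (a X t)) T" using run[OF order_refl] unfolding w_def tr_def by simp
      have mid: "m \<in> c X v \<longleftrightarrow> m = pr 0 1 \<or> p1 m = 2 \<and> p2 m \<in> a X t" if m: "p1 m \<noteq> 3" and v: "u1 \<le> v" "v \<le> w" for m v
      proof -
        obtain s where s: "v = tadd u1 s" using tadd_surj[OF v(1)] by auto
        then have "s \<le> T" using v(2) tadd_mono_iff[of u1 T s] unfolding w_def by (simp add: not_less[symmetric])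
        from run[OF this] m show ?thesis unfolding s cu1 N_def by simp
      qed
      have u1w: "u1 \<le> w" unfolding w_def by (rule le_tadd)
      have "0 \<in> tr 3 (c X w)" "tr 1 (tr 3 (c X w)) = F (a X t)" "1 \<in> tr 0 (c X w)" "2 \<notin> tr 0 (c X w)"
        using cw hltD(1)[OF T(1)] T(2) mid[OF _ u1w order_refl, of "pr 0 1"] mid[OF _ u1w order_refl, of "pr 0 2"] by simp_all
      then have cf: "c X (tsuc w) = {m. m = pr 0 1 \<or> m = pr 0 2 \<or> p1 m = 2 \<and> p2 m \<in> F (a X t)}"
        unfolding c_suc G_def by simp
      have asuc: "a X (tsuc t) = F (a X t)" unfolding a_def by simp
      have split: "v \<le> u \<or> (u1 \<le> v \<and> v \<le> w) \<or> v = tsuc w" if v: "v \<le> tsuc w" for v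
        using v less_tsuc_iff[of v w] unfolding u1_def tsuc_le_iff by (metis le_less not_le)
      have "B X (tsuc w) (tsuc t)" unfolding B_def
      proof (intro conjI allI impI)
        fix v assume "v \<le> tsuc w"
        from split[OF this] show "0 \<notin> c X v"
        proof (elim disjE conjE)
          assume "u1 \<le> v" "v \<le> w" then show ?thesis using mid[of 0 v] by simp
        qed (use b(4) cf in simp_all)
      qed (simp_all add: cf asuc tr_def)
      moreover have "(n \<in> ob X v) = (n \<in> a X t) \<or> (n \<in> ob X v) = (n \<in> a X (tsuc t))" if v: "u \<le> v" "v \<le> tsuc w" for v n
        using split[OF v(2)]
      proof (elim disjE conjE)
        assume "v \<le> u" then have "v = u" using v(1) by simp
        then show ?thesis unfolding ob_def using b(1) by simp
      next
        assume "u1 \<le> v" "v \<le> w" then show ?thesis unfolding ob_def using mid[of "pr 2 n" v] by simp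
      next
        assume "v = tsuc w" then show ?thesis unfolding ob_def by (simp add: cf asuc)
      qed
      moreover have "u < tsuc w" using u1w less_tsuc[of u] less_tsuc[of w] unfolding u1_def by (meson less_le_trans order.strict_trans)
      ultimately show ?thesis by blast
    qed
    obtain \<phi> where \<phi>: "\<And>t. (\<forall>s<t. \<not> 0 \<in> a X s) \<Longrightarrow> B X (\<phi> t) t \<and> t \<le> \<phi> t \<and> (\<forall>s<t. \<phi> s < \<phi> t) \<and>
      (\<forall>s w n. s \<le> t \<longrightarrow> \<phi> s \<le> w \<longrightarrow> w \<le> \<phi> t \<longrightarrow> (\<exists>r\<ge>s. r \<le> t \<and> (n \<in> ob X w) = (n \<in> a X r)))"
    proof (rule simulation[where B = "B X" and H = "\<lambda>t. 0 \<in> a X t" and ob = "ob X" and ab = "a X" and ?u0.0 = "tsuc tz"])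
      have c1: "c X (tsuc tz) = {m. m = pr 0 1 \<or> m = pr 0 2 \<or> p1 m = 2 \<and> p2 m \<in> X}"
        unfolding c_suc by (simp add: c_def G_def)
      have c0: "c X tz = ec X" unfolding c_def by simp
      have "0 \<notin> c X v" if v: "v \<le> tsuc tz" for v
      proof (cases "v = tsuc tz")
        case False
        then have "v = tz" using v less_tsuc_iff[of v tz] by (simp add: less_le)
        then show ?thesis using c0 by simp
      qed (simp add: c1)
      then show "B X (tsuc tz) tz" unfolding B_def by (simp add: c1 tr_def a_def)
      show "\<exists>u'\<ge>u. B X u' t \<and> (\<forall>w. u \<le> w \<longrightarrow> w \<le> u' \<longrightarrow> ob X w = a X t)"
        if "tlim t" and u: "tlim u" and cof: "\<And>b. b < u \<Longrightarrow> \<exists>w s. b \<le> w \<and> w < u \<and> s < t \<and> B X w s" and o: "ob X u = a X t" for u t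
      proof -
        have cu: "c X u = Lim (c X) u" unfolding c_def by (rule arun_tlim[OF u])
        have "pr 0 1 \<in> c X u" unfolding cu by (rule in_LimI) (drule cof, unfold B_def, blast)
        moreover have "pr 0 2 \<in> c X u" unfolding cu by (rule in_LimI) (drule cof, unfold B_def, blast)
        moreover have nb: "0 \<notin> c X v" if v: "v < u" for v
        proof -
          obtain w s where "v \<le> w" "B X w s" using cof[OF v] by blast
          then show ?thesis unfolding B_def by blast
        qed
        moreover have "0 \<notin> c X u" unfolding cu using nb tlim_pos[OF u] by (blast elim: in_LimD)
        ultimately have "B X u t" using o unfolding B_def ob_def by (auto simp: le_less)
        then show ?thesis using o by (intro exI[of _ u]) auto
      qed
      show "ob X u = Lim (ob X) u" if u: "tlim u" for u
        unfolding ob_def tr_def c_def by (subst arun_tlim[OF u]) (rule Lim_vimage)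
      show "a X u = Lim (a X) u" if u: "tlim u" for u unfolding a_def by (rule arun_tlim[OF u])
      show "ob X u = a X t" if "B X u t" for u t using that unfolding B_def ob_def by simp
      show "\<exists>u'>u. B X u' (tsuc t) \<and> (\<forall>w n. u \<le> w \<longrightarrow> w \<le> u' \<longrightarrow> (n \<in> ob X w) = (n \<in> a X t) \<or> (n \<in> ob X w) = (n \<in> a X (tsuc t)))"
        if "B X u t" "\<not> 0 \<in> a X t" for u t using that by (rule step)
    qed (rule that)
    show ?thesis by (rule exI[of _ \<phi>], intro allI impI) (rule \<phi>)
  qed
  show ?thesis
  proof (rule that[OF rG])
    fix X t
    obtain \<phi> where "\<forall>t. (\<forall>s<t. \<not> 0 \<in> a X s) \<longrightarrow> B X (\<phi> t) t \<and> t \<le> \<phi> t \<and> (\<forall>s<t. \<phi> s < \<phi> t) \<and>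
      (\<forall>s w n. s \<le> t \<longrightarrow> \<phi> s \<le> w \<longrightarrow> w \<le> \<phi> t \<longrightarrow> (\<exists>r\<ge>s. r \<le> t \<and> (n \<in> ob X w) = (n \<in> a X r)))"
      using main[of X] by (rule exE)
    note \<phi> = this[THEN spec, THEN mp]
    show "\<exists>u. hlt G (ec X) u \<and> tr 1 (arun G (ec X) u) = arun F X t" if h: "hlt F X t"
    proof (rule exI[of _ "tsuc (\<phi> t)"], rule conjI)
      have ns: "\<forall>s<t. \<not> 0 \<in> a X s" using hltD(2)[OF h] unfolding a_def by blast
      have g: "tr 2 (c X (\<phi> t)) = a X t" "pr 0 1 \<in> c X (\<phi> t)" "pr 0 2 \<in> c X (\<phi> t)" "\<forall>v\<le>\<phi> t. 0 \<notin> c X v"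
        using conjunct1[OF \<phi>[OF ns]] unfolding B_def by blast+
      have cs: "arun G (ec X) (tsuc (\<phi> t)) = G (c X (\<phi> t))" unfolding c_def by simp
      have e: "arun G (ec X) (tsuc (\<phi> t)) = {m. m = 0 \<or> p1 m = 1 \<and> p2 m \<in> arun F X t}"
        unfolding cs G_def using g(1-3) hltD(1)[OF h] by (simp add: a_def)
      show "hlt G (ec X) (tsuc (\<phi> t))" unfolding hlt_def e using g(4) by (simp add: less_tsuc_iff c_def)
      show "tr 1 (arun G (ec X) (tsuc (\<phi> t))) = arun F X t" unfolding e by (simp add: tr_def)
    qed
    assume nh: "\<forall>s. 0 \<notin> arun F X s"
    have ns: "\<forall>s<t. \<not> 0 \<in> a X s" for t using nh unfolding a_def by simp
    note g = \<phi>[OF ns]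
    have gB: "tr 2 (c X (\<phi> s)) = a X s" "\<forall>v\<le>\<phi> s. 0 \<notin> c X v" for s using conjunct1[OF g[of s]] unfolding B_def by blast+
    have ge: "s \<le> \<phi> s" for s using conjunct1[OF conjunct2[OF g[of s]]] .
    have nz: "\<forall>s. 0 \<notin> arun G (ec X) s" using gB(2) ge unfolding c_def by blast
    have dsp: "\<exists>u\<ge>t. tr 2 (arun G (ec X) u) = arun F X t" using gB(1)[of t] ge[of t] unfolding c_def a_def by blast
    have "\<forall>w\<ge>\<phi> t. \<forall>n. \<exists>r\<ge>t. (pr 2 n \<in> arun G (ec X) w) = (n \<in> arun F X r)"
    proof (intro allI impI)
      fix w n assume w: "\<phi> t \<le> w"
      have m: "w \<le> \<phi> (max t w)" using ge[of "max t w"] by simp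
      have "\<exists>r\<ge>t. r \<le> max t w \<and> (n \<in> ob X w) = (n \<in> a X r)"
        using conjunct2[OF conjunct2[OF conjunct2[OF g[of "max t w"]]], rule_format, of t w n] w m by simp
      then show "\<exists>r\<ge>t. (pr 2 n \<in> arun G (ec X) w) = (n \<in> arun F X r)" unfolding ob_def c_def a_def in_tr by blast
    qed
    then show "(\<forall>s. 0 \<notin> arun G (ec X) s) \<and> (\<exists>u\<ge>t. tr 2 (arun G (ec X) u) = arun F X t) \<and>
       (\<exists>u. \<forall>w\<ge>u. \<forall>n. \<exists>r\<ge>t. (pr 2 n \<in> arun G (ec X) w) = (n \<in> arun F X r))"
      using nz dsp by blast
  qed
qed

lemma lc_loop:
  assumes "lc F" "\<And>X. X \<in> D \<Longrightarrow> \<exists>t. hlt F X t \<and> arun F X t = L X"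
  shows "lcd D L"
proof -
  obtain G where G: "rop G" "\<And>X t. hlt F X t \<Longrightarrow> \<exists>u. hlt G (ec X) u \<and> tr 1 (arun G (ec X) u) = arun F X t"
    using iteration_machine[OF assms(1)] by metis
  have "\<exists>t. hlt G (ec X) t \<and> tr 1 (arun G (ec X) t) = L X" if "X \<in> D" for X
    using assms(2)[OF that] G(2)[of X] by metis
  then show ?thesis unfolding lcd_def using G(1) by blast
qed

lemma ec_empty [simp]: "ec {} = {}" unfolding ec_def by simp

text \<open>The oracle is consulted in the first step only, which loads it as the argument onto
  track 2; after that the oracle-free operator runs there.\<close>

theorem operator_computable:
  assumes "lcd D F"
  obtains i where "\<And>y. y \<in> D \<Longrightarrow> halts_with (P i) y {} (F y)"
proof -
  obtain G where G: "rop G" "\<forall>X\<in>D. \<exists>t. hlt G (ec X) t \<and> tr 1 (arun G (ec X) t) = F X" using assms unfolding lcd_def by blast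
  define G' where "G' y S = {m. if 1 \<notin> tr 0 S then m = pr 0 1 \<or> p1 m = 2 \<and> p1 (p2 m) = 1 \<and> p2 (p2 m) \<in> y
     else if 0 \<in> tr 2 S then m = 0 \<or> p1 m = 1 \<and> p2 m \<in> tr 1 (tr 2 S)
     else m = pr 0 1 \<or> p1 m = 2 \<and> p2 m \<in> G (tr 2 S)}" for y S
  have "rp (\<lambda>y S m. m \<in> G' y S)" unfolding G'_def mem_Collect_eq
    by (intro rp_rules rp_O rop_tr G(1) rf_intros)
  then obtain i where i: "\<And>y t. (\<forall>s<t. 0 \<notin> arun (G' y) {} s) \<Longrightarrow> 0 \<in> arun (G' y) {} t \<Longrightarrow> halts_with (P i) y {} {n. pr 1 n \<in> arun (G' y) {} t}"
    by (rule compile) (rule that)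
  show ?thesis
  proof (rule that[of i])
    fix y assume y: "y \<in> D"
    obtain t where t: "hlt G (ec y) t" "tr 1 (arun G (ec y) t) = F y" using G(2) y by blast
    define c where "c = arun (G' y) {}"
    have c_suc: "c (tsuc s) = G' y (c s)" for s unfolding c_def by simp
    define u where "u = tsuc tz"
    have cu: "c u = {m. m = pr 0 1 \<or> p1 m = 2 \<and> p2 m \<in> ec y}" unfolding u_def c_suc by (simp add: c_def G'_def ec_def)
    define N where "N = {m. p1 m \<noteq> 2}"
    have run: "{n. pr 2 n \<in> c (tadd u s)} = arun G (ec y) s \<and> (\<forall>n\<in>N. n \<in> c (tadd u s) \<longleftrightarrow> n \<in> c u)" if s: "s \<le> t" for s
      unfolding c_def
    proof (rule embedded_run)
      show "{n. pr 2 n \<in> arun (G' y) {} u} = ec y" unfolding c_def[symmetric] cu by simp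
      show "\<forall>n\<in>N. n \<in> arun (G' y) {} u \<longleftrightarrow> n \<in> arun (G' y) {} u" by simp
      show "\<forall>s'<s. 0 \<notin> arun G (ec y) s'" using hltD(2)[OF t(1)] s by simp
      fix S assume S: "\<forall>n\<in>N. n \<in> S \<longleftrightarrow> n \<in> arun (G' y) {} u" and h: "pr 2 0 \<notin> S"
      have SN: "m \<in> S \<longleftrightarrow> m = pr 0 1" if "p1 m \<noteq> 2" for m
        using S that unfolding N_def c_def[symmetric] cu by simp
      have GS: "G' y S = {m. m = pr 0 1 \<or> p1 m = 2 \<and> p2 m \<in> G (tr 2 S)}"
        unfolding G'_def using SN[of "pr 0 1"] h by simp
      show "{n. pr 2 n \<in> G' y S} = G {n. pr 2 n \<in> S} \<and> (\<forall>n\<in>N. n \<in> G' y S \<longleftrightarrow> n \<in> arun (G' y) {} u)"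
        unfolding GS c_def[symmetric] cu N_def tr_def by simp
    qed
    define w where "w = tadd u t"
    have cw: "tr 2 (c w) = arun G (ec y) t" using run[OF order_refl] unfolding w_def tr_def by simp
    have "pr 0 1 \<in> c w" using run[OF order_refl] unfolding w_def cu N_def by simp
    then have fin: "c (tsuc w) = {m. m = 0 \<or> p1 m = 1 \<and> p2 m \<in> F y}"
      unfolding c_suc G'_def using cw hltD(1)[OF t(1)] t(2) by simp
    have no: "0 \<notin> c s" if s: "s < tsuc w" for s
    proof (cases "u \<le> s")
      case True
      then obtain r where r: "s = tadd u r" using tadd_surj[of u s] by auto
      then have "r \<le> t" using s tadd_mono_iff[of u t r] unfolding w_def less_tsuc_iff by (simp add: not_less[symmetric])
      from run[OF this] show ?thesis unfolding r cu N_def by simp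
    next
      case False
      then have "s = tz" unfolding u_def tsuc_le_iff by (simp add: tz_less_iff)
      then show ?thesis unfolding c_def by simp
    qed
    have "halts_with (P i) y {} {n. pr 1 n \<in> c (tsuc w)}" unfolding c_def
      by (rule i) (use no fin in \<open>simp_all add: c_def[symmetric]\<close>)
    then show "halts_with (P i) y {} (F y)" unfolding fin by simp
  qed
qed

text \<open>In the address, \<open>Suc\<close> skips the control cell of the machine, and 2 is the
  track on which \<open>iteration_machine\<close> keeps the iterate.\<close>

theorem iteration_displayed:
  assumes "lc F" and nh: "\<And>t. 0 \<notin> arun F {} t"
  obtains i where
    "\<And>t. \<exists>u\<ge>t. \<forall>n. tout (crun (P i) {} {} u) (Suc (pr 2 n)) = (n \<in> arun F {} t)"
    "\<And>t. \<exists>u. \<forall>w\<ge>u. \<forall>n. \<exists>r\<ge>t. tout (crun (P i) {} {} w) (Suc (pr 2 n)) = (n \<in> arun F {} r)"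
proof -
  obtain G where G: "rop G"
    "\<And>X t. (\<forall>s. 0 \<notin> arun F X s) \<Longrightarrow> (\<forall>s. 0 \<notin> arun G (ec X) s) \<and> (\<exists>u\<ge>t. tr 2 (arun G (ec X) u) = arun F X t) \<and>
       (\<exists>u. \<forall>w\<ge>u. \<forall>n. \<exists>r\<ge>t. (pr 2 n \<in> arun G (ec X) w) = (n \<in> arun F X r))"
    by (rule iteration_machine[OF assms(1)]) (rule that)
  have g: "\<forall>s. 0 \<notin> arun G {} s" "\<exists>u\<ge>t. tr 2 (arun G {} u) = arun F {} t"
    "\<exists>u. \<forall>w\<ge>u. \<forall>n. \<exists>r\<ge>t. (pr 2 n \<in> arun G {} w) = (n \<in> arun F {} r)" for t
    using G(2)[of "{}" t] nh by simp_all
  obtain i where i: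
    "\<And>y t. (\<forall>s. 0 \<notin> arun G {} s) \<Longrightarrow> \<exists>u\<ge>t. \<forall>n. tout (crun (P i) y {} u) (Suc n) = (n \<in> arun G {} t)"
    "\<And>y t. (\<forall>s. 0 \<notin> arun G {} s) \<Longrightarrow> \<exists>u. \<forall>w\<ge>u. \<forall>n. \<exists>r\<ge>t. tout (crun (P i) y {} w) (Suc n) = (n \<in> arun G {} r)"
    by (rule compile[where G = "\<lambda>y. G", OF G(1)[unfolded rop_def]]) (rule that)
  show ?thesis
  proof (rule that[of i])
    fix t
    obtain v where v: "v \<ge> t" "tr 2 (arun G {} v) = arun F {} t" using g(2) by blast
    obtain u where u: "u \<ge> v" "\<forall>n. tout (crun (P i) {} {} u) (Suc n) = (n \<in> arun G {} v)" using i(1)[OF g(1)] by blast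
    have "tout (crun (P i) {} {} u) (Suc (pr 2 n)) = (n \<in> arun F {} t)" for n
      unfolding v(2)[symmetric] using u(2) by simp
    then show "\<exists>u\<ge>t. \<forall>n. tout (crun (P i) {} {} u) (Suc (pr 2 n)) = (n \<in> arun F {} t)"
      using u(1) v(1) order_trans[of t v u] by blast
  next
    fix t
    obtain v where v: "\<forall>w\<ge>v. \<forall>n. \<exists>r\<ge>t. (pr 2 n \<in> arun G {} w) = (n \<in> arun F {} r)" using g(3) by blast
    obtain u where u: "\<forall>w\<ge>u. \<forall>n. \<exists>r\<ge>v. tout (crun (P i) {} {} w) (Suc n) = (n \<in> arun G {} r)" using i(2)[OF g(1)] by blast
    have "\<exists>r\<ge>t. tout (crun (P i) {} {} w) (Suc (pr 2 n)) = (n \<in> arun F {} r)" if w: "w \<ge> u" for w n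
    proof -
      obtain r where r: "r \<ge> v" "tout (crun (P i) {} {} w) (Suc (pr 2 n)) = (pr 2 n \<in> arun G {} r)" using u w by blast
      obtain r' where "r' \<ge> t" "(pr 2 n \<in> arun G {} r) = (n \<in> arun F {} r')" using v r(1) by blast
      then show ?thesis using r(2) by blast
    qed
    then show "\<exists>u. \<forall>w\<ge>u. \<forall>n. \<exists>r\<ge>t. tout (crun (P i) {} {} w) (Suc (pr 2 n)) = (n \<in> arun F {} r)" by blast
  qed
qed

lemma rop_id: "rop (\<lambda>X. X)" unfolding rop_def by (intro rp_X rf_id)

lemma rop_tr1: "rop (tr i)" unfolding rop_def by (intro rp_tr rf_id)

lemma lc_compose:
  assumes "lcd D F" "lcd E F'" "\<And>X. X \<in> D \<Longrightarrow> F X \<in> E"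
  shows "lcd D (\<lambda>X. F' (F X))"
proof -
  have "lcd D (\<lambda>X. F' (tr 1 (jn X (F X))))"
    by (rule lc_comp[OF assms(1,2) rop_tr1]) (use assms(3) in simp)
  then show ?thesis by simp
qed

lemma lc_pair: assumes "lcd D F" "lc F'" shows "lcd D (\<lambda>X. jn (F X) (F' X))"
proof -
  have "lcd D (\<lambda>X. (\<lambda>X. X) ((\<lambda>X. X) (jn X (F X))))"
    by (rule lc_comp[OF assms(1) lc_rop[OF rop_id] rop_id]) simp
  then have 1: "lcd D (\<lambda>X. jn X (F X))" by simp
  have 2: "lc (\<lambda>Y. F' (tr 0 Y))" by (rule lc_compose[OF lc_rop[OF rop_tr1] assms(2)]) simp
  have rH: "rop (\<lambda>Z. {n. (if p1 n = 0 then pr 0 (pr 1 (p2 n)) else pr 1 (p2 n)) \<in> Z})"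
    unfolding rop_def mem_Collect_eq by (intro rp_X rf_intros)
  have "lc (\<lambda>Y. (\<lambda>X. X) ((\<lambda>Z. {n. (if p1 n = 0 then pr 0 (pr 1 (p2 n)) else pr 1 (p2 n)) \<in> Z}) (jn Y (F' (tr 0 Y)))))"
    by (rule lc_comp[OF 2 lc_rop[OF rop_id] rH]) simp
  moreover have "(\<lambda>Z. {n. (if p1 n = 0 then pr 0 (pr 1 (p2 n)) else pr 1 (p2 n)) \<in> Z}) (jn Y (F' (tr 0 Y))) = jn (tr 1 Y) (F' (tr 0 Y))" for Y
  proof (rule set_eqI)
    fix n show "n \<in> (\<lambda>Z. {n. (if p1 n = 0 then pr 0 (pr 1 (p2 n)) else pr 1 (p2 n)) \<in> Z}) (jn Y (F' (tr 0 Y))) \<longleftrightarrow> n \<in> jn (tr 1 Y) (F' (tr 0 Y))"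
      by (cases "p1 n = 0") (simp_all add: jn_def)
  qed
  ultimately have 3: "lc (\<lambda>Y. jn (tr 1 Y) (F' (tr 0 Y)))" by simp
  have "lcd D (\<lambda>X. jn (tr 1 (jn X (F X))) (F' (tr 0 (jn X (F X)))))"
    by (rule lc_compose[OF 1 3]) simp
  then show ?thesis by simp
qed

section \<open>Computable predicates on reals\<close>

definition cop :: "(nat set \<Rightarrow> nat \<Rightarrow> bool) \<Rightarrow> bool" where "cop Q \<longleftrightarrow> lc (\<lambda>X. {n. Q X n})"

lemma lc_cop: "cop Q \<Longrightarrow> lc (\<lambda>X. {n. Q X n})" unfolding cop_def .

lemma cop_rp: "rp (\<lambda>y X n. Q X n) \<Longrightarrow> cop Q"
  unfolding cop_def by (intro lc_rop) (simp add: rop_def)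

lemma cop_after:
  assumes "lc F" "cop Q" shows "cop (\<lambda>X n. Q (F X) n)"
  using lc_compose[OF assms(1) lc_cop[OF assms(2)]] unfolding cop_def by simp

lemma cop_sub: assumes "cop Q" "rf f" shows "cop (\<lambda>X n. Q X (f n))"
proof -
  have "rop (\<lambda>Z. {n. f n \<in> Z})" unfolding rop_def mem_Collect_eq by (intro rp_X assms)
  from lc_compose[OF lc_cop[OF assms(1)] lc_rop[OF this]] show ?thesis unfolding cop_def by simp
qed

lemma cop_mem_lc: "lc F \<Longrightarrow> rf f \<Longrightarrow> cop (\<lambda>X n. f n \<in> F X)"
proof -
  assume a: "lc F" "rf f"
  have "cop (\<lambda>X n. n \<in> F X)" using a(1) unfolding cop_def by simp
  from cop_sub[OF this a(2)] show ?thesis .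
qed

lemma cop_not: assumes "cop Q" shows "cop (\<lambda>X n. \<not> Q X n)"
proof -
  have "rop (\<lambda>Z. {n. n \<notin> Z})" unfolding rop_def mem_Collect_eq by (intro rp_not rp_X rf_id)
  from lc_compose[OF lc_cop[OF assms] lc_rop[OF this]] show ?thesis unfolding cop_def by simp
qed

lemma cop_and: assumes "cop Q" "cop R" shows "cop (\<lambda>X n. Q X n \<and> R X n)"
proof -
  have "rop (\<lambda>Z. {n. n \<in> tr 0 Z \<and> n \<in> tr 1 Z})" unfolding rop_def mem_Collect_eq by (intro rp_and rp_tr rf_id)
  from lc_compose[OF lc_pair[OF lc_cop[OF assms(1)] lc_cop[OF assms(2)]] lc_rop[OF this]] show ?thesis
    unfolding cop_def by (simp add: pr_in_jn)
qed

lemma cop_or: assumes "cop Q" "cop R" shows "cop (\<lambda>X n. Q X n \<or> R X n)"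
  using cop_not[OF cop_and[OF cop_not[OF assms(1)] cop_not[OF assms(2)]]] by simp

lemma cop_imp: assumes "cop Q" "cop R" shows "cop (\<lambda>X n. Q X n \<longrightarrow> R X n)"
  unfolding imp_conv_disj by (rule cop_or[OF cop_not[OF assms(1)] assms(2)])

lemma cop_iff: assumes "cop Q" "cop R" shows "cop (\<lambda>X n. Q X n \<longleftrightarrow> R X n)"
  unfolding iff_conv_conj_imp by (intro cop_and cop_imp assms)

lemma cop_if: assumes "cop C" "cop Q" "cop R" shows "cop (\<lambda>X n. if C X n then Q X n else R X n)"
  unfolding if_bool_eq_conj by (intro cop_and cop_imp cop_not assms)

text \<open>The two flags \<open>pr 0 1\<close> and \<open>pr 0 2\<close> alternate, so that both are on exactly at the limit.\<close>

lemma lc_exists: "lc (\<lambda>Y. {n. \<exists>m. pr n m \<in> Y})"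
proof -
  define G where "G S = {m. if 1 \<notin> tr 0 S \<and> 2 \<notin> tr 0 S then m = pr 0 1 \<or> p1 m = 2 \<and> p2 m \<in> tr 1 S
     else if 1 \<in> tr 0 S \<and> 2 \<in> tr 0 S then m = 0 \<or> p1 m = 1 \<and> p2 m \<in> tr 3 S
     else m = pr 0 1 \<and> 2 \<in> tr 0 S \<or> m = pr 0 2 \<and> 1 \<in> tr 0 S \<or> p1 m = 2 \<and> pr (p1 (p2 m)) (Suc (p2 (p2 m))) \<in> tr 2 S
       \<or> p1 m = 3 \<and> (p2 m \<in> tr 3 S \<or> pr (p2 m) 0 \<in> tr 2 S)}" for S
  have "rop G" unfolding rop_def G_def mem_Collect_eq by (intro rp_rules rf_intros)
  moreover have "\<exists>t. hlt G (ec Y) t \<and> tr 1 (arun G (ec Y) t) = {n. \<exists>m. pr n m \<in> Y}" for Y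
  proof -
    define c where "c = arun G (ec Y)"
    have c_suc: "c (tsuc s) = G (c s)" for s unfolding c_def by simp
    define g where "g n = c ((tsuc ^^ n) (tsuc tz))" for n
    have g: "g n = {m. m = pr 0 1 \<and> even n \<or> m = pr 0 2 \<and> odd n \<or> p1 m = 2 \<and> pr (p1 (p2 m)) (p2 (p2 m) + n) \<in> Y
        \<or> p1 m = 3 \<and> (\<exists>b<n. pr (p2 m) b \<in> Y)}" for n
    proof (induction n)
      case 0
      show ?case unfolding g_def by (simp add: c_suc) (simp add: c_def G_def)
    next
      case (Suc n)
      have "g (Suc n) = G (g n)" unfolding g_def by (simp add: c_suc)
      also have "\<dots> = {m. m = pr 0 1 \<and> even (Suc n) \<or> m = pr 0 2 \<and> odd (Suc n) \<or> p1 m = 2 \<and> pr (p1 (p2 m)) (p2 (p2 m) + Suc n) \<in> Y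
        \<or> p1 m = 3 \<and> (\<exists>b<Suc n. pr (p2 m) b \<in> Y)}"
        unfolding Suc.IH by (cases "even n") (simp_all add: G_def less_Suc_eq ex_disj_distrib conj_disj_distribR disj_commute)
      finally show ?case .
    qed
    define w where "w = tom (tsuc tz)"
    have wl: "tlim w" unfolding w_def by (rule tlim_tom)
    have cw: "c w = Lim c w" unfolding c_def by (rule arun_tlim[OF wl])
    have lt: "(tsuc ^^ n) (tsuc tz) < w" for n unfolding w_def by (rule less_tom)
    have cof: "x \<in> c w" if x: "\<And>n. x \<in> g n \<or> x \<in> g (Suc n)" for x
      unfolding cw
    proof (rule in_LimI)
      fix b assume "b < w"
      then obtain n where n: "b \<le> (tsuc ^^ n) (tsuc tz)" using tom_least unfolding w_def by blast
      have n': "b \<le> (tsuc ^^ Suc n) (tsuc tz)" by (rule order_trans[OF n]) simp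
      from x[of n] show "\<exists>d\<ge>b. d < w \<and> x \<in> c d"
      proof
        assume "x \<in> g n" then show ?thesis using n lt[of n] unfolding g_def by blast
      next
        assume "x \<in> g (Suc n)" then show ?thesis using n' lt[of "Suc n"] unfolding g_def by blast
      qed
    qed
    have ev: "(x \<in> c w) = v" if x: "\<And>n. n \<ge> k \<Longrightarrow> (x \<in> g n) = v" for x k v
      unfolding cw
    proof (rule Lim_eventually[OF lt[of k]])
      fix d assume d: "(tsuc ^^ k) (tsuc tz) \<le> d" "d < w"
      have "tsuc tz \<le> d" using d(1) tsuc_funpow_mono[of 0 k "tsuc tz"] by simp
      then obtain n where n: "d = (tsuc ^^ n) (tsuc tz)" using tom_between d(2) unfolding w_def by blast
      have "k \<le> n"
      proof (rule ccontr)
        assume "\<not> k \<le> n"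
        then have "(tsuc ^^ Suc n) (tsuc tz) \<le> (tsuc ^^ k) (tsuc tz)" by (intro tsuc_funpow_mono) simp
        then have "tsuc d \<le> d" using d(1) n by simp
        then show False by (simp add: tsuc_le_iff)
      qed
      then show "(x \<in> c d) = v" using x[of n] n unfolding g_def by simp
    qed
    have "pr 0 1 \<in> c w" by (rule cof) (simp add: g)
    moreover have "pr 0 2 \<in> c w"
    proof (rule cof)
      fix n show "pr 0 2 \<in> g n \<or> pr 0 2 \<in> g (Suc n)" unfolding g by (cases "even n") simp_all
    qed
    ultimately have f1: "1 \<in> tr 0 (c w)" "2 \<in> tr 0 (c w)" by simp_all
    have f3: "tr 3 (c w) = {n. \<exists>m. pr n m \<in> Y}"
    proof (rule set_eqI)
      fix n
      show "n \<in> tr 3 (c w) \<longleftrightarrow> n \<in> {n. \<exists>m. pr n m \<in> Y}"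
      proof (cases "\<exists>m. pr n m \<in> Y")
        case True
        then obtain m where m: "pr n m \<in> Y" by blast
        have "(pr 3 n \<in> c w) = True" by (rule ev[of "Suc m"]) (use m in \<open>auto simp: g intro!: exI[of _ m]\<close>)
        then show ?thesis using True by simp
      next
        case False
        have "(pr 3 n \<in> c w) = False" by (rule ev[of 0]) (use False in \<open>auto simp: g\<close>)
        then show ?thesis using False by simp
      qed
    qed
    have fin: "c (tsuc w) = {m. m = 0 \<or> p1 m = 1 \<and> (\<exists>k. pr (p2 m) k \<in> Y)}"
      unfolding c_suc G_def using f1 f3 by simp
    have n0: "0 \<notin> c w"
    proof -
      have "(0 \<in> c w) = False" by (rule ev[of 0]) (simp add: g)
      then show ?thesis by simp
    qed
    have no: "0 \<notin> c s" if s: "s < tsuc w" for s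
    proof -
      have "s \<le> w" using s by (simp add: less_tsuc_iff)
      then consider "s = tz" | "s = w" | "tsuc tz \<le> s" "s < w" unfolding tsuc_le_iff by (metis le_less tz_less_iff)
      then show ?thesis
      proof cases
        case 1 then show ?thesis unfolding c_def by simp
      next
        case 2 then show ?thesis using n0 by simp
      next
        case 3
        then obtain n where "s = (tsuc ^^ n) (tsuc tz)" using tom_between unfolding w_def by blast
        then have "c s = g n" unfolding g_def by simp
        then show ?thesis by (simp add: g)
      qed
    qed
    show ?thesis by (rule exI[of _ "tsuc w"]) (use fin no in \<open>simp add: hlt_def c_def[symmetric] tr_def\<close>)
  qed
  ultimately show ?thesis unfolding lcd_def by blast
qed

text \<open>A number quantifier costs \<omega> steps. With the Boolean operations this makes every
  arithmetical condition on computed reals computable.\<close>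

lemma cop_ex: assumes "cop (\<lambda>X p. Q X (p1 p) (p2 p))" shows "cop (\<lambda>X n. \<exists>m. Q X n m)"
  using lc_compose[OF lc_cop[OF assms] lc_exists] unfolding cop_def by simp

lemma cop_all: assumes "cop (\<lambda>X p. Q X (p1 p) (p2 p))" shows "cop (\<lambda>X n. \<forall>m. Q X n m)"
  using cop_not[OF cop_ex[OF cop_not[OF assms]]] by simp

lemma cop_const: "cop (\<lambda>X n. b)" by (intro cop_rp rp_const)
lemma cop_eq: "rf f \<Longrightarrow> rf g \<Longrightarrow> cop (\<lambda>X n. f n = g n)" by (intro cop_rp rp_eq)
lemma cop_le: "rf f \<Longrightarrow> rf g \<Longrightarrow> cop (\<lambda>X n. f n \<le> g n)" by (intro cop_rp rp_le)
lemma cop_less: "rf f \<Longrightarrow> rf g \<Longrightarrow> cop (\<lambda>X n. f n < g n)" by (intro cop_rp rp_less)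
lemma cop_odd: "rf f \<Longrightarrow> cop (\<lambda>X n. odd (f n))" by (intro cop_rp rp_odd)
lemma cop_tr: "rf f \<Longrightarrow> cop (\<lambda>X n. f n \<in> tr i X)" by (intro cop_rp rp_tr)
lemma cop_tr_tr: "rf f \<Longrightarrow> cop (\<lambda>X n. f n \<in> tr j (tr i X))" by (intro cop_rp rp_tr_tr)
lemma cop_mem: "rf f \<Longrightarrow> cop (\<lambda>X n. f n \<in> X)" by (intro cop_rp rp_X)

lemmas cop_intros = cop_const cop_eq cop_le cop_less cop_odd cop_not cop_and cop_or cop_imp cop_iff cop_if cop_ex cop_all
  cop_tr cop_tr_tr cop_mem

section \<open>The universal step\<close>

text \<open>\<open>act e q r\<close> is one more than the code of the instruction of program \<open>e\<close> that applies in state \<open>q\<close> when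
  reading \<open>r\<close>, and 0 if there is none.  It is found by iterating \<open>scan\<close>, which walks down the list code.\<close>

definition scan :: "nat \<Rightarrow> nat" where
  "scan z = (if p2 (p2 z) = 0 then (if p1 (p2 z) = 0 then z else
     (if (p1 (p1 (p1 (p2 z) - 1)) - p1 (p1 z)) + (p1 (p1 z) - p1 (p1 (p1 (p2 z) - 1)))
       + ((p1 (p2 (p1 (p1 (p2 z) - 1))) - p2 (p1 z)) + (p2 (p1 z) - p1 (p2 (p1 (p1 (p2 z) - 1))))) = 0
      then pr (p1 z) (pr (p1 (p2 z)) (Suc (p1 (p1 (p2 z) - 1))))
      else pr (p1 z) (pr (p2 (p1 (p2 z) - 1)) 0))) else z)"

definition act :: "nat \<Rightarrow> nat \<Rightarrow> nat \<Rightarrow> nat" where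
  "act e q r = p2 (p2 ((scan ^^ e) (pr (pr q r) (pr e 0))))"

lemma rf_scan: "rf scan"
  unfolding scan_def[abs_def] by (intro rf_if0 rf_p1 rf_p2 rf_pr rf_plus rf_minus rf_Suc rf_const rf_id)

lemma rf_act: "rf a \<Longrightarrow> rf b \<Longrightarrow> rf c \<Longrightarrow> rf (\<lambda>n. act (a n) (b n) (c n))"
  unfolding act_def by (intro rf_p2 rf_iter rf_scan rf_pr rf_const)

lemma scan_simps:
  "scan (pr (pr q r) (pr s (Suc a))) = pr (pr q r) (pr s (Suc a))"
  "scan (pr (pr q r) (pr 0 0)) = pr (pr q r) (pr 0 0)"
  "scan (pr (pr q r) (pr (Suc n) 0)) = (if p1 (p1 n) = q \<and> p1 (p2 (p1 n)) = r
     then pr (pr q r) (pr (Suc n) (Suc (p1 n))) else pr (pr q r) (pr (p2 n) 0))"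
  unfolding scan_def by auto

lemma scan_stop: "(scan ^^ k) (pr (pr q r) (pr s (Suc a))) = pr (pr q r) (pr s (Suc a))"
  "(scan ^^ k) (pr (pr q r) (pr 0 0)) = pr (pr q r) (pr 0 0)"
  by (induction k) (auto simp: scan_simps)

lemma list_decode_Suc_p: "list_decode (Suc n) = p1 n # list_decode (p2 n)"
  by (simp add: p1_def p2_def case_prod_beta)

lemma scan_find:
  "length (list_decode s) \<le> k \<Longrightarrow> p2 (p2 ((scan ^^ k) (pr (pr q r) (pr s 0)))) =
     (case find (\<lambda>c. p1 c = q \<and> p1 (p2 c) = r) (list_decode s) of None \<Rightarrow> 0 | Some c \<Rightarrow> Suc c)"
proof (induction k arbitrary: s)
  case 0
  then have "s = 0" by (cases s) (auto simp: list_decode_Suc_p simp del: list_decode.simps(2))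
  then show ?case by simp
next
  case (Suc k)
  have sw: "(scan ^^ Suc k) z = (scan ^^ k) (scan z)" for z by (simp only: funpow_Suc_right o_apply)
  show ?case
  proof (cases s)
    case 0
    then show ?thesis unfolding sw by (simp add: scan_simps scan_stop)
  next
    case (Suc n)
    show ?thesis
    proof (cases "p1 (p1 n) = q \<and> p1 (p2 (p1 n)) = r")
      case True
      then show ?thesis unfolding sw Suc list_decode_Suc_p by (simp add: scan_simps scan_stop)
    next
      case False
      have "length (list_decode (p2 n)) \<le> k" using Suc.prems unfolding Suc list_decode_Suc_p by simp
      note IH = Suc.IH[OF this]
      have "scan (pr (pr q r) (pr (Suc n) 0)) = pr (pr q r) (pr (p2 n) 0)" using False by (simp only: scan_simps if_False)
      then show ?thesis unfolding sw Suc list_decode_Suc_p using IH False by auto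
    qed
  qed
qed

lemma p2_le: "p2 n \<le> n" using le_prod_encode_2[of "p2 n" "p1 n"] by simp

text \<open>Makes the program code itself a sufficient number of rounds for \<open>scan\<close>, as
  \<open>act\<close> assumes.\<close>

lemma length_list_decode: "length (list_decode s) \<le> s"
proof (induction s rule: less_induct)
  case (less s)
  show ?case
  proof (cases s)
    case (Suc n)
    then have "length (list_decode (p2 n)) \<le> p2 n" using less[of "p2 n"] p2_le[of n] by simp
    then show ?thesis unfolding Suc list_decode_Suc_p using p2_le[of n] by simp
  qed simp
qed

lemma act_find: "act e q r = (case find (\<lambda>c. p1 c = q \<and> p1 (p2 c) = r) (list_decode e) of None \<Rightarrow> 0 | Some c \<Rightarrow> Suc c)"
  unfolding act_def by (rule scan_find[OF length_list_decode])

lemma decode_instr_p: "decode_instr c = (p1 c, p1 (p2 c), p1 (p2 (p2 c)), p1 (p2 (p2 (p2 c))), p2 (p2 (p2 (p2 c))))"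
  unfolding decode_instr_def p1_def p2_def by (simp add: case_prod_beta)

lemma find_map': "find R (map g xs) = map_option g (find (\<lambda>x. R (g x)) xs)"
  by (induction xs) auto

text \<open>The subtraction removes the \<open>Suc\<close> by which \<open>act\<close> marks that an
  instruction was found.\<close>

definition fq :: "nat \<Rightarrow> nat" where "fq a = p1 (p2 (p2 (a - 1)))"
definition fw :: "nat \<Rightarrow> nat" where "fw a = p1 (p2 (p2 (p2 (a - 1))))"
definition fm :: "nat \<Rightarrow> nat" where "fm a = p2 (p2 (p2 (p2 (a - 1))))"

lemma step_act:
  fixes a and c :: cfg and e y defines "a \<equiv> act e (st c) (readcode y c)"
  shows "step (P e) y c = (if st c = 1 \<or> a = 0 then c\<lparr>st := 1\<rparr> else
     c\<lparr>st := fq a, tin := (tin c)(hd c := odd (fw a)), tsc := (tsc c)(hd c := odd (fw a div 2)),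
       tout := (tout c)(hd c := odd (fw a div 4)), hd := (if fm a = 0 then hd c - 1 else Suc (hd c))\<rparr>)"
proof (cases "st c = 1")
  case True
  then show ?thesis unfolding step_def by (cases c) simp
next
  case False
  let ?F = "find (\<lambda>k. p1 k = st c \<and> p1 (p2 k) = readcode y c) (list_decode e)"
  have f: "find (\<lambda>(q, r, _). q = st c \<and> r = readcode y c) (P e) = map_option decode_instr ?F"
    unfolding P_def find_map' decode_instr_p by simp
  have a: "a = (case ?F of None \<Rightarrow> 0 | Some c \<Rightarrow> Suc c)" unfolding a_def act_find ..
  show ?thesis
  proof (cases ?F)
    case None
    then show ?thesis using False unfolding step_def f a by simp
  next
    case (Some k)
    then show ?thesis using False unfolding step_def f a by (simp add: decode_instr_p fq_def fw_def fm_def)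
  qed
qed

text \<open>Both flags are off only in the initial state, where the state and head tracks are still
  empty.\<close>

definition ust :: "nat set \<Rightarrow> nat \<Rightarrow> nat \<Rightarrow> bool" where
  "ust S e q \<longleftrightarrow> (if 1 \<in> tr 0 S \<and> 2 \<in> tr 0 S then q = 2 else if 1 \<notin> tr 0 S \<and> 2 \<notin> tr 0 S then q = 0 else pr e q \<in> tr 2 S)"
definition uhd :: "nat set \<Rightarrow> nat \<Rightarrow> nat \<Rightarrow> bool" where
  "uhd S e h \<longleftrightarrow> (if (1 \<in> tr 0 S) = (2 \<in> tr 0 S) then h = 0 else pr e h \<in> tr 3 S)"
definition urd :: "nat set \<Rightarrow> nat \<Rightarrow> nat \<Rightarrow> nat \<Rightarrow> bool" where
  "urd S e h r \<longleftrightarrow> (odd r \<longleftrightarrow> h \<in> tr 1 S) \<and> (odd (r div 2) \<longleftrightarrow> pr e (pr 0 h) \<in> tr 4 S) \<and>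
     (odd (r div 2 div 2) \<longleftrightarrow> pr e (pr 1 h) \<in> tr 4 S) \<and> (odd (r div 2 div 2 div 2) \<longleftrightarrow> pr e (pr 2 h) \<in> tr 4 S) \<and> r div 2 div 2 div 2 div 2 = 0"

text \<open>One step of all programs at once, with a common oracle on track 1.  Tracks 2, 3 and 4 hold the states, head
  positions and tapes.  As in \<open>lc_exists\<close>, both flags are on exactly at limits; the state and head
  tracks are then void and the programs are in state 2 at cell 0.\<close>

definition US :: "nat set \<Rightarrow> nat set" where
  "US S = {m. (m = pr 0 1 \<and> \<not> (1 \<in> tr 0 S \<and> 2 \<notin> tr 0 S)) \<or> (m = pr 0 2 \<and> (1 \<in> tr 0 S \<and> 2 \<notin> tr 0 S))
     \<or> (p1 m = 1 \<and> p2 m \<in> tr 1 S)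
     \<or> (p1 m = 2 \<and> (\<exists>q h r. ust S (p1 (p2 m)) q \<and> uhd S (p1 (p2 m)) h \<and> urd S (p1 (p2 m)) h r \<and>
          p2 (p2 m) = (if (if q = 1 then 0 else act (p1 (p2 m)) q r) = 0 then 1 else fq (act (p1 (p2 m)) q r))))
     \<or> (p1 m = 3 \<and> (\<exists>q h r. ust S (p1 (p2 m)) q \<and> uhd S (p1 (p2 m)) h \<and> urd S (p1 (p2 m)) h r \<and>
          p2 (p2 m) = (if (if q = 1 then 0 else act (p1 (p2 m)) q r) = 0 then h else
             if fm (act (p1 (p2 m)) q r) = 0 then h - 1 else Suc h)))
     \<or> (p1 m = 4 \<and> (\<exists>q h r. ust S (p1 (p2 m)) q \<and> uhd S (p1 (p2 m)) h \<and> urd S (p1 (p2 m)) h r \<and>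
          (if q \<noteq> 1 \<and> act (p1 (p2 m)) q r \<noteq> 0 \<and> p2 (p2 (p2 m)) = h
           then (p1 (p2 (p2 m)) = 0 \<and> odd (fw (act (p1 (p2 m)) q r))) \<or> (p1 (p2 (p2 m)) = 1 \<and> odd (fw (act (p1 (p2 m)) q r) div 2))
             \<or> (p1 (p2 (p2 m)) = 2 \<and> odd (fw (act (p1 (p2 m)) q r) div 2 div 2))
           else p2 m \<in> tr 4 S)))}"

lemma rf_if_eq: "rf a \<Longrightarrow> rf b \<Longrightarrow> rf f \<Longrightarrow> rf g \<Longrightarrow> rf (\<lambda>n. if a n = b n then f n else g n)"
proof -
  assume r: "rf a" "rf b" "rf f" "rf g"
  have "rf (\<lambda>n. if (a n - b n) + (b n - a n) = 0 then f n else g n)" by (intro rf_if0 rf_plus rf_minus r)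
  moreover have "(a n - b n) + (b n - a n) = 0 \<longleftrightarrow> a n = b n" for n by auto
  ultimately show ?thesis by simp
qed

lemma rf_f: "rf a \<Longrightarrow> rf (\<lambda>n. fq (a n))" "rf a \<Longrightarrow> rf (\<lambda>n. fw (a n))" "rf a \<Longrightarrow> rf (\<lambda>n. fm (a n))"
  unfolding fq_def fw_def fm_def by (intro rf_p1 rf_p2 rf_minus rf_const; assumption)+

lemma cop_ust: "rf a \<Longrightarrow> rf b \<Longrightarrow> cop (\<lambda>S n. ust S (a n) (b n))"
  unfolding ust_def by (intro cop_intros rf_intros)
lemma cop_uhd: "rf a \<Longrightarrow> rf b \<Longrightarrow> cop (\<lambda>S n. uhd S (a n) (b n))"
  unfolding uhd_def by (intro cop_intros rf_intros)
lemma cop_urd: "rf a \<Longrightarrow> rf b \<Longrightarrow> rf c \<Longrightarrow> cop (\<lambda>S n. urd S (a n) (b n) (c n))"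
  unfolding urd_def by (intro cop_intros rf_intros)

lemma lc_US: "lc US"
proof -
  have "lc (\<lambda>S. {m. m \<in> US S})" unfolding US_def mem_Collect_eq
    by (rule lc_cop) (intro cop_ust cop_uhd cop_urd cop_intros rf_act rf_f rf_if_eq rf_intros)
  then show ?thesis by simp
qed

definition Uinv :: "nat set \<Rightarrow> nat set \<Rightarrow> (nat \<Rightarrow> cfg) \<Rightarrow> bool" where
  "Uinv z S C \<longleftrightarrow> tr 1 S = z \<and> (\<forall>e. (\<forall>q. ust S e q \<longleftrightarrow> q = st (C e)) \<and> (\<forall>h. uhd S e h \<longleftrightarrow> h = hd (C e)) \<and>
     (\<forall>n. (pr e (pr 0 n) \<in> tr 4 S \<longleftrightarrow> tin (C e) n) \<and> (pr e (pr 1 n) \<in> tr 4 S \<longleftrightarrow> tsc (C e) n) \<and> (pr e (pr 2 n) \<in> tr 4 S \<longleftrightarrow> tout (C e) n)))"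

lemma four_bits:
  "(odd r \<longleftrightarrow> a) \<and> (odd (r div 2) \<longleftrightarrow> b) \<and> (odd (r div 2 div 2) \<longleftrightarrow> c) \<and> (odd (r div 2 div 2 div 2) \<longleftrightarrow> d) \<and> r div 2 div 2 div 2 div 2 = 0
   \<longleftrightarrow> r = (if a then 1 else 0) + (if b then 2 else 0) + (if c then 4 else 0) + (if d then (8::nat) else 0)" (is "?L \<longleftrightarrow> ?R")
proof
  assume L: ?L
  have k: "k = 2 * (k div 2) + (if odd k then 1 else 0)" for k :: nat by presburger
  have "r = ((if a then 1 else 0) + (if b then 2 else 0) + (if c then 4 else 0) + (if d then 8 else 0) :: nat)"
    if "r = 2 * s1 + (if a then 1 else 0)" "s1 = 2 * s2 + (if b then 1 else 0)" "s2 = 2 * s3 + (if c then 1 else 0)"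
      "s3 = 2 * s4 + (if d then 1 else 0)" "s4 = 0" for s1 s2 s3 s4 :: nat
    using that by simp
  from this[of "r div 2" "r div 2 div 2" "r div 2 div 2 div 2" "r div 2 div 2 div 2 div 2"] show ?R
    using k[of r] k[of "r div 2"] k[of "r div 2 div 2"] k[of "r div 2 div 2 div 2"] L by (simp only: if_True if_False)
next
  assume ?R then show ?L by (cases a; cases b; cases c; cases d) simp_all
qed

lemma Uinv_step:
  assumes inv: "Uinv z S C" shows "Uinv z (US S) (\<lambda>e. step (P e) z (C e))"
proof -
  have tz: "tr 1 S = z" and u: "ust S e q \<longleftrightarrow> q = st (C e)" "uhd S e h \<longleftrightarrow> h = hd (C e)"
    "pr e (pr 0 n) \<in> tr 4 S \<longleftrightarrow> tin (C e) n" "pr e (pr 1 n) \<in> tr 4 S \<longleftrightarrow> tsc (C e) n" "pr e (pr 2 n) \<in> tr 4 S \<longleftrightarrow> tout (C e) n" for e q h n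
    using inv unfolding Uinv_def by blast+
  have ur: "urd S e (hd (C e)) r \<longleftrightarrow> r = readcode z (C e)" for e r
    unfolding urd_def four_bits readcode_def tz u ..
  have ex: "(\<exists>q h r. ust S e q \<and> uhd S e h \<and> urd S e h r \<and> \<Phi> q h r) \<longleftrightarrow> \<Phi> (st (C e)) (hd (C e)) (readcode z (C e))" for e \<Phi>
    unfolding u(1,2) by (simp add: ur)
  define A where "A e = act e (st (C e)) (readcode z (C e))" for e
  have fl: "1 \<in> tr 0 (US S) \<longleftrightarrow> \<not> (1 \<in> tr 0 S \<and> 2 \<notin> tr 0 S)" "2 \<in> tr 0 (US S) \<longleftrightarrow> (1 \<in> tr 0 S \<and> 2 \<notin> tr 0 S)"
    unfolding US_def tr_Collect by simp_all
  have s2: "pr e q \<in> tr 2 (US S) \<longleftrightarrow> q = (if (if st (C e) = 1 then 0 else A e) = 0 then 1 else fq (A e))" for e q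
    unfolding US_def tr_Collect mem_Collect_eq A_def using ex[of e] by simp
  have s3: "pr e h \<in> tr 3 (US S) \<longleftrightarrow> h = (if (if st (C e) = 1 then 0 else A e) = 0 then hd (C e) else if fm (A e) = 0 then hd (C e) - 1 else Suc (hd (C e)))" for e h
    unfolding US_def tr_Collect mem_Collect_eq A_def using ex[of e] by simp
  have s4: "pr e (pr j n) \<in> tr 4 (US S) \<longleftrightarrow> (if st (C e) \<noteq> 1 \<and> A e \<noteq> 0 \<and> n = hd (C e)
      then (j = 0 \<and> odd (fw (A e))) \<or> (j = 1 \<and> odd (fw (A e) div 2)) \<or> (j = 2 \<and> odd (fw (A e) div 2 div 2)) else pr e (pr j n) \<in> tr 4 S)" for e j n
    unfolding US_def tr_Collect mem_Collect_eq A_def using ex[of e] by simp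
  have "tr 1 (US S) = z" unfolding tz[symmetric] by (auto simp: US_def)
  moreover have "ust (US S) e q \<longleftrightarrow> q = st (step (P e) z (C e))" for e q
    unfolding ust_def fl step_act A_def[symmetric] using s2[of e q] by auto
  moreover have "uhd (US S) e h \<longleftrightarrow> h = hd (step (P e) z (C e))" for e h
    unfolding uhd_def fl step_act A_def[symmetric] using s3[of e h] by auto
  moreover have "(pr e (pr 0 n) \<in> tr 4 (US S) \<longleftrightarrow> tin (step (P e) z (C e)) n) \<and> (pr e (pr 1 n) \<in> tr 4 (US S) \<longleftrightarrow> tsc (step (P e) z (C e)) n)
     \<and> (pr e (pr 2 n) \<in> tr 4 (US S) \<longleftrightarrow> tout (step (P e) z (C e)) n)" for e n
    unfolding s4 step_act A_def[symmetric] u by (auto simp: div_mult2_eq[symmetric])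
  ultimately show ?thesis unfolding Uinv_def by blast
qed

lemma US_flags_lim:
  assumes t: "tlim t" shows "1 \<in> tr 0 (arun US S t)" "2 \<in> tr 0 (arun US S t)"
proof -
  have fl: "1 \<in> tr 0 (US S) \<longleftrightarrow> \<not> (1 \<in> tr 0 S \<and> 2 \<notin> tr 0 S)" "2 \<in> tr 0 (US S) \<longleftrightarrow> (1 \<in> tr 0 S \<and> 2 \<notin> tr 0 S)" for S
    unfolding US_def tr_Collect by simp_all
  have two: "\<exists>d. b \<le> d \<and> d < t \<and> pr 0 i \<in> arun US S d" if b: "b < t" and i: "i = 1 \<or> i = 2" for b i
  proof -
    have b1: "tsuc b < t" using tlimD[OF t b] .
    have b2: "tsuc (tsuc b) < t" using tlimD[OF t b1] .
    have "pr 0 i \<in> arun US S (tsuc b) \<or> pr 0 i \<in> arun US S (tsuc (tsuc b))"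
      using i fl[of "arun US S b"] fl[of "arun US S (tsuc b)"] by auto
    moreover have "b \<le> tsuc b" "b \<le> tsuc (tsuc b)" using le_tsuc[of b] order_trans[OF le_tsuc[of b] le_tsuc[of "tsuc b"]] by simp_all
    ultimately show ?thesis using b1 b2 by blast
  qed
  show "1 \<in> tr 0 (arun US S t)" "2 \<in> tr 0 (arun US S t)"
    unfolding in_tr arun_tlim[OF t] by (rule in_LimI, rule two, assumption, simp)+
qed

lemma US_sim: "Uinv z (arun US (ec z) t) (\<lambda>e. crun (P e) z {} t)"
proof (induction t rule: time_induct)
  case zero
  show ?case unfolding Uinv_def by (simp add: ust_def uhd_def init_cfg_def)
next
  case (suc t)
  then show ?case using Uinv_step by simp
next
  case (lim t)
  have IH: "tr 1 (arun US (ec z) u) = z"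
    "pr e (pr 0 n) \<in> tr 4 (arun US (ec z) u) \<longleftrightarrow> tin (crun (P e) z {} u) n" "pr e (pr 1 n) \<in> tr 4 (arun US (ec z) u) \<longleftrightarrow> tsc (crun (P e) z {} u) n"
    "pr e (pr 2 n) \<in> tr 4 (arun US (ec z) u) \<longleftrightarrow> tout (crun (P e) z {} u) n" if u: "u < t" for u e n
    using lim(2)[OF u] unfolding Uinv_def by blast+
  have trL: "tr i (arun US (ec z) t) = Lim (\<lambda>u. tr i (arun US (ec z) u)) t" for i
    unfolding tr_def by (subst arun_tlim[OF lim(1)]) (rule Lim_vimage)
  have "tr 1 (arun US (ec z) t) = z"
  proof (rule set_eqI)
    fix n show "n \<in> tr 1 (arun US (ec z) t) \<longleftrightarrow> n \<in> z"
      unfolding trL by (rule Lim_eventually[OF tlim_pos[OF lim(1)]]) (use IH(1) in simp)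
  qed
  moreover have cell: "pr e (pr j n) \<in> tr 4 (arun US (ec z) t) \<longleftrightarrow> n \<in> Lim (\<lambda>u. Collect (v (crun (P e) z {} u))) t"
    if v: "\<And>u n. u < t \<Longrightarrow> pr e (pr j n) \<in> tr 4 (arun US (ec z) u) \<longleftrightarrow> v (crun (P e) z {} u) n" for e j n v
  proof -
    have "pr e (pr j n) \<in> tr 4 (arun US (ec z) t) \<longleftrightarrow> n \<in> {n. pr e (pr j n) \<in> Lim (\<lambda>u. tr 4 (arun US (ec z) u)) t}"
      unfolding trL by simp
    also have "{n. pr e (pr j n) \<in> Lim (\<lambda>u. tr 4 (arun US (ec z) u)) t} = Lim (\<lambda>u. {n. pr e (pr j n) \<in> tr 4 (arun US (ec z) u)}) t"
      by (rule Lim_vimage)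
    also have "\<dots> = Lim (\<lambda>u. Collect (v (crun (P e) z {} u))) t"
      by (rule Lim_cong) (use v in blast)
    finally show ?thesis .
  qed
  ultimately show ?case unfolding Uinv_def
    using US_flags_lim[OF lim(1), of "ec z"] IH(2-4)
    by (simp add: ust_def uhd_def crun_tlim[OF lim(1)] clim_def cell[where v = tin] cell[where v = tsc] cell[where v = tout] del: in_tr)
qed

section \<open>Tracks that evolve by themselves, and while loops\<close>

lemma arun_tr:
  assumes "\<And>s. s < t \<Longrightarrow> tr i (G (arun G X s)) = G' (tr i (arun G X s))"
  shows "tr i (arun G X t) = arun G' (tr i X) t"
  using assms
proof (induction t rule: time_induct)
  case (suc t)
  have "tr i (arun G X t) = arun G' (tr i X) t" by (rule suc.IH) (use suc.prems in \<open>simp add: less_tsuc_iff\<close>)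
  then show ?case using suc.prems[OF less_tsuc] by simp
next
  case (lim t)
  have "tr i (arun G X t) = Lim (\<lambda>u. tr i (arun G X u)) t" unfolding tr_def by (subst arun_tlim[OF lim(1)]) (rule Lim_vimage)
  also have "\<dots> = Lim (arun G' (tr i X)) t"
    by (rule Lim_cong) (rule lim(2), assumption, rule lim(3), erule order.strict_trans)
  finally show ?case unfolding arun_tlim[OF lim(1)] .
qed simp

lemma arun_id: "arun (\<lambda>S. S) X t = X"
proof (induction t rule: time_induct)
  case (lim t)
  show ?case unfolding arun_tlim[OF lim(1)]
    by (rule set_eqI, rule Lim_eventually[OF tlim_pos[OF lim(1)]]) (simp add: lim(2))
qed simp_all

lemma arun_tr_const: "(\<And>s. s < t \<Longrightarrow> tr i (G (arun G X s)) = tr i (arun G X s)) \<Longrightarrow> tr i (arun G X t) = tr i X"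
  by (subst arun_tr[where G' = "\<lambda>S. S"]) (auto simp: arun_id)

text \<open>For a track that only accumulates, the limit superior is the union.\<close>

lemma arun_union:
  assumes "tr i X = {}" "\<And>s. s < t \<Longrightarrow> tr i (G (arun G X s)) = tr i (arun G X s) \<union> B s"
  shows "tr i (arun G X t) = (\<Union>s\<in>{..<t}. B s)"
  using assms(2)
proof (induction t rule: time_induct)
  case zero
  then show ?case using assms(1) by (auto simp: not_less_tz)
next
  case (suc t)
  have "tr i (arun G X t) = (\<Union>s\<in>{..<t}. B s)" by (rule suc.IH) (use suc.prems in \<open>simp add: less_tsuc_iff\<close>)
  moreover have "{..<tsuc t} = insert t {..<t}" by (auto simp: less_tsuc_iff)
  ultimately show ?case using suc.prems[OF less_tsuc] by auto
next
  case (lim t)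
  have "tr i (arun G X t) = Lim (\<lambda>u. tr i (arun G X u)) t" unfolding tr_def by (subst arun_tlim[OF lim(1)]) (rule Lim_vimage)
  also have "\<dots> = Lim (\<lambda>u. \<Union>s\<in>{..<u}. B s) t"
    by (rule Lim_cong) (rule lim(2), assumption, rule lim(3), erule order.strict_trans)
  also have "\<dots> = (\<Union>s\<in>{..<t}. B s)"
  proof (intro set_eqI iffI)
    fix n assume "n \<in> Lim (\<lambda>u. \<Union>s\<in>{..<u}. B s) t"
    then obtain d where "d < t" "n \<in> (\<Union>s\<in>{..<d}. B s)" by (rule in_LimD[OF _ tlim_pos[OF lim(1)]])
    then show "n \<in> (\<Union>s\<in>{..<t}. B s)" by (auto intro: order.strict_trans)
  next
    fix n assume "n \<in> (\<Union>s\<in>{..<t}. B s)"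
    then obtain s where s: "s < t" "n \<in> B s" by auto
    show "n \<in> Lim (\<lambda>u. \<Union>s\<in>{..<u}. B s) t"
    proof (rule in_LimI)
      fix b assume b: "b < t"
      have "max b (tsuc s) < t" using b tlimD[OF lim(1) s(1)] by simp
      moreover have "s < max b (tsuc s)" using less_tsuc[of s] by (simp add: less_max_iff_disj)
      ultimately show "\<exists>d. b \<le> d \<and> d < t \<and> n \<in> (\<Union>s\<in>{..<d}. B s)" using s(2) by (intro exI[of _ "max b (tsuc s)"]) auto
    qed
  qed
  finally show ?case .
qed

lemma lc_ident: "lc (\<lambda>X. X)" by (rule lc_rop[OF rop_id])

lemma lc_const_empty: "lc (\<lambda>X. {})"
  using lc_cop[OF cop_const[of False]] by simp

lemma lc_of_cop: "cop (\<lambda>X n. n \<in> F X) \<Longrightarrow> lc F" unfolding cop_def by simp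

lemma lc_then: "lcd D F \<Longrightarrow> lc F' \<Longrightarrow> lcd D (\<lambda>X. F' (F X))"
  using lc_compose[of D F UNIV F'] by simp

lemma lc_tr: "lcd D F \<Longrightarrow> lcd D (\<lambda>X. tr i (F X))" by (rule lc_then[OF _ lc_rop[OF rop_tr1]])

lemma lc_ec: "lcd D F \<Longrightarrow> lcd D (\<lambda>X. ec (F X))"
proof -
  assume a: "lcd D F"
  have "lc ec" by (rule lc_of_cop) (unfold ec_def mem_Collect_eq, intro cop_intros rf_intros)
  then show ?thesis by (rule lc_then[OF a])
qed

lemmas cop_rules = cop_const cop_eq cop_le cop_less cop_odd cop_not cop_and cop_or cop_imp cop_iff cop_if cop_ex cop_all cop_mem_lc

definition tk :: "nat set \<Rightarrow> nat set \<Rightarrow> nat set \<Rightarrow> nat set \<Rightarrow> nat set \<Rightarrow> nat set \<Rightarrow> nat set" where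
  "tk A B C D E F = {m. p1 m = 1 \<and> p2 m \<in> A \<or> p1 m = 2 \<and> p2 m \<in> B \<or> p1 m = 3 \<and> p2 m \<in> C \<or> p1 m = 4 \<and> p2 m \<in> D
     \<or> p1 m = 5 \<and> p2 m \<in> E \<or> p1 m = 6 \<and> p2 m \<in> F}"

lemma tr_tk [simp]: "tr (Suc 0) (tk A B C D E F) = A" "tr 2 (tk A B C D E F) = B" "tr 3 (tk A B C D E F) = C"
  "tr 4 (tk A B C D E F) = D" "tr 5 (tk A B C D E F) = E" "tr 6 (tk A B C D E F) = F" "0 \<notin> tk A B C D E F"
  unfolding tk_def tr_def by simp_all

lemma lc_tk: "lc A \<Longrightarrow> lc B \<Longrightarrow> lc C \<Longrightarrow> lc D \<Longrightarrow> lc E \<Longrightarrow> lc F \<Longrightarrow> lc (\<lambda>X. tk (A X) (B X) (C X) (D X) (E X) (F X))"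
  unfolding tk_def by (rule lc_cop) (intro cop_rules rf_intros)

lemmas lc_rules = lc_tk lc_tr lc_ec lc_ident lc_const_empty

lemma arun_tk_nonzero: assumes "\<And>S. 0 \<notin> G S" "0 \<notin> X" shows "0 \<notin> arun G X t"
proof (induction t rule: time_induct)
  case (lim t)
  then show ?case unfolding arun_tlim[OF lim(1)] using tlim_pos[OF lim(1)] by (auto elim: in_LimD)
qed (use assms in simp_all)

lemma tr_empty [simp]: "tr i {} = {}" unfolding tr_def by simp

text \<open>The state is moved to track 1, so that 0 is free to signal that \<open>H\<close> holds.
  Since \<open>H\<close> is tested before each step and the state is then kept, the loop ends with
  the state of the least time satisfying \<open>H\<close>, which may be a limit.\<close>

lemma lc_while:
  assumes "lc G" "cop (\<lambda>S n. H S)" "lcd D J" "\<And>X. X \<in> D \<Longrightarrow> \<exists>t. H (arun G (J X) t)"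
  shows "lcd D (\<lambda>X. arun G (J X) (LEAST t. H (arun G (J X) t)))"
proof -
  define F where "F S = {m. m = 0 \<and> H (tr 1 S) \<or> p1 m = 1 \<and> (if H (tr 1 S) then p2 m \<in> tr 1 S else p2 m \<in> G (tr 1 S))}" for S
  have H1: "cop (\<lambda>S n. H (tr 1 S))" by (rule cop_after[OF lc_tr[OF lc_ident] assms(2)])
  have "lc F" unfolding F_def
    by (rule lc_cop) (intro H1 cop_rules lc_then[OF _ assms(1)] lc_rules rf_intros)
  define T where "T Y = (LEAST t. H (arun G Y t))" for Y
  define L where "L Z = {m. m = 0 \<or> p1 m = 1 \<and> p2 m \<in> arun G (tr 1 Z) (T (tr 1 Z))}" for Z
  define D' where "D' = {Y. \<exists>t. H (arun G Y t)}"
  have "lcd {Z. \<exists>Y\<in>D'. Z = ec Y} L"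
  proof (rule lc_loop[OF \<open>lc F\<close>])
    fix Z assume "Z \<in> {Z. \<exists>Y\<in>D'. Z = ec Y}"
    then obtain Y t0 where Y: "Z = ec Y" "H (arun G Y t0)" unfolding D'_def by blast
    have HT: "H (arun G Y (T Y))" unfolding T_def by (rule LeastI[of _ t0]) (rule Y(2))
    have nH: "\<not> H (arun G Y t)" if "t < T Y" for t using that unfolding T_def by (rule not_less_Least)
    have e: "arun F Z t = ec (arun G Y t)" if "t \<le> T Y" for t
      using that
    proof (induction t rule: time_induct)
      case zero
      then show ?case using Y(1) by simp
    next
      case (suc t)
      then have tT: "t < T Y" by (simp add: tsuc_le_iff)
      have IH: "arun F Z t = ec (arun G Y t)" by (rule suc.IH) (rule less_imp_le[OF tT])
      then show ?case unfolding arun_tsuc IH using nH[OF tT] by (simp add: F_def) (simp add: ec_def)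
    next
      case (lim t)
      have "arun F Z t = Lim (\<lambda>u. ec (arun G Y u)) t" unfolding arun_tlim[OF lim(1)]
        by (rule Lim_cong) (rule lim(2), assumption, use lim(3) in simp)
      also have "\<dots> = ec (Lim (arun G Y) t)"
        using tlim_pos[OF lim(1)] unfolding Lim_def ec_def by auto
      finally show ?case unfolding arun_tlim[OF lim(1)] .
    qed
    have f: "arun F Z (tsuc (T Y)) = L Z"
      unfolding arun_tsuc e[OF order_refl] using HT by (simp add: F_def L_def Y(1))
    show "\<exists>t. hlt F Z t \<and> arun F Z t = L Z"
      by (rule exI[of _ "tsuc (T Y)"], unfold hlt_def f) (simp add: L_def less_tsuc_iff e)
  qed
  then have "lcd D (\<lambda>X. L (ec (J X)))"
    by (rule lc_compose[OF lc_ec[OF assms(3)]]) (use assms(4) D'_def in blast)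
  from lc_tr[OF this, of 1] show ?thesis unfolding L_def T_def by (simp add: tr_Collect)
qed

section \<open>Ordinals of relations coded by reals\<close>

text \<open>A real \<open>c\<close> is read as the relation \<open>pr a b \<in> c\<close>. The
  stages \<open>ws\<close> build up its well-founded part, and \<open>Ord\<close> is the closure
  ordinal of this process, which makes sense for every real.\<close>

definition acc :: "nat set \<Rightarrow> nat set \<Rightarrow> nat set" where "acc c W = {b. \<forall>a. pr a b \<in> c \<longrightarrow> a \<in> W}"
definition ws :: "nat set \<Rightarrow> time \<Rightarrow> nat set" where "ws c t = arun (acc c) {} t"
definition Ord :: "nat set \<Rightarrow> time" where "Ord c = (LEAST t. ws c (tsuc t) = ws c t)"

lemma acc_mono: "W \<subseteq> W' \<Longrightarrow> acc c W \<subseteq> acc c W'" unfolding acc_def by auto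
lemma in_acc: "b \<in> acc c W \<longleftrightarrow> (\<forall>a. pr a b \<in> c \<longrightarrow> a \<in> W)" unfolding acc_def by simp

lemma lc_acc: "lc C \<Longrightarrow> lc W \<Longrightarrow> lc (\<lambda>X. acc (C X) (W X))"
  unfolding acc_def by (rule lc_cop) (intro cop_rules rf_intros)

lemma ws_tz [simp]: "ws c tz = {}" unfolding ws_def by simp
lemma ws_tsuc: "ws c (tsuc t) = acc c (ws c t)" unfolding ws_def by simp

lemma ws_increasing: "(\<forall>s\<le>t. ws c s \<subseteq> ws c t) \<and> ws c t \<subseteq> acc c (ws c t)"
proof (induction t rule: time_induct)
  case zero
  then show ?case by (simp add: le_tz_iff)
next
  case (suc t)
  have "ws c s \<subseteq> ws c (tsuc t)" if s: "s \<le> tsuc t" for s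
  proof (cases "s = tsuc t")
    case False
    then have "s < tsuc t" using s by simp
    then have "s \<le> t" unfolding less_tsuc_iff .
    then show ?thesis using suc unfolding ws_tsuc by blast
  qed simp
  moreover have "acc c (ws c t) \<subseteq> acc c (acc c (ws c t))" using suc by (intro acc_mono) simp
  ultimately show ?case unfolding ws_tsuc by blast
next
  case (lim t)
  have wl: "ws c t = Lim (ws c) t" unfolding ws_def[abs_def] by (rule arun_tlim[OF lim(1)])
  have a: "ws c s \<subseteq> ws c t" if s: "s \<le> t" for s
  proof (cases "s = t")
    case False
    then have st: "s < t" using s by simp
    show ?thesis
    proof
      fix n assume n: "n \<in> ws c s"
      show "n \<in> ws c t" unfolding wl
      proof (rule in_LimI)
        fix b assume b: "b < t"
        have m: "max b s < t" using b st by simp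
        then have "ws c s \<subseteq> ws c (max b s)" using lim(2)[OF m] by simp
        then show "\<exists>d. b \<le> d \<and> d < t \<and> n \<in> ws c d" using m n by (intro exI[of _ "max b s"]) auto
      qed
    qed
  qed simp
  moreover have "ws c t \<subseteq> acc c (ws c t)"
  proof
    fix n assume "n \<in> ws c t"
    then obtain d where d: "d < t" "n \<in> ws c d" unfolding wl by (rule in_LimD[OF _ tlim_pos[OF lim(1)]])
    then have "n \<in> acc c (ws c d)" using lim(2) by blast
    then show "n \<in> acc c (ws c t)" using acc_mono[OF a[OF less_imp_le[OF d(1)]], of c] by blast
  qed
  ultimately show ?case by blast
qed

lemma ws_mono: "s \<le> t \<Longrightarrow> ws c s \<subseteq> ws c t" using ws_increasing[of t c] by blast

lemma ws_stable: "ws c (tsuc t) = ws c t \<Longrightarrow> t \<le> u \<Longrightarrow> ws c u = ws c t"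
proof (induction u rule: time_induct)
  case zero
  then show ?case by (simp add: le_tz_iff)
next
  case (suc u)
  show ?case
  proof (cases "t = tsuc u")
    case False
    then have "t < tsuc u" using suc.prems(2) by simp
    then have "t \<le> u" unfolding less_tsuc_iff .
    then have "ws c u = ws c t" using suc.IH suc.prems(1) by blast
    then have "ws c (tsuc u) = ws c (tsuc t)" unfolding ws_tsuc by simp
    then show ?thesis using suc.prems(1) by simp
  qed simp
next
  case (lim u)
  show ?case
  proof (cases "t = u")
    case False
    then have tu: "t < u" using lim(4) by simp
    show ?thesis
    proof
      show "ws c t \<subseteq> ws c u" by (rule ws_mono[OF lim(4)])
      show "ws c u \<subseteq> ws c t"
      proof
        fix n assume "n \<in> ws c u"
        then have "n \<in> Lim (ws c) u" unfolding ws_def[abs_def] by (simp add: arun_tlim[OF lim(1)])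
        then obtain d where "t \<le> d" "d < u" "n \<in> ws c d" by (rule in_LimD[OF _ tu])
        then show "n \<in> ws c t" using lim(2)[of d] lim(3) by simp
      qed
    qed
  qed simp
qed

text \<open>Each number enters at a single stage, and countably many times are bounded.\<close>

lemma ws_closes: "\<exists>t. ws c (tsuc t) = ws c t"
proof (rule ccontr)
  assume "\<not> ?thesis"
  then have ne: "ws c (tsuc t) \<noteq> ws c t" for t by blast
  obtain b where b: "\<And>n. (SOME t. n \<in> ws c (tsuc t) \<and> n \<notin> ws c t) < b" using time_bounded_nat by blast
  obtain n where n: "n \<in> ws c (tsuc b)" "n \<notin> ws c b" using ne[of b] ws_mono[OF le_tsuc[of b], of c] by blast
  define t where "t = (SOME t. n \<in> ws c (tsuc t) \<and> n \<notin> ws c t)"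
  have "n \<in> ws c (tsuc t) \<and> n \<notin> ws c t" unfolding t_def by (rule someI[of _ b]) (simp add: n)
  moreover have "tsuc t \<le> b" using b[of n] unfolding t_def by (simp add: tsuc_le_iff)
  ultimately show False using ws_mono[of "tsuc t" b c] n(2) by blast
qed

lemma ws_Ord: "ws c (tsuc (Ord c)) = ws c (Ord c)"
  unfolding Ord_def by (rule LeastI_ex[OF ws_closes])

lemma Ord_le_iff: "Ord c \<le> t \<longleftrightarrow> ws c (tsuc t) = ws c t"
proof
  assume "Ord c \<le> t"
  then show "ws c (tsuc t) = ws c t"
    using ws_stable[OF ws_Ord, of c t] ws_stable[OF ws_Ord, of c "tsuc t"] order_trans[OF _ le_tsuc] by simp
qed (unfold Ord_def, rule Least_le)

lemma Ord_le_iff_acc: "Ord c \<le> t \<longleftrightarrow> acc c (ws c t) = ws c t" unfolding Ord_le_iff ws_tsuc ..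

definition wsi :: "nat set \<Rightarrow> nat set" where "wsi c = ws c (Ord c)"

lemma ws_wsi: "Ord c \<le> t \<Longrightarrow> ws c t = wsi c" unfolding wsi_def by (rule ws_stable[OF ws_Ord])
lemma ws_sub_wsi: "ws c t \<subseteq> wsi c"
  using ws_mono[of t "Ord c" c] ws_wsi[of c t] by (cases "t \<le> Ord c") (auto simp: wsi_def)

lemma Ord_eqI: "ws c t = wsi c \<Longrightarrow> Ord c \<le> t"
  unfolding Ord_le_iff_acc wsi_def using ws_Ord[of c] by (simp add: ws_tsuc)

lemma Ord_as_least: "Ord c = (LEAST t. acc c (ws c t) = ws c t)" unfolding Ord_def ws_tsuc ..

lemma lc_wsi: "lc wsi"
proof -
  define G where "G S = tk (tr 1 S) (acc (tr 1 S) (tr 2 S)) {} {} {} {}" for S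
  define H where "H S \<longleftrightarrow> (\<forall>n. n \<in> acc (tr 1 S) (tr 2 S) \<longleftrightarrow> n \<in> tr 2 S)" for S
  have 1: "lc G" unfolding G_def by (intro lc_acc lc_rules)
  have 2: "cop (\<lambda>S n. H S)" unfolding H_def by (intro cop_rules lc_acc lc_rules rf_intros)
  have "tr 1 (arun G (ec c) t) = tr 1 (ec c)" for c t by (rule arun_tr_const) (simp add: G_def)
  then have t1: "tr 1 (arun G (ec c) t) = c" for c t by simp
  have "tr 2 (arun G (ec c) t) = arun (acc c) (tr 2 (ec c)) t" for c t
    by (rule arun_tr) (unfold G_def tr_tk, unfold G_def[symmetric] t1, rule refl)
  moreover have "tr 2 (ec c) = {}" for c unfolding tr_def by simp
  ultimately have t2: "tr 2 (arun G (ec c) t) = ws c t" for c t unfolding ws_def by simp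
  have H: "H (arun G (ec c) t) \<longleftrightarrow> acc c (ws c t) = ws c t" for c t unfolding H_def t1 t2 by blast
  have "lc (\<lambda>c. arun G (ec c) (LEAST t. H (arun G (ec c) t)))"
    by (rule lc_while[OF 1 2 lc_ec[OF lc_ident]]) (unfold H Ord_le_iff_acc[symmetric], blast)
  from lc_tr[OF this, of 2] show ?thesis unfolding t2 H Ord_as_least[symmetric] wsi_def[symmetric] .
qed

text \<open>The old points are shifted by \<open>Suc\<close>, and the new point 0 is put above the
  whole well-founded part; it enters one stage after the old relation has closed.\<close>

definition osuc :: "nat set \<Rightarrow> nat set" where
  "osuc c = {m. 0 < p1 m \<and> (if p2 m = 0 then p1 m - 1 \<in> wsi c else pr (p1 m - 1) (p2 m - 1) \<in> c)}"

lemma lc_osuc: "lc osuc"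
  unfolding osuc_def by (rule lc_cop) (intro cop_rules lc_wsi lc_rules rf_intros)

lemma ws_osuc: "{b. Suc b \<in> ws (osuc c) t} = ws c t"
proof (induction t rule: time_induct)
  case (suc t)
  have "Suc b \<in> acc (osuc c) (ws (osuc c) t) \<longleftrightarrow> b \<in> acc c (ws c t)" for b
  proof -
    have "pr a (Suc b) \<in> osuc c \<longleftrightarrow> (\<exists>a'. a = Suc a' \<and> pr a' b \<in> c)" for a by (cases a) (simp_all add: osuc_def)
    then show ?thesis unfolding in_acc suc[symmetric] by auto
  qed
  then show ?case unfolding ws_tsuc by blast
next
  case (lim t)
  have "{b. Suc b \<in> ws (osuc c) t} = Lim (\<lambda>u. {b. Suc b \<in> ws (osuc c) u}) t"
    unfolding ws_def by (subst arun_tlim[OF lim(1)]) (rule Lim_vimage)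
  also have "\<dots> = Lim (ws c) t" by (rule Lim_cong) (rule lim(2))
  finally show ?case unfolding ws_def[abs_def] by (simp add: arun_tlim[OF lim(1)])
qed simp

lemma zero_in_ws_osuc: "0 \<in> ws (osuc c) t \<longleftrightarrow> Ord c < t"
proof (induction t rule: time_induct)
  case (suc t)
  have "0 \<in> acc (osuc c) (ws (osuc c) t) \<longleftrightarrow> wsi c \<subseteq> ws c t"
  proof -
    have "pr a 0 \<in> osuc c \<longleftrightarrow> (\<exists>a'. a = Suc a' \<and> a' \<in> wsi c)" for a by (cases a) (simp_all add: osuc_def)
    then show ?thesis unfolding in_acc ws_osuc[of c t, symmetric] by auto
  qed
  also have "\<dots> \<longleftrightarrow> Ord c \<le> t" using ws_wsi[of c t] Ord_eqI[of c t] ws_sub_wsi[of c t] by blast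
  finally show ?case unfolding ws_tsuc less_tsuc_iff .
next
  case (lim t)
  have wl: "ws (osuc c) t = Lim (ws (osuc c)) t" unfolding ws_def[abs_def] by (rule arun_tlim[OF lim(1)])
  show ?case
  proof
    assume "0 \<in> ws (osuc c) t"
    then obtain d where "d < t" "0 \<in> ws (osuc c) d" unfolding wl by (rule in_LimD[OF _ tlim_pos[OF lim(1)]])
    then show "Ord c < t" using lim(2) order.strict_trans by blast
  next
    assume "Ord c < t"
    then have d: "tsuc (Ord c) < t" by (rule tlimD[OF lim(1)])
    then have "0 \<in> ws (osuc c) (tsuc (Ord c))" using lim(2)[OF d] less_tsuc by blast
    then show "0 \<in> ws (osuc c) t" using ws_mono[OF less_imp_le[OF d]] by blast
  qed
qed simp

lemma Ord_osuc: "Ord c < Ord (osuc c)"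
proof (rule ccontr)
  assume "\<not> ?thesis"
  then have "ws (osuc c) (tsuc (Ord c)) = ws (osuc c) (Ord c)" unfolding not_less Ord_le_iff .
  then show False using zero_in_ws_osuc[of c "tsuc (Ord c)"] zero_in_ws_osuc[of c "Ord c"] less_tsuc by simp
qed

section \<open>The ordinals written by all programs\<close>

text \<open>In the universal state, \<open>pr e (pr 2 n)\<close> on track 4 is output cell
  \<open>n\<close> of program \<open>e\<close>. The cell is chosen so that a program from
  \<open>iteration_displayed\<close> exhibits track 1 of the iterated operator. Below,
  \<open>qq\<close> is the disjoint sum of the relations of all rows with a point on top, so its
  ordinal exceeds that of every row.\<close>

definition row :: "nat \<Rightarrow> nat set \<Rightarrow> nat set" where
  "row e S = {m. pr e (pr 2 (Suc (pr 2 (pr 1 m)))) \<in> tr 4 S}"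
definition qq :: "nat set \<Rightarrow> nat set" where
  "qq S = osuc {k. p1 (p1 k) = p1 (p2 k) \<and> pr (p2 (p1 k)) (p2 (p2 k)) \<in> row (p1 (p1 k)) S}"

lemma lc_qq: "lc qq"
  unfolding qq_def by (rule lc_then[OF _ lc_osuc], rule lc_cop) (unfold row_def mem_Collect_eq, intro cop_rules lc_rules rf_intros)

lemma Ord_row: "Ord (row e S) < Ord (qq S)"
proof -
  define v where "v = {k. p1 (p1 k) = p1 (p2 k) \<and> pr (p2 (p1 k)) (p2 (p2 k)) \<in> row (p1 (p1 k)) S}"
  have "{b. pr e b \<in> ws v t} = ws (row e S) t" for t
  proof (induction t rule: time_induct)
    case (suc t)
    have "pr e b \<in> acc v (ws v t) \<longleftrightarrow> b \<in> acc (row e S) (ws (row e S) t)" for b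
    proof -
      have "pr a (pr e b) \<in> v \<longleftrightarrow> (\<exists>a'. a = pr e a' \<and> pr a' b \<in> row e S)" for a
        unfolding v_def by (auto intro!: exI[of _ "p2 a"])
      then show ?thesis unfolding in_acc suc[symmetric] by auto
    qed
    then show ?case unfolding ws_tsuc by blast
  next
    case (lim t)
    have "{b. pr e b \<in> ws v t} = Lim (\<lambda>u. {b. pr e b \<in> ws v u}) t"
      unfolding ws_def by (subst arun_tlim[OF lim(1)]) (rule Lim_vimage)
    also have "\<dots> = Lim (ws (row e S)) t" by (rule Lim_cong) (rule lim(2))
    finally show ?case unfolding ws_def[abs_def] by (simp add: arun_tlim[OF lim(1)])
  qed simp
  then have "Ord (row e S) \<le> Ord v" unfolding Ord_le_iff[of "row e S"] using ws_Ord[of v] by metis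
  then show ?thesis unfolding qq_def v_def[symmetric] using Ord_osuc[of v] by simp
qed

abbreviation VV :: "time \<Rightarrow> nat set" where "VV \<equiv> arun US {}"
definition cl :: "time \<Rightarrow> nat set" where "cl t = tr 4 (VV t)"
definition oo :: "time \<Rightarrow> time" where "oo t = Ord (qq (VV t))"

lemma cl_cells: "pr e (pr 0 n) \<in> cl t \<longleftrightarrow> tin (crun (P e) {} {} t) n" "pr e (pr 1 n) \<in> cl t \<longleftrightarrow> tsc (crun (P e) {} {} t) n"
  "pr e (pr 2 n) \<in> cl t \<longleftrightarrow> tout (crun (P e) {} {} t) n"
  using US_sim[of "{}" t] unfolding Uinv_def cl_def ec_empty by blast+

lemma cl_tlim: "tlim t \<Longrightarrow> cl t = Lim cl t"
  unfolding cl_def[abs_def] tr_def by (subst arun_tlim, assumption, rule Lim_vimage)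

lemma in_row: "m \<in> row i (VV t) \<longleftrightarrow> tout (crun (P i) {} {} t) (Suc (pr 2 (pr 1 m)))"
  using cl_cells(3)[of i "Suc (pr 2 (pr 1 m))" t] unfolding row_def cl_def by simp

text \<open>The one question about the universal run that the guessing machines ask. A run of length
  \<open>Ord d\<close> answers it, whatever relations \<open>c\<close> and \<open>d\<close>
  are.\<close>

definition Dset :: "nat set \<Rightarrow> nat set \<Rightarrow> nat set" where
  "Dset c d = {n. \<exists>t. Ord c \<le> t \<and> t < Ord d \<and> n \<in> cl t}"

lemma lc_Dset: assumes "lc C" "lc E" shows "lc (\<lambda>X. Dset (C X) (E X))"
proof -
  \<comment> \<open>Tracks 3 and 4 are clocks: such a track is constant from the ordinal of its
    relation on, and not before. Track 6 collects what is on in the universal run of track 5 once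
    the first clock has stopped, and the second clock ends the loop.\<close>
  define G where "G S = tk (tr 1 S) (tr 2 S) (acc (tr 1 S) (tr 3 S)) (acc (tr 2 S) (tr 4 S)) (US (tr 5 S))
    {n. n \<in> tr 6 S \<or> (\<forall>b. b \<in> acc (tr 1 S) (tr 3 S) \<longleftrightarrow> b \<in> tr 3 S) \<and> n \<in> tr 4 (tr 5 S)}" for S
  define H where "H S \<longleftrightarrow> (\<forall>n. n \<in> acc (tr 2 S) (tr 4 S) \<longleftrightarrow> n \<in> tr 4 S)" for S
  define J where "J X = tk (C X) (E X) {} {} {} {}" for X
  have 6: "lc (\<lambda>S. {n. n \<in> tr 6 S \<or> (\<forall>b. b \<in> acc (tr 1 S) (tr 3 S) \<longleftrightarrow> b \<in> tr 3 S) \<and> n \<in> tr 4 (tr 5 S)})"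
    by (rule lc_cop) (intro cop_rules lc_acc lc_rules rf_intros)
  have 1: "lc G" unfolding G_def by (intro lc_tk 6 lc_acc lc_then[OF _ lc_US] lc_rules)
  have 2: "cop (\<lambda>S n. H S)" unfolding H_def by (intro cop_rules lc_acc lc_rules rf_intros)
  have 3: "lc J" unfolding J_def by (intro lc_tk assms lc_rules)
  define R where "R X = arun G (J X)" for X
  have t1: "tr 1 (R X t) = C X" for X t
    using arun_tr_const[of t 1 G "J X"] unfolding R_def by (simp add: G_def J_def)
  have t2: "tr 2 (R X t) = E X" for X t
    using arun_tr_const[of t 2 G "J X"] unfolding R_def by (simp add: G_def J_def)
  have t3: "tr 3 (R X t) = ws (C X) t" for X t
    using arun_tr[of t 3 G "J X" "acc (C X)"] t1[unfolded R_def] unfolding R_def ws_def by (simp add: G_def J_def)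
  have t4: "tr 4 (R X t) = ws (E X) t" for X t
    using arun_tr[of t 4 G "J X" "acc (E X)"] t2[unfolded R_def] unfolding R_def ws_def by (simp add: G_def J_def)
  have t5: "tr 5 (R X t) = VV t" for X t
    using arun_tr[of t 5 G "J X" US] unfolding R_def by (simp add: G_def J_def)
  have t6: "tr 6 (R X t) = (\<Union>s\<in>{..<t}. {n. Ord (C X) \<le> s \<and> n \<in> cl s})" for X t
    unfolding R_def
  proof (rule arun_union)
    show "tr 6 (J X) = {}" unfolding J_def by simp
    fix s
    have "tr 6 (G (R X s)) = {n. n \<in> tr 6 (R X s) \<or> (\<forall>b. b \<in> acc (C X) (ws (C X) s) \<longleftrightarrow> b \<in> ws (C X) s) \<and> n \<in> cl s}"
      unfolding G_def tr_tk t1 t3 t5 cl_def ..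
    then show "tr 6 (G (arun G (J X) s)) = tr 6 (arun G (J X) s) \<union> {n. Ord (C X) \<le> s \<and> n \<in> cl s}"
      unfolding R_def[symmetric] Ord_le_iff_acc by (auto simp: set_eq_iff)
  qed
  have H: "H (R X t) \<longleftrightarrow> acc (E X) (ws (E X) t) = ws (E X) t" for X t unfolding H_def t2 t4 by blast
  have "lc (\<lambda>X. R X (LEAST t. H (R X t)))" unfolding R_def
    by (rule lc_while[OF 1 2 3]) (unfold R_def[symmetric] H Ord_le_iff_acc[symmetric], blast)
  from lc_tr[OF this, of 6] have "lc (\<lambda>X. \<Union>s\<in>{..<Ord (E X)}. {n. Ord (C X) \<le> s \<and> n \<in> cl s})"
    unfolding H Ord_as_least[symmetric] t6 .
  moreover have "(\<Union>s\<in>{..<Ord (E X)}. {n. Ord (C X) \<le> s \<and> n \<in> cl s}) = Dset (C X) (E X)" for X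
    unfolding Dset_def by auto
  ultimately show ?thesis by simp
qed

text \<open>The eventually writable reals of Hamkins and Lewis, with operators in place of machines.\<close>

definition ew :: "nat set \<Rightarrow> bool" where
  "ew c \<longleftrightarrow> (\<exists>F T. lc F \<and> (\<forall>t. 0 \<notin> arun F {} t) \<and> (\<forall>t\<ge>T. tr 1 (arun F {} t) = c))"

lemma arun_stays:
  assumes "tr i (arun F X T) = c" "\<And>t. T \<le> t \<Longrightarrow> tr i (arun F X t) = c \<Longrightarrow> tr i (F (arun F X t)) = c" "T \<le> t"
  shows "tr i (arun F X t) = c"
  using assms(3)
proof (induction t rule: time_induct)
  case zero
  then show ?case using assms(1) by (simp add: le_tz_iff)
next
  case (suc t)
  show ?case
  proof (cases "T = tsuc t")
    case False
    then have "T < tsuc t" using suc.prems by simp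
    then have "T \<le> t" unfolding less_tsuc_iff .
    then show ?thesis using assms(2) suc.IH by simp
  qed (use assms(1) in simp)
next
  case (lim t)
  show ?case
  proof (cases "T = t")
    case False
    then have Tt: "T < t" using lim(3) by simp
    have "tr i (arun F X t) = Lim (\<lambda>u. tr i (arun F X u)) t" unfolding tr_def by (subst arun_tlim[OF lim(1)]) (rule Lim_vimage)
    also have "\<dots> = c" by (rule set_eqI, rule Lim_eventually[OF Tt]) (simp only: lim(2))
    finally show ?thesis .
  qed (use assms(1) in simp)
qed

text \<open>Diagonalization: some program shows, at a later time, \<open>osuc\<close> of the sum of
  all that is shown at time \<open>t\<close>, and at that later time the sum exceeds this very
  row.\<close>

lemma oo_grows: "\<exists>u\<ge>t. oo t < oo u"
proof -
  define F where "F S = tk (osuc (qq (tr 2 S))) (US (tr 2 S)) {} {} {} {}" for S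
  have "lc F" unfolding F_def by (intro lc_tk lc_then[OF _ lc_osuc] lc_then[OF _ lc_qq] lc_then[OF _ lc_US] lc_rules)
  moreover have "0 \<notin> arun F {} s" for s by (rule arun_tk_nonzero) (simp_all add: F_def)
  ultimately obtain i where i: "\<And>t. \<exists>u\<ge>t. \<forall>n. tout (crun (P i) {} {} u) (Suc (pr 2 n)) = (n \<in> arun F {} t)"
    by (rule iteration_displayed) (rule that)
  have t2: "tr 2 (arun F {} s) = VV s" for s
    using arun_tr[of s 2 F "{}" US] by (simp add: F_def)
  obtain u where u: "u \<ge> tsuc t" "\<forall>n. tout (crun (P i) {} {} u) (Suc (pr 2 n)) = (n \<in> arun F {} (tsuc t))" using i by blast
  have "row i (VV u) = tr 1 (arun F {} (tsuc t))" by (rule set_eqI) (simp only: in_row u(2) in_tr)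
  also have "\<dots> = osuc (qq (VV t))" unfolding arun_tsuc by (simp add: F_def t2)
  finally have "Ord (qq (VV t)) < Ord (row i (VV u))" using Ord_osuc by simp
  then have "oo t < oo u" using Ord_row[of i "VV u"] unfolding oo_def by simp
  moreover have "t \<le> u" using order_trans[OF le_tsuc u(1)] .
  ultimately show ?thesis by blast
qed

lemma ew_row: assumes "ew c" shows "\<exists>i u. \<forall>w\<ge>u. row i (VV w) = c"
proof -
  obtain F T where F: "lc F" "\<And>t. 0 \<notin> arun F {} t" "\<And>t. t \<ge> T \<Longrightarrow> tr 1 (arun F {} t) = c" using assms unfolding ew_def by blast
  obtain i where i: "\<And>t. \<exists>u. \<forall>w\<ge>u. \<forall>n. \<exists>r\<ge>t. tout (crun (P i) {} {} w) (Suc (pr 2 n)) = (n \<in> arun F {} r)"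
    by (rule iteration_displayed[OF F(1,2)]) (rule that)
  obtain u where u: "\<forall>w\<ge>u. \<forall>n. \<exists>r\<ge>T. tout (crun (P i) {} {} w) (Suc (pr 2 n)) = (n \<in> arun F {} r)" using i by blast
  have "row i (VV w) = c" if w: "w \<ge> u" for w
  proof (rule set_eqI)
    fix m
    obtain r where r: "r \<ge> T" "tout (crun (P i) {} {} w) (Suc (pr 2 (pr 1 m))) = (pr 1 m \<in> arun F {} r)" using u w by blast
    show "m \<in> row i (VV w) \<longleftrightarrow> m \<in> c" unfolding in_row r(2) in_tr[symmetric] F(3)[OF r(1)] ..
  qed
  then show ?thesis by blast
qed

text \<open>There are countably many rows, so one time bounds the moments at which they become
  constant, as far as they do. Every eventually writable real is the final value of a row.\<close>

lemma ew_bound: "\<exists>U. \<forall>c. ew c \<longrightarrow> (\<forall>w\<ge>U. Ord c < oo w)"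
proof -
  define f where "f i = (SOME u. \<exists>c. \<forall>w\<ge>u. row i (VV w) = c)" for i
  obtain U where U: "\<And>i. f i < U" using time_bounded_nat[of f] by blast
  have "Ord c < oo w" if c: "ew c" and w: "w \<ge> U" for c w
  proof -
    obtain i u where u: "\<forall>w\<ge>u. row i (VV w) = c" using ew_row[OF c] by blast
    then have "\<exists>c. \<forall>w\<ge>f i. row i (VV w) = c" unfolding f_def by (rule someI[of "\<lambda>u. \<exists>c. \<forall>w\<ge>u. row i (VV w) = c", OF exI])
    then obtain c' where c': "\<forall>w\<ge>f i. row i (VV w) = c'" by blast
    have "c' = c" using u c' max.cobounded1[of u "f i"] max.cobounded2[of "f i" u] by blast
    moreover have "f i \<le> w" using U[of i] w by simp
    ultimately show ?thesis using c' Ord_row[of i "VV w"] unfolding oo_def by simp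
  qed
  then show ?thesis by blast
qed

lemma ew_osuc: assumes "ew c" shows "ew (osuc c)"
proof -
  obtain F T where F: "lc F" "\<And>t. 0 \<notin> arun F {} t" "\<And>t. t \<ge> T \<Longrightarrow> tr 1 (arun F {} t) = c" using assms unfolding ew_def by blast
  define G where "G S = tk (osuc (tr 1 (tr 2 S))) (F (tr 2 S)) {} {} {} {}" for S
  have "lc G" unfolding G_def by (intro lc_tk lc_then[OF _ lc_osuc] lc_then[OF _ F(1)] lc_rules)
  moreover have "0 \<notin> arun G {} s" for s by (rule arun_tk_nonzero) (simp_all add: G_def)
  moreover have t2: "tr 2 (arun G {} s) = arun F {} s" for s
    using arun_tr[of s 2 G "{}" F] by (simp add: G_def)
  have g: "tr 1 (G (arun G {} t)) = osuc c" if t: "T \<le> t" for t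
  proof -
    have "tr 1 (G S) = osuc (tr 1 (tr 2 S))" for S unfolding G_def by simp
    then show ?thesis using F(3)[OF t] t2 by simp
  qed
  have "tr 1 (arun G {} t) = osuc c" if t: "tsuc T \<le> t" for t
  proof (rule arun_stays[OF _ _ t])
    show "tr 1 (arun G {} (tsuc T)) = osuc c" unfolding arun_tsuc by (rule g) simp
    fix u assume "tsuc T \<le> u" then have "T \<le> u" using le_tsuc[of T] by (rule order_trans[rotated])
    then show "tr 1 (G (arun G {} u)) = osuc c" by (rule g)
  qed
  ultimately show ?thesis unfolding ew_def by blast
qed

lemma ew_empty: "ew {}"
proof -
  have "arun (\<lambda>S. {}) {} t = {}" for t
  proof (induction t rule: time_induct)
    case (lim t)
    show ?case unfolding arun_tlim[OF lim(1)] Lim_def using lim(2) tlim_pos[OF lim(1)] by blast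
  qed simp_all
  then show ?thesis unfolding ew_def using lc_const_empty by (intro exI[of _ "\<lambda>S. {}"]) simp
qed

text \<open>\<open>\<sigma>\<close> is the least eventual upper bound of \<open>oo\<close>. The
  bound is strict, since \<open>oo_grows\<close> would otherwise push a later value beyond it; and
  by minimality every smaller ordinal is exceeded again and again.\<close>

lemma sigma_exists:
  obtains \<sigma> T0 where "tlim \<sigma>" "\<And>t. T0 \<le> t \<Longrightarrow> oo t < \<sigma>" "\<And>s T. s < \<sigma> \<Longrightarrow> \<exists>t\<ge>T. s < oo t"
proof -
  define Q where "Q s \<longleftrightarrow> (\<exists>T. \<forall>t\<ge>T. oo t \<le> s)" for s
  obtain b where "\<And>c. Ord c < b" using time_bounded_real[of Ord] by blast
  then have "Q b" unfolding Q_def oo_def by (meson less_imp_le)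
  define \<sigma> where "\<sigma> = (LEAST s. Q s)"
  have "Q \<sigma>" unfolding \<sigma>_def by (rule LeastI) (rule \<open>Q b\<close>)
  then obtain T0 where T0: "\<And>t. T0 \<le> t \<Longrightarrow> oo t \<le> \<sigma>" unfolding Q_def by blast
  have lt: "oo t < \<sigma>" if t: "T0 \<le> t" for t
  proof -
    obtain u where "u \<ge> t" "oo t < oo u" using oo_grows by blast
    moreover then have "oo u \<le> \<sigma>" using T0[of u] t by simp
    ultimately show ?thesis by simp
  qed
  have cof: "\<exists>t\<ge>T. s < oo t" if s: "s < \<sigma>" for s T
  proof -
    have "\<not> Q s" using s unfolding \<sigma>_def by (rule not_less_Least)
    then show ?thesis unfolding Q_def by (auto simp: not_le)
  qed
  have "tlim \<sigma>" unfolding tlim_def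
  proof (intro conjI allI impI)
    show "\<sigma> \<noteq> tz" using lt[OF order_refl] not_less_tz by auto
    fix s assume "s < \<sigma>"
    then obtain t where "t \<ge> T0" "s < oo t" using cof by blast
    then show "tsuc s < \<sigma>" using lt[of t] tsuc_le_iff[of s "oo t"] by simp
  qed
  then show ?thesis using that lt cof by blast
qed

lemma zeta_exists:
  assumes "\<And>t. T0 \<le> t \<Longrightarrow> oo t < \<sigma>"
  obtains \<zeta> where "tlim \<zeta>" "\<zeta> < \<sigma>" "\<And>c. ew c \<Longrightarrow> Ord c < \<zeta>" "\<And>s. s < \<zeta> \<Longrightarrow> \<exists>c. ew c \<and> s \<le> Ord c"
proof -
  define Q where "Q s \<longleftrightarrow> (\<forall>c. ew c \<longrightarrow> Ord c < s)" for s
  obtain U where U: "\<And>c w. ew c \<Longrightarrow> w \<ge> U \<Longrightarrow> Ord c < oo w" using ew_bound by blast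
  have QU: "Q (oo (max U T0))" unfolding Q_def using U by simp
  define \<zeta> where "\<zeta> = (LEAST s. Q s)"
  have "Q \<zeta>" unfolding \<zeta>_def by (rule LeastI) (rule QU)
  have "\<zeta> \<le> oo (max U T0)" unfolding \<zeta>_def by (rule Least_le) (rule QU)
  also have "\<dots> < \<sigma>" by (rule assms) simp
  finally have zs: "\<zeta> < \<sigma>" .
  have z1: "Ord c < \<zeta>" if "ew c" for c using that \<open>Q \<zeta>\<close> unfolding Q_def by blast
  have z2: "\<exists>c. ew c \<and> s \<le> Ord c" if s: "s < \<zeta>" for s
  proof -
    have "\<not> Q s" using s unfolding \<zeta>_def by (rule not_less_Least)
    then show ?thesis unfolding Q_def by (auto simp: not_less)
  qed
  have "tlim \<zeta>" unfolding tlim_def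
  proof (intro conjI allI impI)
    show "\<zeta> \<noteq> tz" using z1[OF ew_empty] not_less_tz by auto
    fix s assume "s < \<zeta>"
    then obtain c where c: "ew c" "s \<le> Ord c" using z2 by blast
    then have "tsuc s \<le> Ord (osuc c)" using Ord_osuc[of c] by (simp add: tsuc_le_iff)
    also have "\<dots> < \<zeta>" by (rule z1[OF ew_osuc[OF c(1)]])
    finally show "tsuc s < \<zeta>" .
  qed
  then show ?thesis using that zs z1 z2 by blast
qed

text \<open>A machine that guesses ordinals until it finds one below which the cell is on somewhere above \<open>Ord c\<close>
  eventually writes such an ordinal.\<close>

lemma cell_reflects:
  assumes \<sigma>: "\<And>s T. s < \<sigma> \<Longrightarrow> \<exists>t\<ge>T. s < oo t"
    and c: "ew c" and \<theta>: "Ord c \<le> \<theta>" "\<theta> < \<sigma>" "n \<in> cl \<theta>"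
  shows "\<exists>d t. ew d \<and> Ord c \<le> t \<and> t < Ord d \<and> n \<in> cl t"
proof -
  obtain F T where F: "lc F" "\<And>t. 0 \<notin> arun F {} t" "\<And>t. t \<ge> T \<Longrightarrow> tr 1 (arun F {} t) = c" using c unfolding ew_def by blast
  define B where "B S = {m. if n \<in> Dset (tr 1 (tr 2 S)) (tr 1 S) then m \<in> tr 1 S else m \<in> qq (tr 3 S)}" for S
  define G where "G S = tk (B S) (F (tr 2 S)) (US (tr 3 S)) {} {} {}" for S
  have lB: "lc B" unfolding B_def by (rule lc_cop) (intro cop_rules lc_Dset lc_then[OF _ lc_qq] lc_rules rf_intros)
  have lG: "lc G" unfolding G_def by (intro lc_tk lB lc_then[OF _ F(1)] lc_then[OF _ lc_US] lc_rules)
  have z: "0 \<notin> arun G {} s" for s by (rule arun_tk_nonzero) (simp_all add: G_def)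
  have t2: "tr 2 (arun G {} s) = arun F {} s" for s using arun_tr[of s 2 G "{}" F] by (simp add: G_def)
  have t3: "tr 3 (arun G {} s) = VV s" for s using arun_tr[of s 3 G "{}" US] by (simp add: G_def)
  define d where "d s = tr 1 (arun G {} s)" for s
  have dB: "tr 1 (G (arun G {} s)) = B (arun G {} s)" for s unfolding G_def by simp
  have Bs: "B (arun G {} s) = (if n \<in> Dset c (d s) then d s else qq (VV s))" if s: "T \<le> s" for s
    unfolding B_def t2 t3 F(3)[OF s] d_def[symmetric] by simp
  have "\<exists>s\<ge>T. n \<in> Dset c (d s)"
  proof (rule ccontr)
    assume no: "\<not> ?thesis"
    obtain t where t: "t \<ge> T" "\<theta> < oo t" using \<sigma>[OF \<theta>(2)] by blast
    have "d (tsuc t) = qq (VV t)" using Bs[OF t(1)] no t(1) dB[of t] unfolding d_def[of "tsuc t"] arun_tsuc by simp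
    moreover have "T \<le> tsuc t" using order_trans[OF t(1) le_tsuc] .
    ultimately have "n \<notin> Dset c (qq (VV t))" using no by metis
    then show False unfolding Dset_def using \<theta> t(2) unfolding oo_def by blast
  qed
  then obtain s where s: "T \<le> s" "n \<in> Dset c (d s)" by blast
  have "tr 1 (arun G {} t) = d s" if t: "s \<le> t" for t
  proof (rule arun_stays[OF _ _ t])
    show "tr 1 (arun G {} s) = d s" unfolding d_def ..
    fix u assume u: "s \<le> u" "tr 1 (arun G {} u) = d s"
    have "T \<le> u" using s(1) u(1) by simp
    from Bs[OF this] show "tr 1 (G (arun G {} u)) = d s" unfolding dB using s(2) u(2) by (simp add: d_def)
  qed
  then have "ew (d s)" unfolding ew_def using lG z by blast
  then show ?thesis using s(2) unfolding Dset_def by blast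
qed

text \<open>The machine guesses a bound beyond which the cell is off, and replaces the guess by the
  ordinal now shown whenever the cell is found on in between. At a time when an ordinal above
  \<open>\<eta>\<close> is shown, the guess is either replaced by it or confirmed up to it, and
  beyond \<open>\<eta>\<close> the cell is off anyway. From then on no refutation is possible,
  because all ordinals shown stay below \<open>\<sigma>\<close>; so the guess is final.\<close>

lemma cell_settles:
  assumes \<sigma>: "\<And>t. T0 \<le> t \<Longrightarrow> oo t < \<sigma>" "\<And>s T. s < \<sigma> \<Longrightarrow> \<exists>t\<ge>T. s < oo t"
    and \<eta>: "\<eta> < \<sigma>" "\<And>t. \<eta> \<le> t \<Longrightarrow> t < \<sigma> \<Longrightarrow> n \<notin> cl t"
  shows "\<exists>c. ew c \<and> (\<forall>t. Ord c \<le> t \<longrightarrow> t < \<sigma> \<longrightarrow> n \<notin> cl t)"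
proof -
  define B where "B S = {m. if n \<in> Dset (tr 1 S) (qq (tr 2 S)) then m \<in> qq (tr 2 S) else m \<in> tr 1 S}" for S
  define G where "G S = tk (B S) (US (tr 2 S)) {} {} {} {}" for S
  have lB: "lc B" unfolding B_def by (rule lc_cop) (intro cop_rules lc_Dset lc_then[OF _ lc_qq] lc_rules rf_intros)
  have lG: "lc G" unfolding G_def by (intro lc_tk lB lc_then[OF _ lc_US] lc_rules)
  have z: "0 \<notin> arun G {} s" for s by (rule arun_tk_nonzero) (simp_all add: G_def)
  have t2: "tr 2 (arun G {} s) = VV s" for s using arun_tr[of s 2 G "{}" US] by (simp add: G_def)
  define w where "w s = tr 1 (arun G {} s)" for s
  have wB: "tr 1 (G (arun G {} s)) = (if n \<in> Dset (w s) (qq (VV s)) then qq (VV s) else w s)" for s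
  proof -
    have "tr 1 (G (arun G {} s)) = B (arun G {} s)" unfolding G_def by simp
    then show ?thesis unfolding B_def t2 w_def[symmetric] by simp
  qed
  obtain t0 where t0: "t0 \<ge> T0" "\<eta> < oo t0" using \<sigma>(2)[OF \<eta>(1)] by blast
  have "\<exists>s\<ge>T0. \<forall>t. Ord (w s) \<le> t \<longrightarrow> t < \<sigma> \<longrightarrow> n \<notin> cl t"
  proof (cases "n \<in> Dset (w t0) (qq (VV t0))")
    case True
    have "w (tsuc t0) = qq (VV t0)" unfolding w_def arun_tsuc wB[unfolded w_def] using True by (simp add: w_def)
    then have "\<eta> < Ord (w (tsuc t0))" using t0(2) unfolding oo_def by simp
    moreover have "T0 \<le> tsuc t0" using order_trans[OF t0(1) le_tsuc] .
    ultimately show ?thesis using \<eta>(2) by (intro exI[of _ "tsuc t0"]) (auto dest: less_le_trans less_imp_le)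
  next
    case False
    have "n \<notin> cl t" if t: "Ord (w t0) \<le> t" "t < \<sigma>" for t
    proof (cases "t < oo t0")
      case True
      then show ?thesis using False t(1) unfolding Dset_def oo_def by blast
    next
      case F: False
      then have "\<eta> \<le> t" using t0(2) by simp
      then show ?thesis using \<eta>(2) t(2) by blast
    qed
    then show ?thesis using t0(1) by blast
  qed
  then obtain s where s: "s \<ge> T0" "\<And>t. Ord (w s) \<le> t \<Longrightarrow> t < \<sigma> \<Longrightarrow> n \<notin> cl t" by blast
  have "tr 1 (arun G {} t) = w s" if t: "s \<le> t" for t
  proof (rule arun_stays[OF _ _ t])
    show "tr 1 (arun G {} s) = w s" unfolding w_def ..
    fix u assume u: "s \<le> u" "tr 1 (arun G {} u) = w s"
    have "T0 \<le> u" using s(1) u(1) by simp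
    from \<sigma>(1)[OF this] have "n \<notin> Dset (w s) (qq (VV u))"
      unfolding Dset_def oo_def using s(2) order.strict_trans by blast
    then show "tr 1 (G (arun G {} u)) = w s" unfolding wB using u(2) by (simp add: w_def)
  qed
  then have "ew (w s)" unfolding ew_def using lG z by blast
  then show ?thesis using s(2) by blast
qed

section \<open>Repetition of snapshots\<close>

lemma crun_shift: "crun p y z u = crun p y z u' \<Longrightarrow> crun p y z (tadd u s) = crun p y z (tadd u' s)"
proof (induction s rule: time_induct)
  case (lim s)
  have "Lim (\<lambda>d. Collect (v (crun p y z d))) (tadd u s) = Lim (\<lambda>d. Collect (v (crun p y z d))) (tadd u' s)" for v :: "cfg \<Rightarrow> nat \<Rightarrow> bool"
    unfolding Lim_tadd[OF lim(1)] by (rule Lim_cong) (simp add: lim(2)[OF _ lim(3)])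
  then show ?case unfolding crun_tlim[OF tlim_tadd[OF lim(1)]] clim_def by simp
qed simp_all

text \<open>Equal snapshots repeat the stretch from \<open>\<zeta>\<close> to
  \<open>\<sigma>\<close> finitely often without further ado; the issue is a limit of repetitions.
  There every cell that is on at \<open>\<zeta>\<close> is on cofinally often, and by
  \<open>le\<close> no other cell has been on since \<open>\<zeta>\<close>, so the snapshot of
  \<open>\<zeta>\<close> recurs and the cycle continues.\<close>

lemma crun_loops:
  fixes p y z
  defines "C \<equiv> crun p y z"
  assumes \<zeta>: "tlim \<zeta>" "\<zeta> < \<sigma>" "C \<sigma> = C \<zeta>"
    and le: "\<And>t n. \<zeta> \<le> t \<Longrightarrow> t < \<sigma> \<Longrightarrow> (tin (C t) n \<longrightarrow> tin (C \<zeta>) n) \<and> (tsc (C t) n \<longrightarrow> tsc (C \<zeta>) n) \<and> (tout (C t) n \<longrightarrow> tout (C \<zeta>) n)"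
    and t: "\<zeta> \<le> t"
  shows "\<exists>s\<ge>\<zeta>. s < \<sigma> \<and> C t = C s"
proof -
  obtain \<delta> where \<delta>: "tadd \<zeta> \<delta> = \<sigma>" using tadd_surj[OF less_imp_le[OF \<zeta>(2)]] by blast
  then have d0: "tz < \<delta>" using \<zeta>(2) tadd_mono_iff[of \<zeta> tz \<delta>] by simp
  have sh: "C u = C \<zeta> \<Longrightarrow> C (tadd u s) = C (tadd \<zeta> s)" for u s unfolding C_def by (rule crun_shift)
  have "\<exists>u s. \<zeta> \<le> u \<and> s < \<delta> \<and> t = tadd u s \<and> C u = C \<zeta>" using t
  proof (induction t rule: less_induct)
    case (less t)
    \<comment> \<open>The times up to \<open>t\<close> with the snapshot of \<open>\<zeta>\<close>.
      Their supremum \<open>m\<close> is one of them, and \<open>t\<close> lies less than one period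
      after \<open>m\<close>, as otherwise \<open>m\<close> plus a period would belong to
      \<open>B\<close> too.\<close>
    define B where "B = {u. \<zeta> \<le> u \<and> u \<le> t \<and> C u = C \<zeta>}"
    have zB: "\<zeta> \<in> B" unfolding B_def using less.prems by simp
    define m where "m = (LEAST m. \<forall>u\<in>B. u \<le> m)"
    have tB: "\<forall>u\<in>B. u \<le> t" unfolding B_def by simp
    have ub: "\<forall>u\<in>B. u \<le> m" unfolding m_def by (rule LeastI[of "\<lambda>m. \<forall>u\<in>B. u \<le> m"]) (rule tB)
    have mt: "m \<le> t" unfolding m_def by (rule Least_le) (rule tB)
    have lub: "\<exists>u\<in>B. b < u" if b: "b < m" for b
    proof -
      have "\<not> (\<forall>u\<in>B. u \<le> b)" using b unfolding m_def by (rule not_less_Least)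
      then show ?thesis by (auto simp: not_le)
    qed
    have "m \<in> B"
    proof (rule ccontr)
      assume mB: "m \<notin> B"
      have zm: "\<zeta> < m" using ub zB mB by (metis le_less)
      have cof: "\<exists>u\<in>B. b < u \<and> u < m" if b: "b < m" for b
        using lub[OF b] ub mB by (metis le_less)
      have ml: "tlim m" unfolding tlim_def
      proof (intro conjI allI impI)
        show "m \<noteq> tz" using zm not_less_tz by auto
        fix b assume "b < m"
        then obtain u where "b < u" "u < m" using cof by blast
        then show "tsuc b < m" using tsuc_le_iff[of b u] by simp
      qed
      have cells: "n \<in> Lim (\<lambda>d. Collect (v (C d))) m \<longleftrightarrow> v (C \<zeta>) n"
        if v: "\<And>t. \<zeta> \<le> t \<Longrightarrow> t < \<sigma> \<Longrightarrow> v (C t) n \<longrightarrow> v (C \<zeta>) n" for v :: "cfg \<Rightarrow> nat \<Rightarrow> bool" and n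
      proof
        assume "n \<in> Lim (\<lambda>d. Collect (v (C d))) m"
        then obtain d where d: "\<zeta> \<le> d" "d < m" "n \<in> Collect (v (C d))" by (rule in_LimD[OF _ zm])
        have "d < t" using d(2) mt by simp
        from less.IH[OF this d(1)] obtain u s where us: "s < \<delta>" "d = tadd u s" "C u = C \<zeta>" by blast
        have "C d = C (tadd \<zeta> s)" unfolding us(2) by (rule sh[OF us(3)])
        moreover have "tadd \<zeta> s < \<sigma>" using tadd_mono[OF us(1), of \<zeta>] \<delta> by simp
        ultimately show "v (C \<zeta>) n" using v[OF le_tadd[of \<zeta> s]] d(3) by simp
      next
        assume vn: "v (C \<zeta>) n"
        show "n \<in> Lim (\<lambda>d. Collect (v (C d))) m"
        proof (rule in_LimI)
          fix b assume "b < m"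
          then obtain u where "u \<in> B" "b < u" "u < m" using cof by blast
          then show "\<exists>d. b \<le> d \<and> d < m \<and> n \<in> Collect (v (C d))" using vn unfolding B_def by (intro exI[of _ u]) auto
        qed
      qed
      have c1: "n \<in> Lim (\<lambda>d. Collect (tin (C d))) m \<longleftrightarrow> tin (C \<zeta>) n" for n by (rule cells) (use le in blast)
      have c2: "n \<in> Lim (\<lambda>d. Collect (tsc (C d))) m \<longleftrightarrow> tsc (C \<zeta>) n" for n by (rule cells) (use le in blast)
      have c3: "n \<in> Lim (\<lambda>d. Collect (tout (C d))) m \<longleftrightarrow> tout (C \<zeta>) n" for n by (rule cells) (use le in blast)
      have sz: "st (C \<zeta>) = 2" "cfg.hd (C \<zeta>) = 0" unfolding C_def by (simp_all add: crun_tlim[OF \<zeta>(1)] clim_def)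
      have "C m = clim C m" unfolding C_def by (rule crun_tlim[OF ml])
      also have "\<dots> = C \<zeta>" unfolding clim_def c1 c2 c3 by (rule cfg.equality) (simp_all add: sz)
      finally have "m \<in> B" unfolding B_def using zm mt by simp
      then show False using mB by simp
    qed
    then have mm: "\<zeta> \<le> m" "C m = C \<zeta>" unfolding B_def by simp_all
    obtain s where s: "t = tadd m s" using tadd_surj[OF mt] by metis
    have "s < \<delta>"
    proof (rule ccontr)
      assume "\<not> s < \<delta>"
      then have "tadd m \<delta> \<le> t" unfolding s using tadd_mono_iff[of m s \<delta>] by (simp add: not_less[symmetric])
      moreover have "C (tadd m \<delta>) = C \<zeta>" using sh[OF mm(2), of \<delta>] \<delta> \<zeta>(3) by simp
      moreover have "\<zeta> \<le> tadd m \<delta>" using mm(1) le_tadd[of m \<delta>] by simp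
      ultimately have "tadd m \<delta> \<in> B" unfolding B_def by simp
      then have "tadd m \<delta> \<le> m" using ub by blast
      then show False using tadd_mono[OF d0, of m] by simp
    qed
    then show ?case using s mm by blast
  qed
  then obtain u s where us: "s < \<delta>" "t = tadd u s" "C u = C \<zeta>" by blast
  have "C t = C (tadd \<zeta> s)" unfolding us(2) by (rule sh[OF us(3)])
  moreover have "tadd \<zeta> s < \<sigma>" using tadd_mono[OF us(1), of \<zeta>] \<delta> by simp
  ultimately show ?thesis using le_tadd[of \<zeta> s] by blast
qed

theorem halting_before_writable_ordinals:
  obtains \<sigma> where "\<And>s. s < \<sigma> \<Longrightarrow> \<exists>t. s < oo t"
    "\<And>e t. st (crun (P e) {} {} t) = 1 \<Longrightarrow> \<exists>s<\<sigma>. st (crun (P e) {} {} s) = 1"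
proof -
  obtain \<sigma> T0 where \<sigma>: "tlim \<sigma>" "\<And>t. T0 \<le> t \<Longrightarrow> oo t < \<sigma>" "\<And>s T. s < \<sigma> \<Longrightarrow> \<exists>t\<ge>T. s < oo t"
    by (rule sigma_exists) (rule that)
  obtain \<zeta> where \<zeta>: "tlim \<zeta>" "\<zeta> < \<sigma>" "\<And>c. ew c \<Longrightarrow> Ord c < \<zeta>" "\<And>s. s < \<zeta> \<Longrightarrow> \<exists>c. ew c \<and> s \<le> Ord c"
    by (rule zeta_exists[of T0 \<sigma>, OF \<sigma>(2)]) (assumption, rule that)
  have A: "n \<in> cl \<zeta>" if t: "\<zeta> \<le> t" "t < \<sigma>" "n \<in> cl t" for n t
    unfolding cl_tlim[OF \<zeta>(1)]
  proof (rule in_LimI)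
    fix b assume "b < \<zeta>"
    then obtain c where c: "ew c" "b \<le> Ord c" using \<zeta>(4) by blast
    have "Ord c \<le> t" using \<zeta>(3)[OF c(1)] t(1) by simp
    from cell_reflects[OF \<sigma>(3) c(1) this t(2,3)] obtain d s where d: "ew d" "Ord c \<le> s" "s < Ord d" "n \<in> cl s" by blast
    have "b \<le> s" "s < \<zeta>" using c(2) d(2,3) \<zeta>(3)[OF d(1)] by simp_all
    then show "\<exists>d. b \<le> d \<and> d < \<zeta> \<and> n \<in> cl d" using d(4) by blast
  qed
  have "cl \<sigma> = cl \<zeta>"
  proof (intro set_eqI iffI)
    fix n assume "n \<in> cl \<sigma>"
    then have "n \<in> Lim cl \<sigma>" unfolding cl_tlim[OF \<sigma>(1)] .
    then obtain t where "\<zeta> \<le> t" "t < \<sigma>" "n \<in> cl t" by (rule in_LimD[OF _ \<zeta>(2)])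
    then show "n \<in> cl \<zeta>" by (rule A)
  next
    fix n assume n: "n \<in> cl \<zeta>"
    show "n \<in> cl \<sigma>"
    proof (rule ccontr)
      assume "n \<notin> cl \<sigma>"
      then obtain \<eta> where \<eta>: "\<eta> < \<sigma>" "\<And>t. \<eta> \<le> t \<Longrightarrow> t < \<sigma> \<Longrightarrow> n \<notin> cl t" unfolding cl_tlim[OF \<sigma>(1)] Lim_def by blast
      \<comment> \<open>The bound \<open>\<eta>\<close> below \<open>\<sigma>\<close> is improved to
        one below \<open>\<zeta>\<close>, which contradicts the cell being on at
        \<open>\<zeta>\<close>.\<close>
      obtain c where c: "ew c" "\<forall>t. Ord c \<le> t \<longrightarrow> t < \<sigma> \<longrightarrow> n \<notin> cl t" using cell_settles[OF \<sigma>(2,3) \<eta>] by blast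
      then show False using n \<zeta>(2) \<zeta>(3)[OF c(1)] less_imp_le by blast
    qed
  qed
  note cl_eq = this
  have "\<exists>s<\<sigma>. st (crun (P e) {} {} s) = 1" if t: "st (crun (P e) {} {} t) = 1" for e t
  proof (cases "t < \<sigma>")
    case False
    define C where "C = crun (P e) {} {}"
    have cs: "C s = \<lparr>st = 2, hd = 0, tin = (\<lambda>n. pr e (pr 0 n) \<in> cl s), tsc = (\<lambda>n. pr e (pr 1 n) \<in> cl s), tout = (\<lambda>n. pr e (pr 2 n) \<in> cl s)\<rparr>"
      if s: "tlim s" for s unfolding cl_cells C_def by (rule cfg.equality) (simp_all add: crun_tlim[OF s] clim_def)
    have "C \<sigma> = C \<zeta>" unfolding cs[OF \<sigma>(1)] cs[OF \<zeta>(1)] cl_eq ..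
    moreover have "(tin (C t) n \<longrightarrow> tin (C \<zeta>) n) \<and> (tsc (C t) n \<longrightarrow> tsc (C \<zeta>) n) \<and> (tout (C t) n \<longrightarrow> tout (C \<zeta>) n)"
      if "\<zeta> \<le> t" "t < \<sigma>" for t n unfolding C_def cl_cells[symmetric] using A[OF that] by blast
    moreover have "\<zeta> \<le> t" using False \<zeta>(2) by simp
    ultimately obtain s where "s < \<sigma>" "C t = C s" unfolding C_def using crun_loops[OF \<zeta>(1,2), of "P e" "{}" "{}" t] by blast
    then show ?thesis using t unfolding C_def by auto
  qed (use t in blast)
  then show ?thesis using that \<sigma>(3) by blast
qed

section \<open>Runs along a coded well-founded relation\<close>

definition rk :: "nat set \<Rightarrow> nat \<Rightarrow> time" where "rk c b = (SOME t. \<forall>u. b \<in> ws c u \<longleftrightarrow> t < u)"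

text \<open>Nothing new enters at a limit stage, so the first stage containing \<open>b\<close> is a
  successor; the rank is its predecessor.\<close>

lemma in_ws_iff: assumes "b \<in> wsi c" shows "b \<in> ws c u \<longleftrightarrow> rk c b < u"
proof -
  have ex: "\<exists>u. b \<in> ws c u" using assms unfolding wsi_def by blast
  define w where "w = (LEAST u. b \<in> ws c u)"
  have w: "b \<in> ws c w" unfolding w_def by (rule LeastI_ex[OF ex])
  have wl: "b \<notin> ws c u" if "u < w" for u using that unfolding w_def by (rule not_less_Least)
  have iff: "b \<in> ws c u \<longleftrightarrow> w \<le> u" for u using wl[of u] w ws_mono[of w u c] by (cases "w \<le> u") auto
  have "\<exists>t. w = tsuc t"
  proof (cases w rule: time_cases)
    case 1 then show ?thesis using w by simp
  next
    case (2 u) then show ?thesis by blast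
  next
    case 3
    have "b \<in> Lim (ws c) w" using w unfolding ws_def[abs_def] by (simp add: arun_tlim[OF 3])
    then obtain d where "d < w" "b \<in> ws c d" by (rule in_LimD[OF _ tlim_pos[OF 3]])
    then show ?thesis using wl by blast
  qed
  then obtain t where "w = tsuc t" by blast
  then have "\<forall>u. b \<in> ws c u \<longleftrightarrow> t < u" using iff by (simp add: tsuc_le_iff)
  then have "\<forall>u. b \<in> ws c u \<longleftrightarrow> rk c b < u" unfolding rk_def by (rule someI)
  then show ?thesis by blast
qed

lemma rk_less: "b \<in> wsi c \<Longrightarrow> rk c b < Ord c"
  using in_ws_iff[of b c "Ord c"] unfolding wsi_def by simp

lemma rk_surj: assumes "t < Ord c" shows "\<exists>b\<in>wsi c. rk c b = t"
proof -
  have "ws c (tsuc t) \<noteq> ws c t" using assms Ord_le_iff[of c t] by (simp add: not_le[symmetric])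
  then obtain b where b: "b \<in> ws c (tsuc t)" "b \<notin> ws c t" using ws_mono[OF le_tsuc[of t], of c] by blast
  have N: "b \<in> wsi c" using ws_sub_wsi b(1) by blast
  have "rk c b = t" using b in_ws_iff[OF N, of t] in_ws_iff[OF N, of "tsuc t"] by (simp add: less_tsuc_iff)
  then show ?thesis using N by blast
qed

text \<open>Comparison of ranks, obtained by watching the stages. Different numbers may have the
  same rank, so this is a prewellordering of the well-founded part; its length is
  \<open>Ord c\<close>. It replaces \<open>c\<close> as the time axis of the coded runs, since there
  zero, successor and limit nodes are arithmetically definable.\<close>

definition RL :: "nat set \<Rightarrow> nat set" where
  "RL c = {m. p2 m \<in> wsi c \<and> (\<exists>t<Ord c. p1 m \<in> ws c t \<and> p2 m \<notin> ws c t)}"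

lemma in_RL: "pr a b \<in> RL c \<longleftrightarrow> a \<in> wsi c \<and> b \<in> wsi c \<and> rk c a < rk c b"
proof
  assume "pr a b \<in> RL c"
  then obtain t where t: "b \<in> wsi c" "a \<in> ws c t" "b \<notin> ws c t" unfolding RL_def by auto
  have a: "a \<in> wsi c" using ws_sub_wsi t(2) by blast
  show "a \<in> wsi c \<and> b \<in> wsi c \<and> rk c a < rk c b" using t in_ws_iff[OF a, of t] in_ws_iff[OF t(1), of t] a by auto
next
  assume h: "a \<in> wsi c \<and> b \<in> wsi c \<and> rk c a < rk c b"
  then show "pr a b \<in> RL c" unfolding RL_def using in_ws_iff[of a c "rk c b"] in_ws_iff[of b c "rk c b"] rk_less[of b c] by auto
qed

lemma lc_RL: "lc RL"
proof -
  define G where "G S = tk (tr 1 S) (acc (tr 1 S) (tr 2 S)) {m. m \<in> tr 3 S \<or> p1 m \<in> tr 2 S \<and> p2 m \<notin> tr 2 S} {} {} {}" for S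
  define H where "H S \<longleftrightarrow> (\<forall>n. n \<in> acc (tr 1 S) (tr 2 S) \<longleftrightarrow> n \<in> tr 2 S)" for S
  have 3: "lc (\<lambda>S. {m. m \<in> tr 3 S \<or> p1 m \<in> tr 2 S \<and> p2 m \<notin> tr 2 S})" by (rule lc_cop) (intro cop_rules lc_rules rf_intros)
  have 1: "lc G" unfolding G_def by (intro lc_tk 3 lc_acc lc_rules)
  have 2: "cop (\<lambda>S n. H S)" unfolding H_def by (intro cop_rules lc_acc lc_rules rf_intros)
  define R where "R c = arun G (ec c)" for c
  have e: "tr 2 (ec c) = {}" "tr 3 (ec c) = {}" for c unfolding tr_def by simp_all
  have g: "tr 1 (G S) = tr 1 S" "tr 2 (G S) = acc (tr 1 S) (tr 2 S)"
    "tr 3 (G S) = {m. m \<in> tr 3 S \<or> p1 m \<in> tr 2 S \<and> p2 m \<notin> tr 2 S}" for S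
    unfolding G_def by simp_all
  have "tr 1 (R c t) = tr 1 (ec c)" for c t unfolding R_def by (rule arun_tr_const) (rule g)
  then have t1: "tr 1 (R c t) = c" for c t by simp
  have "tr 2 (R c t) = arun (acc c) (tr 2 (ec c)) t" for c t
    unfolding R_def by (rule arun_tr) (simp only: g t1[unfolded R_def])
  then have t2: "tr 2 (R c t) = ws c t" for c t unfolding ws_def e .
  have t3: "tr 3 (R c t) = (\<Union>s\<in>{..<t}. {m. p1 m \<in> ws c s \<and> p2 m \<notin> ws c s})" for c t
    unfolding R_def
  proof (rule arun_union)
    fix s
    show "tr 3 (G (arun G (ec c) s)) = tr 3 (arun G (ec c) s) \<union> {m. p1 m \<in> ws c s \<and> p2 m \<notin> ws c s}"
      unfolding R_def[symmetric] g t2 by blast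
  qed (rule e)
  have H: "H (R c t) \<longleftrightarrow> acc c (ws c t) = ws c t" for c t unfolding H_def t1 t2 by blast
  have "lc (\<lambda>c. R c (LEAST t. H (R c t)))" unfolding R_def
    by (rule lc_while[OF 1 2 lc_ec[OF lc_ident]]) (unfold R_def[symmetric] H Ord_le_iff_acc[symmetric], blast)
  from lc_tr[OF this, of 3] have U: "lc (\<lambda>c. \<Union>s\<in>{..<Ord c}. {m. p1 m \<in> ws c s \<and> p2 m \<notin> ws c s})"
    unfolding H Ord_as_least[symmetric] t3 .
  have L: "lc (\<lambda>c. {m. p2 m \<in> wsi c \<and> m \<in> (\<Union>s\<in>{..<Ord c}. {m. p1 m \<in> ws c s \<and> p2 m \<notin> ws c s})})"
    by (rule lc_cop) (intro cop_and cop_mem_lc U lc_wsi rf_intros)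
  have E: "{m. p2 m \<in> wsi c \<and> m \<in> (\<Union>s\<in>{..<Ord c}. {m. p1 m \<in> ws c s \<and> p2 m \<notin> ws c s})} = RL c" for c
    unfolding RL_def by auto
  show ?thesis using L unfolding E .
qed

definition nzero :: "nat set \<Rightarrow> nat \<Rightarrow> bool" where "nzero c b \<longleftrightarrow> b \<in> wsi c \<and> (\<forall>a. pr a b \<notin> RL c)"
definition nsuc :: "nat set \<Rightarrow> nat \<Rightarrow> nat \<Rightarrow> bool" where
  "nsuc c a b \<longleftrightarrow> pr a b \<in> RL c \<and> (\<forall>d. pr a d \<in> RL c \<longrightarrow> pr d b \<notin> RL c)"
definition nlim :: "nat set \<Rightarrow> nat \<Rightarrow> bool" where
  "nlim c b \<longleftrightarrow> b \<in> wsi c \<and> (\<exists>a. pr a b \<in> RL c) \<and> (\<forall>a. pr a b \<in> RL c \<longrightarrow> (\<exists>d. pr a d \<in> RL c \<and> pr d b \<in> RL c))"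

lemma cop_nodes: "rf a \<Longrightarrow> cop (\<lambda>c n. nzero c (a n))" "rf a \<Longrightarrow> rf b \<Longrightarrow> cop (\<lambda>c n. nsuc c (a n) (b n))" "rf a \<Longrightarrow> cop (\<lambda>c n. nlim c (a n))"
proof -
  have "cop (\<lambda>c n. nzero c n)" unfolding nzero_def by (intro cop_rules lc_wsi lc_RL rf_intros)
  from cop_sub[OF this] show "rf a \<Longrightarrow> cop (\<lambda>c n. nzero c (a n))" .
  have "cop (\<lambda>c m. nsuc c (p1 m) (p2 m))" unfolding nsuc_def by (intro cop_rules lc_wsi lc_RL rf_intros)
  from cop_sub[OF this rf_pr[of a b]] show "rf a \<Longrightarrow> rf b \<Longrightarrow> cop (\<lambda>c n. nsuc c (a n) (b n))" by simp
  have "cop (\<lambda>c n. nlim c n)" unfolding nlim_def by (intro cop_rules lc_wsi lc_RL rf_intros)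
  from cop_sub[OF this] show "rf a \<Longrightarrow> cop (\<lambda>c n. nlim c (a n))" .
qed

lemma rk_below: assumes "b \<in> wsi c" "t < rk c b" obtains a where "a \<in> wsi c" "rk c a = t"
  using rk_surj[of t c] rk_less[OF assms(1)] assms(2) order.strict_trans by blast

lemma nzero_iff: "nzero c b \<longleftrightarrow> b \<in> wsi c \<and> rk c b = tz"
proof
  assume h: "nzero c b"
  then have b: "b \<in> wsi c" and no: "pr a b \<notin> RL c" for a unfolding nzero_def by simp_all
  have "rk c b = tz"
  proof (rule ccontr)
    assume "rk c b \<noteq> tz"
    then have "tz < rk c b" by (simp add: tz_less_iff)
    then obtain a where "a \<in> wsi c" "rk c a = tz" by (rule rk_below[OF b])
    then show False using no[of a] b \<open>tz < rk c b\<close> unfolding in_RL by simp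
  qed
  then show "b \<in> wsi c \<and> rk c b = tz" using b by simp
qed (simp add: nzero_def in_RL not_less_tz)

lemma nsuc_iff: "nsuc c a b \<longleftrightarrow> a \<in> wsi c \<and> b \<in> wsi c \<and> rk c b = tsuc (rk c a)"
proof
  assume h: "nsuc c a b"
  then have ab: "a \<in> wsi c" "b \<in> wsi c" "rk c a < rk c b" unfolding nsuc_def in_RL by simp_all
  have "\<not> tsuc (rk c a) < rk c b"
  proof
    assume lt: "tsuc (rk c a) < rk c b"
    then obtain d where "d \<in> wsi c" "rk c d = tsuc (rk c a)" by (rule rk_below[OF ab(2)])
    then show False using h ab lt less_tsuc[of "rk c a"] unfolding nsuc_def in_RL by metis
  qed
  moreover have "tsuc (rk c a) \<le> rk c b" using ab(3) by (simp add: tsuc_le_iff)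
  ultimately show "a \<in> wsi c \<and> b \<in> wsi c \<and> rk c b = tsuc (rk c a)" using ab by simp
next
  assume h: "a \<in> wsi c \<and> b \<in> wsi c \<and> rk c b = tsuc (rk c a)"
  then show "nsuc c a b" unfolding nsuc_def in_RL by (auto simp: less_tsuc less_tsuc_iff not_le)
qed

lemma nlim_iff: "nlim c b \<longleftrightarrow> b \<in> wsi c \<and> tlim (rk c b)"
proof
  assume h: "nlim c b"
  then have b: "b \<in> wsi c" unfolding nlim_def by simp
  have "tlim (rk c b)" unfolding tlim_def
  proof (intro conjI allI impI)
    obtain a where "pr a b \<in> RL c" using h unfolding nlim_def by blast
    then show "rk c b \<noteq> tz" unfolding in_RL using not_less_tz by auto
    fix t assume t: "t < rk c b"
    then obtain a where a: "a \<in> wsi c" "rk c a = t" by (rule rk_below[OF b])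
    then obtain d where "pr a d \<in> RL c" "pr d b \<in> RL c" using h b t unfolding nlim_def in_RL by blast
    then show "tsuc t < rk c b" using a tsuc_le_iff[of t "rk c d"] unfolding in_RL by (auto intro: le_less_trans)
  qed
  then show "b \<in> wsi c \<and> tlim (rk c b)" using b by simp
next
  assume h: "b \<in> wsi c \<and> tlim (rk c b)"
  then have b: "b \<in> wsi c" and l: "tlim (rk c b)" by simp_all
  have "\<exists>d. pr a d \<in> RL c \<and> pr d b \<in> RL c" if a: "pr a b \<in> RL c" for a
  proof -
    have lt: "tsuc (rk c a) < rk c b" using a tlimD[OF l] unfolding in_RL by simp
    then obtain d where "d \<in> wsi c" "rk c d = tsuc (rk c a)" by (rule rk_below[OF b])
    then show ?thesis using a b lt less_tsuc[of "rk c a"] unfolding in_RL by metis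
  qed
  moreover obtain a where "a \<in> wsi c" "rk c a = tz" using tlim_pos[OF l] by (rule rk_below[OF b])
  then have "pr a b \<in> RL c" using b tlim_pos[OF l] unfolding in_RL by simp
  ultimately show "nlim c b" unfolding nlim_def using b by blast
qed

definition cell :: "cfg \<Rightarrow> nat \<Rightarrow> nat \<Rightarrow> bool" where
  "cell C k n = (if k = 0 then tin C n else if k = 1 then tsc C n else if k = 2 then tout C n else False)"

text \<open>Here \<open>u\<close> is a number in the format of \<open>node\<close>, packing state,
  head position and reading. These determine the next state and head; for \<open>ncell\<close> one
  also needs the previous value \<open>w\<close> of the cell, nonzero meaning on.\<close>

definition nst :: "nat \<Rightarrow> nat \<Rightarrow> nat" where
  "nst r u = (if p1 u = 1 then 1 else if act r (p1 u) (p2 (p2 u)) = 0 then 1 else fq (act r (p1 u) (p2 (p2 u))))"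
definition nhd :: "nat \<Rightarrow> nat \<Rightarrow> nat" where
  "nhd r u = (if p1 u = 1 then p1 (p2 u) else if act r (p1 u) (p2 (p2 u)) = 0 then p1 (p2 u)
     else if fm (act r (p1 u) (p2 (p2 u))) = 0 then p1 (p2 u) - 1 else Suc (p1 (p2 u)))"
definition ncell :: "nat \<Rightarrow> nat \<Rightarrow> nat \<Rightarrow> nat \<Rightarrow> nat \<Rightarrow> bool" where
  "ncell r u k n w \<longleftrightarrow> (if p1 u \<noteq> 1 \<and> act r (p1 u) (p2 (p2 u)) \<noteq> 0 \<and> n = p1 (p2 u) then
      k = 0 \<and> odd (fw (act r (p1 u) (p2 (p2 u)))) \<or> k = 1 \<and> odd (fw (act r (p1 u) (p2 (p2 u))) div 2)
      \<or> k = 2 \<and> odd (fw (act r (p1 u) (p2 (p2 u))) div 2 div 2)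
     else w \<noteq> 0)"

definition node :: "nat set \<Rightarrow> cfg \<Rightarrow> nat" where "node z C = pr (st C) (pr (cfg.hd C) (readcode z C))"

lemma step_node: "st (step (P r) z C) = nst r (node z C)" "cfg.hd (step (P r) z C) = nhd r (node z C)"
  "(w \<noteq> 0 \<longleftrightarrow> cell C k n) \<Longrightarrow> cell (step (P r) z C) k n \<longleftrightarrow> ncell r (node z C) k n w"
  unfolding step_act nst_def nhd_def ncell_def node_def p_pr cell_def
  by (auto simp: div_mult2_eq[symmetric])

lemma rf_nst: "rf u \<Longrightarrow> rf (\<lambda>n. nst r (u n))" "rf u \<Longrightarrow> rf (\<lambda>n. nhd r (u n))"
  unfolding nst_def nhd_def by (intro rf_if_eq rf_act rf_f rf_const rf_p1 rf_p2 rf_minus rf_Suc; assumption)+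

lemma cop_ncell: "rf u \<Longrightarrow> rf k \<Longrightarrow> rf n \<Longrightarrow> rf w \<Longrightarrow> cop (\<lambda>c m. ncell r (u m) (k m) (n m) (w m))"
  unfolding ncell_def by (intro cop_rules rf_act rf_f rf_intros)

text \<open>A function \<open>f\<close> codes a run of program \<open>r\<close> along the nodes of \<open>c\<close>: \<open>f (pr 0 m)\<close> is bit \<open>m\<close> of the oracle,
  \<open>f (pr 1 b)\<close> state, head and symbols read at node \<open>b\<close>, \<open>f (pr 3 (pr b (pr k n)))\<close> cell \<open>n\<close> of tape \<open>k\<close> at node \<open>b\<close>.
  At a limit node \<open>b\<close>, \<open>f (pr 4 (pr a \<dots>))\<close> is a node between \<open>a\<close> and \<open>b\<close> at which the cell is on and
  \<open>f (pr 5 \<dots>)\<close> a node from which on the cell is off; \<open>f (pr 6 0)\<close> is the halting node.  These Skolem functions make the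
  conditions closed; each involves only the values \<open>u\<close>, \<open>v\<close>, \<open>w\<close> of \<open>f\<close> at three arguments \<open>i\<close>, \<open>j\<close>, \<open>l\<close>.\<close>

definition Crd :: "nat set \<Rightarrow> nat \<Rightarrow> nat \<Rightarrow> nat \<Rightarrow> nat \<Rightarrow> bool" where
  "Crd c i j u v \<longleftrightarrow> (p1 i = 1 \<and> p2 i \<in> wsi c \<longrightarrow> p2 (p2 u) div 2 div 2 div 2 div 2 = 0 \<and>
      (j = pr 0 (p1 (p2 u)) \<longrightarrow> (odd (p2 (p2 u)) \<longleftrightarrow> v \<noteq> 0)) \<and>
      (j = pr 3 (pr (p2 i) (pr 0 (p1 (p2 u)))) \<longrightarrow> (odd (p2 (p2 u) div 2) \<longleftrightarrow> v \<noteq> 0)) \<and>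
      (j = pr 3 (pr (p2 i) (pr 1 (p1 (p2 u)))) \<longrightarrow> (odd (p2 (p2 u) div 2 div 2) \<longleftrightarrow> v \<noteq> 0)) \<and>
      (j = pr 3 (pr (p2 i) (pr 2 (p1 (p2 u)))) \<longrightarrow> (odd (p2 (p2 u) div 2 div 2 div 2) \<longleftrightarrow> v \<noteq> 0)))"
definition Czero :: "nat set \<Rightarrow> nat \<Rightarrow> nat \<Rightarrow> bool" where
  "Czero c i u \<longleftrightarrow> (p1 i = 1 \<and> nzero c (p2 i) \<longrightarrow> p1 u = 0 \<and> p1 (p2 u) = 0) \<and> (p1 i = 3 \<and> nzero c (p1 (p2 i)) \<longrightarrow> u = 0)"
definition Csuc :: "nat \<Rightarrow> nat set \<Rightarrow> nat \<Rightarrow> nat \<Rightarrow> nat \<Rightarrow> nat \<Rightarrow> nat \<Rightarrow> nat \<Rightarrow> bool" where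
  "Csuc r c i j l u v w \<longleftrightarrow> (p1 i = 1 \<and> p1 j = 1 \<and> nsuc c (p2 i) (p2 j) \<longrightarrow> p1 v = nst r u \<and> p1 (p2 v) = nhd r u) \<and>
     (p1 i = 1 \<and> p1 j = 3 \<and> nsuc c (p2 i) (p1 (p2 j)) \<and> l = pr 3 (pr (p2 i) (p2 (p2 j))) \<longrightarrow>
       (v \<noteq> 0 \<longleftrightarrow> ncell r u (p1 (p2 (p2 j))) (p2 (p2 (p2 j))) w))"
definition Clim :: "nat set \<Rightarrow> nat \<Rightarrow> nat \<Rightarrow> nat \<Rightarrow> nat \<Rightarrow> nat \<Rightarrow> nat \<Rightarrow> bool" where
  "Clim c i j l u v w \<longleftrightarrow> (p1 i = 1 \<and> nlim c (p2 i) \<longrightarrow> p1 u = 2 \<and> p1 (p2 u) = 0) \<and>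
     (p1 i = 3 \<and> nlim c (p1 (p2 i)) \<and> u \<noteq> 0 \<and> p1 j = 4 \<and> p2 (p2 j) = p2 i \<and> pr (p1 (p2 j)) (p1 (p2 i)) \<in> RL c \<longrightarrow>
       pr v (p1 (p2 j)) \<notin> RL c \<and> pr v (p1 (p2 i)) \<in> RL c \<and> (l = pr 3 (pr v (p2 (p2 i))) \<longrightarrow> w \<noteq> 0)) \<and>
     (p1 i = 3 \<and> nlim c (p1 (p2 i)) \<and> u = 0 \<and> j = pr 5 (p2 i) \<longrightarrow>
       pr v (p1 (p2 i)) \<in> RL c \<and> (p1 l = 3 \<and> p2 (p2 l) = p2 (p2 i) \<and> pr (p1 (p2 l)) v \<notin> RL c \<and> pr (p1 (p2 l)) (p1 (p2 i)) \<in> RL c \<longrightarrow> w = 0))"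
definition Chalt :: "nat set \<Rightarrow> nat \<Rightarrow> nat \<Rightarrow> nat \<Rightarrow> nat \<Rightarrow> bool" where
  "Chalt c i j u v \<longleftrightarrow> (i = pr 6 0 \<longrightarrow> u \<in> wsi c \<and> (j = pr 1 u \<longrightarrow> p1 v = 1) \<and> (j = pr 3 (pr u (pr 2 0)) \<longrightarrow> v \<noteq> 0) \<and>
     (p1 j = 1 \<and> pr (p2 j) u \<in> RL c \<longrightarrow> p1 v \<noteq> 1))"
definition Con :: "nat \<Rightarrow> nat set \<Rightarrow> nat \<Rightarrow> nat \<Rightarrow> nat \<Rightarrow> nat \<Rightarrow> nat \<Rightarrow> nat \<Rightarrow> bool" where
  "Con r c i j l u v w \<longleftrightarrow> Crd c i j u v \<and> Czero c i u \<and> Csuc r c i j l u v w \<and> Clim c i j l u v w \<and> Chalt c i j u v"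

lemma cop_Con:
  assumes rf: "rf i" "rf j" "rf l" "rf u" "rf v" "rf w"
  shows "cop (\<lambda>c n. Con r c (i n) (j n) (l n) (u n) (v n) (w n))"
proof -
  have "cop (\<lambda>c n. Crd c (i n) (j n) (u n) (v n))"
    unfolding Crd_def by (intro cop_rules lc_wsi lc_RL cop_nodes rf rf_intros)
  moreover have "cop (\<lambda>c n. Czero c (i n) (u n))"
    unfolding Czero_def by (intro cop_nodes cop_rules lc_wsi lc_RL rf rf_intros)
  moreover have "cop (\<lambda>c n. Csuc r c (i n) (j n) (l n) (u n) (v n) (w n))"
    unfolding Csuc_def by (intro cop_nodes cop_ncell cop_rules lc_wsi lc_RL rf rf_nst rf_intros)
  moreover have "cop (\<lambda>c n. Clim c (i n) (j n) (l n) (u n) (v n) (w n))"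
    unfolding Clim_def by (intro cop_nodes cop_rules lc_wsi lc_RL rf rf_intros)
  moreover have "cop (\<lambda>c n. Chalt c (i n) (j n) (u n) (v n))"
    unfolding Chalt_def by (intro cop_nodes cop_rules lc_wsi lc_RL rf rf_intros)
  ultimately show ?thesis unfolding Con_def by (intro cop_and)
qed

lemma cell_clim: assumes "tlim t" shows "cell (clim C t) k n \<longleftrightarrow> n \<in> Lim (\<lambda>d. Collect (cell (C d) k)) t"
proof -
  have "cell X k = (if k = 0 then tin X else if k = 1 then tsc X else if k = 2 then tout X else (\<lambda>n. False))" for X
    by (rule ext) (simp add: cell_def)
  then show ?thesis using tlim_pos[OF assms] by (auto simp: clim_def Lim_def)
qed

lemma node_eqI:
  assumes rd: "\<And>j. Crd c (pr 1 b) j u (f j)" and z: "z = {m. f (pr 0 m) \<noteq> 0}" and b: "b \<in> wsi c"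
    and u: "p1 u = st C" "p1 (p2 u) = cfg.hd C"
    and cells: "\<And>k n. f (pr 3 (pr b (pr k n))) \<noteq> 0 \<longleftrightarrow> cell C k n"
  shows "u = node z C"
proof -
  have "p2 (p2 u) = readcode z C"
    unfolding readcode_def using four_bits[of "p2 (p2 u)" "cfg.hd C \<in> z" "tin C (cfg.hd C)" "tsc C (cfg.hd C)" "tout C (cfg.hd C)"]
      rd[of "pr 0 (cfg.hd C)"] rd[of "pr 3 (pr b (pr 0 (cfg.hd C)))"] rd[of "pr 3 (pr b (pr 1 (cfg.hd C)))"] rd[of "pr 3 (pr b (pr 2 (cfg.hd C)))"]
      b u(2) cells[of 0 "cfg.hd C"] cells[of 1 "cfg.hd C"] cells[of 2 "cfg.hd C"]
    unfolding Crd_def z cell_def by simp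
  then show ?thesis unfolding node_def u[symmetric] by (metis pr_p)
qed

text \<open>By induction on the rank, the conditions at a node force its configuration from those at
  nodes of smaller rank. In particular nodes of equal rank carry the same configuration, although no
  condition compares them.\<close>

lemma Con_sound:
  assumes con: "\<And>i j l. Con r c i j l (f i) (f j) (f l)" and z: "z = {m. f (pr 0 m) \<noteq> 0}"
  shows "b \<in> wsi c \<Longrightarrow> f (pr 1 b) = node z (crun (P r) z {} (rk c b)) \<and>
     (\<forall>k n. f (pr 3 (pr b (pr k n))) \<noteq> 0 \<longleftrightarrow> cell (crun (P r) z {} (rk c b)) k n)"
proof (induction "rk c b" arbitrary: b rule: less_induct)
  case (less b)
  define C where "C = crun (P r) z {}"
  have IH: "f (pr 1 a) = node z (C (rk c a))" "\<And>k n. f (pr 3 (pr a (pr k n))) \<noteq> 0 \<longleftrightarrow> cell (C (rk c a)) k n"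
    if "a \<in> wsi c" "rk c a < rk c b" for a using less.hyps[of a] that unfolding C_def by blast+
  have rd: "Crd c (pr 1 b) j (f (pr 1 b)) (f j)" for j using con[of "pr 1 b" j] unfolding Con_def by blast
  have cons: "Czero c i (f i)" "Csuc r c i j l (f i) (f j) (f l)" "Clim c i j l (f i) (f j) (f l)" for i j l
    using con[of i j l] unfolding Con_def by blast+
  have "p1 (f (pr 1 b)) = st (C (rk c b)) \<and> p1 (p2 (f (pr 1 b))) = cfg.hd (C (rk c b)) \<and>
     (\<forall>k n. f (pr 3 (pr b (pr k n))) \<noteq> 0 \<longleftrightarrow> cell (C (rk c b)) k n)"
  proof (cases "rk c b" rule: time_cases)
    case 1
    then have nz: "nzero c b" using less.prems unfolding nzero_iff by simp
    have "p1 (f (pr 1 b)) = 0" "p1 (p2 (f (pr 1 b))) = 0" using cons(1)[of "pr 1 b"] nz unfolding Czero_def by simp_all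
    moreover have "f (pr 3 (pr b (pr k n))) = 0" for k n using cons(1)[of "pr 3 (pr b (pr k n))"] nz unfolding Czero_def by simp
    ultimately show ?thesis unfolding 1 C_def by (simp add: init_cfg_def cell_def)
  next
    case (2 t)
    have "t < rk c b" unfolding 2 by (rule less_tsuc)
    then obtain a where a: "a \<in> wsi c" "rk c a = t" by (rule rk_below[OF less.prems])
    have ns: "nsuc c a b" unfolding nsuc_iff using a less.prems 2 by simp
    have ia: "f (pr 1 a) = node z (C t)" "\<And>k n. f (pr 3 (pr a (pr k n))) \<noteq> 0 \<longleftrightarrow> cell (C t) k n"
      using IH[OF a(1)] a(2) \<open>t < rk c b\<close> by auto
    have Cs: "C (rk c b) = step (P r) z (C t)" unfolding 2 C_def by simp
    have "p1 (f (pr 1 b)) = nst r (f (pr 1 a)) \<and> p1 (p2 (f (pr 1 b))) = nhd r (f (pr 1 a))"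
      using cons(2)[of "pr 1 a" "pr 1 b"] ns unfolding Csuc_def by simp
    moreover have "f (pr 3 (pr b (pr k n))) \<noteq> 0 \<longleftrightarrow> ncell r (f (pr 1 a)) k n (f (pr 3 (pr a (pr k n))))" for k n
      using cons(2)[of "pr 1 a" "pr 3 (pr b (pr k n))" "pr 3 (pr a (pr k n))"] ns unfolding Csuc_def by simp
    ultimately show ?thesis unfolding Cs step_node(1,2) ia(1) using step_node(3)[OF ia(2), where z = z and r = r] by simp
  next
    case 3
    have nl: "nlim c b" using 3 less.prems unfolding nlim_iff by simp
    have Cl: "C (rk c b) = clim C (rk c b)" unfolding C_def by (rule crun_tlim[OF 3])
    have "p1 (f (pr 1 b)) = 2 \<and> p1 (p2 (f (pr 1 b))) = 0" using cons(3)[of "pr 1 b"] nl unfolding Clim_def by simp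
    moreover have "f (pr 3 (pr b (pr k n))) \<noteq> 0 \<longleftrightarrow> n \<in> Lim (\<lambda>d. Collect (cell (C d) k)) (rk c b)" for k n
    proof (cases "f (pr 3 (pr b (pr k n))) = 0")
      case True
      define a where "a = f (pr 5 (pr b (pr k n)))"
      have ab: "pr a b \<in> RL c" using cons(3)[of "pr 3 (pr b (pr k n))" "pr 5 (pr b (pr k n))"] nl True unfolding Clim_def a_def by simp
      have off: "f (pr 3 (pr d (pr k n))) = 0" if "pr d a \<notin> RL c" "pr d b \<in> RL c" for d
        using cons(3)[of "pr 3 (pr b (pr k n))" "pr 5 (pr b (pr k n))" "pr 3 (pr d (pr k n))"] nl True that unfolding Clim_def a_def by simp
      have "n \<notin> Lim (\<lambda>d. Collect (cell (C d) k)) (rk c b)"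
      proof
        assume L: "n \<in> Lim (\<lambda>d. Collect (cell (C d) k)) (rk c b)"
        have "rk c a < rk c b" using ab unfolding in_RL by simp
        with L obtain t where t: "rk c a \<le> t" "t < rk c b" "n \<in> Collect (cell (C t) k)" by (rule in_LimD)
        from t(2) obtain d where d: "d \<in> wsi c" "rk c d = t" by (rule rk_below[OF less.prems])
        have "f (pr 3 (pr d (pr k n))) = 0" by (rule off) (use d t less.prems in \<open>simp_all add: in_RL not_less\<close>)
        then show False using IH(2)[of d k n] d t by simp
      qed
      then show ?thesis using True by simp
    next
      case False
      have "n \<in> Lim (\<lambda>d. Collect (cell (C d) k)) (rk c b)"
      proof (rule in_LimI)
        fix t assume "t < rk c b"
        then obtain a where a: "a \<in> wsi c" "rk c a = t" by (rule rk_below[OF less.prems])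
        have ab: "pr a b \<in> RL c" using a less.prems \<open>t < rk c b\<close> unfolding in_RL by simp
        define d where "d = f (pr 4 (pr a (pr b (pr k n))))"
        have d: "pr d a \<notin> RL c" "pr d b \<in> RL c" "f (pr 3 (pr d (pr k n))) \<noteq> 0"
          using cons(3)[of "pr 3 (pr b (pr k n))" "pr 4 (pr a (pr b (pr k n)))" "pr 3 (pr d (pr k n))"] nl False ab unfolding Clim_def d_def[symmetric] by simp_all
        then have "t \<le> rk c d" "rk c d < rk c b" "d \<in> wsi c" using a unfolding in_RL by auto
        then show "\<exists>d. t \<le> d \<and> d < rk c b \<and> n \<in> Collect (cell (C d) k)" using IH(2)[of d k n] d(3) by auto
      qed
      then show ?thesis using False by simp
    qed
    moreover have "st (clim C (rk c b)) = 2" "cfg.hd (clim C (rk c b)) = 0" unfolding clim_def by simp_all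
    ultimately show ?thesis unfolding Cl cell_clim[OF 3] by presburger
  qed
  then have g: "p1 (f (pr 1 b)) = st (C (rk c b))" "p1 (p2 (f (pr 1 b))) = cfg.hd (C (rk c b))"
     "\<And>k n. f (pr 3 (pr b (pr k n))) \<noteq> 0 \<longleftrightarrow> cell (C (rk c b)) k n" by blast+
  show ?case using node_eqI[OF rd z less.prems g] g(3) unfolding C_def by blast
qed

lemma Con_halts:
  assumes con: "\<And>i j l. Con r c i j l (f i) (f j) (f l)" and z: "z = {m. f (pr 0 m) \<noteq> 0}"
  obtains w where "halts_with (P r) z {} w" "0 \<in> w"
proof -
  note s = Con_sound[OF con z]
  define b where "b = f (pr 6 0)"
  have ch: "Chalt c (pr 6 0) j b (f j)" for j using con[of "pr 6 0" j] unfolding Con_def b_def by blast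
  have b: "b \<in> wsi c" using ch unfolding Chalt_def by blast
  have 1: "st (crun (P r) z {} (rk c b)) = 1" using ch[of "pr 1 b"] s[OF b] unfolding Chalt_def node_def by simp
  have 2: "tout (crun (P r) z {} (rk c b)) 0" using ch[of "pr 3 (pr b (pr 2 0))"] s[OF b] unfolding Chalt_def cell_def by simp
  have 3: "st (crun (P r) z {} u) \<noteq> 1" if u: "u < rk c b" for u
  proof -
    obtain a where a: "a \<in> wsi c" "rk c a = u" using u by (rule rk_below[OF b])
    then have "pr a b \<in> RL c" unfolding in_RL using b u by simp
    then have "p1 (f (pr 1 a)) \<noteq> 1" using ch[of "pr 1 a"] unfolding Chalt_def by simp
    then show ?thesis using s[OF a(1)] a(2) unfolding node_def by simp
  qed
  have "halts_with (P r) z {} {n. tout (crun (P r) z {} (rk c b)) n}"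
    unfolding halts_with_iff using 1 3 by blast
  then show ?thesis using that 2 by blast
qed

text \<open>The true run is copied onto the nodes by rank and the Skolem values are chosen. The
  hypothesis \<open>t < Ord c\<close> supplies a node for the halting time.\<close>

lemma Con_exists:
  assumes t: "t < Ord c" "st (crun (P r) x {} t) = 1" "\<And>u. u < t \<Longrightarrow> st (crun (P r) x {} u) \<noteq> 1" "tout (crun (P r) x {} t) 0"
  obtains f where "\<And>i j l. Con r c i j l (f i) (f j) (f l)" "x = {m. f (pr 0 m) \<noteq> 0}"
proof -
  define C where "C b = crun (P r) x {} (rk c b)" for b
  \<comment> \<open>The last branch is there for the argument \<open>pr 6 0\<close>, the halting
    node; what it gives elsewhere is never constrained.\<close>
  define f where "f m = (if p1 m = 0 then (if p2 m \<in> x then 1 else 0)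
     else if p1 m = 1 then node x (C (p2 m))
     else if p1 m = 3 then (if cell (C (p1 (p2 m))) (p1 (p2 (p2 m))) (p2 (p2 (p2 m))) then 1 else 0)
     else if p1 m = 4 then (SOME d. pr d (p1 (p2 m)) \<notin> RL c \<and> pr d (p1 (p2 (p2 m))) \<in> RL c \<and> cell (C d) (p1 (p2 (p2 (p2 m)))) (p2 (p2 (p2 (p2 m)))))
     else if p1 m = 5 then (SOME a. pr a (p1 (p2 m)) \<in> RL c \<and> (\<forall>d. pr d a \<notin> RL c \<and> pr d (p1 (p2 m)) \<in> RL c \<longrightarrow> \<not> cell (C d) (p1 (p2 (p2 m))) (p2 (p2 (p2 m)))))
     else (SOME b. b \<in> wsi c \<and> rk c b = t))" for m
  have f0: "f (pr 0 m) \<noteq> 0 \<longleftrightarrow> m \<in> x" for m unfolding f_def by simp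
  have f1: "p1 i = 1 \<Longrightarrow> f i = node x (C (p2 i))" for i unfolding f_def by simp
  have f3: "p1 i = 3 \<Longrightarrow> f i \<noteq> 0 \<longleftrightarrow> cell (C (p1 (p2 i))) (p1 (p2 (p2 i))) (p2 (p2 (p2 i)))" for i unfolding f_def by simp
  have "\<exists>b. b \<in> wsi c \<and> rk c b = t" using rk_surj[OF t(1)] by blast
  then have f6: "f (pr 6 0) \<in> wsi c" "rk c (f (pr 6 0)) = t"
    using someI_ex[of "\<lambda>b. b \<in> wsi c \<and> rk c b = t"] unfolding f_def by simp_all
  have lim: "cell (C b) k n \<longleftrightarrow> n \<in> Lim (\<lambda>d. Collect (cell (crun (P r) x {} d) k)) (rk c b)" if "nlim c b" for b k n
    using that unfolding nlim_iff C_def by (simp add: crun_tlim cell_clim)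
  have f4: "pr (f j) (p1 (p2 j)) \<notin> RL c \<and> pr (f j) b \<in> RL c \<and> cell (C (f j)) k n"
    if j: "p1 j = 4" "p2 (p2 j) = pr b (pr k n)" and b: "nlim c b" "cell (C b) k n" "pr (p1 (p2 j)) b \<in> RL c" for j b k n
  proof -
    define a where "a = p1 (p2 j)"
    have ab: "a \<in> wsi c" "b \<in> wsi c" "rk c a < rk c b" using b(3) unfolding a_def in_RL by simp_all
    have "n \<in> Lim (\<lambda>d. Collect (cell (crun (P r) x {} d) k)) (rk c b)" using b(2) lim[OF b(1)] by simp
    then obtain s where s: "rk c a \<le> s" "s < rk c b" "n \<in> Collect (cell (crun (P r) x {} s) k)" by (rule in_LimD[OF _ ab(3)])
    from s(2) obtain d where d: "d \<in> wsi c" "rk c d = s" by (rule rk_below[OF ab(2)])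
    have "pr d a \<notin> RL c \<and> pr d b \<in> RL c \<and> cell (C d) k n" using s d ab unfolding in_RL C_def by simp
    then have "\<exists>d. pr d a \<notin> RL c \<and> pr d b \<in> RL c \<and> cell (C d) k n" by blast
    from someI_ex[OF this] show ?thesis unfolding f_def a_def using j by simp
  qed
  have f5: "pr (f j) b \<in> RL c \<and> (\<forall>d. pr d (f j) \<notin> RL c \<and> pr d b \<in> RL c \<longrightarrow> \<not> cell (C d) k n)"
    if j: "j = pr 5 (pr b (pr k n))" and b: "nlim c b" "\<not> cell (C b) k n" for j b k n
  proof -
    have bN: "b \<in> wsi c" using b(1) unfolding nlim_iff by simp
    have "n \<notin> Lim (\<lambda>d. Collect (cell (crun (P r) x {} d) k)) (rk c b)" using b(2) lim[OF b(1)] by simp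
    then obtain s where s: "s < rk c b" "\<And>d. s \<le> d \<Longrightarrow> d < rk c b \<Longrightarrow> \<not> cell (crun (P r) x {} d) k n" unfolding Lim_def by auto
    from s(1) obtain a where a: "a \<in> wsi c" "rk c a = s" by (rule rk_below[OF bN])
    have "pr a b \<in> RL c \<and> (\<forall>d. pr d a \<notin> RL c \<and> pr d b \<in> RL c \<longrightarrow> \<not> cell (C d) k n)"
      using s a bN unfolding in_RL C_def by (auto simp: not_less)
    then have "\<exists>a. pr a b \<in> RL c \<and> (\<forall>d. pr d a \<notin> RL c \<and> pr d b \<in> RL c \<longrightarrow> \<not> cell (C d) k n)" by blast
    from someI_ex[OF this] show ?thesis unfolding f_def j by simp
  qed
  have Crd: "Crd c i j (f i) (f j)" for i j
  proof (cases "p1 i = 1")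
    case True
    have rc: "readcode x D div 2 div 2 div 2 div 2 = 0" "odd (readcode x D) \<longleftrightarrow> cfg.hd D \<in> x" "odd (readcode x D div 2) \<longleftrightarrow> tin D (cfg.hd D)"
      "odd (readcode x D div 2 div 2) \<longleftrightarrow> tsc D (cfg.hd D)" "odd (readcode x D div 2 div 2 div 2) \<longleftrightarrow> tout D (cfg.hd D)" for D
      using four_bits[of "readcode x D" "cfg.hd D \<in> x" "tin D (cfg.hd D)" "tsc D (cfg.hd D)" "tout D (cfg.hd D)"] unfolding readcode_def by blast+
    show ?thesis unfolding Crd_def f1[OF True] node_def p_pr rc using f0 f3[of j] by (auto simp: cell_def)
  qed (simp add: Crd_def)
  have Czero: "Czero c i (f i)" for i
  proof -
    have C0: "C b = init_cfg {}" if "nzero c b" for b using that unfolding nzero_iff C_def by simp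
    have "p1 (f i) = 0 \<and> p1 (p2 (f i)) = 0" if h: "p1 i = 1" "nzero c (p2 i)"
      unfolding f1[OF h(1)] C0[OF h(2)] node_def by (simp add: init_cfg_def)
    moreover have "f i = 0" if h: "p1 i = 3" "nzero c (p1 (p2 i))"
    proof -
      have "\<not> cell (C (p1 (p2 i))) k n" for k n unfolding C0[OF h(2)] by (simp add: init_cfg_def cell_def)
      then show ?thesis using f3[OF h(1)] by blast
    qed
    ultimately show ?thesis unfolding Czero_def by blast
  qed
  have Csuc: "Csuc r c i j l (f i) (f j) (f l)" for i j l
  proof -
    have Cs: "C b = step (P r) x (C a)" if "nsuc c a b" for a b using that unfolding nsuc_iff C_def by simp
    have "p1 (f j) = nst r (f i) \<and> p1 (p2 (f j)) = nhd r (f i)" if h: "p1 i = 1" "p1 j = 1" "nsuc c (p2 i) (p2 j)"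
      unfolding f1[OF h(1)] f1[OF h(2)] Cs[OF h(3)] node_def[of x "step _ _ _"] p_pr step_node(1,2) by simp
    moreover have "f j \<noteq> 0 \<longleftrightarrow> ncell r (f i) (p1 (p2 (p2 j))) (p2 (p2 (p2 j))) (f l)"
      if h: "p1 i = 1" "p1 j = 3" "nsuc c (p2 i) (p1 (p2 j))" "l = pr 3 (pr (p2 i) (p2 (p2 j)))"
      unfolding f1[OF h(1)] f3[OF h(2)] Cs[OF h(3)] by (rule step_node(3)) (use f3[of l] h(4) in simp)
    ultimately show ?thesis unfolding Csuc_def by blast
  qed
  have Clim: "Clim c i j l (f i) (f j) (f l)" for i j l
  proof -
    define b k n where "b = p1 (p2 i)" and "k = p1 (p2 (p2 i))" and "n = p2 (p2 (p2 i))"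
    have i2: "p2 i = pr b (pr k n)" "p2 (p2 i) = pr k n" unfolding b_def k_def n_def by simp_all
    have "p1 (f i) = 2 \<and> p1 (p2 (f i)) = 0" if h: "p1 i = 1" "nlim c (p2 i)"
      unfolding f1[OF h(1)] node_def p_pr C_def using h(2) unfolding nlim_iff by (simp add: crun_tlim clim_def)
    moreover have "pr (f j) (p1 (p2 j)) \<notin> RL c \<and> pr (f j) b \<in> RL c \<and> (l = pr 3 (pr (f j) (pr k n)) \<longrightarrow> f l \<noteq> 0)"
      if h: "p1 i = 3" "nlim c b" "f i \<noteq> 0" "p1 j = 4" "p2 (p2 j) = p2 i" "pr (p1 (p2 j)) b \<in> RL c"
    proof -
      have "cell (C b) k n" using f3[OF h(1)] h(3) unfolding b_def k_def n_def by simp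
      from f4[OF h(4) h(5)[unfolded i2(1)] h(2) this h(6)] show ?thesis using f3[of l] by auto
    qed
    moreover have "pr (f j) b \<in> RL c \<and> (p1 l = 3 \<and> p2 (p2 l) = pr k n \<and> pr (p1 (p2 l)) (f j) \<notin> RL c \<and> pr (p1 (p2 l)) b \<in> RL c \<longrightarrow> f l = 0)"
      if h: "p1 i = 3" "nlim c b" "f i = 0" "j = pr 5 (p2 i)"
    proof -
      have "\<not> cell (C b) k n" using f3[OF h(1)] h(3) unfolding b_def k_def n_def by simp
      from f5[OF h(4)[unfolded i2(1)] h(2) this] show ?thesis using f3[of l] by auto
    qed
    ultimately show ?thesis unfolding Clim_def i2(2) b_def[symmetric] by blast
  qed
  have Chalt: "Chalt c i j (f i) (f j)" for i j
  proof (cases "i = pr 6 0")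
    case True
    define b where "b = f (pr 6 0)"
    have b: "b \<in> wsi c" "C b = crun (P r) x {} t" "rk c b = t" using f6 unfolding b_def C_def by simp_all
    have "p1 (f j) \<noteq> 1" if "p1 j = 1" "pr (p2 j) b \<in> RL c"
      unfolding f1[OF that(1)] node_def p_pr C_def using that(2) b(3) t(3) unfolding in_RL by simp
    moreover have "j = pr 1 b \<longrightarrow> p1 (f j) = 1" using f1[of "pr 1 b"] b(2) t(2) by (simp add: node_def)
    moreover have "j = pr 3 (pr b (pr 2 0)) \<longrightarrow> f j \<noteq> 0" using f3[of "pr 3 (pr b (pr 2 0))"] b(2) t(4) by (simp add: cell_def)
    ultimately show ?thesis unfolding Chalt_def True b_def[symmetric] using b(1) by blast
  qed (simp add: Chalt_def)
  show ?thesis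
  proof (rule that[of f])
    show "Con r c i j l (f i) (f j) (f l)" for i j l unfolding Con_def using Crd Czero Csuc Clim Chalt by blast
    show "x = {m. f (pr 0 m) \<noteq> 0}" using f0 by auto
  qed
qed

section \<open>The tree of finite approximations to an accepting run\<close>

definition dfd :: "nat \<Rightarrow> nat \<Rightarrow> bool" where "dfd s i \<longleftrightarrow> ((\<lambda>n. p2 (n - 1)) ^^ i) s \<noteq> 0"
definition ev :: "nat \<Rightarrow> nat \<Rightarrow> nat" where "ev s i = p1 (((\<lambda>n. p2 (n - 1)) ^^ i) s - 1)"

text \<open>A nonempty list is coded as the successor of the pair of its head and the code of its
  tail, so \<open>p2 (n - 1)\<close> is the tail map; it fixes 0, the code of the empty
  list.\<close>

lemma list_decode_tail: "list_decode (((\<lambda>n. p2 (n - 1)) ^^ i) s) = drop i (list_decode s)"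
proof (induction i)
  case (Suc i)
  have t: "list_decode (p2 (n - 1)) = drop 1 (list_decode n)" for n
    by (cases n) (simp_all add: p_zero list_decode_Suc_p del: list_decode.simps(2))
  show ?case unfolding funpow.simps o_apply t Suc by simp
qed simp

lemma dfd_iff: "dfd s i \<longleftrightarrow> i < length (list_decode s)"
proof -
  have n: "n \<noteq> 0 \<longleftrightarrow> list_decode n \<noteq> []" for n by (cases n) (simp_all add: list_decode_Suc_p del: list_decode.simps(2))
  show ?thesis unfolding dfd_def n list_decode_tail by (simp add: not_le)
qed

lemma ev_nth: assumes "i < length (list_decode s)" shows "ev s i = list_decode s ! i"
proof -
  define m where "m = ((\<lambda>n. p2 (n - 1)) ^^ i) s"
  have d: "list_decode m = drop i (list_decode s)" unfolding m_def by (rule list_decode_tail)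
  have "m \<noteq> 0" using assms dfd_iff[of s i] unfolding dfd_def m_def by simp
  then obtain k where k: "m = Suc k" by (cases m) auto
  have "p1 k = List.hd (list_decode m)" unfolding k list_decode_Suc_p by simp
  also have "\<dots> = list_decode s ! i" unfolding d using assms by (rule hd_drop_conv_nth)
  finally show ?thesis unfolding ev_def m_def[symmetric] k by simp
qed

lemma cop_dfd: "rf s \<Longrightarrow> rf i \<Longrightarrow> cop (\<lambda>X n. dfd (s n) (i n))"
  unfolding dfd_def by (intro cop_not cop_eq rf_iter rf_p2 rf_minus rf_const rf_id)

lemma rf_ev: "rf s \<Longrightarrow> rf i \<Longrightarrow> rf (\<lambda>n. ev (s n) (i n))"
  unfolding ev_def by (intro rf_iter rf_p1 rf_p2 rf_minus rf_const rf_id)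

definition ext :: "nat \<Rightarrow> nat \<Rightarrow> bool" where
  "ext s s' \<longleftrightarrow> (\<forall>i. dfd s i \<longrightarrow> dfd s' i \<and> ev s i = ev s' i) \<and> (\<exists>i. dfd s' i \<and> \<not> dfd s i)"

text \<open>Every condition involves three arguments only, so a function satisfies all of them just
  when the codes of all its finite initial segments lie in this set. Values are arbitrary numbers,
  and the tree is infinitely branching.\<close>

definition TT :: "nat \<Rightarrow> nat set \<Rightarrow> nat set" where
  "TT r c = {s. \<forall>i j l. dfd s i \<and> dfd s j \<and> dfd s l \<longrightarrow> Con r c i j l (ev s i) (ev s j) (ev s l)}"

text \<open>The well-founded part of proper extension consists of the nodes lying on no branch.\<close>

definition Find :: "nat \<Rightarrow> nat set \<Rightarrow> nat set" where
  "Find r c = {m. \<exists>s. s \<in> TT r c \<and> s \<notin> wsi {k. p1 k \<in> TT r c \<and> ext (p2 k) (p1 k)} \<and> dfd s (pr 0 m) \<and> ev s (pr 0 m) \<noteq> 0}"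

lemma lc_Find: "lc (Find r)"
proof -
  have T: "lc (TT r)" unfolding TT_def
    by (rule lc_cop) (intro cop_Con cop_dfd cop_rules rf_ev rf_intros)
  have E: "lc (\<lambda>c. {k. p1 k \<in> TT r c \<and> ext (p2 k) (p1 k)})" unfolding ext_def
    by (rule lc_cop) (intro cop_dfd cop_rules T rf_ev rf_intros)
  show ?thesis unfolding Find_def
    by (rule lc_cop) (intro cop_dfd cop_rules T lc_then[OF E lc_wsi] rf_ev rf_intros)
qed

lemma ext_length: "ext s s' \<Longrightarrow> length (list_decode s) < length (list_decode s')"
  unfolding ext_def dfd_iff by (metis leI less_le_trans)

text \<open>A sequence outside the well-founded part has a proper extension outside it, and so on;
  the resulting branch codes an accepting run with some oracle, which can only be \<open>x\<close>.
  Conversely the run with oracle \<open>x\<close> fits along \<open>c\<close> and is a branch, and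
  no node of a branch ever enters the well-founded part. Uniqueness thus lets bits be read off from
  any node with a branch through it.\<close>

lemma Find_eq:
  assumes uniq: "\<And>z w. halts_with (P r) z {} w \<Longrightarrow> 0 \<in> w \<Longrightarrow> z = x"
    and t: "t < Ord c" "st (crun (P r) x {} t) = 1" "\<And>u. u < t \<Longrightarrow> st (crun (P r) x {} u) \<noteq> 1" "tout (crun (P r) x {} t) 0"
  shows "Find r c = x"
proof (intro set_eqI iffI)
  define e where "e = {k. p1 k \<in> TT r c \<and> ext (p2 k) (p1 k)}"
  fix m assume "m \<in> Find r c"
  then obtain s0 where s0: "s0 \<in> TT r c" "s0 \<notin> wsi e" "dfd s0 (pr 0 m)" "ev s0 (pr 0 m) \<noteq> 0" unfolding Find_def e_def by blast
  have we: "acc e (wsi e) = wsi e" using Ord_le_iff_acc[of e "Ord e"] unfolding wsi_def by simp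
  have "\<exists>s'. (s' \<in> TT r c \<and> s' \<notin> wsi e) \<and> ext s s'" if s: "s \<notin> wsi e" for s
  proof -
    have "s \<notin> acc e (wsi e)" using s unfolding we .
    then show ?thesis unfolding in_acc e_def by auto
  qed
  then have "\<exists>S. \<forall>n. (S n \<in> TT r c \<and> S n \<notin> wsi e) \<and> (n = 0 \<longrightarrow> S n = s0) \<and> ext (S n) (S (Suc n))"
    using dependent_nat_choice[of "\<lambda>n s. (s \<in> TT r c \<and> s \<notin> wsi e) \<and> (n = 0 \<longrightarrow> s = s0)" "\<lambda>n. ext"] s0 by simp
  then obtain S where S: "\<And>n. S n \<in> TT r c" "S 0 = s0" "\<And>n. ext (S n) (S (Suc n))" by blast
  have len: "n \<le> length (list_decode (S n))" for n
  proof (induction n)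
    case (Suc n)
    then show ?case using ext_length[OF S(3)[of n]] by simp
  qed simp
  have mono: "dfd (S n) i \<Longrightarrow> dfd (S (n + k)) i \<and> ev (S (n + k)) i = ev (S n) i" for n k i
  proof (induction k)
    case (Suc k)
    then have a: "dfd (S (n + k)) i" "ev (S (n + k)) i = ev (S n) i" by blast+
    have "dfd (S (Suc (n + k))) i \<and> ev (S (n + k)) i = ev (S (Suc (n + k))) i"
      using S(3)[of "n + k"] a(1) unfolding ext_def by blast
    then show ?case using a(2) by simp
  qed simp
  \<comment> \<open>\<open>S n\<close> has at least \<open>n\<close> entries, since every extension
    is proper; so entry \<open>i\<close> is present in \<open>S (Suc i)\<close>, and later
    extensions do not change it.\<close>
  define f where "f i = ev (S (Suc i)) i" for i
  have dlS: "dfd (S n) i" if "i < n" for i n using len[of n] that unfolding dfd_iff by simp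
  have fe: "ev (S n) i = f i" if d: "dfd (S n) i" for n i
  proof (cases "n \<le> Suc i")
    case True
    then show ?thesis using mono[OF d, of "Suc i - n"] unfolding f_def by simp
  next
    case False
    then show ?thesis using mono[OF dlS[of i "Suc i"], of "n - Suc i"] unfolding f_def by simp
  qed
  have con: "Con r c i j l (f i) (f j) (f l)" for i j l
  proof -
    define n where "n = Suc (i + j + l)"
    have d: "dfd (S n) i" "dfd (S n) j" "dfd (S n) l" by (rule dlS, simp add: n_def)+
    then have "Con r c i j l (ev (S n) i) (ev (S n) j) (ev (S n) l)" using S(1)[of n] unfolding TT_def by blast
    then show ?thesis unfolding fe[OF d(1)] fe[OF d(2)] fe[OF d(3)] .
  qed
  obtain w where "halts_with (P r) {m. f (pr 0 m) \<noteq> 0} {} w" "0 \<in> w" by (rule Con_halts[OF con refl]) (rule that)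
  then have "{m. f (pr 0 m) \<noteq> 0} = x" by (rule uniq)
  moreover have "f (pr 0 m) \<noteq> 0" using fe[of 0 "pr 0 m"] s0 S(2) by simp
  ultimately show "m \<in> x" by blast
next
  define e where "e = {k. p1 k \<in> TT r c \<and> ext (p2 k) (p1 k)}"
  fix m assume m: "m \<in> x"
  obtain f where f: "\<And>i j l. Con r c i j l (f i) (f j) (f l)" "x = {m. f (pr 0 m) \<noteq> 0}"
    by (rule Con_exists[OF t]) (assumption, rule that)
  define S where "S n = list_encode (map f [0..<n])" for n
  have dlS: "dfd (S n) i \<longleftrightarrow> i < n" for n i unfolding dfd_iff S_def by simp
  have evS: "i < n \<Longrightarrow> ev (S n) i = f i" for n i using ev_nth[of i "S n"] unfolding S_def by simp
  have TS: "S n \<in> TT r c" for n unfolding TT_def mem_Collect_eq dlS using f(1) evS by simp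
  have xS: "ext (S n) (S (Suc n))" for n unfolding ext_def dlS using evS by auto
  have "S n \<notin> ws e t" for n t
  proof (induction t arbitrary: n rule: time_induct)
    case (suc t)
    have "pr (S (Suc n)) (S n) \<in> e" unfolding e_def using TS xS by simp
    then show ?case unfolding ws_tsuc in_acc using suc by blast
  next
    case (lim t)
    have "ws e t = Lim (ws e) t" unfolding ws_def[abs_def] by (rule arun_tlim[OF lim(1)])
    then show ?case using lim(2) tlim_pos[OF lim(1)] unfolding Lim_def by blast
  qed simp
  then have "S n \<notin> wsi e" for n unfolding wsi_def by blast
  moreover have "dfd (S (Suc (pr 0 m))) (pr 0 m)" "ev (S (Suc (pr 0 m))) (pr 0 m) \<noteq> 0"
    using m f(2) evS[of "pr 0 m" "Suc (pr 0 m)"] unfolding dlS by simp_all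
  ultimately show "m \<in> Find r c" unfolding Find_def e_def[symmetric] using TS by blast
qed

lemma halts_with_unique: "halts_with p y z w \<Longrightarrow> halts_with p y z w' \<Longrightarrow> w = w'"
  unfolding halts_with_iff by (metis less_linear)

theorem mainTheorem7:
  fixes x :: "nat set"
  assumes "ittm_recognizable x"
  shows "ittm_computable x \<or> ittm_computable_from ittm_halting_set x"
proof -
  obtain r where r: "\<And>z. halts_with (P r) z {} (delta z x)" using assms unfolding ittm_recognizable_def by blast
  define C where "C z = crun (P r) z {}" for z
  have sim: "ust (arun US (ec z) t) e q \<longleftrightarrow> q = st (crun (P e) z {} t)" "pr e (pr 2 n) \<in> tr 4 (arun US (ec z) t) \<longleftrightarrow> tout (crun (P e) z {} t) n" for z t e q n
    using US_sim[of z t] unfolding Uinv_def by blast+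
  have ex: "\<exists>t. st (C z t) = 1 \<and> (\<forall>u<t. st (C z u) \<noteq> 1) \<and> {n. tout (C z t) n} = delta z x" for z
    using r[of z] unfolding halts_with_iff C_def .
  define h where "h z = (LEAST t. st (C z t) = 1)" for z
  have h: "st (C z (h z)) = 1" "tout (C z (h z)) 0 \<longleftrightarrow> z = x" "\<And>u. u < h z \<Longrightarrow> st (C z u) \<noteq> 1" for z
  proof -
    obtain t where t: "st (C z t) = 1" "\<forall>u<t. st (C z u) \<noteq> 1" "{n. tout (C z t) n} = delta z x" using ex by blast
    have "h z = t" unfolding h_def by (rule Least_equality) (use t in \<open>auto simp: not_less[symmetric]\<close>)
    moreover have "tout (C z t) 0 \<longleftrightarrow> 0 \<in> delta z x" using t(3) by blast
    ultimately show "st (C z (h z)) = 1" "tout (C z (h z)) 0 \<longleftrightarrow> z = x" "\<And>u. u < h z \<Longrightarrow> st (C z u) \<noteq> 1"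
      using t(1,2) by (simp_all add: delta_def)
  qed
  have uniq: "z = x" if "halts_with (P r) z {} w" "0 \<in> w" for z w
    using halts_with_unique[OF that(1) r[of z]] that(2) by (auto simp: delta_def split: if_splits)
  obtain \<sigma> where \<sigma>: "\<And>s. s < \<sigma> \<Longrightarrow> \<exists>t. s < oo t"
    "\<And>e t. st (crun (P e) {} {} t) = 1 \<Longrightarrow> \<exists>s<\<sigma>. st (crun (P e) {} {} s) = 1"
    by (rule halting_before_writable_ordinals) (rule that)
  have cu: "cop (\<lambda>S n. ust S r 1)" by (intro cop_ust rf_const)
  have hL: "(LEAST t. ust (arun US (ec z) t) r 1) = h z" for z unfolding h_def sim C_def by (simp only: eq_commute[of "1::nat"])
  have exh: "\<exists>t. ust (arun US (ec z) t) r 1" for z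
    unfolding sim by (rule exI[of _ "h z"]) (use h(1)[of z] in \<open>simp add: C_def\<close>)
  show ?thesis
  proof (cases "h x < \<sigma>")
    case True
    \<comment> \<open>The test of a candidate \<open>z\<close>: run all programs with oracle
      \<open>z\<close> until \<open>r\<close> halts, then read output cell 0 of \<open>r\<close>.
      This ends for every \<open>z\<close> because \<open>r\<close> halts with every oracle.\<close>
    have "lc (\<lambda>z. arun US (ec z) (LEAST t. ust (arun US (ec z) t) r 1))"
      by (rule lc_while[OF lc_US cu lc_ec[OF lc_ident]]) (rule exh)
    then have lh: "lc (\<lambda>z. arun US (ec z) (h z))" unfolding hL .
    have c4: "cop (\<lambda>S n. pr r (pr 2 0) \<in> tr 4 S)" by (intro cop_tr rf_const)
    have "pr r (pr 2 0) \<in> tr 4 (arun US (ec z) (h z)) \<longleftrightarrow> z = x" for z unfolding sim using h(2)[of z] unfolding C_def .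
    with cop_after[OF lh c4] have cx: "cop (\<lambda>z n. z = x)" by (simp only:)
    have lF: "lc (\<lambda>S. Find r (qq S))" by (rule lc_then[OF lc_qq lc_Find])
    obtain t where t: "h x < oo t" using \<sigma>(1)[OF True] by blast
    have F: "Find r (qq (VV t)) = x"
    proof (rule Find_eq[where t = "h x"])
      show "z = x" if "halts_with (P r) z {} w" "0 \<in> w" for z w using that by (rule uniq)
      show "h x < Ord (qq (VV t))" using t unfolding oo_def .
      show "st (crun (P r) x {} (h x)) = 1" using h(1)[of x] unfolding C_def .
      show "tout (crun (P r) x {} (h x)) 0" using h(2)[of x] unfolding C_def by simp
      show "st (crun (P r) x {} u) \<noteq> 1" if "u < h x" for u using h(3)[OF that] unfolding C_def .
    qed
    define T where "T = (LEAST t. Find r (qq (VV t)) = x)"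
    have FT: "Find r (qq (VV T)) = x" unfolding T_def by (rule LeastI[of _ t]) (rule F)
    \<comment> \<open>Termination of the search is known from the empty state only, hence the
      domain. The loop passes through all states of the universal run; \<open>Find\<close> may
      return anything for unsuitable codes, and the test discards it.\<close>
    have "lcd {{}} (\<lambda>X. arun US X (LEAST t. Find r (qq (arun US X t)) = x))"
    proof (rule lc_while[OF lc_US cop_after[OF lF cx]])
      show "lcd {{}} (\<lambda>X. X)" using lc_ident unfolding lcd_def by blast
      show "\<exists>t. Find r (qq (arun US X t)) = x" if "X \<in> {{}}" for X using F that by blast
    qed
    from lc_then[OF this lF] obtain i where "\<And>y. y \<in> {{}} \<Longrightarrow> halts_with (P i) y {} (Find r (qq (arun US y (LEAST t. Find r (qq (arun US y t)) = x))))"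
      by (rule operator_computable) (rule that)
    from this[of "{}"] have "halts_with (P i) {} {} x" using FT unfolding T_def by simp
    then show ?thesis unfolding ittm_computable_def ittm_computable_from_def by blast
  next
    case False
    \<comment> \<open>Track 1 runs all programs with the given oracle and serves as a clock through
      \<open>r\<close>; track 2 runs them with empty oracle, and track 3 collects those that have
      halted there.\<close>
    define G where "G S = tk (US (tr 1 S)) (US (tr 2 S)) {e. e \<in> tr 3 S \<or> ust (tr 2 S) e 1} {} {} {}" for S
    have u2: "cop (\<lambda>S n. ust (tr 2 S) n 1)" by (rule cop_after[OF lc_tr[OF lc_ident] cop_ust]) (intro rf_intros)+
    have l3: "lc (\<lambda>S. {e. e \<in> tr 3 S \<or> ust (tr 2 S) e 1})" by (rule lc_cop) (intro u2 cop_or cop_mem_lc lc_rules rf_intros)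
    have lG: "lc G" unfolding G_def by (intro lc_tk l3 lc_then[OF _ lc_US] lc_rules)
    have cH: "cop (\<lambda>S n. ust (tr 1 S) r 1)" by (rule cop_after[OF lc_tr[OF lc_ident] cu])
    \<comment> \<open>The inner \<open>ec\<close> forms the initial universal state for oracle
      \<open>y\<close>, the outer one puts it on track 1. Track 2 is then empty, which is the
      initial state for the empty oracle.\<close>
    define R where "R y = arun G (ec (ec y))" for y
    have g: "tr 1 (G S) = US (tr 1 S)" "tr 2 (G S) = US (tr 2 S)" "tr 3 (G S) = tr 3 S \<union> {e. ust (tr 2 S) e 1}" for S
      unfolding G_def by (simp_all only: tr_tk One_nat_def) auto
    have e: "tr 1 (ec (ec y)) = ec y" "tr 2 (ec (ec y)) = {}" "tr 3 (ec (ec y)) = {}" for y by (auto simp: tr_def)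
    have t1: "tr 1 (R y t) = arun US (ec y) t" for y t
      using arun_tr[of t 1 G "ec (ec y)" US, OF g(1)] unfolding e R_def .
    have t2: "tr 2 (R y t) = VV t" for y t
      using arun_tr[of t 2 G "ec (ec y)" US, OF g(2)] unfolding e R_def .
    have t3: "tr 3 (R y t) = (\<Union>s\<in>{..<t}. {e. ust (VV s) e 1})" for y t
      unfolding R_def by (rule arun_union[OF e(3)]) (unfold R_def[symmetric] g t2, rule refl)
    have "lc (\<lambda>y. R y (LEAST t. ust (tr 1 (R y t)) r 1))" unfolding R_def
    proof (rule lc_while[OF lG cH])
      show "lc (\<lambda>y. ec (ec y))" by (intro lc_rules)
      show "\<exists>t. ust (tr 1 (arun G (ec (ec y)) t)) r 1" for y
        unfolding R_def[symmetric] t1 by (rule exh)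
    qed
    from lc_tr[OF this, of 3] obtain i where "\<And>y. y \<in> UNIV \<Longrightarrow> halts_with (P i) y {} (tr 3 (R y (LEAST t. ust (tr 1 (R y t)) r 1)))"
      by (rule operator_computable) (rule that)
    then have i: "halts_with (P i) x {} (\<Union>s\<in>{..<h x}. {e. ust (VV s) e 1})" unfolding t1 t3 hL by blast
    have V: "ust (VV s) e 1 \<longleftrightarrow> st (crun (P e) {} {} s) = 1" for s e using sim(1)[of "{}" s e 1] by auto
    have hl: "halts (P e) {} {} \<longleftrightarrow> (\<exists>t. st (crun (P e) {} {} t) = 1)" for e
    proof
      assume "\<exists>t. st (crun (P e) {} {} t) = 1"
      then obtain t where t: "st (crun (P e) {} {} t) = 1" "\<forall>u<t. st (crun (P e) {} {} u) \<noteq> 1"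
        using exists_least_iff[of "\<lambda>t. st (crun (P e) {} {} t) = 1"] by blast
      have "halts_with (P e) {} {} {n. tout (crun (P e) {} {} t) n}"
        unfolding halts_with_iff by (rule exI[of _ t]) (use t in simp)
      then show "halts (P e) {} {}" unfolding halts_def ..
    qed (auto simp: halts_def halts_with_iff)
    have eq: "(\<Union>s\<in>{..<h x}. {e. ust (VV s) e 1}) = ittm_halting_set"
    proof (intro set_eqI iffI)
      fix e assume "e \<in> (\<Union>s\<in>{..<h x}. {e. ust (VV s) e 1})"
      then show "e \<in> ittm_halting_set" unfolding ittm_halting_set_def V hl by blast
    next
      fix e assume "e \<in> ittm_halting_set"
      then obtain s where "s < \<sigma>" "st (crun (P e) {} {} s) = 1" unfolding ittm_halting_set_def hl using \<sigma>(2) by blast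
      moreover then have "s < h x" using False by simp
      ultimately show "e \<in> (\<Union>s\<in>{..<h x}. {e. ust (VV s) e 1})" unfolding V by blast
    qed
    show ?thesis using i unfolding eq ittm_computable_from_def by blast
  qed
qed

end
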